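(* Let $\mathcal O$ be a cyclic operad, and let $A$ be a dg $k$-vector space of finite type. Then a $\phi^!(\mathcal O)$-algebra structure on $A$ is equivalent to an $\mathcal O$-algebra structure on $(\mathsf d(A),\langle-,-\rangle)$. (That is, dioperad morphisms $\phi^!(\mathcal O)\to End_A^{di}$ correspond bijectively to cyclic operad morphisms $\mathcal O\to End^{cyc}_{(\mathsf d(A),\langle-,-\rangle)}$.)
   Context: $k$ is a field of characteristic $0$; all objects are in $dgVect_k$ and operadic structures are considered without units. A cyclic operad $\mathcal O=\{\mathcal O((n))\}$ has $S_n$-modules $\mathcal O((n))$ and compositions along trees. A dioperad $\mathcal P=\{\mathcal P(r,s)\}$ has $S_r\times S_s$-modules ($r$ outputs, $s$ inputs) and compositions along directed trees, each edge joining an output flag to an input flag; here dioperads are allowed to have empty inputs or empty outputs, but not both. $\phi$ is the functor from the (Feynman) category encoding such dioperads to that encoding cyclic operads which forgets directions. The functor $\phi_!$ from dioperads to cyclic operads is $\phi_!(\mathcal P)((n))=\bigoplus_{r+s=n}\mathcal P(r,s)\otimes_{k[S_r\times S_s]}k[S_n]$: elements are corollas all of whose flags are directed, decorated by $\mathcal P$; composing two such elements by gluing two flags is given by the composition of $\mathcal P$ if one of the flags is an output and the other an input, and is $0$ otherwise. $\phi^!$ is the left adjoint of $\phi_!$. For $A$ of finite type with linear dual $A^*$, $\mathsf d(A)=A\oplus A^*$ with the symmetric non-degenerate bilinear form $\langle a\oplus\eta,b\oplus\xi\rangle=\eta(b)+\xi(a)$. $End_A^{di}(r,s)\cong A^{\otimes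 r}\otimes(A^* )^{\otimes s}$ is the endomorphism dioperad, with composition by evaluation; for a finite type $V$ with symmetric non-degenerate form $\langle-,-\rangle$, $End^{cyc}_{(V,\langle-,-\rangle)}((n))\cong V^{\otimes n}$ is the endomorphism cyclic operad, with composition given by contracting with the form. An algebra structure over a dioperad on $A$ (resp. over a cyclic operad on $(V,\langle-,-\rangle)$) is a morphism to $End_A^{di}$ (resp. $End^{cyc}_{(V,\langle-,-\rangle)}$). *)

theory Defs
  imports
    Complex_Main
    "HOL-Library.FuncSet"
    "HOL-Library.Function_Algebras"
    "HOL-Library.Product_Plus"
    "HOL-Combinatorics.Permutations"
begin

section \<open>Differential graded vector spaces\<close>

text \<open>
  A dg vector space is a family of vector spaces indexed by the degree, with a differential of
  degree +1. Elements are always homogeneous; the pieces \<open>Gr V p\<close> are subspaces of a common ambient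
  vector space but need not be independent there, so every operation carries the degrees of its
  arguments explicitly.
\<close>

record ('k, 'v) dgvs =
  Scl :: "'k \<Rightarrow> 'v \<Rightarrow> 'v"
  Gr :: "int \<Rightarrow> 'v set"
  Dif :: "int \<Rightarrow> 'v \<Rightarrow> 'v"

abbreviation ksgn :: "int \<Rightarrow> 'k::field" where
  "ksgn p \<equiv> (- 1) powi p"

definition chain_map ::
  "('k, 'v::ab_group_add) dgvs \<Rightarrow> ('k, 'w::ab_group_add) dgvs \<Rightarrow> (int \<Rightarrow> 'v \<Rightarrow> 'w) \<Rightarrow> bool" where
  "chain_map V W f \<longleftrightarrow> (\<forall>p. \<forall>x \<in> Gr V p.
     f p x \<in> Gr W p \<and>
     (\<forall>y \<in> Gr V p. f p (x + y) = f p x + f p y) \<and>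
     (\<forall>c. f p (Scl V c x) = Scl W c (f p x)) \<and>
     f (p + 1) (Dif V p x) = Dif W p (f p x))"

definition chain_bimap ::
  "('k::field, 'u::ab_group_add) dgvs \<Rightarrow> ('k, 'v::ab_group_add) dgvs \<Rightarrow> ('k, 'w::ab_group_add) dgvs
   \<Rightarrow> (int \<Rightarrow> int \<Rightarrow> 'u \<Rightarrow> 'v \<Rightarrow> 'w) \<Rightarrow> bool" where
  "chain_bimap U V W m \<longleftrightarrow> (\<forall>p q. \<forall>x \<in> Gr U p. \<forall>y \<in> Gr V q.
     m p q x y \<in> Gr W (p + q) \<and>
     (\<forall>x' \<in> Gr U p. m p q (x + x') y = m p q x y + m p q x' y) \<and>
     (\<forall>y' \<in> Gr V q. m p q x (y + y') = m p q x y + m p q x y') \<and>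
     (\<forall>c. m p q (Scl U c x) y = Scl W c (m p q x y)) \<and>
     (\<forall>c. m p q x (Scl V c y) = Scl W c (m p q x y)) \<and>
     Dif W (p + q) (m p q x y) =
       m (p + 1) q (Dif U p x) y + Scl W (ksgn p) (m p (q + 1) x (Dif V q y)))"

definition dg_vector_space :: "('k::field, 'v::ab_group_add) dgvs \<Rightarrow> bool" where
  "dg_vector_space V \<longleftrightarrow>
     vector_space (Scl V) \<and>
     (\<forall>p. module.subspace (Scl V) (Gr V p)) \<and>
     (\<forall>p. \<forall>x \<in> Gr V p.
        Dif V p x \<in> Gr V (p + 1) \<and>
        (\<forall>y \<in> Gr V p. Dif V p (x + y) = Dif V p x + Dif V p y) \<and>
        (\<forall>c. Dif V p (Scl V c x) = Scl V c (Dif V p x)) \<and>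
        Dif V (p + 1) (Dif V p x) = 0)"

definition finite_type :: "('k::field, 'v::ab_group_add) dgvs \<Rightarrow> bool" where
  "finite_type V \<longleftrightarrow> (\<forall>p. \<exists>B. finite B \<and> Gr V p = module.span (Scl V) B)"


section \<open>Cyclic operads\<close>

text \<open>
  Deleting the flag \<open>i\<close> moves the flag \<open>x \<noteq> i\<close> to position \<open>skip i x\<close>. Gluing the flag \<open>i\<close> of \<open>a\<close> to the
  flag \<open>j\<close> of \<open>b\<close> produces an element whose flags are numbered by concatenation: first the remaining
  flags of \<open>a\<close>, then the remaining flags of \<open>b\<close>. The compositions along arbitrary trees are generated
  by these one-edge compositions. \<open>block_swap w u v\<close> fixes the first \<open>w\<close> positions and
  exchanges the two following blocks, of sizes \<open>u\<close> and \<open>v\<close>.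
\<close>

definition skip :: "nat \<Rightarrow> nat \<Rightarrow> nat" where
  "skip i x = (if x < i then x else x - 1)"

definition block_swap :: "nat \<Rightarrow> nat \<Rightarrow> nat \<Rightarrow> nat \<Rightarrow> nat" where
  "block_swap w u v x =
     (if x < w then x else if x < w + u then x + v else if x < w + u + v then x - u else x)"

text \<open>
  \<open>cact \<O> n p \<sigma> a\<close> is the left action of a permutation \<open>\<sigma>\<close> of \<open>{..<n}\<close> on \<open>a\<close> of degree \<open>p\<close>: the flag \<open>x\<close> of
  \<open>a\<close> becomes the flag \<open>\<sigma> x\<close>. \<open>ccomp \<O> n p i m q j a b\<close> glues the flag \<open>i\<close> of \<open>a \<in> \<O>((n))\<close> of degree \<open>p\<close>
  to the flag \<open>j\<close> of \<open>b \<in> \<O>((m))\<close> of degree \<open>q\<close>. Every corolla has at least one flag: the slot \<open>n = 0\<close>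
  is ignored, and so is the composition of \<open>\<O>((1))\<close> with itself.
\<close>

record ('k, 'o) cyc_data =
  Csp :: "nat \<Rightarrow> ('k, 'o) dgvs"
  cact :: "nat \<Rightarrow> int \<Rightarrow> (nat \<Rightarrow> nat) \<Rightarrow> 'o \<Rightarrow> 'o"
  ccomp :: "nat \<Rightarrow> int \<Rightarrow> nat \<Rightarrow> nat \<Rightarrow> int \<Rightarrow> nat \<Rightarrow> 'o \<Rightarrow> 'o \<Rightarrow> 'o"

locale cyclic_operad =
  fixes \<O> :: "('k::field_char_0, 'o::ab_group_add) cyc_data"
  assumes space: "0 < n \<Longrightarrow> dg_vector_space (Csp \<O> n)"
    and act_chain: "\<lbrakk>0 < n; \<sigma> permutes {..<n}\<rbrakk>
      \<Longrightarrow> chain_map (Csp \<O> n) (Csp \<O> n) (\<lambda>p. cact \<O> n p \<sigma>)"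
    and act_id: "\<lbrakk>0 < n; a \<in> Gr (Csp \<O> n) p\<rbrakk> \<Longrightarrow> cact \<O> n p id a = a"
    and act_comp: "\<lbrakk>0 < n; \<sigma> permutes {..<n}; \<tau> permutes {..<n}; a \<in> Gr (Csp \<O> n) p\<rbrakk>
      \<Longrightarrow> cact \<O> n p (\<sigma> \<circ> \<tau>) a = cact \<O> n p \<sigma> (cact \<O> n p \<tau> a)"
    and comp_chain: "\<lbrakk>i < n; j < m; 2 < n + m\<rbrakk>
      \<Longrightarrow> chain_bimap (Csp \<O> n) (Csp \<O> m) (Csp \<O> (n + m - 2)) (\<lambda>p q. ccomp \<O> n p i m q j)"
    and equivariant: "\<lbrakk>i < n; j < m; 2 < n + m; a \<in> Gr (Csp \<O> n) p; b \<in> Gr (Csp \<O> m) q;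
        \<sigma> permutes {..<n}; \<tau> permutes {..<m}; \<rho> permutes {..<n + m - 2};
        \<And>x. x < n \<Longrightarrow> x \<noteq> i \<Longrightarrow> \<rho> (skip i x) = skip (\<sigma> i) (\<sigma> x);
        \<And>y. y < m \<Longrightarrow> y \<noteq> j \<Longrightarrow> \<rho> (n - 1 + skip j y) = n - 1 + skip (\<tau> j) (\<tau> y)\<rbrakk>
      \<Longrightarrow> ccomp \<O> n p (\<sigma> i) m q (\<tau> j) (cact \<O> n p \<sigma> a) (cact \<O> m q \<tau> b) =
          cact \<O> (n + m - 2) (p + q) \<rho> (ccomp \<O> n p i m q j a b)"
    and commute: "\<lbrakk>i < n; j < m; 2 < n + m; a \<in> Gr (Csp \<O> n) p; b \<in> Gr (Csp \<O> m) q\<rbrakk>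
      \<Longrightarrow> ccomp \<O> m q j n p i b a =
          Scl (Csp \<O> (n + m - 2)) (ksgn (p * q))
            (cact \<O> (n + m - 2) (p + q) (block_swap 0 (n - 1) (m - 1)) (ccomp \<O> n p i m q j a b))"
    and assoc: "\<lbrakk>i < n; j < m; k < m; j \<noteq> k; h < l; 4 < n + m + l;
        a \<in> Gr (Csp \<O> n) p; b \<in> Gr (Csp \<O> m) q; c \<in> Gr (Csp \<O> l) r\<rbrakk>
      \<Longrightarrow> ccomp \<O> (n + m - 2) (p + q) (n - 1 + skip j k) l r h (ccomp \<O> n p i m q j a b) c =
          ccomp \<O> n p i (m + l - 2) (q + r) (skip k j) a (ccomp \<O> m q k l r h b c)"

text \<open>
  Morphisms have a component for each arity and degree, and are made \<open>undefined\<close> off the carriers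
  so that the morphism sets are not inflated by junk values.
\<close>

definition ccar :: "('k, 'o) cyc_data \<Rightarrow> nat \<Rightarrow> int \<Rightarrow> 'o set" where
  "ccar \<O> n p = (if n = 0 then {} else Gr (Csp \<O> n) p)"

definition cyc_hom ::
  "('k, 'o::ab_group_add) cyc_data \<Rightarrow> ('k, 'q::ab_group_add) cyc_data
   \<Rightarrow> (nat \<Rightarrow> int \<Rightarrow> 'o \<Rightarrow> 'q) set" where
  "cyc_hom \<O> \<Q> = {f.
     (\<forall>n p. f n p \<in> extensional (ccar \<O> n p)) \<and>
     (\<forall>n>0. chain_map (Csp \<O> n) (Csp \<Q> n) (f n)) \<and>
     (\<forall>n>0. \<forall>p \<sigma>. \<sigma> permutes {..<n} \<longrightarrow> (\<forall>a \<in> Gr (Csp \<O> n) p.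
        f n p (cact \<O> n p \<sigma> a) = cact \<Q> n p \<sigma> (f n p a))) \<and>
     (\<forall>n m p q i j. i < n \<and> j < m \<and> 2 < n + m \<longrightarrow>
        (\<forall>a \<in> Gr (Csp \<O> n) p. \<forall>b \<in> Gr (Csp \<O> m) q.
          f (n + m - 2) (p + q) (ccomp \<O> n p i m q j a b) =
          ccomp \<Q> n p i m q j (f n p a) (f m q b)))}"

definition cyc_compose ::
  "('k, 'o) cyc_data \<Rightarrow> (nat \<Rightarrow> int \<Rightarrow> 'p \<Rightarrow> 'q) \<Rightarrow> (nat \<Rightarrow> int \<Rightarrow> 'o \<Rightarrow> 'p)
   \<Rightarrow> nat \<Rightarrow> int \<Rightarrow> 'o \<Rightarrow> 'q" where
  "cyc_compose \<O> g f = (\<lambda>n p. restrict (\<lambda>a. g n p (f n p a)) (ccar \<O> n p))"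


section \<open>Dioperads\<close>

text \<open>
  \<open>Dsp P r s\<close> has \<open>r\<close> outputs and \<open>s\<close> inputs. \<open>dcomp P r s p i r' s' p' j a b\<close> glues the output \<open>i\<close> of \<open>a\<close>
  to the input \<open>j\<close> of \<open>b\<close>; both the remaining outputs and the remaining inputs are numbered by
  concatenation, those of \<open>a\<close> first. The slot \<open>(0, 0)\<close> is ignored, and so are compositions landing in it.
  The three associativity laws correspond to the three shapes of a directed tree with two edges.
\<close>

record ('k, 'p) dio_data =
  Dsp :: "nat \<Rightarrow> nat \<Rightarrow> ('k, 'p) dgvs"
  dact :: "nat \<Rightarrow> nat \<Rightarrow> int \<Rightarrow> (nat \<Rightarrow> nat) \<Rightarrow> (nat \<Rightarrow> nat) \<Rightarrow> 'p \<Rightarrow> 'p"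
  dcomp :: "nat \<Rightarrow> nat \<Rightarrow> int \<Rightarrow> nat \<Rightarrow> nat \<Rightarrow> nat \<Rightarrow> int \<Rightarrow> nat \<Rightarrow> 'p \<Rightarrow> 'p \<Rightarrow> 'p"

locale dioperad =
  fixes P :: "('k::field_char_0, 'p::ab_group_add) dio_data"
  assumes space: "0 < r + s \<Longrightarrow> dg_vector_space (Dsp P r s)"
    and act_chain: "\<lbrakk>0 < r + s; \<sigma> permutes {..<r}; \<tau> permutes {..<s}\<rbrakk>
      \<Longrightarrow> chain_map (Dsp P r s) (Dsp P r s) (\<lambda>p. dact P r s p \<sigma> \<tau>)"
    and act_id: "\<lbrakk>0 < r + s; a \<in> Gr (Dsp P r s) p\<rbrakk> \<Longrightarrow> dact P r s p id id a = a"
    and act_comp: "\<lbrakk>0 < r + s; \<sigma> permutes {..<r}; \<tau> permutes {..<s};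
        \<sigma>' permutes {..<r}; \<tau>' permutes {..<s}; a \<in> Gr (Dsp P r s) p\<rbrakk>
      \<Longrightarrow> dact P r s p (\<sigma> \<circ> \<sigma>') (\<tau> \<circ> \<tau>') a = dact P r s p \<sigma> \<tau> (dact P r s p \<sigma>' \<tau>' a)"
    and comp_chain: "\<lbrakk>i < r; j < s'; 2 < r + s + r' + s'\<rbrakk>
      \<Longrightarrow> chain_bimap (Dsp P r s) (Dsp P r' s') (Dsp P (r + r' - 1) (s + s' - 1))
            (\<lambda>p p'. dcomp P r s p i r' s' p' j)"
    and equivariant: "\<lbrakk>i < r; j < s'; 2 < r + s + r' + s';
        a \<in> Gr (Dsp P r s) p; b \<in> Gr (Dsp P r' s') p';
        \<sigma> permutes {..<r}; \<tau> permutes {..<s}; \<sigma>' permutes {..<r'}; \<tau>' permutes {..<s'};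
        \<rho> permutes {..<r + r' - 1}; \<pi> permutes {..<s + s' - 1};
        \<And>x. x < r \<Longrightarrow> x \<noteq> i \<Longrightarrow> \<rho> (skip i x) = skip (\<sigma> i) (\<sigma> x);
        \<And>y. y < r' \<Longrightarrow> \<rho> (r - 1 + y) = r - 1 + \<sigma>' y;
        \<And>x. x < s \<Longrightarrow> \<pi> x = \<tau> x;
        \<And>y. y < s' \<Longrightarrow> y \<noteq> j \<Longrightarrow> \<pi> (s + skip j y) = s + skip (\<tau>' j) (\<tau>' y)\<rbrakk>
      \<Longrightarrow> dcomp P r s p (\<sigma> i) r' s' p' (\<tau>' j) (dact P r s p \<sigma> \<tau> a) (dact P r' s' p' \<sigma>' \<tau>' b) =
          dact P (r + r' - 1) (s + s' - 1) (p + p') \<rho> \<pi> (dcomp P r s p i r' s' p' j a b)"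
    and assoc_chain: "\<lbrakk>i < r1; j < s2; k < r2; l < s3; 4 < r1 + s1 + r2 + s2 + r3 + s3;
        a \<in> Gr (Dsp P r1 s1) p1; b \<in> Gr (Dsp P r2 s2) p2; c \<in> Gr (Dsp P r3 s3) p3\<rbrakk>
      \<Longrightarrow> dcomp P (r1 + r2 - 1) (s1 + s2 - 1) (p1 + p2) (r1 - 1 + k) r3 s3 p3 l
            (dcomp P r1 s1 p1 i r2 s2 p2 j a b) c =
          dcomp P r1 s1 p1 i (r2 + r3 - 1) (s2 + s3 - 1) (p2 + p3) j
            a (dcomp P r2 s2 p2 k r3 s3 p3 l b c)"
    and assoc_target: "\<lbrakk>i < r1; k < r3; j < s2; l < s2; j \<noteq> l; 4 < r1 + s1 + r2 + s2 + r3 + s3;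
        a \<in> Gr (Dsp P r1 s1) p1; b \<in> Gr (Dsp P r2 s2) p2; c \<in> Gr (Dsp P r3 s3) p3\<rbrakk>
      \<Longrightarrow> dcomp P r3 s3 p3 k (r1 + r2 - 1) (s1 + s2 - 1) (p1 + p2) (s1 + skip j l)
            c (dcomp P r1 s1 p1 i r2 s2 p2 j a b) =
          Scl (Dsp P (r1 + r2 + r3 - 2) (s1 + s2 + s3 - 2)) (ksgn (p1 * p3))
            (dact P (r1 + r2 + r3 - 2) (s1 + s2 + s3 - 2) (p1 + p2 + p3)
              (block_swap 0 (r1 - 1) (r3 - 1)) (block_swap 0 s1 s3)
              (dcomp P r1 s1 p1 i (r3 + r2 - 1) (s3 + s2 - 1) (p3 + p2) (s3 + skip l j)
                a (dcomp P r3 s3 p3 k r2 s2 p2 l c b)))"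
    and assoc_source: "\<lbrakk>i < r2; k < r2; i \<noteq> k; j < s1; l < s3; 4 < r1 + s1 + r2 + s2 + r3 + s3;
        a \<in> Gr (Dsp P r1 s1) p1; b \<in> Gr (Dsp P r2 s2) p2; c \<in> Gr (Dsp P r3 s3) p3\<rbrakk>
      \<Longrightarrow> dcomp P (r2 + r1 - 1) (s2 + s1 - 1) (p2 + p1) (skip i k) r3 s3 p3 l
            (dcomp P r2 s2 p2 i r1 s1 p1 j b a) c =
          Scl (Dsp P (r1 + r2 + r3 - 2) (s1 + s2 + s3 - 2)) (ksgn (p1 * p3))
            (dact P (r1 + r2 + r3 - 2) (s1 + s2 + s3 - 2) (p1 + p2 + p3)
              (block_swap (r2 - 2) r3 r1) (block_swap s2 (s3 - 1) (s1 - 1))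
              (dcomp P (r2 + r3 - 1) (s2 + s3 - 1) (p2 + p3) (skip k i) r1 s1 p1 j
                (dcomp P r2 s2 p2 k r3 s3 p3 l b c) a))"

definition dcar :: "('k, 'p) dio_data \<Rightarrow> nat \<Rightarrow> nat \<Rightarrow> int \<Rightarrow> 'p set" where
  "dcar P r s p = (if r + s = 0 then {} else Gr (Dsp P r s) p)"

definition dio_hom ::
  "('k, 'p::ab_group_add) dio_data \<Rightarrow> ('k, 'q::ab_group_add) dio_data
   \<Rightarrow> (nat \<Rightarrow> nat \<Rightarrow> int \<Rightarrow> 'p \<Rightarrow> 'q) set" where
  "dio_hom P Q = {f.
     (\<forall>r s p. f r s p \<in> extensional (dcar P r s p)) \<and>
     (\<forall>r s. 0 < r + s \<longrightarrow> chain_map (Dsp P r s) (Dsp Q r s) (f r s)) \<and>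
     (\<forall>r s p \<sigma> \<tau>. 0 < r + s \<and> \<sigma> permutes {..<r} \<and> \<tau> permutes {..<s} \<longrightarrow>
        (\<forall>a \<in> Gr (Dsp P r s) p. f r s p (dact P r s p \<sigma> \<tau> a) = dact Q r s p \<sigma> \<tau> (f r s p a))) \<and>
     (\<forall>r s p i r' s' p' j. i < r \<and> j < s' \<and> 2 < r + s + r' + s' \<longrightarrow>
        (\<forall>a \<in> Gr (Dsp P r s) p. \<forall>b \<in> Gr (Dsp P r' s') p'.
          f (r + r' - 1) (s + s' - 1) (p + p') (dcomp P r s p i r' s' p' j a b) =
          dcomp Q r s p i r' s' p' j (f r s p a) (f r' s' p' b)))}"


section \<open>The functor from dioperads to cyclic operads and its left adjoint\<close>

text \<open>
  The shuffles form a basis of \<open>k[S\<^sub>n]\<close> over \<open>k[S\<^sub>r \<times> S\<^sub>s]\<close>, so the sum over \<open>r + s = n\<close> of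
  \<open>P(r,s) \<otimes> k[S\<^sub>n]\<close>, tensored over \<open>k[S\<^sub>r \<times> S\<^sub>s]\<close>, has one summand \<open>P(|X|, n - |X|)\<close> for every choice
  \<open>X \<subseteq> {..<n}\<close> of the flags that are directed outwards; on either side the flags are numbered
  increasingly. An element is the function \<open>u\<close> sending \<open>X\<close> to its component. \<open>rank X x\<close> is the position of
  \<open>x\<close> in \<open>X\<close>, and \<open>std \<sigma> X\<close> is the permutation of \<open>{..<|X|}\<close> induced by the bijection from \<open>X\<close> to \<open>\<sigma> ` X\<close>.
\<close>

definition rank :: "nat set \<Rightarrow> nat \<Rightarrow> nat" where
  "rank X x = card {y \<in> X. y < x}"

definition std :: "(nat \<Rightarrow> nat) \<Rightarrow> nat set \<Rightarrow> nat \<Rightarrow> nat" where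
  "std \<sigma> X k = (if k < card X then rank (\<sigma> ` X) (\<sigma> (sorted_list_of_set X ! k)) else k)"

definition glued_outputs :: "nat \<Rightarrow> nat \<Rightarrow> nat set \<Rightarrow> nat \<Rightarrow> nat set \<Rightarrow> nat set" where
  "glued_outputs n i X j Y = skip i ` (X - {i}) \<union> (\<lambda>y. n - 1 + skip j y) ` (Y - {j})"

text \<open>
  The composition of two directed corollas. If \<open>i\<close> is an input and \<open>j\<close> an output, the dioperad composes
  the second element into the first; the result is brought back to the order first-second.
\<close>

definition glue ::
  "('k::field, 'p::zero) dio_data \<Rightarrow> nat \<Rightarrow> int \<Rightarrow> nat \<Rightarrow> nat set \<Rightarrow> nat \<Rightarrow> int \<Rightarrow> nat \<Rightarrow> nat set
   \<Rightarrow> 'p \<Rightarrow> 'p \<Rightarrow> 'p" where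
  "glue P n p i X m q j Y a b =
    (let r = card X; s = n - card X; r' = card Y; s' = m - card Y in
     if i \<in> X \<and> j \<notin> Y then
       dcomp P r s p (rank X i) r' s' q (rank ({..<m} - Y) j) a b
     else if i \<notin> X \<and> j \<in> Y then
       Scl (Dsp P (r + r' - 1) (s + s' - 1)) (ksgn (p * q))
         (dact P (r + r' - 1) (s + s' - 1) (p + q)
           (block_swap 0 (r' - 1) r) (block_swap 0 s' (s - 1))
           (dcomp P r' s' q (rank Y j) r s p (rank ({..<n} - X) i) b a))
     else 0)"

definition phi_push ::
  "('k::field, 'p::ab_group_add) dio_data \<Rightarrow> ('k, nat set \<Rightarrow> 'p) cyc_data" where
  "phi_push P =
   \<lparr>Csp = (\<lambda>n.
      \<lparr>Scl = (\<lambda>c u X. Scl (Dsp P (card X) (n - card X)) c (u X)),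
       Gr = (\<lambda>p. {u. \<forall>X. if X \<subseteq> {..<n} then u X \<in> Gr (Dsp P (card X) (n - card X)) p else u X = 0}),
       Dif = (\<lambda>p u X. if X \<subseteq> {..<n} then Dif (Dsp P (card X) (n - card X)) p (u X) else 0)\<rparr>),
    cact = (\<lambda>n p \<sigma> u Y. if Y \<subseteq> {..<n}
       then let X = inv \<sigma> ` Y in
         dact P (card X) (n - card X) p (std \<sigma> X) (std \<sigma> ({..<n} - X)) (u X)
       else 0),
    ccomp = (\<lambda>n p i m q j u v Z.
       \<Sum>X \<in> Pow {..<n}. \<Sum>Y \<in> Pow {..<m}.
         if glued_outputs n i X j Y = Z then glue P n p i X m q j Y (u X) (v Y) else 0)\<rparr>"

definition phi_push_map ::
  "('k::field, 'p::ab_group_add) dio_data \<Rightarrow> (nat \<Rightarrow> nat \<Rightarrow> int \<Rightarrow> 'p \<Rightarrow> 'q::ab_group_add)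
   \<Rightarrow> nat \<Rightarrow> int \<Rightarrow> (nat set \<Rightarrow> 'p) \<Rightarrow> (nat set \<Rightarrow> 'q)" where
  "phi_push_map P f = (\<lambda>n p. restrict
     (\<lambda>u X. if X \<subseteq> {..<n} then f (card X) (n - card X) p (u X) else 0) (ccar (phi_push P) n p))"

text \<open>
  \<open>P\<close> together with the unit \<open>\<eta>\<close> is a value at \<open>\<O>\<close> of the left adjoint of \<open>phi_push\<close>: every morphism from
  \<open>\<O>\<close> to some \<open>phi_push Q\<close> factors uniquely through \<open>\<eta>\<close>. This determines \<open>P\<close> up to unique isomorphism. A
  definition cannot quantify over types, so the type of the elements of the test dioperads \<open>Q\<close> is a
  parameter.
\<close>

definition phi_left_adjoint ::
  "'q::ab_group_add itself \<Rightarrow> ('k::field_char_0, 'o::ab_group_add) cyc_data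
   \<Rightarrow> ('k, 'p::ab_group_add) dio_data \<Rightarrow> (nat \<Rightarrow> int \<Rightarrow> 'o \<Rightarrow> (nat set \<Rightarrow> 'p)) \<Rightarrow> bool" where
  "phi_left_adjoint (_ :: 'q itself) \<O> P \<eta> \<longleftrightarrow>
     dioperad P \<and> \<eta> \<in> cyc_hom \<O> (phi_push P) \<and>
     (\<forall>Q :: ('k, 'q) dio_data. dioperad Q \<longrightarrow>
        (\<forall>g \<in> cyc_hom \<O> (phi_push Q).
           \<exists>!f. f \<in> dio_hom P Q \<and> cyc_compose \<O> (phi_push_map P f) \<eta> = g))"


section \<open>Tensor products\<close>

text \<open>
  The tensor product of a list of graded vector spaces. A homogeneous list consists of pairs (degree,
  vector). The pure tensor of a homogeneous list is realised as the functional that evaluates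
  multilinear forms on this list; it is set to 0 on functions that are not multilinear, so the pure
  tensors satisfy precisely the multilinear relations. \<open>tlin F\<close> is the linear extension of the
  multilinear map \<open>F\<close>, that is, \<open>tlin F (pure Ws xs) = F xs\<close>.
\<close>

type_synonym ('k, 'v) tens = "((int \<times> 'v) list \<Rightarrow> 'k) \<Rightarrow> 'k"

definition homog :: "('k, 'v) dgvs list \<Rightarrow> (int \<times> 'v) list \<Rightarrow> bool" where
  "homog Ws xs \<longleftrightarrow> list_all2 (\<lambda>W x. snd x \<in> Gr W (fst x)) Ws xs"

definition multilinear ::
  "('k::field, 'v::ab_group_add) dgvs list \<Rightarrow> ((int \<times> 'v) list \<Rightarrow> 'k) \<Rightarrow> bool" where
  "multilinear Ws \<phi> \<longleftrightarrow> (\<forall>xs k. homog Ws xs \<and> k < length xs \<longrightarrow>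
     (let p = fst (xs ! k); x = snd (xs ! k) in
      (\<forall>y \<in> Gr (Ws ! k) p. \<phi> (xs[k := (p, x + y)]) = \<phi> xs + \<phi> (xs[k := (p, y)])) \<and>
      (\<forall>c. \<phi> (xs[k := (p, Scl (Ws ! k) c x)]) = c * \<phi> xs)))"

definition pure ::
  "('k::field, 'v::ab_group_add) dgvs list \<Rightarrow> (int \<times> 'v) list \<Rightarrow> ('k, 'v) tens" where
  "pure Ws xs = (\<lambda>\<phi>. if multilinear Ws \<phi> then \<phi> xs else 0)"

definition tscale :: "'k::field \<Rightarrow> ('k, 'v) tens \<Rightarrow> ('k, 'v) tens" where
  "tscale c T = (\<lambda>\<phi>. c * T \<phi>)"

definition tlin :: "((int \<times> 'v) list \<Rightarrow> ('k, 'w) tens) \<Rightarrow> ('k, 'v) tens \<Rightarrow> ('k, 'w) tens" where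
  "tlin F T = (\<lambda>\<phi>. T (\<lambda>xs. F xs \<phi>))"

definition degsum :: "(int \<times> 'v) list \<Rightarrow> int" where
  "degsum xs = sum_list (map fst xs)"

definition tensor ::
  "('k::field, 'v::ab_group_add) dgvs list \<Rightarrow> ('k, ('k, 'v) tens) dgvs" where
  "tensor Ws =
   \<lparr>Scl = tscale,
    Gr = (\<lambda>p. module.span tscale {pure Ws xs | xs. homog Ws xs \<and> degsum xs = p}),
    Dif = (\<lambda>p. tlin (\<lambda>xs. \<Sum>k<length xs. tscale (ksgn (degsum (take k xs)))
       (pure Ws (xs[k := (fst (xs ! k) + 1, Dif (Ws ! k) (fst (xs ! k)) (snd (xs ! k)))]))))\<rparr>"

text \<open>
  \<open>tperm Ws \<sigma>\<close> moves the \<open>k\<close>-th factor to position \<open>\<sigma> k\<close>, with the Koszul sign; \<open>Ws\<close> is the list of the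
  permuted spaces.
\<close>

definition koszul :: "(nat \<Rightarrow> nat) \<Rightarrow> (int \<times> 'v) list \<Rightarrow> 'k::field" where
  "koszul \<sigma> xs = (\<Prod>(k, l) \<in> {(k, l). k < l \<and> l < length xs \<and> \<sigma> l < \<sigma> k}.
     ksgn (fst (xs ! k) * fst (xs ! l)))"

definition tperm ::
  "('k::field, 'v::ab_group_add) dgvs list \<Rightarrow> (nat \<Rightarrow> nat) \<Rightarrow> ('k, 'v) tens \<Rightarrow> ('k, 'v) tens" where
  "tperm Ws \<sigma> = tlin (\<lambda>xs. tscale (koszul \<sigma> xs) (pure Ws (permute_list (inv \<sigma>) xs)))"

definition delete_at :: "nat \<Rightarrow> 'b list \<Rightarrow> 'b list" where
  "delete_at i xs = take i xs @ drop (Suc i) xs"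

text \<open>
  The Koszul sign for bringing the factors \<open>x\<^sub>i\<close> and \<open>y\<^sub>j\<close> of \<open>x\<^sub>0 \<otimes> x\<^sub>1 \<otimes> \<dots> \<otimes> y\<^sub>0 \<otimes> y\<^sub>1 \<otimes> \<dots>\<close> next to each
  other, between the remaining \<open>x\<close> and the remaining \<open>y\<close>.
\<close>

definition contract_sign :: "nat \<Rightarrow> (int \<times> 'v) list \<Rightarrow> nat \<Rightarrow> (int \<times> 'v) list \<Rightarrow> 'k::field" where
  "contract_sign i xs j ys =
     ksgn (fst (xs ! i) * degsum (drop (Suc i) xs) + fst (ys ! j) * degsum (take j ys))"


section \<open>The endomorphism cyclic operad\<close>

text \<open>A bilinear form of degree 0 on a graded space is given by its components \<open>B p q\<close>.\<close>

definition End_cyc ::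
  "('k::field, 'v::ab_group_add) dgvs \<Rightarrow> (int \<Rightarrow> int \<Rightarrow> 'v \<Rightarrow> 'v \<Rightarrow> 'k)
   \<Rightarrow> ('k, ('k, 'v) tens) cyc_data" where
  "End_cyc V B =
   \<lparr>Csp = (\<lambda>n. tensor (replicate n V)),
    cact = (\<lambda>n p. tperm (replicate n V)),
    ccomp = (\<lambda>n p i m q j S T.
      tlin (\<lambda>xs. tlin (\<lambda>ys.
        tscale (contract_sign i xs j ys *
                B (fst (xs ! i)) (fst (ys ! j)) (snd (xs ! i)) (snd (ys ! j)))
          (pure (replicate (n + m - 2) V) (delete_at i xs @ delete_at j ys))) T) S)\<rparr>"


section \<open>The dual, the double and the endomorphism dioperad\<close>

text \<open>
  \<open>A\<^sup>*\<close> is the graded dual, with the linear forms on \<open>A\<^sub>-\<^sub>p\<close> (extended by 0) in degree \<open>p\<close> and the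
  differential for which evaluation is a chain map.
\<close>

definition dual :: "('k::field, 'a::ab_group_add) dgvs \<Rightarrow> ('k, 'a \<Rightarrow> 'k) dgvs" where
  "dual A =
   \<lparr>Scl = (\<lambda>c \<eta> x. c * \<eta> x),
    Gr = (\<lambda>p. {\<eta>.
       (\<forall>x \<in> Gr A (- p). (\<forall>y \<in> Gr A (- p). \<eta> (x + y) = \<eta> x + \<eta> y) \<and>
                        (\<forall>c. \<eta> (Scl A c x) = c * \<eta> x)) \<and>
       (\<forall>x. x \<notin> Gr A (- p) \<longrightarrow> \<eta> x = 0)}),
    Dif = (\<lambda>p \<eta> x. if x \<in> Gr A (- p - 1) then - ksgn p * \<eta> (Dif A (- p - 1) x) else 0)\<rparr>"

definition double ::
  "('k::field, 'a::ab_group_add) dgvs \<Rightarrow> ('k, 'a \<times> ('a \<Rightarrow> 'k)) dgvs" where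
  "double A =
   \<lparr>Scl = (\<lambda>c z. (Scl A c (fst z), Scl (dual A) c (snd z))),
    Gr = (\<lambda>p. Gr A p \<times> Gr (dual A) p),
    Dif = (\<lambda>p z. (Dif A p (fst z), Dif (dual A) p (snd z)))\<rparr>"

text \<open>
  Evaluation on \<open>A \<otimes> A\<^sup>*\<close> is evaluation on \<open>A\<^sup>* \<otimes> A\<close> preceded by the symmetry of graded vector spaces, hence
  the sign. With it the form \<open>\<langle>a \<oplus> \<eta>, b \<oplus> \<xi>\<rangle> = \<eta>(b) + \<xi>(a)\<close> is symmetric in the graded sense.
\<close>

definition eval_form :: "int \<Rightarrow> int \<Rightarrow> 'a \<Rightarrow> ('a \<Rightarrow> 'k::field) \<Rightarrow> 'k" where
  "eval_form p q a \<xi> = (if p + q = 0 then ksgn (p * q) * \<xi> a else 0)"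

definition double_form ::
  "int \<Rightarrow> int \<Rightarrow> 'a \<times> ('a \<Rightarrow> 'k::field) \<Rightarrow> 'a \<times> ('a \<Rightarrow> 'k) \<Rightarrow> 'k" where
  "double_form p q z w =
     (if p + q = 0 then snd z (fst w) else 0) + eval_form p q (fst z) (snd w)"

text \<open>
  \<open>A\<close> and \<open>A\<^sup>*\<close> are regarded as the two summands of the double, so that their elements have a common
  type. \<open>End_di A\<close> in arity \<open>(r, s)\<close> is the tensor product of \<open>r\<close> copies of \<open>A\<close> followed by \<open>s\<close> copies
  of \<open>A\<^sup>*\<close>.
\<close>

definition summand :: "('k::field, 'a::ab_group_add) dgvs \<Rightarrow> ('k, 'a \<times> ('a \<Rightarrow> 'k)) dgvs" where
  "summand A = (double A)\<lparr>Gr := \<lambda>p. Gr A p \<times> {0}\<rparr>"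

definition dual_summand :: "('k::field, 'a::ab_group_add) dgvs \<Rightarrow> ('k, 'a \<times> ('a \<Rightarrow> 'k)) dgvs" where
  "dual_summand A = (double A)\<lparr>Gr := \<lambda>p. {0} \<times> Gr (dual A) p\<rparr>"

definition mixed ::
  "('k::field, 'a::ab_group_add) dgvs \<Rightarrow> nat \<Rightarrow> nat \<Rightarrow> ('k, 'a \<times> ('a \<Rightarrow> 'k)) dgvs list" where
  "mixed A r s = replicate r (summand A) @ replicate s (dual_summand A)"

definition perm_sum :: "nat \<Rightarrow> (nat \<Rightarrow> nat) \<Rightarrow> (nat \<Rightarrow> nat) \<Rightarrow> nat \<Rightarrow> nat" where
  "perm_sum r \<sigma> \<tau> x = (if x < r then \<sigma> x else r + \<tau> (x - r))"

text \<open>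
  In the composition, the factor \<open>i\<close> of \<open>xs\<close> (in \<open>A\<close>) is evaluated against the factor \<open>r' + j\<close> of \<open>ys\<close>
  (in \<open>A\<^sup>*\<close>); the second sign comes from moving the \<open>r'\<close> outputs of \<open>ys\<close> across the \<open>s\<close> inputs of \<open>xs\<close>.
\<close>

definition End_di ::
  "('k::field, 'a::ab_group_add) dgvs \<Rightarrow> ('k, ('k, 'a \<times> ('a \<Rightarrow> 'k)) tens) dio_data" where
  "End_di A =
   \<lparr>Dsp = (\<lambda>r s. tensor (mixed A r s)),
    dact = (\<lambda>r s p \<sigma> \<tau>. tperm (mixed A r s) (perm_sum r \<sigma> \<tau>)),
    dcomp = (\<lambda>r s p i r' s' p' j S T.
      tlin (\<lambda>xs. tlin (\<lambda>ys.
        tscale (contract_sign i xs (r' + j) ys *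
                ksgn (degsum (drop r xs) * degsum (take r' ys)) *
                eval_form (fst (xs ! i)) (fst (ys ! (r' + j)))
                  (fst (snd (xs ! i))) (snd (snd (ys ! (r' + j)))))
          (pure (mixed A (r + r' - 1) (s + s' - 1))
            (delete_at i (take r xs) @ take r' ys @ drop r xs @ delete_at j (drop r' ys)))) T) S)\<rparr>"


section \<open>Algebras\<close>

definition dioperad_algebras ::
  "('k::field, 'p::ab_group_add) dio_data \<Rightarrow> ('k, 'a::ab_group_add) dgvs
   \<Rightarrow> (nat \<Rightarrow> nat \<Rightarrow> int \<Rightarrow> 'p \<Rightarrow> ('k, 'a \<times> ('a \<Rightarrow> 'k)) tens) set" where
  "dioperad_algebras P A = dio_hom P (End_di A)"

definition cyclic_algebras ::
  "('k::field, 'o::ab_group_add) cyc_data \<Rightarrow> ('k, 'v::ab_group_add) dgvs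
   \<Rightarrow> (int \<Rightarrow> int \<Rightarrow> 'v \<Rightarrow> 'v \<Rightarrow> 'k) \<Rightarrow> (nat \<Rightarrow> int \<Rightarrow> 'o \<Rightarrow> ('k, 'v) tens) set" where
  "cyclic_algebras \<O> V B = cyc_hom \<O> (End_cyc V B)"

text \<open>
  The canonical map from \<open>phi_push (End_di A)\<close> to \<open>End_cyc (double A)\<close>: in arity \<open>n\<close>, the tensor
  power of \<open>A \<oplus> A\<^sup>*\<close> is the sum over \<open>X \<subseteq> {..<n}\<close> of the tensor products with \<open>A\<close> in the positions from \<open>X\<close>
  and \<open>A\<^sup>*\<close> in the others. \<open>unshuffle n X\<close> sends \<open>0, 1, \<dots>\<close> to the elements of \<open>X\<close> in increasing order,
  followed by those of the complement.
\<close>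

definition unshuffle :: "nat \<Rightarrow> nat set \<Rightarrow> nat \<Rightarrow> nat" where
  "unshuffle n X k =
     (if k < n then (sorted_list_of_set X @ sorted_list_of_set ({..<n} - X)) ! k else k)"

definition canonical_map ::
  "('k::field, 'a::ab_group_add) dgvs \<Rightarrow> nat \<Rightarrow> int
   \<Rightarrow> (nat set \<Rightarrow> ('k, 'a \<times> ('a \<Rightarrow> 'k)) tens) \<Rightarrow> ('k, 'a \<times> ('a \<Rightarrow> 'k)) tens" where
  "canonical_map A n p u =
     (\<Sum>X \<in> Pow {..<n}. tperm (replicate n (double A)) (unshuffle n X) (u X))"

text \<open>
  The \<open>\<O>\<close>-algebra structure on the double of \<open>A\<close> associated to a structure \<open>f\<close> on \<open>A\<close> over a value \<open>(P, \<eta>)\<close>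
  of the left adjoint.
\<close>

definition induced_structure ::
  "('k::field, 'o) cyc_data \<Rightarrow> ('k, 'p::ab_group_add) dio_data
   \<Rightarrow> (nat \<Rightarrow> int \<Rightarrow> 'o \<Rightarrow> (nat set \<Rightarrow> 'p)) \<Rightarrow> ('k, 'a::ab_group_add) dgvs
   \<Rightarrow> (nat \<Rightarrow> nat \<Rightarrow> int \<Rightarrow> 'p \<Rightarrow> ('k, 'a \<times> ('a \<Rightarrow> 'k)) tens)
   \<Rightarrow> nat \<Rightarrow> int \<Rightarrow> 'o \<Rightarrow> ('k, 'a \<times> ('a \<Rightarrow> 'k)) tens" where
  "induced_structure \<O> P \<eta> A f =
     cyc_compose \<O> (canonical_map A) (cyc_compose \<O> (phi_push_map P f) \<eta>)"

end

theory Submission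
  imports Defs
begin

text \<open>
  Put \<open>V = A \<oplus> A\<^sup>*\<close>. Expanding the \<open>n\<close>-th tensor power of \<open>V\<close> gives one summand for each set \<open>X\<close> of
  flags, those carrying \<open>A\<close>; listing the flags in \<open>X\<close> first identifies it with \<open>End A (card X, n - card X)\<close>.
  The form pairs only \<open>A\<close> with \<open>A\<^sup>*\<close>, so contracting two flags of the same type gives \<open>0\<close> and contracting
  flags of opposite types is the composition of the endomorphism dioperad, with the same Koszul
  sign. Hence \<open>End V\<close> is isomorphic as a cyclic operad to the push-forward of \<open>End A\<close>, and the universal
  property of the left adjoint applies once \<open>End A\<close> is known to be a dioperad. For the latter,
  embed \<open>End A (r, s)\<close> into the tensor power of \<open>V\<close> with \<open>r + s\<close> factors, where the axioms are inherited from
  the cyclic operad \<open>End V\<close>.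
\<close>

section \<open>Signs\<close>

text \<open>A tensor is a functional on forms, so tensor products over different lists of spaces are
  different objects even when the factors of one are subspaces of the factors of the other: smaller
  factors admit more multilinear forms. Hence A and A* do not give literal subspaces of the tensor
  powers of V. The inclusion is an operator, \<open>tperm\<close> with the identity, and its
  injectivity comes from a retraction (\<open>tproject\<close>). Signs are the second obstacle. They
  are reduced to inversions of permutations (\<open>inv_sign\<close>), and splitting off one factor
  (\<open>koszul_split\<close>) accounts for the signs of differentials and of contractions alike. A
  direct check of the dioperad axioms would mix these signs with permutations of six blocks. Passing
  through \<open>phi_pull\<close> separates the two: signs are settled for the cyclic operad, and
  what is left is arithmetic on flag numbers. The price is a correction by
  \<open>block_swap\<close>, because gluing concatenates the flags of two elements whereas a
  dioperad lists outputs before inputs. Morphism sets are transported using closure under the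
  operations (\<open>cyc_closed\<close>) and bijectivity in each arity and degree.\<close>

lemma ksgn_if: "ksgn p = (if even p then 1 else (- 1 :: 'k::field))"
proof (cases "p \<ge> 0")
  case True
  then show ?thesis by (auto simp: power_int_def even_nat_iff)
next
  case False
  then show ?thesis by (auto simp: power_int_def even_nat_iff)
qed

lemma ksgn_add: "ksgn (p + q) = (ksgn p * ksgn q :: 'k::field)"
  by (simp add: ksgn_if)

lemma ksgn_cong: "even p = even q \<Longrightarrow> ksgn p = (ksgn q :: 'k::field)"
  by (simp add: ksgn_if)

lemma ksgn_square [simp]: "ksgn p * ksgn p = (1 :: 'k::field)"
  by (simp add: ksgn_if)

lemma ksgn_square_left [simp]: "ksgn p * (ksgn p * x) = (x :: 'k::field)"
  by (simp add: ksgn_if)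

lemma ksgn_sum: "ksgn (sum f S) = (\<Prod>k\<in>S. ksgn (f k) :: 'k::field)"
  by (induction S rule: infinite_finite_induct) (auto simp: ksgn_add)


section \<open>Tensor products\<close>

lemma sum_fun_app: "sum f S x = (\<Sum>s\<in>S. f s x)"
  for f :: "'s \<Rightarrow> 'x \<Rightarrow> 'y::comm_monoid_add"
  by (induction S rule: infinite_finite_induct) auto

interpretation tens: vector_space "tscale :: 'k::field \<Rightarrow> ('k, 'v) tens \<Rightarrow> ('k, 'v) tens"
  by unfold_locales (auto simp: tscale_def fun_eq_iff algebra_simps)

lemma tscale_apply: "tscale c T \<phi> = c * T \<phi>"
  by (simp add: tscale_def)

(* Induction over tensors leaves eta-expanded terms, which these rules would tear apart pointwise. *)
declare plus_fun_apply [simp del] zero_fun_apply [simp del]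

lemmas tens_apply = plus_fun_apply zero_fun_apply tscale_apply

lemma tensor_sel [simp]:
  "Scl (tensor Ws) = tscale"
  "Gr (tensor Ws) p = tens.span {pure Ws xs | xs. homog Ws xs \<and> degsum xs = p}"
  by (auto simp: tensor_def)

lemma homog_iff:
  "homog Ws xs \<longleftrightarrow>
     length xs = length Ws \<and> (\<forall>k < length Ws. snd (xs ! k) \<in> Gr (Ws ! k) (fst (xs ! k)))"
  by (auto simp: homog_def list_all2_conv_all_nth)

lemma homog_length: "homog Ws xs \<Longrightarrow> length xs = length Ws"
  by (simp add: homog_iff)

lemma homog_nth: "homog Ws xs \<Longrightarrow> k < length Ws \<Longrightarrow> snd (xs ! k) \<in> Gr (Ws ! k) (fst (xs ! k))"
  by (simp add: homog_iff)

lemma homog_update: "homog Ws xs \<Longrightarrow> x \<in> Gr (Ws ! k) p \<Longrightarrow> homog Ws (xs[k := (p, x)])"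
  
proof -
  assume h: "homog Ws xs" "x \<in> Gr (Ws ! k) p"
  have "snd (xs[k := (p, x)] ! l) \<in> Gr (Ws ! l) (fst (xs[k := (p, x)] ! l))" if "l < length Ws" for l
    using h that by (cases "l = k") (auto simp: homog_iff)
  then show ?thesis using h by (simp add: homog_iff)
qed

lemma homog_append:
  "length xs = length Ws \<Longrightarrow> homog (Ws @ Us) (xs @ ys) \<longleftrightarrow> homog Ws xs \<and> homog Us ys"
  by (simp add: homog_def list_all2_append)

text \<open>The condition on \<open>F\<close> under which \<open>tlin F\<close> can be evaluated on
  pure tensors: \<open>tlin\<close> hands to a tensor the function
  \<open>\<lambda>xs. F xs \<phi>\<close>, and \<open>pure\<close> returns 0 unless that function is
  multilinear. It is imposed for every \<open>\<phi>\<close>, multilinear or not.\<close>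

definition mlin ::
  "('k::field, 'v::ab_group_add) dgvs list \<Rightarrow> ((int \<times> 'v) list \<Rightarrow> ('k, 'w) tens) \<Rightarrow> bool" where
  "mlin Ws F \<longleftrightarrow> (\<forall>\<phi>. multilinear Ws (\<lambda>xs. F xs \<phi>))"

text \<open>\<open>multilinear\<close> speaks of the entry already present at position
  \<open>k\<close>; here a vector \<open>x\<close> is written there by an update, which is the shape
  produced by later operations on lists. Both say the same because updating a homogeneous list with
  a vector of the right space keeps it homogeneous, and every list is an update of itself.\<close>

lemma multilinear_iff:
  "multilinear Ws \<phi> \<longleftrightarrow> (\<forall>xs k p x. homog Ws xs \<and> k < length Ws \<and> x \<in> Gr (Ws ! k) p \<longrightarrow>
     (\<forall>y \<in> Gr (Ws ! k) p. \<phi> (xs[k := (p, x + y)]) = \<phi> (xs[k := (p, x)]) + \<phi> (xs[k := (p, y)])) \<and>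
     (\<forall>c. \<phi> (xs[k := (p, Scl (Ws ! k) c x)]) = c * \<phi> (xs[k := (p, x)])))"
  (is "?L \<longleftrightarrow> ?R")
proof
  assume L: ?L
  show ?R
  proof (intro allI impI, elim conjE)
    fix xs k p x
    assume h: "homog Ws xs" "k < length Ws" "x \<in> Gr (Ws ! k) p"
    let ?xs = "xs[k := (p, x)]"
    have "homog Ws ?xs" "k < length ?xs" using h by (auto simp: homog_update homog_length)
    with L have "let p = fst (?xs ! k); x = snd (?xs ! k) in
      (\<forall>y \<in> Gr (Ws ! k) p. \<phi> (?xs[k := (p, x + y)]) = \<phi> ?xs + \<phi> (?xs[k := (p, y)])) \<and>
      (\<forall>c. \<phi> (?xs[k := (p, Scl (Ws ! k) c x)]) = c * \<phi> ?xs)"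
      unfolding multilinear_def by blast
    then show "(\<forall>y \<in> Gr (Ws ! k) p. \<phi> (xs[k := (p, x + y)]) = \<phi> ?xs + \<phi> (xs[k := (p, y)])) \<and>
      (\<forall>c. \<phi> (xs[k := (p, Scl (Ws ! k) c x)]) = c * \<phi> ?xs)"
      using \<open>k < length ?xs\<close> by (simp add: Let_def)
  qed
next
  assume R: ?R
  show ?L unfolding multilinear_def Let_def
  proof (intro allI impI, elim conjE)
    fix xs k
    assume h: "homog Ws xs" "k < length xs"
    obtain p x where px: "xs ! k = (p, x)" by (cases "xs ! k")
    then have upd: "xs[k := (p, x)] = xs" using list_update_id[of xs k] by simp
    have "x \<in> Gr (Ws ! k) p" "k < length Ws"
      using homog_nth[OF h(1), of k] px h by (auto simp: homog_length)
    then show "(\<forall>y \<in> Gr (Ws ! k) (fst (xs ! k)). \<phi> (xs[k := (fst (xs ! k), snd (xs ! k) + y)]) =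
          \<phi> xs + \<phi> (xs[k := (fst (xs ! k), y)])) \<and>
        (\<forall>c. \<phi> (xs[k := (fst (xs ! k), Scl (Ws ! k) c (snd (xs ! k)))]) = c * \<phi> xs)"
      using R[rule_format, of xs k x p] h upd px by auto
  qed
qed

lemma mlin_iff:
  "mlin Ws F \<longleftrightarrow> (\<forall>xs k p x. homog Ws xs \<and> k < length Ws \<and> x \<in> Gr (Ws ! k) p \<longrightarrow>
     (\<forall>y \<in> Gr (Ws ! k) p. F (xs[k := (p, x + y)]) = F (xs[k := (p, x)]) + F (xs[k := (p, y)])) \<and>
     (\<forall>c. F (xs[k := (p, Scl (Ws ! k) c x)]) = tscale c (F (xs[k := (p, x)]))))"
  unfolding mlin_def multilinear_iff fun_eq_iff by (simp add: Ball_def tens_apply) metis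

lemma mlinI:
  assumes "\<And>xs k p x y. \<lbrakk>homog Ws xs; k < length Ws; x \<in> Gr (Ws ! k) p; y \<in> Gr (Ws ! k) p\<rbrakk>
      \<Longrightarrow> F (xs[k := (p, x + y)]) = F (xs[k := (p, x)]) + F (xs[k := (p, y)])"
    and "\<And>xs k p x c. \<lbrakk>homog Ws xs; k < length Ws; x \<in> Gr (Ws ! k) p\<rbrakk>
      \<Longrightarrow> F (xs[k := (p, Scl (Ws ! k) c x)]) = tscale c (F (xs[k := (p, x)]))"
  shows "mlin Ws F"
  using assms unfolding mlin_iff by blast

lemma mlin_add:
  "\<lbrakk>mlin Ws F; homog Ws xs; k < length Ws; x \<in> Gr (Ws ! k) p; y \<in> Gr (Ws ! k) p\<rbrakk>
      \<Longrightarrow> F (xs[k := (p, x + y)]) = F (xs[k := (p, x)]) + F (xs[k := (p, y)])"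
  unfolding mlin_iff by blast

lemma mlin_scale:
  "\<lbrakk>mlin Ws F; homog Ws xs; k < length Ws; x \<in> Gr (Ws ! k) p\<rbrakk>
      \<Longrightarrow> F (xs[k := (p, Scl (Ws ! k) c x)]) = tscale c (F (xs[k := (p, x)]))"
  unfolding mlin_iff by blast

lemma mlin_zero_entry:
  assumes "mlin Ws F" "homog Ws xs" "k < length Ws" "0 \<in> Gr (Ws ! k) p"
  shows "F (xs[k := (p, 0)]) = 0"
  using mlin_add[OF assms(1-4) assms(4)] by simp

text \<open>On forms that are not multilinear \<open>pure\<close> is 0 for every list, and on the
  others the relations hold by assumption.\<close>

lemma mlin_pure: "mlin Ws (pure Ws)"
  unfolding mlin_iff pure_def fun_eq_iff by (auto simp: multilinear_iff tens_apply)

text \<open>Multilinearity also evaluates \<open>F\<close> at sums and multiples of entries. The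
  pieces have to be closed under these operations for the lists involved to stay homogeneous, hence
  the assumption that the factors are dg vector spaces.\<close>

lemma mlin_cong:
  assumes "\<And>xs. homog Ws xs \<Longrightarrow> F xs = G xs" and sub: "\<And>W p. W \<in> set Ws \<Longrightarrow> dg_vector_space W"
  shows "mlin Ws F \<longleftrightarrow> mlin Ws G"
proof -
  have "x + y \<in> Gr (Ws ! k) p \<and> Scl (Ws ! k) c x \<in> Gr (Ws ! k) p"
    if "k < length Ws" "x \<in> Gr (Ws ! k) p" "y \<in> Gr (Ws ! k) p" for k x y p c
  proof -
    interpret vector_space "Scl (Ws ! k)" using sub[of "Ws ! k"] that by (simp add: dg_vector_space_def)
    show ?thesis using that sub[of "Ws ! k"] by (auto simp: dg_vector_space_def intro: subspace_add subspace_scale)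
  qed
  then show ?thesis
    unfolding mlin_iff using assms(1) by (smt (verit, ccfv_SIG) homog_update)
qed

lemma mlin_sum:
  "(\<And>s. s \<in> S \<Longrightarrow> mlin Ws (F s)) \<Longrightarrow> mlin Ws (\<lambda>xs. \<Sum>s\<in>S. F s xs)"
  unfolding mlin_iff
  by (simp add: sum.distrib[symmetric] tens.scale_sum_right[symmetric] cong: sum.cong)

text \<open>The factor \<open>c\<close> will be a Koszul sign or a sign of a differential: it sees
  only the degrees, and the updates in the definition of multilinearity keep them.\<close>

lemma mlin_tscale:
  assumes "mlin Ws F" and "\<And>xs ys. map fst xs = map fst ys \<Longrightarrow> c xs = c ys"
  shows "mlin Ws (\<lambda>xs. tscale (c xs) (F xs))"
proof (rule mlinI)
  have c: "c (xs[k := (p, y)]) = c (xs[k := (p, x)])" for xs k p x y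
    by (rule assms(2)) (simp add: map_update)
  fix xs k p x
  assume h: "homog Ws xs" "k < length Ws" "x \<in> Gr (Ws ! k) p"
  show "tscale (c (xs[k := (p, x + y)])) (F (xs[k := (p, x + y)])) =
      tscale (c (xs[k := (p, x)])) (F (xs[k := (p, x)])) + tscale (c (xs[k := (p, y)])) (F (xs[k := (p, y)]))"
    if "y \<in> Gr (Ws ! k) p" for y
    using mlin_add[OF assms(1) h that] c[of xs k p "x + y" x] c[of xs k p y x]
    by (simp add: tens.scale_right_distrib)
  show "tscale (c (xs[k := (p, Scl (Ws ! k) d x)])) (F (xs[k := (p, Scl (Ws ! k) d x)])) =
      tscale d (tscale (c (xs[k := (p, x)])) (F (xs[k := (p, x)])))" for d
    using mlin_scale[OF assms(1) h] c[of xs k p "Scl (Ws ! k) d x" x]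
    by (simp add: mult.commute)
qed

text \<open>The universal property of the tensor product: the case distinction hidden in
  \<open>pure\<close> is decided in favour of evaluation by \<open>mlin\<close>, for any
  list.\<close>

lemma tlin_pure: "mlin Ws F \<Longrightarrow> tlin F (pure Ws xs) = F xs"
  unfolding mlin_def by (simp add: tlin_def pure_def fun_eq_iff)

lemma tlin_zero [simp]: "tlin F 0 = 0"
  and tlin_add: "tlin F (S + T) = tlin F S + tlin F T"
  and tlin_scale: "tlin F (tscale c T) = tscale c (tlin F T)"
  by (auto simp: tlin_def fun_eq_iff tens_apply)

lemma tlin_sum: "tlin F (sum g S) = (\<Sum>s\<in>S. tlin F (g s))"
  by (simp add: tlin_def fun_eq_iff sum_fun_app)

lemma tensor_induct [consumes 1, case_names zero add pure]:
  assumes "T \<in> Gr (tensor Ws) p"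
    and "P 0"
    and "\<And>c S T. \<lbrakk>S \<in> Gr (tensor Ws) p; T \<in> Gr (tensor Ws) p; P S; P T\<rbrakk> \<Longrightarrow> P (tscale c S + T)"
    and "\<And>xs. \<lbrakk>homog Ws xs; degsum xs = p\<rbrakk> \<Longrightarrow> P (pure Ws xs)"
  shows "P T"
proof -
  let ?B = "{pure Ws xs | xs. homog Ws xs \<and> degsum xs = p}"
  have "T \<in> tens.span ?B \<and> P T"
  proof (rule tens.span_induct_alt[of T ?B])
    show "T \<in> tens.span ?B" using assms(1) by simp
    show "0 \<in> tens.span ?B \<and> P 0" using assms(2) by (simp add: tens.span_zero)
    fix c S T assume "S \<in> ?B" "T \<in> tens.span ?B \<and> P T"
    then show "tscale c S + T \<in> tens.span ?B \<and> P (tscale c S + T)"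
      using assms(3)[of S T c] assms(4) tens.span_base[of S ?B]
      by (auto intro: tens.span_add tens.span_scale)
  qed
  then show ?thesis by simp
qed

lemma pure_mem: "homog Ws xs \<Longrightarrow> degsum xs = p \<Longrightarrow> pure Ws xs \<in> Gr (tensor Ws) p"
  by (auto intro: tens.span_base)

lemma tensor_zero [simp]: "0 \<in> Gr (tensor Ws) p"
  and tensor_add: "S \<in> Gr (tensor Ws) p \<Longrightarrow> T \<in> Gr (tensor Ws) p \<Longrightarrow> S + T \<in> Gr (tensor Ws) p"
  and tensor_scale: "T \<in> Gr (tensor Ws) p \<Longrightarrow> tscale c T \<in> Gr (tensor Ws) p"
  by (auto intro: tens.span_add tens.span_scale tens.span_zero)

lemma tensor_sum: "(\<And>s. s \<in> S \<Longrightarrow> f s \<in> Gr (tensor Ws) p) \<Longrightarrow> sum f S \<in> Gr (tensor Ws) p"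
  by (simp add: tens.span_sum)

declare tensor_sel(2) [simp del]

lemma tlin_mem:
  assumes "T \<in> Gr (tensor Ws) p" "mlin Ws F"
    and "\<And>xs. \<lbrakk>homog Ws xs; degsum xs = p\<rbrakk> \<Longrightarrow> F xs \<in> Gr (tensor Us) q"
  shows "tlin F T \<in> Gr (tensor Us) q"
  using assms(1)
  by (induction rule: tensor_induct)
    (auto simp: tlin_add tlin_scale tlin_pure assms intro: tensor_add tensor_scale)

text \<open>Additivity and homogeneity are asked for on one graded piece only. Composition of
  tensors, which is defined by a nested \<open>tlin\<close>, is shown to be linear in its second
  argument just there.\<close>

lemma tensor_eqI:
  assumes "T \<in> Gr (tensor Ws) p"
    and "\<And>S T. S \<in> Gr (tensor Ws) p \<Longrightarrow> T \<in> Gr (tensor Ws) p \<Longrightarrow> L (S + T) = L S + L T"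
    and "\<And>c T. T \<in> Gr (tensor Ws) p \<Longrightarrow> L (tscale c T) = tscale c (L T)"
    and "\<And>S T. S \<in> Gr (tensor Ws) p \<Longrightarrow> T \<in> Gr (tensor Ws) p \<Longrightarrow> M (S + T) = M S + M T"
    and "\<And>c T. T \<in> Gr (tensor Ws) p \<Longrightarrow> M (tscale c T) = tscale c (M T)"
    and "\<And>xs. \<lbrakk>homog Ws xs; degsum xs = p\<rbrakk> \<Longrightarrow> L (pure Ws xs) = M (pure Ws xs)"
  shows "L T = M T"
  using assms(1)
proof (induction rule: tensor_induct)
  case zero
  show ?case using assms(3)[of 0 0] assms(5)[of 0 0] by simp
next
  case (add c S T)
  then show ?case by (simp add: assms(2-5) tensor_scale)
qed (rule assms(6))

text \<open>Bilinear extension; its linearity in \<open>T\<close> holds only on the span of the pure tensors.\<close>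

definition blin ::
  "((int \<times> 'v) list \<Rightarrow> (int \<times> 'w) list \<Rightarrow> ('k, 'u) tens) \<Rightarrow> ('k, 'v) tens \<Rightarrow> ('k, 'w) tens
   \<Rightarrow> ('k, 'u) tens" where
  "blin G S T = tlin (\<lambda>xs. tlin (G xs) T) S"

text \<open>The condition on the factors \<open>Ws\<close> serves \<open>mlin_cong\<close>: for a
  fixed pure tensor the map \<open>\<lambda>xs. tlin (G xs) (pure Us ys)\<close> is known to equal
  \<open>\<lambda>xs. G xs ys\<close> on homogeneous lists only, and multilinearity has to pass from
  one to the other.\<close>

definition bimlin ::
  "('k::field, 'v::ab_group_add) dgvs list \<Rightarrow> ('k, 'w::ab_group_add) dgvs list \<Rightarrow>
   ((int \<times> 'v) list \<Rightarrow> (int \<times> 'w) list \<Rightarrow> ('k, 'u) tens) \<Rightarrow> bool" where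
  "bimlin Ws Us G \<longleftrightarrow> (\<forall>W \<in> set Ws. dg_vector_space W) \<and> (\<forall>xs. homog Ws xs \<longrightarrow> mlin Us (G xs)) \<and>
     (\<forall>ys. homog Us ys \<longrightarrow> mlin Ws (\<lambda>xs. G xs ys))"

lemma blin_add_left: "blin G (S + S') T = blin G S T + blin G S' T"
  and blin_scale_left: "blin G (tscale c S) T = tscale c (blin G S T)"
  by (simp_all add: blin_def tlin_add tlin_scale)

text \<open>Multilinear maps are stable under linear combinations, so \<open>T\<close> may be taken
  pure, where \<open>tlin\<close> evaluates to \<open>G xs ys\<close> as soon as \<open>xs\<close>
  is homogeneous.\<close>

lemma mlin_tlin_right:
  assumes "bimlin Ws Us G" "T \<in> Gr (tensor Us) q"
  shows "mlin Ws (\<lambda>xs. tlin (G xs) T)"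
  using assms(2)
proof (induction rule: tensor_induct)
  case zero
  show ?case by (simp add: mlin_iff)
next
  case (add c S T)
  then show ?case
    by (simp add: mlin_iff tlin_add tlin_scale tens.scale_right_distrib)
next
  case (pure ys)
  have "mlin Ws (\<lambda>xs. tlin (G xs) (pure Us ys)) \<longleftrightarrow> mlin Ws (\<lambda>xs. G xs ys)"
    using assms(1) by (intro mlin_cong) (auto simp: bimlin_def tlin_pure)
  then show ?case using assms(1) pure by (simp add: bimlin_def)
qed

lemma blin_pure_left:
  "bimlin Ws Us G \<Longrightarrow> T \<in> Gr (tensor Us) q \<Longrightarrow> blin G (pure Ws xs) T = tlin (G xs) T"
  unfolding blin_def by (rule tlin_pure[OF mlin_tlin_right])

lemma blin_pure:
  assumes "bimlin Ws Us G" "homog Ws xs" "homog Us ys"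
  shows "blin G (pure Ws xs) (pure Us ys) = G xs ys"
  using blin_pure_left[OF assms(1) pure_mem[OF assms(3) refl]] assms tlin_pure[of Us "G xs"]
  by (simp add: bimlin_def)

text \<open>For fixed \<open>T\<close> and \<open>T'\<close> both sides are linear in
  \<open>S\<close>, so \<open>S\<close> may be taken pure; what remains is the linearity of
  \<open>tlin (G xs)\<close>.\<close>

lemma blin_add_right:
  assumes "bimlin Ws Us G" "S \<in> Gr (tensor Ws) p" "T \<in> Gr (tensor Us) q" "T' \<in> Gr (tensor Us) q"
  shows "blin G S (T + T') = blin G S T + blin G S T'"
  using assms(2)
  by (rule tensor_eqI)
    (auto simp: blin_add_left blin_scale_left blin_pure_left[OF assms(1), where q = q] assms tensor_add tlin_add
      tens.scale_right_distrib)

lemma blin_scale_right: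
  assumes "bimlin Ws Us G" "S \<in> Gr (tensor Ws) p" "T \<in> Gr (tensor Us) q"
  shows "blin G S (tscale c T) = tscale c (blin G S T)"
  using assms(2)
  by (rule tensor_eqI)
    (auto simp: blin_add_left blin_scale_left blin_pure_left[OF assms(1), where q = q] assms tensor_scale tlin_scale
      tens.scale_right_distrib mult.commute)

lemma blin_mem:
  assumes "bimlin Ws Us G" "S \<in> Gr (tensor Ws) p" "T \<in> Gr (tensor Us) q"
    and "\<And>xs ys. \<lbrakk>homog Ws xs; degsum xs = p; homog Us ys; degsum ys = q\<rbrakk> \<Longrightarrow> G xs ys \<in> Gr (tensor Vs) r"
  shows "blin G S T \<in> Gr (tensor Vs) r"
  unfolding blin_def
  using assms(1)
  by (intro tlin_mem[OF assms(2) mlin_tlin_right[OF assms(1,3)]] tlin_mem[OF assms(3)] assms(4))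
    (auto simp: bimlin_def)

section \<open>Degrees of lists and of their segments\<close>

lemma degsum_simps [simp]:
  "degsum [] = 0" "degsum (x # xs) = fst x + degsum xs" "degsum (xs @ ys) = degsum xs + degsum ys"
  by (auto simp: degsum_def)

lemma degsum_take_cong: "map fst xs = map fst ys \<Longrightarrow> degsum (take k xs) = degsum (take k ys)"
  and degsum_drop_cong: "map fst xs = map fst ys \<Longrightarrow> degsum (drop k xs) = degsum (drop k ys)"
  by (simp_all add: degsum_def take_map[symmetric] drop_map[symmetric])

lemma degsum_sum: "degsum xs = (\<Sum>k<length xs. fst (xs ! k))"
  unfolding degsum_def by (subst sum_list_sum_nth) (simp add: atLeast0LessThan)

lemma degsum_take_sum: "k \<le> length xs \<Longrightarrow> degsum (take k xs) = (\<Sum>l<k. fst (xs ! l))"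
  by (subst degsum_sum) (simp add: min_def)

lemma degsum_take_drop: "k < length xs \<Longrightarrow> degsum xs = degsum (take k xs) + fst (xs ! k) + degsum (drop (Suc k) xs)"
  using arg_cong[OF id_take_nth_drop[of k xs], of degsum] by simp

lemma degsum_update: "k < length xs \<Longrightarrow> degsum (xs[k := z]) = degsum xs - fst (xs ! k) + fst z"
  by (simp add: upd_conv_take_nth_drop degsum_take_drop[of k xs])

lemma degsum_take_update:
  "k < length xs \<Longrightarrow> degsum (take l (xs[k := z])) = degsum (take l xs) + (if k < l then fst z - fst (xs ! k) else 0)"
  by (cases "k < l") (simp_all add: take_update_swap degsum_update, metis not_less take_update_cancel take_update_swap)

lemma degsum_drop_update:
  "k < length xs \<Longrightarrow> degsum (drop l (xs[k := z])) = degsum (drop l xs) + (if k < l then 0 else fst z - fst (xs ! k))"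
  by (cases "k < l") (auto simp: drop_update_swap degsum_update)


section \<open>The differential of a tensor product\<close>

text \<open>The list in the \<open>k\<close>-th summand of the differential, without the
  sign.\<close>

definition dstep :: "('k, 'v) dgvs list \<Rightarrow> nat \<Rightarrow> (int \<times> 'v) list \<Rightarrow> (int \<times> 'v) list" where
  "dstep Ws k xs = xs[k := (fst (xs ! k) + 1, Dif (Ws ! k) (fst (xs ! k)) (snd (xs ! k)))]"

abbreviation dg_list :: "('k::field, 'v::ab_group_add) dgvs list \<Rightarrow> bool" where
  "dg_list Ws \<equiv> \<forall>W \<in> set Ws. dg_vector_space W"

lemma
  assumes "dg_vector_space W" "x \<in> Gr W p"
  shows dg_zero: "0 \<in> Gr W p" and dg_scale: "Scl W c x \<in> Gr W p"
    and dg_Dif: "Dif W p x \<in> Gr W (p + 1)"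
    and dg_Dif_scale: "Dif W p (Scl W c x) = Scl W c (Dif W p x)"
    and dg_Dif_Dif: "Dif W (p + 1) (Dif W p x) = 0"
    and dg_add: "y \<in> Gr W p \<Longrightarrow> x + y \<in> Gr W p"
    and dg_Dif_add: "y \<in> Gr W p \<Longrightarrow> Dif W p (x + y) = Dif W p x + Dif W p y"
proof -
  interpret vector_space "Scl W" using assms(1) by (simp add: dg_vector_space_def)
  show "0 \<in> Gr W p" "Scl W c x \<in> Gr W p" "y \<in> Gr W p \<Longrightarrow> x + y \<in> Gr W p"
    using assms by (auto simp: dg_vector_space_def intro: subspace_0 subspace_add subspace_scale)
  show "Dif W p x \<in> Gr W (p + 1)" "y \<in> Gr W p \<Longrightarrow> Dif W p (x + y) = Dif W p x + Dif W p y"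
    "Dif W p (Scl W c x) = Scl W c (Dif W p x)" "Dif W (p + 1) (Dif W p x) = 0"
    using assms by (auto simp: dg_vector_space_def)
qed

lemma length_dstep [simp]: "length (dstep Ws k xs) = length xs"
  by (simp add: dstep_def)

lemma dstep_nth:
  "l < length xs \<Longrightarrow> dstep Ws k xs ! l =
    (if l = k then (fst (xs ! k) + 1, Dif (Ws ! k) (fst (xs ! k)) (snd (xs ! k))) else xs ! l)"
  by (simp add: dstep_def nth_list_update)

lemma homog_dstep: "dg_list Ws \<Longrightarrow> homog Ws xs \<Longrightarrow> k < length Ws \<Longrightarrow> homog Ws (dstep Ws k xs)"
  unfolding dstep_def by (rule homog_update) (auto simp: homog_nth intro!: dg_Dif)

lemma degsum_dstep: "k < length xs \<Longrightarrow> degsum (dstep Ws k xs) = degsum xs + 1"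
  by (simp add: dstep_def degsum_update)

lemma degsum_take_dstep:
  "k < length xs \<Longrightarrow> degsum (take l (dstep Ws k xs)) = degsum (take l xs) + (if k < l then 1 else 0)"
  by (simp add: dstep_def degsum_take_update)

lemma degsum_drop_dstep:
  "k < length xs \<Longrightarrow> degsum (drop l (dstep Ws k xs)) = degsum (drop l xs) + (if k < l then 0 else 1)"
  by (simp add: dstep_def degsum_drop_update)

lemma dstep_comm: "k \<noteq> l \<Longrightarrow> dstep Ws l (dstep Ws k xs) = dstep Ws k (dstep Ws l xs)"
  by (auto simp: dstep_def list_update_swap)

text \<open>If position \<open>l\<close> is the differentiated one, linearity of \<open>Dif\<close>
  moves the sum or the scalar outside; otherwise the two updates are at different positions and
  commute.\<close>

lemma mlin_dstep:
  assumes "dg_list Ws" "mlin Ws F" "k < length Ws"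
  shows "mlin Ws (\<lambda>xs. F (dstep Ws k xs))"
proof (rule mlinI)
  fix xs l p x
  assume h: "homog Ws xs" "l < length Ws" "x \<in> Gr (Ws ! l) p"
  have dg: "dg_vector_space (Ws ! l)" using assms(1) h by simp
  have step: "dstep Ws k (xs[l := (p, y)]) =
      (if k = l then xs[l := (p + 1, Dif (Ws ! l) p y)] else (dstep Ws k xs)[l := (p, y)])" for y
    using h by (auto simp: dstep_def list_update_swap homog_length)
  have hd: "homog Ws (dstep Ws k xs)" by (rule homog_dstep) (use assms h in auto)
  show "F (dstep Ws k (xs[l := (p, x + y)])) = F (dstep Ws k (xs[l := (p, x)])) + F (dstep Ws k (xs[l := (p, y)]))"
    if "y \<in> Gr (Ws ! l) p" for y
    using mlin_add[OF assms(2) hd h(2,3) that] mlin_add[OF assms(2) h(1,2) dg_Dif[OF dg h(3)] dg_Dif[OF dg that]]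
    by (simp add: step dg_Dif_add[OF dg h(3) that])
  show "F (dstep Ws k (xs[l := (p, Scl (Ws ! l) c x)])) = tscale c (F (dstep Ws k (xs[l := (p, x)])))" for c
    using mlin_scale[OF assms(2) hd h(2,3)] mlin_scale[OF assms(2) h(1,2) dg_Dif[OF dg h(3)]]
    by (simp add: step dg_Dif_scale[OF dg h(3)])
qed

lemma Dif_tensor: "Dif (tensor Ws) p =
    tlin (\<lambda>xs. \<Sum>k<length xs. tscale (ksgn (degsum (take k xs))) (pure Ws (dstep Ws k xs)))"
  by (simp add: tensor_def dstep_def)

lemma Dif_add: "Dif (tensor Ws) p (S + T) = Dif (tensor Ws) p S + Dif (tensor Ws) p T"
  and Dif_scale: "Dif (tensor Ws) p (tscale c T) = tscale c (Dif (tensor Ws) p T)"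
  and Dif_zero: "Dif (tensor Ws) p 0 = 0"
  and Dif_sum: "Dif (tensor Ws) p (sum f A) = (\<Sum>a\<in>A. Dif (tensor Ws) p (f a))"
  by (simp_all add: Dif_tensor tlin_add tlin_scale tlin_sum)

text \<open>The range of the sum depends on the argument. On homogeneous lists it equals
  \<open>length Ws\<close>, and for this fixed range the rules for sums, signs and single steps
  apply.\<close>

lemma mlin_Dif:
  assumes "dg_list Ws"
  shows "mlin Ws (\<lambda>xs. \<Sum>k<length xs. tscale (ksgn (degsum (take k xs))) (pure Ws (dstep Ws k xs)))"
proof -
  have "mlin Ws (\<lambda>xs. \<Sum>k<length Ws. tscale (ksgn (degsum (take k xs))) (pure Ws (dstep Ws k xs)))"
    by (intro mlin_sum mlin_tscale mlin_dstep mlin_pure assms)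
      (auto intro!: arg_cong[of _ _ ksgn] degsum_take_cong)
  then show ?thesis
    by (subst mlin_cong[where G = "\<lambda>xs. \<Sum>k<length Ws. tscale (ksgn (degsum (take k xs))) (pure Ws (dstep Ws k xs))"])
      (use assms in \<open>auto simp: homog_length\<close>)
qed

lemma Dif_pure:
  "dg_list Ws \<Longrightarrow> Dif (tensor Ws) p (pure Ws xs) =
    (\<Sum>k<length xs. tscale (ksgn (degsum (take k xs))) (pure Ws (dstep Ws k xs)))"
  unfolding Dif_tensor by (rule tlin_pure[OF mlin_Dif])

lemma Dif_mem:
  assumes "dg_list Ws" "T \<in> Gr (tensor Ws) p"
  shows "Dif (tensor Ws) p T \<in> Gr (tensor Ws) (p + 1)"
  unfolding Dif_tensor
  using assms by (intro tlin_mem[OF assms(2)] mlin_Dif tensor_sum tensor_scale pure_mem)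
    (auto simp: homog_length degsum_dstep intro!: homog_dstep)

text \<open>Exchanging the summations shows that twice the sum is 0, and 2 is invertible in
  characteristic 0. The diagonal is covered by the assumption with \<open>k = l\<close>.\<close>

lemma sum_antisymmetric:
  fixes f :: "nat \<Rightarrow> nat \<Rightarrow> ('k::field_char_0, 'v) tens"
  assumes "\<And>k l. k \<in> S \<Longrightarrow> l \<in> S \<Longrightarrow> f k l + f l k = 0"
  shows "(\<Sum>k\<in>S. \<Sum>l\<in>S. f k l) = 0"
proof -
  let ?T = "\<Sum>k\<in>S. \<Sum>l\<in>S. f k l"
  have "?T + ?T = (\<Sum>k\<in>S. \<Sum>l\<in>S. f k l) + (\<Sum>k\<in>S. \<Sum>l\<in>S. f l k)" by (subst (3) sum.swap) simp
  also have "\<dots> = 0" by (simp add: sum.distrib[symmetric] assms)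
  finally have "tscale 2 ?T = 0"
    using tens.scale_left_distrib[of 1 1 ?T] by simp
  then show ?thesis by simp
qed

text \<open>Differentiating two different factors in either order gives the same list with opposite
  signs, since a step at the left of the two positions raises by one the degree in front of the
  right one. Differentiating the same factor twice produces an entry 0.\<close>

lemma dg_tensor:
  fixes Ws :: "('k::field_char_0, 'v::ab_group_add) dgvs list"
  assumes "dg_list Ws"
  shows "dg_vector_space (tensor Ws)"
proof -
  have DD: "Dif (tensor Ws) (p + 1) (Dif (tensor Ws) p T) = 0" if "T \<in> Gr (tensor Ws) p" for p T
  proof -
    \<comment> \<open>Zero is written as a multiple of \<open>T\<close>, so that both sides are
      linear in \<open>T\<close> and can be compared on pure tensors.\<close>
    have "Dif (tensor Ws) (p + 1) (Dif (tensor Ws) p T) = tscale 0 T" using that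
    proof (rule tensor_eqI)
      fix xs assume h: "homog Ws xs" "degsum xs = p"
      let ?n = "length Ws"
      let ?f = "\<lambda>k l. tscale (ksgn (degsum (take k xs)) * ksgn (degsum (take l (dstep Ws k xs))))
         (pure Ws (dstep Ws l (dstep Ws k xs)))"
      have "Dif (tensor Ws) (p + 1) (Dif (tensor Ws) p (pure Ws xs)) = (\<Sum>k<?n. \<Sum>l<?n. ?f k l)"
        using h by (simp add: Dif_pure[OF assms] Dif_sum Dif_scale tens.scale_sum_right homog_length)
      also have "\<dots> = 0"
      proof (rule sum_antisymmetric)
        fix k l assume kl: "k \<in> {..<?n}" "l \<in> {..<?n}"
        show "?f k l + ?f l k = 0"
        proof (cases "k = l")
          case True
          have dg: "dg_vector_space (Ws ! k)" using assms kl by simp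
          have x: "snd (xs ! k) \<in> Gr (Ws ! k) (fst (xs ! k))" using h kl homog_nth by auto
          have "dstep Ws k (dstep Ws k xs) = xs[k := (fst (xs ! k) + 2, 0)]"
            using kl h dg_Dif_Dif[OF dg x] by (simp add: dstep_def homog_length add.commute)
          moreover have "pure Ws (xs[k := (fst (xs ! k) + 2, 0)]) = 0"
            using mlin_zero_entry[OF mlin_pure h(1)] kl
              dg_Dif_Dif[OF dg x] dg_Dif[OF dg dg_Dif[OF dg x]] by (simp add: add.assoc)
          ultimately show ?thesis using True by simp
        next
          case False
          have "ksgn (degsum (take k xs)) * ksgn (degsum (take l (dstep Ws k xs))) =
            - (ksgn (degsum (take l xs)) * ksgn (degsum (take k (dstep Ws l xs))) :: 'k)"
            using kl h False by (auto simp: degsum_take_dstep homog_length ksgn_if)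
          then show ?thesis
            by (simp add: dstep_comm[OF False] tens.scale_minus_left)
        qed
      qed
      finally show "Dif (tensor Ws) (p + 1) (Dif (tensor Ws) p (pure Ws xs)) = tscale 0 (pure Ws xs)" by simp
    qed (simp_all add: Dif_add Dif_scale tens.scale_right_distrib)
    then show ?thesis by simp
  qed
  have "tens.subspace (Gr (tensor Ws) p)" for p
    by (simp add: tensor_sel(2) tens.subspace_span)
  then show ?thesis
    unfolding dg_vector_space_def
    using DD Dif_mem[OF assms] tens.vector_space_axioms by (auto simp: Dif_add Dif_scale)
qed


section \<open>Koszul signs\<close>

text \<open>The Koszul sign of \<sigma> for factors of degrees \<open>d\<close> placed at the
  positions in \<open>S\<close>. The double product with conditions, in place of a product over
  inversions, makes it easy to split, enlarge and reindex the set \<open>S\<close>.\<close>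

definition inv_sign :: "nat set \<Rightarrow> (nat \<Rightarrow> nat) \<Rightarrow> (nat \<Rightarrow> int) \<Rightarrow> 'k::field" where
  "inv_sign S \<sigma> d =
     (\<Prod>k\<in>S. \<Prod>l\<in>S. if k < l then if \<sigma> l < \<sigma> k then ksgn (d k * d l) else 1 else 1)"

lemma koszul_inv_sign: "koszul \<sigma> xs = (inv_sign {..<length xs} \<sigma> (\<lambda>k. fst (xs ! k)) :: 'k::field)"
proof -
  let ?N = "{..<length xs}" and ?S = "{(k, l). k < l \<and> l < length xs \<and> \<sigma> l < \<sigma> k}"
  let ?f = "\<lambda>(k, l). ksgn (fst (xs ! k) * fst (xs ! l)) :: 'k"
  have "inv_sign ?N \<sigma> (\<lambda>k. fst (xs ! k)) = (\<Prod>z \<in> ?N \<times> ?N. if z \<in> ?S then ?f z else 1)"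
    unfolding inv_sign_def prod.cartesian_product by (intro prod.cong) (auto split: if_splits)
  also have "\<dots> = prod ?f ((?N \<times> ?N) \<inter> ?S)"
    by (rule prod.inter_restrict[symmetric]) simp
  also have "(?N \<times> ?N) \<inter> ?S = ?S" by auto
  finally show ?thesis by (simp add: koszul_def)
qed

lemma inv_sign_cong:
  assumes "\<And>k. k \<in> S \<Longrightarrow> d k = e k"
    and "\<And>k l. k \<in> S \<Longrightarrow> l \<in> S \<Longrightarrow> k < l \<Longrightarrow> \<sigma> l < \<sigma> k \<longleftrightarrow> \<tau> l < \<tau> k"
  shows "inv_sign S \<sigma> d = inv_sign S \<tau> e"
  unfolding inv_sign_def using assms by (intro prod.cong refl) auto

lemma koszul_cong:
  assumes "map fst xs = map fst ys"
  shows "koszul \<sigma> xs = (koszul \<sigma> ys :: 'k::field)"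
proof -
  have len: "length xs = length ys" using assms by (metis length_map)
  have "fst (xs ! k) = fst (ys ! k)" if "k < length ys" for k
    using that len arg_cong[OF assms, of "\<lambda>zs. zs ! k"] by simp
  then show ?thesis
    unfolding koszul_inv_sign len by (intro inv_sign_cong) auto
qed

text \<open>The pairs gained are those of \<open>i\<close> with an element of \<open>S\<close>. Such
  a pair is an inversion exactly if \<sigma> changes its order, and the degrees of these elements
  are collected in the exponent.\<close>

lemma inv_sign_insert:
  assumes "finite S" "i \<notin> S" "inj_on \<sigma> (insert i S)"
  shows "inv_sign (insert i S) \<sigma> d =
    (inv_sign S \<sigma> d * ksgn (d i * (\<Sum>l \<in> {l \<in> S. (l < i) \<noteq> (\<sigma> l < \<sigma> i)}. d l)) :: 'k::field)"
proof -
  let ?g = "\<lambda>k l. if k < l then if \<sigma> l < \<sigma> k then ksgn (d k * d l) else 1 else (1 :: 'k)"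
  have "inv_sign (insert i S) \<sigma> d = (\<Prod>l\<in>S. ?g i l) * (\<Prod>k\<in>S. ?g k i * (\<Prod>l\<in>S. ?g k l))"
    unfolding inv_sign_def using assms by simp
  also have "\<dots> = inv_sign S \<sigma> d * (\<Prod>l\<in>S. ?g i l * ?g l i)"
    unfolding inv_sign_def by (simp add: prod.distrib)
  also have "(\<Prod>l\<in>S. ?g i l * ?g l i) = (\<Prod>l\<in>S. if (l < i) \<noteq> (\<sigma> l < \<sigma> i) then ksgn (d i * d l) else 1)"
  proof (rule prod.cong[OF refl])
    fix l assume l: "l \<in> S"
    then have "l \<noteq> i" "\<sigma> l \<noteq> \<sigma> i" using assms(2,3) by (auto simp: inj_on_def)
    then show "?g i l * ?g l i = (if (l < i) \<noteq> (\<sigma> l < \<sigma> i) then ksgn (d i * d l) else 1)"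
      by (auto simp: mult.commute)
  qed
  also have "\<dots> = (\<Prod>l \<in> {l \<in> S. (l < i) \<noteq> (\<sigma> l < \<sigma> i)}. ksgn (d i * d l))"
    using assms(1) by (rule prod.inter_filter[symmetric])
  also have "\<dots> = ksgn (d i * (\<Sum>l \<in> {l \<in> S. (l < i) \<noteq> (\<sigma> l < \<sigma> i)}. d l))"
    by (simp add: sum_distrib_left ksgn_sum)
  finally show ?thesis .
qed

lemma inv_sign_reindex:
  assumes "inj_on h S"
    and "\<And>k l. k \<in> S \<Longrightarrow> l \<in> S \<Longrightarrow> h k < h l \<longleftrightarrow> k < l"
    and "\<And>k l. k \<in> S \<Longrightarrow> l \<in> S \<Longrightarrow> \<sigma> (h k) < \<sigma> (h l) \<longleftrightarrow> \<tau> k < \<tau> l"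
  shows "inv_sign (h ` S) \<sigma> d = inv_sign S \<tau> (d \<circ> h)"
  unfolding inv_sign_def
  by (auto simp: prod.reindex[OF assms(1)] assms(2,3) intro!: prod.cong)

text \<open>No inversion has one index in \<open>S\<close> and the other in \<open>T\<close>, as
  both the positions and their images keep all of \<open>S\<close> in front of
  \<open>T\<close>.\<close>

lemma inv_sign_Un:
  assumes "finite S" "finite T" "\<And>k l. k \<in> S \<Longrightarrow> l \<in> T \<Longrightarrow> k < l \<and> \<sigma> k < \<sigma> l"
  shows "inv_sign (S \<union> T) \<sigma> d = (inv_sign S \<sigma> d * inv_sign T \<sigma> d :: 'k::field)"
proof -
  let ?g = "\<lambda>k l. if k < l then if \<sigma> l < \<sigma> k then ksgn (d k * d l) else 1 else (1 :: 'k)"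
  have disj: "S \<inter> T = {}" using assms(3) by force
  have "inv_sign (S \<union> T) \<sigma> d =
      (\<Prod>k\<in>S. (\<Prod>l\<in>S. ?g k l) * (\<Prod>l\<in>T. ?g k l)) * (\<Prod>k\<in>T. (\<Prod>l\<in>S. ?g k l) * (\<Prod>l\<in>T. ?g k l))"
    unfolding inv_sign_def using assms(1,2) disj by (simp add: prod.union_disjoint)
  moreover have "(\<Prod>k\<in>S. \<Prod>l\<in>T. ?g k l) = 1"
    using assms(3) by (intro prod.neutral ballI) (auto dest: less_asym)
  moreover have "(\<Prod>k\<in>T. \<Prod>l\<in>S. ?g k l) = 1"
    using assms(3) by (intro prod.neutral ballI) (auto dest: less_asym)
  ultimately show ?thesis unfolding inv_sign_def prod.distrib by simp
qed

text \<open>A product of a symmetric function over unordered pairs does not depend on the linear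
  order used to list each pair once, and \<tau> induces another such order. In the induction a new
  element \<open>i\<close> contributes the product of \<open>h i l\<close> over the old elements
  \<open>l\<close>, for either order.\<close>

lemma prod_pairs_reindex:
  fixes h :: "nat \<Rightarrow> nat \<Rightarrow> 'k::field" and \<tau> :: "nat \<Rightarrow> nat"
  assumes "finite S" "inj_on \<tau> S" "\<And>k l. h k l = h l k"
  shows "(\<Prod>k\<in>S. \<Prod>l\<in>S. if \<tau> k < \<tau> l then h k l else 1) = (\<Prod>k\<in>S. \<Prod>l\<in>S. if k < l then h k l else 1)"
  using assms(1,2)
proof (induction S)
  case (insert i S)
  have split: "(\<Prod>k\<in>insert i S. \<Prod>l\<in>insert i S. if t k < t l then h k l else 1) =
      (\<Prod>k\<in>S. \<Prod>l\<in>S. if t k < t l then h k l else 1) * (\<Prod>l\<in>S. h i l)"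
    if "inj_on t (insert i S)" for t :: "nat \<Rightarrow> nat"
  proof -
    let ?g = "\<lambda>k l. if t k < t l then h k l else 1"
    have "(\<Prod>k\<in>insert i S. \<Prod>l\<in>insert i S. ?g k l) = (\<Prod>l\<in>S. ?g i l) * (\<Prod>k\<in>S. ?g k i * (\<Prod>l\<in>S. ?g k l))"
      using insert.hyps by simp
    also have "\<dots> = (\<Prod>k\<in>S. \<Prod>l\<in>S. ?g k l) * (\<Prod>l\<in>S. ?g i l * ?g l i)"
      by (simp add: prod.distrib)
    also have "(\<Prod>l\<in>S. ?g i l * ?g l i) = (\<Prod>l\<in>S. h i l)"
    proof (rule prod.cong[OF refl])
      fix l assume l: "l \<in> S"
      then have "t l \<noteq> t i" using that insert.hyps by (auto simp: inj_on_def)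
      then show "?g i l * ?g l i = h i l" using assms(3)[of i l] by auto
    qed
    finally show ?thesis .
  qed
  from insert show ?case using split[of \<tau>] split[of "\<lambda>x. x"] by simp
qed simp

lemma nth_permute_inv:
  assumes "\<sigma> permutes {..<length xs}" "k < length xs"
  shows "permute_list (inv \<sigma>) xs ! \<sigma> k = xs ! k"
  using permute_list_nth[of "inv \<sigma>" xs "\<sigma> k"] assms permutes_inv[OF assms(1)] permutes_in_image[OF assms(1)]
  by (simp add: permutes_inverses)

text \<open>A pair is inverted by \<open>\<sigma> \<circ> \<tau>\<close> if and only if exactly one
  of two things happens: \<tau> inverts it, or \<sigma> changes the order of its images under
  \<tau>. A pair for which both happen contributes a square, which is 1.\<close>

lemma koszul_comp:
  assumes "\<sigma> permutes {..<length xs}" "\<tau> permutes {..<length xs}"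
  shows "koszul (\<sigma> \<circ> \<tau>) xs = (koszul \<tau> xs * koszul \<sigma> (permute_list (inv \<tau>) xs) :: 'k::field)"
proof -
  let ?N = "{..<length xs}" and ?d = "\<lambda>k. fst (xs ! k)"
  \<comment> \<open>\<open>?h \<sigma> k l\<close> asks whether the permutation changes the order of
    \<open>k\<close> and \<open>l\<close>. This is symmetric in \<open>k\<close> and
    \<open>l\<close>, as \<open>prod_pairs_reindex\<close> requires, and so is \<open>?h'\<close>,
    which asks the same about \<sigma> and the images under \<tau>.\<close>
  let ?h = "\<lambda>\<sigma> k l. if (k < l) \<noteq> (\<sigma> k < \<sigma> l) \<and> k \<noteq> l then ksgn (?d k * ?d l) else (1 :: 'k)"
  let ?h' = "\<lambda>k l. if (\<tau> k < \<tau> l) \<noteq> (\<sigma> (\<tau> k) < \<sigma> (\<tau> l)) \<and> k \<noteq> l then ksgn (?d k * ?d l) else (1 :: 'k)"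
  have inj: "\<tau> k = \<tau> l \<longleftrightarrow> k = l" "\<sigma> k = \<sigma> l \<longleftrightarrow> k = l" for k l
    using assms by (metis permutes_inverses(2))+
  have form: "koszul \<rho> xs = (\<Prod>k\<in>?N. \<Prod>l\<in>?N. if k < l then ?h \<rho> k l else 1)" if "inj \<rho>" for \<rho>
    unfolding koszul_inv_sign inv_sign_def
    by (intro prod.cong refl) (use injD[OF that] in \<open>auto simp: not_less le_less\<close>)
  have N: "?N = \<tau> ` ?N" using permutes_image[OF assms(2)] by simp
  have "koszul \<sigma> (permute_list (inv \<tau>) xs) =
      (\<Prod>k\<in>?N. \<Prod>l\<in>?N. if \<tau> k < \<tau> l then ?h' k l else 1)"
    unfolding koszul_inv_sign length_permute_list inv_sign_def
    apply (subst (1 2) N)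
    apply (subst (1 2) prod.reindex)
    using assms(2) inj by (auto simp: nth_permute_inv inj_on_def not_less le_less intro!: prod.cong)
  \<comment> \<open>The left side lists each pair in the order of its images under \<tau>, the right
    side in the natural order.\<close>
  also have "\<dots> = (\<Prod>k\<in>?N. \<Prod>l\<in>?N. if k < l then ?h' k l else 1)"
    by (rule prod_pairs_reindex) (use inj in \<open>auto simp: inj_on_def not_less le_less mult.commute\<close>)
  finally have 1: "koszul \<sigma> (permute_list (inv \<tau>) xs) = (\<Prod>k\<in>?N. \<Prod>l\<in>?N. if k < l then ?h' k l else 1)" .
  have "inj \<tau>" "inj (\<sigma> \<circ> \<tau>)" using inj by (auto simp: inj_on_def)
  then show ?thesis
    unfolding 1 form[OF \<open>inj \<tau>\<close>] form[OF \<open>inj (\<sigma> \<circ> \<tau>)\<close>] prod.distrib[symmetric]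
    by (intro prod.cong refl) (auto)
qed

lemma koszul_id [simp]: "koszul id xs = 1"
  unfolding koszul_inv_sign inv_sign_def by (intro prod.neutral ballI) auto

section \<open>Permutations of tensor factors\<close>

text \<open>Only the graded pieces may shrink while the operations stay the same; in this way A and
  A* lie in the double.\<close>

definition sub_dg :: "('k, 'v) dgvs \<Rightarrow> ('k, 'v) dgvs \<Rightarrow> bool" where
  "sub_dg W V \<longleftrightarrow> Scl W = Scl V \<and> Dif W = Dif V \<and> (\<forall>p. Gr W p \<subseteq> Gr V p)"

lemma sub_dg_refl [simp]: "sub_dg W W"
  by (simp add: sub_dg_def)

text \<open>A permutation of factors may at the same time enlarge each factor. With the identity as
  permutation this describes the inclusion of a tensor product of subspaces, so \<open>tperm\<close>
  covers permutations and inclusions alike.\<close>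

definition perm_compat ::
  "(nat \<Rightarrow> nat) \<Rightarrow> ('k, 'v) dgvs list \<Rightarrow> ('k, 'v) dgvs list \<Rightarrow> bool" where
  "perm_compat \<sigma> Ws Us \<longleftrightarrow> length Us = length Ws \<and> \<sigma> permutes {..<length Ws} \<and>
     (\<forall>k < length Ws. sub_dg (Ws ! k) (Us ! \<sigma> k))"

lemma permutes_less: "\<sigma> permutes {..<n} \<Longrightarrow> \<sigma> k < n \<longleftrightarrow> k < n"
  using permutes_in_image[of \<sigma> "{..<n}" k] by simp

lemma permute_list_eqI:
  assumes "\<sigma> permutes {..<length xs}" "length ys = length xs" "\<And>k. k < length xs \<Longrightarrow> ys ! \<sigma> k = xs ! k"
  shows "permute_list (inv \<sigma>) xs = ys"
proof (rule nth_equalityI)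
  fix k assume "k < length (permute_list (inv \<sigma>) xs)"
  then have k: "k < length xs" by simp
  have inv: "inv \<sigma> k < length xs" using permutes_less[OF permutes_inv[OF assms(1)]] k by simp
  show "permute_list (inv \<sigma>) xs ! k = ys ! k"
    using assms(3)[OF inv] permute_list_nth[OF permutes_inv[OF assms(1)] k]
    by (simp add: permutes_inverses(1)[OF assms(1)])
qed (use assms in simp)

lemma permute_list_update:
  assumes "\<sigma> permutes {..<length xs}" "k < length xs"
  shows "permute_list (inv \<sigma>) (xs[k := z]) = (permute_list (inv \<sigma>) xs)[\<sigma> k := z]"
proof (rule permute_list_eqI)
  fix l assume l: "l < length (xs[k := z])"
  have "\<sigma> l = \<sigma> k \<longleftrightarrow> l = k" using permutes_inj[OF assms(1)] by (auto dest: injD)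
  moreover have "\<sigma> l < length xs" using l permutes_less[OF assms(1)] by simp
  ultimately show "(permute_list (inv \<sigma>) xs)[\<sigma> k := z] ! \<sigma> l = xs[k := z] ! l"
    using l assms by (auto simp: nth_list_update nth_permute_inv)
qed (use assms in simp_all)

lemma map_permute_inv:
  "\<sigma> permutes {..<length xs} \<Longrightarrow> map f (permute_list (inv \<sigma>) xs) = permute_list (inv \<sigma>) (map f xs)"
  by (simp add: permute_list_map permutes_inv)

lemma degsum_permute: "\<sigma> permutes {..<length xs} \<Longrightarrow> degsum (permute_list (inv \<sigma>) xs) = degsum xs"
  unfolding degsum_def
  by (metis map_permute_inv length_map mset_permute_list permutes_inv sum_mset_sum_list)

lemma homog_permute:
  assumes "perm_compat \<sigma> Ws Us" "homog Ws xs"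
  shows "homog Us (permute_list (inv \<sigma>) xs)"
  unfolding homog_iff
proof (intro conjI allI impI)
  have \<sigma>: "\<sigma> permutes {..<length xs}" using assms by (simp add: perm_compat_def homog_length)
  show "length (permute_list (inv \<sigma>) xs) = length Us"
    using assms by (simp add: perm_compat_def homog_length)
  fix k assume k: "k < length Us"
  then have k': "k < length xs" using assms by (simp add: perm_compat_def homog_length)
  have inv: "inv \<sigma> k < length xs" using permutes_less[OF permutes_inv[OF \<sigma>]] k' by simp
  have "sub_dg (Ws ! inv \<sigma> k) (Us ! k)"
    using assms inv by (metis homog_length perm_compat_def permutes_inverses(1))
  moreover have "snd (xs ! inv \<sigma> k) \<in> Gr (Ws ! inv \<sigma> k) (fst (xs ! inv \<sigma> k))"
    using homog_nth[OF assms(2)] inv assms(2) by (simp add: homog_length)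
  ultimately show "snd (permute_list (inv \<sigma>) xs ! k) \<in> Gr (Us ! k) (fst (permute_list (inv \<sigma>) xs ! k))"
    using permute_list_nth[OF permutes_inv[OF \<sigma>] k'] by (auto simp: sub_dg_def)
qed

lemma mlin_permute:
  assumes "perm_compat \<sigma> Ws Us" "mlin Us F"
  shows "mlin Ws (\<lambda>xs. F (permute_list (inv \<sigma>) xs))"
proof (rule mlinI)
  fix xs k p x
  assume h: "homog Ws xs" "k < length Ws" "x \<in> Gr (Ws ! k) p"
  have \<sigma>: "\<sigma> permutes {..<length xs}" and k: "k < length xs"
    using assms h by (simp_all add: perm_compat_def homog_length)
  have sub: "sub_dg (Ws ! k) (Us ! \<sigma> k)" and k': "\<sigma> k < length Us"
    using assms h permutes_less[OF \<sigma>] by (simp_all add: perm_compat_def homog_length)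
  have mem: "y \<in> Gr (Us ! \<sigma> k) p" if "y \<in> Gr (Ws ! k) p" for y
    using that sub by (auto simp: sub_dg_def)
  note upd = permute_list_update[OF \<sigma> k]
  show "F (permute_list (inv \<sigma>) (xs[k := (p, x + y)])) =
      F (permute_list (inv \<sigma>) (xs[k := (p, x)])) + F (permute_list (inv \<sigma>) (xs[k := (p, y)]))"
    if "y \<in> Gr (Ws ! k) p" for y
    unfolding upd by (rule mlin_add[OF assms(2) homog_permute[OF assms(1) h(1)] k' mem[OF h(3)] mem[OF that]])
  show "F (permute_list (inv \<sigma>) (xs[k := (p, Scl (Ws ! k) c x)])) =
      tscale c (F (permute_list (inv \<sigma>) (xs[k := (p, x)])))" for c
    unfolding upd
    using mlin_scale[OF assms(2) homog_permute[OF assms(1) h(1)] k' mem[OF h(3)]] sub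
    by (simp add: sub_dg_def)
qed

lemma mlin_tperm:
  "perm_compat \<sigma> Ws Us \<Longrightarrow> mlin Ws (\<lambda>xs. tscale (koszul \<sigma> xs) (pure Us (permute_list (inv \<sigma>) xs)))"
  by (intro mlin_tscale mlin_permute[OF _ mlin_pure] koszul_cong)

lemma tperm_pure:
  "perm_compat \<sigma> Ws Us \<Longrightarrow>
    tperm Us \<sigma> (pure Ws xs) = tscale (koszul \<sigma> xs) (pure Us (permute_list (inv \<sigma>) xs))"
  unfolding tperm_def by (rule tlin_pure[OF mlin_tperm])

lemma tperm_add: "tperm Us \<sigma> (S + T) = tperm Us \<sigma> S + tperm Us \<sigma> T"
  and tperm_scale: "tperm Us \<sigma> (tscale c T) = tscale c (tperm Us \<sigma> T)"
  and tperm_sum: "tperm Us \<sigma> (sum f A) = (\<Sum>a\<in>A. tperm Us \<sigma> (f a))"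
  and tperm_zero: "tperm Us \<sigma> 0 = 0"
  by (simp_all add: tperm_def tlin_add tlin_scale tlin_sum)

lemma perm_compat_permutes: "perm_compat \<sigma> Ws Us \<Longrightarrow> homog Ws xs \<Longrightarrow> \<sigma> permutes {..<length xs}"
  by (simp add: perm_compat_def homog_length)

lemma tperm_mem:
  assumes "perm_compat \<sigma> Ws Us" "T \<in> Gr (tensor Ws) p"
  shows "tperm Us \<sigma> T \<in> Gr (tensor Us) p"
  unfolding tperm_def using assms
  by (intro tlin_mem[OF assms(2)] mlin_tperm tensor_scale pure_mem homog_permute)
    (auto simp: degsum_permute perm_compat_permutes)

lemma perm_compat_comp:
  assumes "perm_compat \<tau> Ws Us" "perm_compat \<sigma> Us Vs"
  shows "perm_compat (\<sigma> \<circ> \<tau>) Ws Vs"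
proof -
  have \<tau>: "\<tau> permutes {..<length Ws}" and \<sigma>: "\<sigma> permutes {..<length Ws}"
    using assms by (simp_all add: perm_compat_def)
  have "sub_dg (Ws ! k) (Vs ! \<sigma> (\<tau> k))" if "k < length Ws" for k
  proof -
    have "sub_dg (Ws ! k) (Us ! \<tau> k)" "sub_dg (Us ! \<tau> k) (Vs ! \<sigma> (\<tau> k))"
      using assms that permutes_less[OF \<tau>] by (simp_all add: perm_compat_def)
    then show ?thesis unfolding sub_dg_def by (metis subset_trans)
  qed
  then show ?thesis
    using assms permutes_compose[OF \<tau> \<sigma>] by (simp add: perm_compat_def)
qed

lemma tperm_tperm:
  assumes "perm_compat \<tau> Ws Us" "perm_compat \<sigma> Us Vs" "T \<in> Gr (tensor Ws) p"
  shows "tperm Vs \<sigma> (tperm Us \<tau> T) = tperm Vs (\<sigma> \<circ> \<tau>) T"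
  using assms(3)
proof (rule tensor_eqI)
  fix xs assume xs: "homog Ws xs"
  have \<tau>: "\<tau> permutes {..<length xs}" and \<sigma>: "\<sigma> permutes {..<length xs}"
    using assms xs by (simp_all add: perm_compat_def homog_length)
  have "permute_list (inv (\<sigma> \<circ> \<tau>)) xs = permute_list (inv \<sigma>) (permute_list (inv \<tau>) xs)"
    using permute_list_compose[OF permutes_inv[OF \<sigma>], of "inv \<tau>"] permutes_inv[OF \<tau>]
      permutes_bij[OF \<sigma>] permutes_bij[OF \<tau>] permute_list_compose[OF permutes_inv[OF \<tau>], of "inv \<sigma>"]
    by (simp add: o_inv_distrib)
  then show "tperm Vs \<sigma> (tperm Us \<tau> (pure Ws xs)) = tperm Vs (\<sigma> \<circ> \<tau>) (pure Ws xs)"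
    using assms(1,2) \<sigma> \<tau>
    by (simp add: tperm_pure tperm_scale koszul_comp perm_compat_comp[OF assms(1,2)])
qed (simp_all add: tperm_add tperm_scale)

lemma perm_compat_id: "perm_compat id Ws Ws"
  by (simp add: perm_compat_def permutes_id)

lemma tperm_id: "T \<in> Gr (tensor Ws) p \<Longrightarrow> tperm Ws id T = T"
proof (erule tensor_eqI)
  fix xs show "tperm Ws id (pure Ws xs) = pure Ws xs"
    unfolding tperm_pure[OF perm_compat_id] by simp
qed (simp_all add: tperm_add tperm_scale)

text \<open>An element with both properties is left out on the left and counted twice on the right,
  which does not change the parity.\<close>

lemma ksgn_sum_xor:
  assumes "finite S"
  shows "ksgn (\<Sum>l\<in>{l \<in> S. P l \<noteq> Q l}. d l) =
    (ksgn ((\<Sum>l\<in>{l \<in> S. P l}. d l) + (\<Sum>l\<in>{l \<in> S. Q l}. d l)) :: 'k::field)"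
proof -
  have filter: "ksgn (\<Sum>l\<in>{l \<in> S. R l}. d l) = (\<Prod>l\<in>S. if R l then ksgn (d l) else 1 :: 'k)" for R
    using assms by (simp add: ksgn_sum prod.inter_filter)
  show ?thesis
    unfolding ksgn_add filter prod.distrib[symmetric] by (intro prod.cong) auto
qed

text \<open>Factor \<open>k\<close> is moved to the front, the others are permuted, and the factor
  is put in its new place; it crosses the degrees in front of it before and after the permutation.
  The remaining sign does not involve the degree of factor \<open>k\<close>.\<close>

lemma koszul_split:
  assumes "\<sigma> permutes {..<length xs}" "k < length xs"
  shows "koszul \<sigma> xs = (inv_sign ({..<length xs} - {k}) \<sigma> (\<lambda>l. fst (xs ! l)) *
    ksgn (fst (xs ! k) * (degsum (take k xs) + degsum (take (\<sigma> k) (permute_list (inv \<sigma>) xs)))) :: 'k::field)"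
proof -
  let ?N = "{..<length xs}" and ?d = "\<lambda>l. fst (xs ! l)" and ?ys = "permute_list (inv \<sigma>) xs"
  have N: "?N = insert k (?N - {k})" using assms by auto
  have inj: "\<sigma> l = \<sigma> k \<longleftrightarrow> l = k" for l using permutes_inj[OF assms(1)] by (auto dest: injD)
  have \<sigma>k: "\<sigma> k < length xs" using permutes_less[OF assms(1)] assms(2) by simp
  have "degsum (take k xs) = (\<Sum>l\<in>{l \<in> ?N - {k}. l < k}. ?d l)"
    using assms(2) by (auto simp: degsum_take_sum intro!: sum.cong)
  moreover have "degsum (take (\<sigma> k) ?ys) = (\<Sum>l\<in>{l \<in> ?N - {k}. \<sigma> l < \<sigma> k}. ?d l)"
  proof -
    have "degsum (take (\<sigma> k) ?ys) = (\<Sum>l<\<sigma> k. fst (?ys ! l))"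
      using \<sigma>k by (subst degsum_take_sum) auto
    also have "{..<\<sigma> k} = \<sigma> ` {l \<in> ?N - {k}. \<sigma> l < \<sigma> k}"
    proof -
      have "l \<in> \<sigma> ` {l \<in> ?N - {k}. \<sigma> l < \<sigma> k}" if "l < \<sigma> k" for l
        using that \<sigma>k permutes_less[OF assms(1), of "inv \<sigma> l"]
        by (intro image_eqI[of _ _ "inv \<sigma> l"]) (auto simp: permutes_inverses(1)[OF assms(1)])
      then show ?thesis by auto
    qed
    also have "(\<Sum>l\<in>\<sigma> ` {l \<in> ?N - {k}. \<sigma> l < \<sigma> k}. fst (?ys ! l)) =
        (\<Sum>l\<in>{l \<in> ?N - {k}. \<sigma> l < \<sigma> k}. ?d l)"
      using permutes_inj[OF assms(1)]
      by (subst sum.reindex) (auto simp: nth_permute_inv[OF assms(1)] intro: inj_on_subset)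
    finally show ?thesis .
  qed
  moreover have "ksgn (?d k * (\<Sum>l\<in>{l \<in> ?N - {k}. (l < k) \<noteq> (\<sigma> l < \<sigma> k)}. ?d l)) =
      (ksgn (?d k * ((\<Sum>l\<in>{l \<in> ?N - {k}. l < k}. ?d l) + (\<Sum>l\<in>{l \<in> ?N - {k}. \<sigma> l < \<sigma> k}. ?d l))) :: 'k)"
    using ksgn_sum_xor[where S = "?N - {k}" and P = "\<lambda>l. l < k" and Q = "\<lambda>l. \<sigma> l < \<sigma> k" and d = ?d and 'k = 'k]
    by (auto simp: ksgn_if split: if_splits)
  moreover have "inv_sign ?N \<sigma> ?d = (inv_sign (?N - {k}) \<sigma> ?d *
      ksgn (?d k * (\<Sum>l\<in>{l \<in> ?N - {k}. (l < k) \<noteq> (\<sigma> l < \<sigma> k)}. ?d l)) :: 'k)"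
    using inv_sign_insert[of "?N - {k}" k \<sigma> ?d, where 'k = 'k]
      inj_on_subset[OF permutes_inj[OF assms(1)] subset_UNIV, of "insert k (?N - {k})"]
    unfolding N[symmetric] by simp
  ultimately show ?thesis
    unfolding koszul_inv_sign by simp
qed

text \<open>Taken over both lists, the degrees behind the factor and those in front of it have an
  even sum, because permuting preserves the total degree.\<close>

lemma koszul_split_drop:
  assumes "\<sigma> permutes {..<length xs}" "k < length xs"
  shows "koszul \<sigma> xs = (inv_sign ({..<length xs} - {k}) \<sigma> (\<lambda>l. fst (xs ! l)) *
    ksgn (fst (xs ! k) * (degsum (drop (Suc k) xs) + degsum (drop (Suc (\<sigma> k)) (permute_list (inv \<sigma>) xs)))) :: 'k::field)"
proof -
  let ?ys = "permute_list (inv \<sigma>) xs"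
  have "\<sigma> k < length ?ys" using permutes_less[OF assms(1)] assms(2) by simp
  then have "degsum (drop (Suc k) xs) + degsum (drop (Suc (\<sigma> k)) ?ys) =
      2 * degsum xs - 2 * fst (xs ! k) - (degsum (take k xs) + degsum (take (\<sigma> k) ?ys))"
    using degsum_take_drop[OF assms(2)] degsum_take_drop[of "\<sigma> k" ?ys] degsum_permute[OF assms(1)]
      nth_permute_inv[OF assms] by simp
  then show ?thesis
    unfolding koszul_split[OF assms] by (intro arg_cong2[of _ _ _ _ "(*)"] refl ksgn_cong) simp
qed

text \<open>Raising the degree of factor \<open>k\<close> by one changes the Koszul sign by the
  degrees crossed in \<open>koszul_split\<close>, and these are the degrees in front of the factor,
  before and after permuting, that occur as signs in the two differentials.\<close>

lemma tperm_Dif: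
  fixes Ws :: "('k::field, 'v::ab_group_add) dgvs list"
  assumes compat: "perm_compat \<sigma> Ws Us" and dg: "dg_list Ws" "dg_list Us" and T: "T \<in> Gr (tensor Ws) p"
  shows "Dif (tensor Us) p (tperm Us \<sigma> T) = tperm Us \<sigma> (Dif (tensor Ws) p T)"
  using T
proof (rule tensor_eqI)
  fix xs assume xs: "homog Ws xs"
  let ?n = "length Ws" and ?ys = "permute_list (inv \<sigma>) xs"
  have len: "length xs = ?n" "length Us = ?n" using xs compat by (auto simp: homog_length perm_compat_def)
  have \<sigma>: "\<sigma> permutes {..<length xs}" "\<sigma> permutes {..<?n}"
    using perm_compat_permutes[OF compat xs] len by auto
  have step: "dstep Us (\<sigma> k) ?ys = permute_list (inv \<sigma>) (dstep Ws k xs)" if "k < ?n" for k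
  proof -
    have "Dif (Us ! \<sigma> k) = Dif (Ws ! k)" using compat that by (simp add: perm_compat_def sub_dg_def)
    then show ?thesis
      using that len by (simp add: dstep_def permute_list_update \<sigma> nth_permute_inv)
  qed
  have sign: "koszul \<sigma> xs * ksgn (degsum (take (\<sigma> k) ?ys)) =
      (ksgn (degsum (take k xs)) * koszul \<sigma> (dstep Ws k xs) :: 'k)" if "k < ?n" for k
  proof -
    have \<sigma>k: "\<sigma> k < length ?ys" using permutes_less[OF \<sigma>(2)] that len by simp
    have "inv_sign ({..<length xs} - {k}) \<sigma> (\<lambda>l. fst (dstep Ws k xs ! l)) =
        (inv_sign ({..<length xs} - {k}) \<sigma> (\<lambda>l. fst (xs ! l)) :: 'k)"
      by (intro inv_sign_cong) (auto simp: dstep_nth)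
    moreover have "degsum (take (\<sigma> k) (permute_list (inv \<sigma>) (dstep Ws k xs))) = degsum (take (\<sigma> k) ?ys)"
      using step[OF that] degsum_take_dstep[OF \<sigma>k, of "\<sigma> k" Us] by simp
    moreover have "degsum (take k (dstep Ws k xs)) = degsum (take k xs)"
      using that len by (simp add: degsum_take_dstep)
    ultimately show ?thesis
      using koszul_split[of \<sigma> xs k, where 'k = 'k] koszul_split[of \<sigma> "dstep Ws k xs" k, where 'k = 'k] \<sigma> that len
      by (simp add: dstep_nth ksgn_if)
  qed
  have "Dif (tensor Us) p (tperm Us \<sigma> (pure Ws xs)) =
      (\<Sum>k<?n. tscale (koszul \<sigma> xs * ksgn (degsum (take k ?ys))) (pure Us (dstep Us k ?ys)))"
    using len by (simp add: tperm_pure[OF compat] Dif_scale Dif_pure[OF dg(2)] tens.scale_sum_right)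
  also have "\<dots> = (\<Sum>k<?n. tscale (koszul \<sigma> xs * ksgn (degsum (take (\<sigma> k) ?ys))) (pure Us (dstep Us (\<sigma> k) ?ys)))"
    by (subst sum.permute[OF \<sigma>(2)]) (simp add: comp_def)
  also have "\<dots> = (\<Sum>k<?n. tscale (ksgn (degsum (take k xs)) * koszul \<sigma> (dstep Ws k xs))
      (pure Us (permute_list (inv \<sigma>) (dstep Ws k xs))))"
    by (intro sum.cong refl) (simp add: sign step)
  also have "\<dots> = tperm Us \<sigma> (Dif (tensor Ws) p (pure Ws xs))"
    using len by (simp add: Dif_pure[OF dg(1)] tperm_sum tperm_scale tperm_pure[OF compat])
  finally show "Dif (tensor Us) p (tperm Us \<sigma> (pure Ws xs)) = tperm Us \<sigma> (Dif (tensor Ws) p (pure Ws xs))" .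
qed (simp_all add: tperm_add tperm_scale Dif_add Dif_scale)

text \<open>The inverse is the swap with the two block sizes exchanged.\<close>

lemma block_swap_permutes: "w + u + v \<le> n \<Longrightarrow> block_swap w u v permutes {..<n}"
proof -
  assume h: "w + u + v \<le> n"
  have "block_swap w v u (block_swap w u v x) = x" "block_swap w u v (block_swap w v u x) = x" for x
    by (auto simp: block_swap_def)
  then have "bij (block_swap w u v)" by (metis bijI')
  then show ?thesis
    unfolding permutes_def using h by (auto simp: block_swap_def bij_iff)
qed

text \<open>The inversions are the pairs with one index in each exchanged block, so the exponents
  add up to a product of two sums.\<close>

lemma koszul_block_swap:
  "koszul (block_swap (length ws) (length us) (length vs)) (ws @ us @ vs @ zs) =
    (ksgn (degsum us * degsum vs) :: 'k::field)"
proof -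
  let ?w = "length ws" and ?u = "length us" and ?v = "length vs"
  let ?xs = "ws @ us @ vs @ zs"
  have inv: "{(k, l). k < l \<and> l < length ?xs \<and> block_swap ?w ?u ?v l < block_swap ?w ?u ?v k} =
      {?w..<?w + ?u} \<times> {?w + ?u..<?w + ?u + ?v}" (is "?L = ?R")
    by (auto simp: block_swap_def split: if_splits)
  have "koszul (block_swap ?w ?u ?v) ?xs =
      (\<Prod>k\<in>{?w..<?w + ?u}. \<Prod>l\<in>{?w + ?u..<?w + ?u + ?v}. ksgn (fst (?xs ! k) * fst (?xs ! l)) :: 'k)"
    unfolding koszul_def inv prod.cartesian_product ..
  also have "\<dots> = ksgn (\<Sum>k\<in>{?w..<?w + ?u}. \<Sum>l\<in>{?w + ?u..<?w + ?u + ?v}. fst (?xs ! k) * fst (?xs ! l))"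
    by (simp add: ksgn_sum)
  also have "(\<Sum>k\<in>{?w..<?w + ?u}. \<Sum>l\<in>{?w + ?u..<?w + ?u + ?v}. fst (?xs ! k) * fst (?xs ! l)) =
      (\<Sum>k\<in>{?w..<?w + ?u}. fst (?xs ! k)) * (\<Sum>l\<in>{?w + ?u..<?w + ?u + ?v}. fst (?xs ! l))"
    by (simp add: sum_product)
  also have "(\<Sum>k\<in>{?w..<?w + ?u}. fst (?xs ! k)) = degsum us"
    using sum.shift_bounds_nat_ivl[of "\<lambda>k. fst (?xs ! k)" 0 ?w ?u]
    by (simp add: degsum_sum atLeast0LessThan nth_append add.commute)
  also have "(\<Sum>l\<in>{?w + ?u..<?w + ?u + ?v}. fst (?xs ! l)) = degsum vs"
    using sum.shift_bounds_nat_ivl[of "\<lambda>k. fst (?xs ! k)" 0 "?w + ?u" ?v]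
    by (simp add: degsum_sum atLeast0LessThan nth_append add.commute)
  finally show ?thesis .
qed

lemma permute_block_swap:
  "permute_list (inv (block_swap (length ws) (length us) (length vs))) (ws @ us @ vs @ zs) =
    ws @ vs @ us @ zs"
  by (rule permute_list_eqI) (auto simp: block_swap_permutes block_swap_def nth_append ac_simps)

section \<open>Contractions\<close>

lemma skip_less: "x < n \<Longrightarrow> x \<noteq> i \<Longrightarrow> i < n \<Longrightarrow> skip i x < n - 1"
  by (auto simp: skip_def)

lemma skip_less_iff: "x \<noteq> i \<Longrightarrow> y \<noteq> i \<Longrightarrow> skip i x < skip i y \<longleftrightarrow> x < y"
  by (auto simp: skip_def)

lemma skip_eq_iff: "x \<noteq> i \<Longrightarrow> y \<noteq> i \<Longrightarrow> skip i x = skip i y \<longleftrightarrow> x = y"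
  by (auto simp: skip_def)

lemma skip_surj: "z < n - 1 \<Longrightarrow> i < n \<Longrightarrow> \<exists>x<n. x \<noteq> i \<and> skip i x = z"
  by (rule exI[of _ "if z < i then z else Suc z"]) (auto simp: skip_def)

lemma skip_image: "i < n \<Longrightarrow> skip i ` ({..<n} - {i}) = {..<n - 1}"
proof (intro equalityI subsetI)
  fix z assume "i < n" "z \<in> {..<n - 1}"
  then show "z \<in> skip i ` ({..<n} - {i})" using skip_surj[of z n i] by auto
qed (use skip_less in auto)

lemma glue_flags:
  assumes "i < n" "j < m"
  shows "{..<n + m - 2} = skip i ` ({..<n} - {i}) \<union> (\<lambda>y. n - 1 + skip j y) ` ({..<m} - {j})"
proof -
  have "(\<lambda>y. n - 1 + skip j y) ` ({..<m} - {j}) = (\<lambda>y. n - 1 + y) ` {..<m - 1}"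
    by (simp only: skip_image[OF assms(2), symmetric] image_image)
  also have "\<dots> = {n - 1..<n - 1 + (m - 1)}"
    using image_add_atLeastLessThan[of "n - 1" 0 "m - 1"] by (simp add: atLeast0LessThan add.commute)
  finally show ?thesis using assms by (auto simp: skip_image)
qed

lemma glue_flag_cases:
  assumes "i < n" "j < m" "z < n + m - 2"
  obtains x where "x < n" "x \<noteq> i" "z = skip i x" | y where "y < m" "y \<noteq> j" "z = n - 1 + skip j y"
  using glue_flags[OF assms(1,2)] assms(3) by blast

lemma sum_glue_flags:
  assumes "i < n" "j < m"
  shows "(\<Sum>z<n + m - 2. f z) =
    (\<Sum>x\<in>{..<n} - {i}. f (skip i x)) + (\<Sum>y\<in>{..<m} - {j}. f (n - 1 + skip j y))"
proof -
  have "skip i ` ({..<n} - {i}) \<inter> (\<lambda>y. n - 1 + skip j y) ` ({..<m} - {j}) = {}"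
    unfolding skip_image[OF assms(1)] by auto
  moreover have "inj_on (skip i) ({..<n} - {i})" "inj_on (\<lambda>y. n - 1 + skip j y) ({..<m} - {j})"
    by (auto simp: inj_on_def skip_eq_iff)
  ultimately show ?thesis
    unfolding glue_flags[OF assms] by (simp add: sum.union_disjoint sum.reindex)
qed

lemma length_delete_at [simp]: "i < length xs \<Longrightarrow> length (delete_at i xs) = length xs - 1"
  by (simp add: delete_at_def)

lemma delete_at_nth: "i < length xs \<Longrightarrow> x < length xs \<Longrightarrow> x \<noteq> i \<Longrightarrow> delete_at i xs ! skip i x = xs ! x"
  by (auto simp: delete_at_def skip_def nth_append min_def)

lemma delete_at_nth_if:
  "i < length xs \<Longrightarrow> z < length xs - 1 \<Longrightarrow> delete_at i xs ! z = xs ! (if z < i then z else Suc z)"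
  by (auto simp: delete_at_def nth_append min_def)

lemma delete_at_update_same [simp]: "delete_at i (xs[i := z]) = delete_at i xs"
  by (simp add: delete_at_def)

lemma delete_at_update:
  "i < length xs \<Longrightarrow> x < length xs \<Longrightarrow> x \<noteq> i \<Longrightarrow> delete_at i (xs[x := z]) = (delete_at i xs)[skip i x := z]"
proof (cases "x < i")
  case True
  assume "i < length xs" "x < length xs" "x \<noteq> i"
  then show ?thesis using True by (simp add: delete_at_def skip_def list_update_append take_update_swap)
next
  case False
  assume "i < length xs" "x < length xs" "x \<noteq> i"
  then show ?thesis using False by (auto simp: delete_at_def skip_def list_update_append drop_update_swap)
qed

lemma delete_at_replicate: "i < n \<Longrightarrow> delete_at i (replicate n W) = replicate (n - 1) W"
  by (simp add: delete_at_def replicate_add[symmetric] min_def)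

lemma delete_at_delete_at:
  "j < length ys \<Longrightarrow> k < length ys \<Longrightarrow> j \<noteq> k \<Longrightarrow>
    delete_at (skip j k) (delete_at j ys) = delete_at (skip k j) (delete_at k ys)"
proof (rule nth_equalityI)
  assume h: "j < length ys" "k < length ys" "j \<noteq> k"
  have less: "skip j k < length ys - 1" "skip k j < length ys - 1" using h by (auto simp: skip_def)
  then show "length (delete_at (skip j k) (delete_at j ys)) = length (delete_at (skip k j) (delete_at k ys))"
    using h by simp
  fix z assume "z < length (delete_at (skip j k) (delete_at j ys))"
  then have z: "z < length ys - 1 - 1" using h less by simp
  \<comment> \<open>\<open>?u i\<close> is inverse to \<open>skip i\<close>: it lists the positions
    other than \<open>i\<close> in increasing order.\<close>
  let ?u = "\<lambda>i z. if z < i then z else Suc z"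
  have "delete_at (skip j k) (delete_at j ys) ! z = ys ! ?u j (?u (skip j k) z)"
    using z h less by (simp add: delete_at_nth_if)
  also have "?u j (?u (skip j k) z) = ?u k (?u (skip k j) z)"
    using h(3) by (auto simp: skip_def)
  also have "ys ! \<dots> = delete_at (skip k j) (delete_at k ys) ! z"
    using z h less by (simp add: delete_at_nth_if)
  finally show "delete_at (skip j k) (delete_at j ys) ! z = delete_at (skip k j) (delete_at k ys) ! z" .
qed

lemma delete_at_append_left: "i < length xs \<Longrightarrow> delete_at i (xs @ ys) = delete_at i xs @ ys"
  and delete_at_append_right: "delete_at (length xs + i) (xs @ ys) = xs @ delete_at i ys"
  by (simp_all add: delete_at_def)

lemma homog_delete_at: "homog Ws xs \<Longrightarrow> homog (delete_at i Ws) (delete_at i xs)"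
  unfolding homog_def delete_at_def by (intro list_all2_appendI list_all2_takeI list_all2_dropI)

lemma degsum_delete_at: "i < length xs \<Longrightarrow> degsum (delete_at i xs) = degsum xs - fst (xs ! i)"
  using degsum_take_drop[of i xs] by (simp add: delete_at_def)

lemma degsum_take_delete_at:
  assumes "i < length xs" "k < length xs" "k \<noteq> i"
  shows "degsum (take (skip i k) (delete_at i xs)) = degsum (take k xs) - (if i < k then fst (xs ! i) else 0)"
proof (cases "k < i")
  case True
  then show ?thesis using assms by (simp add: delete_at_def skip_def min_def)
next
  case False
  then have "take (skip i k) (delete_at i xs) = delete_at i (take k xs)"
    using assms by (auto simp: delete_at_def skip_def min_def drop_take dest: le_antisym)
  then show ?thesis using False assms by (simp add: degsum_delete_at)
qed

lemma degsum_drop_delete_at: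
  assumes "i < length xs" "k < length xs" "k \<noteq> i"
  shows "degsum (drop (Suc (skip i k)) (delete_at i xs)) =
    degsum (drop (Suc k) xs) - (if k < i then fst (xs ! i) else 0)"
  using degsum_take_drop[of "skip i k" "delete_at i xs"] degsum_take_drop[OF assms(2)]
    degsum_take_delete_at[OF assms] degsum_delete_at[OF assms(1)] delete_at_nth[OF assms]
    skip_less[OF assms(2,3,1)] assms by (auto split: if_splits)

text \<open>The composition of \<open>End_cyc\<close> on pure tensors with \<open>pure\<close>
  replaced by an arbitrary map \<open>F\<close>: composing in \<open>End_di\<close> is the
  contraction in which \<open>F\<close> also permutes the remaining factors.\<close>

definition contr ::
  "(int \<Rightarrow> int \<Rightarrow> 'v \<Rightarrow> 'v \<Rightarrow> 'k::field) \<Rightarrow> ((int \<times> 'v) list \<Rightarrow> ('k, 'w) tens) \<Rightarrow>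
   nat \<Rightarrow> nat \<Rightarrow> (int \<times> 'v) list \<Rightarrow> (int \<times> 'v) list \<Rightarrow> ('k, 'w) tens" where
  "contr B F i j xs ys =
     tscale (contract_sign i xs j ys * B (fst (xs ! i)) (fst (ys ! j)) (snd (xs ! i)) (snd (ys ! j)))
       (F (delete_at i xs @ delete_at j ys))"

text \<open>Linearity is required in the first argument only and passes to the second by graded
  symmetry. \<open>form_chain\<close> says that the form is a chain map to the ground field, placed
  in degree 0 with zero differential.\<close>

locale graded_form =
  fixes V :: "('k::field_char_0, 'v::ab_group_add) dgvs" and B :: "int \<Rightarrow> int \<Rightarrow> 'v \<Rightarrow> 'v \<Rightarrow> 'k"
  assumes dg: "dg_vector_space V"
    and form_add: "\<lbrakk>x \<in> Gr V p; x' \<in> Gr V p; y \<in> Gr V q\<rbrakk> \<Longrightarrow> B p q (x + x') y = B p q x y + B p q x' y"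
    and form_scale: "\<lbrakk>x \<in> Gr V p; y \<in> Gr V q\<rbrakk> \<Longrightarrow> B p q (Scl V c x) y = c * B p q x y"
    and form_sym: "\<lbrakk>x \<in> Gr V p; y \<in> Gr V q\<rbrakk> \<Longrightarrow> B q p y x = ksgn (p * q) * B p q x y"
    and form_degree: "p + q \<noteq> 0 \<Longrightarrow> B p q x y = 0"
    and form_chain: "\<lbrakk>x \<in> Gr V p; y \<in> Gr V q\<rbrakk>
      \<Longrightarrow> B (p + 1) q (Dif V p x) y + ksgn p * B p (q + 1) x (Dif V q y) = 0"
begin

lemma form_add_right:
  assumes "x \<in> Gr V p" "y \<in> Gr V q" "y' \<in> Gr V q"
  shows "B p q x (y + y') = B p q x y + B p q x y'"
  using form_add[OF assms(2,3,1)] assms dg_add[OF dg assms(2,3)]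
  by (simp add: form_sym[of _ q _ p] distrib_left)

lemma form_scale_right:
  assumes "x \<in> Gr V p" "y \<in> Gr V q"
  shows "B p q x (Scl V c y) = c * B p q x y"
  using form_scale[OF assms(2,1)] assms dg_scale[OF dg assms(2)]
  by (simp add: form_sym[of _ q _ p])

lemma contract_sign_cong:
  assumes "map fst xs = map fst xs'" "map fst ys = map fst ys'" "i < length xs" "j < length ys"
  shows "contract_sign i xs j ys = contract_sign i xs' j ys'"
proof -
  have "length xs = length xs'" "length ys = length ys'" using assms(1,2) by (metis length_map)+
  then have "fst (xs ! i) = fst (xs' ! i)" "fst (ys ! j) = fst (ys' ! j)"
    using assms nth_map[of i xs fst] nth_map[of j ys fst] by simp_all
  then show ?thesis
    unfolding contract_sign_def
    using degsum_drop_cong[OF assms(1)] degsum_take_cong[OF assms(2)] by simp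
qed

text \<open>An updated entry is either contracted, and then linearity of the form applies, or it
  survives at a shifted position, and then linearity of \<open>F\<close> applies. The sign depends
  on degrees only.\<close>

lemma bimlin_contr:
  assumes sub: "\<And>W. W \<in> set Ws \<union> set Us \<Longrightarrow> sub_dg W V \<and> dg_vector_space W"
    and F: "mlin (delete_at i Ws @ delete_at j Us) F" and i: "i < length Ws" and j: "j < length Us"
  shows "bimlin Ws Us (contr B F i j)"
  unfolding bimlin_def
proof (intro conjI allI impI)
  show "dg_list Ws" using sub by auto
  have mem: "x \<in> Gr V p" if "x \<in> Gr (Ws ! k) p" "k < length Ws" for x p k
    using that sub[of "Ws ! k"] by (auto simp: sub_dg_def)
  have mem': "x \<in> Gr V p" if "x \<in> Gr (Us ! k) p" "k < length Us" for x p k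
    using that sub[of "Us ! k"] by (auto simp: sub_dg_def)
  have Scl: "Scl (Ws ! k) = Scl V" if "k < length Ws" for k using that sub[of "Ws ! k"] by (auto simp: sub_dg_def)
  have Scl': "Scl (Us ! k) = Scl V" if "k < length Us" for k using that sub[of "Us ! k"] by (auto simp: sub_dg_def)
  have homog: "homog (delete_at i Ws @ delete_at j Us) (delete_at i xs @ delete_at j ys)"
    if "homog Ws xs" "homog Us ys" for xs ys
    using that i j by (simp add: homog_append homog_delete_at homog_length)
  {
    fix ys assume ys: "homog Us ys"
    show "mlin Ws (\<lambda>xs. contr B F i j xs ys)"
    proof (rule mlinI)
      fix xs k p x
      assume h: "homog Ws xs" "k < length Ws" "x \<in> Gr (Ws ! k) p"
      have len: "length xs = length Ws" "length ys = length Us" using h ys by (simp_all add: homog_length)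
      have csgn: "contract_sign i (xs[k := (p, y)]) j ys = (contract_sign i (xs[k := (p, x)]) j ys :: 'k)" for y
        using i j len by (intro contract_sign_cong) (simp_all add: map_update)
      have yj: "snd (ys ! j) \<in> Gr V (fst (ys ! j))" using homog_nth[OF ys j] mem' j by blast
      have upd: "delete_at i (xs[k := z]) @ delete_at j ys = (delete_at i xs @ delete_at j ys)[skip i k := z]"
        if "k \<noteq> i" for z
        using that h(2) i len skip_less[of k "length Ws" i]
        by (simp add: delete_at_update list_update_append)
      have idx: "skip i k < length (delete_at i Ws @ delete_at j Us)" "(delete_at i Ws @ delete_at j Us) ! skip i k = Ws ! k"
        if "k \<noteq> i"
        using that h(2) i j skip_less[of k "length Ws" i] by (simp_all add: nth_append delete_at_nth)
      show "contr B F i j (xs[k := (p, x + y)]) ys = contr B F i j (xs[k := (p, x)]) ys + contr B F i j (xs[k := (p, y)]) ys"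
        if y: "y \<in> Gr (Ws ! k) p" for y
      proof (cases "k = i")
        case True
        then show ?thesis
          using h y i len yj form_add[OF mem[OF h(3,2)] mem[OF y h(2)] yj] csgn[of "x + y"] csgn[of y]
          by (simp add: contr_def distrib_left tens.scale_left_distrib)
      next
        case False
        then show ?thesis
          using h y mlin_add[OF F homog[OF h(1) ys] idx(1)[OF False], of x p y] csgn[of "x + y"] csgn[of y]
          by (simp add: contr_def upd idx tens.scale_right_distrib)
      qed
      show "contr B F i j (xs[k := (p, Scl (Ws ! k) c x)]) ys = tscale c (contr B F i j (xs[k := (p, x)]) ys)" for c
      proof (cases "k = i")
        case True
        then show ?thesis
          using h i len yj form_scale[OF mem[OF h(3,2)] yj] csgn[of "Scl V c x"] Scl[of k]
          by (simp add: contr_def mult.left_commute)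
      next
        case False
        then show ?thesis
          using h mlin_scale[OF F homog[OF h(1) ys] idx(1)[OF False], of x p c] csgn[of "Scl (Ws ! k) c x"]
          by (simp add: contr_def upd idx mult.commute)
      qed
    qed
  }
  {
    fix xs assume xs: "homog Ws xs"
    show "mlin Us (contr B F i j xs)"
    proof (rule mlinI)
      fix ys k p x
      assume h: "homog Us ys" "k < length Us" "x \<in> Gr (Us ! k) p"
      have len: "length xs = length Ws" "length ys = length Us" using h xs by (simp_all add: homog_length)
      have csgn: "contract_sign i xs j (ys[k := (p, y)]) = (contract_sign i xs j (ys[k := (p, x)]) :: 'k)" for y
        using i j len by (intro contract_sign_cong) (simp_all add: map_update)
      have xi: "snd (xs ! i) \<in> Gr V (fst (xs ! i))" using homog_nth[OF xs i] mem i by blast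
      \<comment> \<open>Entry \<open>k\<close> of \<open>ys\<close> follows the
        \<open>length Ws - 1\<close> surviving entries of \<open>xs\<close>; \<open>Suc 0\<close> is
        how the simplifier leaves the 1.\<close>
      let ?k = "length Ws - Suc 0 + skip j k"
      have upd: "delete_at i xs @ delete_at j (ys[k := z]) = (delete_at i xs @ delete_at j ys)[?k := z]"
        if "k \<noteq> j" for z
        using that h(2) i j len skip_less[of k "length Us" j]
        by (auto simp: delete_at_update list_update_append)
      have idx: "?k < length (delete_at i Ws @ delete_at j Us)" "(delete_at i Ws @ delete_at j Us) ! ?k = Us ! k"
        if "k \<noteq> j"
        using that h(2) i j skip_less[of k "length Us" j] by (simp_all add: nth_append delete_at_nth)
      show "contr B F i j xs (ys[k := (p, x + y)]) = contr B F i j xs (ys[k := (p, x)]) + contr B F i j xs (ys[k := (p, y)])"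
        if y: "y \<in> Gr (Us ! k) p" for y
      proof (cases "k = j")
        case True
        then show ?thesis
          using h y j len xi form_add_right[OF xi mem'[OF h(3,2)] mem'[OF y h(2)]] csgn[of "x + y"] csgn[of y]
          by (simp add: contr_def distrib_left tens.scale_left_distrib)
      next
        case False
        then show ?thesis
          using h y mlin_add[OF F homog[OF xs h(1)] idx(1)[OF False], of x p y] csgn[of "x + y"] csgn[of y]
          by (simp add: contr_def upd idx tens.scale_right_distrib)
      qed
      show "contr B F i j xs (ys[k := (p, Scl (Us ! k) c x)]) = tscale c (contr B F i j xs (ys[k := (p, x)]))" for c
      proof (cases "k = j")
        case True
        then show ?thesis
          using h j len xi form_scale_right[OF xi mem'[OF h(3,2)]] csgn[of "Scl V c x"] Scl'[of k]
          by (simp add: contr_def mult.left_commute)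
      next
        case False
        then show ?thesis
          using h mlin_scale[OF F homog[OF xs h(1)] idx(1)[OF False], of x p c] csgn[of "Scl (Us ! k) c x"]
          by (simp add: contr_def upd idx mult.commute)
      qed
    qed
  }
qed

end

text \<open>Linearity relative to a graded piece, in a form closed under composition, so that both
  sides of an identity of operations are seen to be linear before they are compared on pure
  tensors.\<close>

definition lin_on :: "('k::field, 'v) tens set \<Rightarrow> (('k, 'v) tens \<Rightarrow> ('k, 'w) tens) \<Rightarrow> bool" where
  "lin_on C L \<longleftrightarrow> (\<forall>S\<in>C. (\<forall>T\<in>C. L (S + T) = L S + L T) \<and> (\<forall>c. L (tscale c S) = tscale c (L S)))"

lemma lin_on_eqI:
  assumes "T \<in> Gr (tensor Ws) p" "lin_on (Gr (tensor Ws) p) L" "lin_on (Gr (tensor Ws) p) M"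
    and "\<And>xs. \<lbrakk>homog Ws xs; degsum xs = p\<rbrakk> \<Longrightarrow> L (pure Ws xs) = M (pure Ws xs)"
  shows "L T = M T"
  using assms(1) by (rule tensor_eqI) (use assms(2-4) in \<open>auto simp: lin_on_def\<close>)

lemma lin_on_comp:
  assumes "lin_on D G" "lin_on C L" "\<And>T. T \<in> C \<Longrightarrow> L T \<in> D"
  shows "lin_on C (\<lambda>T. G (L T))"
  using assms by (simp add: lin_on_def)

lemma lin_on_id: "lin_on C (\<lambda>T. T)"
  by (simp add: lin_on_def)

lemma lin_on_add: "lin_on C L \<Longrightarrow> lin_on C M \<Longrightarrow> lin_on C (\<lambda>T. L T + M T)"
  by (simp add: lin_on_def algebra_simps tens.scale_right_distrib)

lemma lin_on_scale: "lin_on C L \<Longrightarrow> lin_on C (\<lambda>T. tscale c (L T))"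
  by (simp add: lin_on_def tens.scale_right_distrib mult.commute)

lemma lin_on_tperm: "lin_on C (tperm Us \<sigma>)"
  by (simp add: lin_on_def tperm_add tperm_scale)

lemma lin_on_Dif: "lin_on C (Dif (tensor Us) p)"
  by (simp add: lin_on_def Dif_add Dif_scale)

lemma lin_on_blin_left: "lin_on C (\<lambda>S. blin G S T)"
  by (simp add: lin_on_def blin_add_left blin_scale_left)

lemma lin_on_blin_right:
  "bimlin Ws Us G \<Longrightarrow> S \<in> Gr (tensor Ws) p \<Longrightarrow> lin_on (Gr (tensor Us) q) (blin G S)"
  by (simp add: lin_on_def blin_add_right blin_scale_right)

lemma lin_on_zero: "lin_on (Gr (tensor Ws) p) L \<Longrightarrow> L 0 = 0"
  unfolding lin_on_def by (metis tens.scale_zero_left tensor_zero)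

lemma lin_on_sum:
  assumes "lin_on (Gr (tensor Ws) p) L" "\<And>a. a \<in> A \<Longrightarrow> f a \<in> Gr (tensor Ws) p"
  shows "L (sum f A) = (\<Sum>a\<in>A. L (f a))"
  using assms(2)
proof (induction A rule: infinite_finite_induct)
  case (insert a A)
  then have "L (f a + sum f A) = L (f a) + L (sum f A)"
    using assms(1) tensor_sum[of A f Ws p] by (simp add: lin_on_def)
  then show ?case using insert by simp
qed (simp_all add: lin_on_zero[OF assms(1)])


section \<open>The endomorphism cyclic operad\<close>

text \<open>\<rho> keeps the remaining flags of \<open>xs\<close> in front of those of
  \<open>ys\<close>, and on each part it is \<sigma> or \<tau> with one flag removed. Since
  \<open>skip\<close> preserves the order of the other flags, the inversions of \<rho> are those of
  \<sigma> and \<tau> that avoid \<open>i\<close> and \<open>j\<close>.\<close>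

lemma glue_koszul:
  fixes xs ys :: "(int \<times> 'v) list"
  assumes i: "i < length xs" and j: "j < length ys"
    and \<sigma>: "\<sigma> permutes {..<length xs}" and \<tau>: "\<tau> permutes {..<length ys}"
    and \<rho>x: "\<And>x. x < length xs \<Longrightarrow> x \<noteq> i \<Longrightarrow> \<rho> (skip i x) = skip (\<sigma> i) (\<sigma> x)"
    and \<rho>y: "\<And>y. y < length ys \<Longrightarrow> y \<noteq> j \<Longrightarrow> \<rho> (length xs - 1 + skip j y) = length xs - 1 + skip (\<tau> j) (\<tau> y)"
  shows "koszul \<rho> (delete_at i xs @ delete_at j ys) =
    (inv_sign ({..<length xs} - {i}) \<sigma> (\<lambda>k. fst (xs ! k)) * inv_sign ({..<length ys} - {j}) \<tau> (\<lambda>k. fst (ys ! k)) :: 'k::field)"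
proof -
  let ?zs = "delete_at i xs @ delete_at j ys" and ?n = "length xs" and ?m = "length ys"
  let ?X = "skip i ` ({..<?n} - {i})" and ?Y = "(\<lambda>y. ?n - 1 + skip j y) ` ({..<?m} - {j})"
  let ?d = "\<lambda>k. fst (?zs ! k)"
  have neq: "\<sigma> x \<noteq> \<sigma> i" if "x \<noteq> i" for x using that permutes_inj[OF \<sigma>] by (auto dest: injD)
  have neq': "\<tau> y \<noteq> \<tau> j" if "y \<noteq> j" for y using that permutes_inj[OF \<tau>] by (auto dest: injD)
  have len: "length ?zs = ?n + ?m - 2" using i j by simp
  have sep: "k < l \<and> \<rho> k < \<rho> l" if "k \<in> ?X" "l \<in> ?Y" for k l
  proof -
    from that(1) obtain x where x: "x \<in> {..<?n} - {i}" "k = skip i x" by (rule imageE)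
    from that(2) obtain y where y: "y \<in> {..<?m} - {j}" "l = ?n - 1 + skip j y" by (rule imageE)
    have "skip i x < ?n - 1" "skip (\<sigma> i) (\<sigma> x) < ?n - 1"
      using x(1) skip_less[of x ?n i] skip_less[of "\<sigma> x" ?n "\<sigma> i"] x i neq permutes_less[OF \<sigma>] by auto
    moreover have "\<rho> k = skip (\<sigma> i) (\<sigma> x)" "\<rho> l = ?n - 1 + skip (\<tau> j) (\<tau> y)"
      using x y \<rho>x[of x] \<rho>y[of y] by blast+
    ultimately show ?thesis using x(2) y(2) by linarith
  qed
  have "koszul \<rho> ?zs = (inv_sign ?X \<rho> ?d * inv_sign ?Y \<rho> ?d :: 'k)"
    unfolding koszul_inv_sign len glue_flags[OF i j] by (rule inv_sign_Un) (simp, simp, rule sep)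
  moreover have "inv_sign ?X \<rho> ?d = (inv_sign ({..<?n} - {i}) \<sigma> (?d \<circ> skip i) :: 'k)"
    by (rule inv_sign_reindex) (auto simp: inj_on_def skip_eq_iff skip_less_iff \<rho>x neq)
  moreover have "inv_sign ?Y \<rho> ?d = (inv_sign ({..<?m} - {j}) \<tau> (?d \<circ> (\<lambda>y. ?n - 1 + skip j y)) :: 'k)"
    by (rule inv_sign_reindex) (auto simp: inj_on_def skip_eq_iff skip_less_iff \<rho>y[simplified] neq')
  moreover have "inv_sign ({..<?n} - {i}) \<sigma> (?d \<circ> skip i) = (inv_sign ({..<?n} - {i}) \<sigma> (\<lambda>k. fst (xs ! k)) :: 'k)"
    using i skip_less[of _ ?n i] by (intro inv_sign_cong) (auto simp: nth_append delete_at_nth)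
  moreover have "inv_sign ({..<?m} - {j}) \<tau> (?d \<circ> (\<lambda>y. ?n - 1 + skip j y)) =
      (inv_sign ({..<?m} - {j}) \<tau> (\<lambda>k. fst (ys ! k)) :: 'k)"
    using i j by (intro inv_sign_cong) (auto simp: nth_append delete_at_nth)
  ultimately show ?thesis by simp
qed

lemma glue_permute:
  assumes i: "i < length xs" and j: "j < length ys"
    and \<sigma>: "\<sigma> permutes {..<length xs}" and \<tau>: "\<tau> permutes {..<length ys}" and \<rho>: "\<rho> permutes {..<length xs + length ys - 2}"
    and \<rho>x: "\<And>x. x < length xs \<Longrightarrow> x \<noteq> i \<Longrightarrow> \<rho> (skip i x) = skip (\<sigma> i) (\<sigma> x)"
    and \<rho>y: "\<And>y. y < length ys \<Longrightarrow> y \<noteq> j \<Longrightarrow> \<rho> (length xs - 1 + skip j y) = length xs - 1 + skip (\<tau> j) (\<tau> y)"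
  shows "permute_list (inv \<rho>) (delete_at i xs @ delete_at j ys) =
    delete_at (\<sigma> i) (permute_list (inv \<sigma>) xs) @ delete_at (\<tau> j) (permute_list (inv \<tau>) ys)"
proof (rule permute_list_eqI)
  let ?n = "length xs" and ?m = "length ys"
  have neq: "\<sigma> x \<noteq> \<sigma> i" if "x \<noteq> i" for x using that permutes_inj[OF \<sigma>] by (auto dest: injD)
  have neq': "\<tau> y \<noteq> \<tau> j" if "y \<noteq> j" for y using that permutes_inj[OF \<tau>] by (auto dest: injD)
  have \<sigma>i: "\<sigma> i < ?n" and \<tau>j: "\<tau> j < ?m" using i j permutes_less[OF \<sigma>] permutes_less[OF \<tau>] by auto
  have len: "length (delete_at i xs @ delete_at j ys) = ?n + ?m - 2" using i j by simp
  show "\<rho> permutes {..<length (delete_at i xs @ delete_at j ys)}" unfolding len by (rule \<rho>)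
  show "length (delete_at (\<sigma> i) (permute_list (inv \<sigma>) xs) @ delete_at (\<tau> j) (permute_list (inv \<tau>) ys)) =
      length (delete_at i xs @ delete_at j ys)"
    using \<sigma>i \<tau>j i j by simp
  fix z assume "z < length (delete_at i xs @ delete_at j ys)"
  then have "z < ?n + ?m - 2" unfolding len .
  with i j show "(delete_at (\<sigma> i) (permute_list (inv \<sigma>) xs) @ delete_at (\<tau> j) (permute_list (inv \<tau>) ys)) ! \<rho> z =
      (delete_at i xs @ delete_at j ys) ! z"
  proof (cases rule: glue_flag_cases)
    case (1 x)
    have "skip i x < ?n - 1" "skip (\<sigma> i) (\<sigma> x) < ?n - 1" "\<sigma> x < ?n"
      using skip_less[of x ?n i] skip_less[of "\<sigma> x" ?n "\<sigma> i"] 1 i neq permutes_less[OF \<sigma>] by auto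
    then show ?thesis
      using 1 i \<sigma>i neq by (simp add: \<rho>x nth_append delete_at_nth nth_permute_inv[OF \<sigma>])
  next
    case (2 y)
    have "\<tau> y < ?m" using 2 permutes_less[OF \<tau>] by auto
    moreover have "\<not> ?n + s - Suc 0 < ?n - Suc 0" "?n + s - Suc 0 - (?n - Suc 0) = s" for s
      using i by auto
    ultimately show ?thesis
      using 2 i j \<sigma>i \<tau>j neq' \<rho>y[OF 2(1,2)] by (simp add: nth_append delete_at_nth nth_permute_inv[OF \<tau>])
  qed
qed

context graded_form
begin

text \<open>The composition of \<open>End_cyc\<close> without its two degree arguments, on which its
  value does not depend.\<close>

abbreviation cc :: "nat \<Rightarrow> nat \<Rightarrow> nat \<Rightarrow> nat \<Rightarrow> ('k, 'v) tens \<Rightarrow> ('k, 'v) tens \<Rightarrow> ('k, 'v) tens" where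
  "cc n i m j \<equiv> blin (contr B (pure (replicate (n + m - 2) V)) i j)"

abbreviation TV :: "nat \<Rightarrow> int \<Rightarrow> ('k, 'v) tens set" where
  "TV n p \<equiv> Gr (tensor (replicate n V)) p"

lemma ccomp_End: "ccomp (End_cyc V B) n p i m q j = cc n i m j"
  unfolding End_cyc_def blin_def[abs_def] contr_def[abs_def] by simp

lemma replicate_append_delete:
  "i < n \<Longrightarrow> j < m \<Longrightarrow> delete_at i (replicate n V) @ delete_at j (replicate m V) = replicate (n + m - 2) V"
  by (simp add: delete_at_replicate replicate_add[symmetric])

lemma bimlin_cc:
  "i < n \<Longrightarrow> j < m \<Longrightarrow> bimlin (replicate n V) (replicate m V) (contr B (pure (replicate (n + m - 2) V)) i j)"
  by (rule bimlin_contr) (auto simp: dg replicate_append_delete mlin_pure)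

lemma cc_pure:
  "\<lbrakk>i < n; j < m; homog (replicate n V) xs; homog (replicate m V) ys\<rbrakk> \<Longrightarrow>
    cc n i m j (pure (replicate n V) xs) (pure (replicate m V) ys) =
      contr B (pure (replicate (n + m - 2) V)) i j xs ys"
  by (rule blin_pure[OF bimlin_cc])

lemma homog_glue:
  "\<lbrakk>i < n; j < m; homog (replicate n V) xs; homog (replicate m V) ys\<rbrakk> \<Longrightarrow>
    homog (replicate (n + m - 2) V) (delete_at i xs @ delete_at j ys)"
  using homog_append[of "delete_at i xs" "delete_at i (replicate n V)" "delete_at j (replicate m V)" "delete_at j ys"]
  by (simp add: replicate_append_delete homog_delete_at homog_length)

lemma contr_degree:
  assumes "i < length xs" "j < length ys" "fst (xs ! i) + fst (ys ! j) \<noteq> 0"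
  shows "contr B F i j xs ys = 0"
  using assms by (simp add: contr_def form_degree)

text \<open>The form has degree 0. Either the degrees of the contracted entries cancel and the
  remaining ones add up to the full degree, or the term vanishes.\<close>

lemma contr_mem:
  assumes "i < n" "j < m" "homog (replicate n V) xs" "homog (replicate m V) ys"
  shows "contr B (pure (replicate (n + m - 2) V)) i j xs ys \<in> TV (n + m - 2) (degsum xs + degsum ys)"
proof (cases "fst (xs ! i) + fst (ys ! j) = 0")
  case True
  then show ?thesis
    using assms homog_glue[OF assms]
    by (auto simp: contr_def degsum_delete_at homog_length intro!: tensor_scale pure_mem)
next
  case False
  then show ?thesis using assms by (simp add: contr_degree homog_length)
qed

lemma cc_mem: "\<lbrakk>i < n; j < m; S \<in> TV n p; T \<in> TV m q\<rbrakk> \<Longrightarrow> cc n i m j S T \<in> TV (n + m - 2) (p + q)"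
  by (rule blin_mem[OF bimlin_cc]) (auto intro: contr_mem)

lemma lin_cc_right: "i < n \<Longrightarrow> j < m \<Longrightarrow> S \<in> TV n p \<Longrightarrow> lin_on (TV m q) (cc n i m j S)"
  by (rule lin_on_blin_right[OF bimlin_cc])

lemma lin_cc_left: "lin_on C (\<lambda>S. cc n i m j S T)"
  by (rule lin_on_blin_left)

lemma cc_eqI:
  assumes "S \<in> TV n p" "T \<in> TV m q"
    and "\<And>T. T \<in> TV m q \<Longrightarrow> lin_on (TV n p) (\<lambda>S. L S T)" "\<And>T. T \<in> TV m q \<Longrightarrow> lin_on (TV n p) (\<lambda>S. M S T)"
    and "\<And>S. S \<in> TV n p \<Longrightarrow> lin_on (TV m q) (L S)" "\<And>S. S \<in> TV n p \<Longrightarrow> lin_on (TV m q) (M S)"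
    and "\<And>xs ys. \<lbrakk>homog (replicate n V) xs; degsum xs = p; homog (replicate m V) ys; degsum ys = q\<rbrakk>
      \<Longrightarrow> L (pure (replicate n V) xs) (pure (replicate m V) ys) = M (pure (replicate n V) xs) (pure (replicate m V) ys)"
  shows "L S T = M S T"
  using assms(1) assms(3)[OF assms(2)] assms(4)[OF assms(2)]
proof (rule lin_on_eqI)
  fix xs assume xs: "homog (replicate n V) xs" "degsum xs = p"
  show "L (pure (replicate n V) xs) T = M (pure (replicate n V) xs) T"
    using assms(2) assms(5)[OF pure_mem[OF xs]] assms(6)[OF pure_mem[OF xs]]
    by (rule lin_on_eqI) (rule assms(7)[OF xs])
qed

lemma compat_replicate: "\<sigma> permutes {..<n} \<Longrightarrow> perm_compat \<sigma> (replicate n V) (replicate n V)"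
  by (simp add: perm_compat_def permutes_less)

lemma dg_replicate: "dg_list (replicate n V)"
  using dg by simp

lemma act_mem: "\<sigma> permutes {..<n} \<Longrightarrow> S \<in> TV n p \<Longrightarrow> tperm (replicate n V) \<sigma> S \<in> TV n p"
  by (rule tperm_mem[OF compat_replicate])

text \<open>A differential at a surviving factor occurs on both sides with the same sign. The two
  differentials at the contracted factors occur on the right only, and they cancel because the form
  is a chain map.\<close>

lemma cc_Dif:
  assumes i: "i < n" and j: "j < m" and S: "S \<in> TV n p" and T: "T \<in> TV m q"
  shows "Dif (tensor (replicate (n + m - 2) V)) (p + q) (cc n i m j S T) =
    cc n i m j (Dif (tensor (replicate n V)) p S) T +
    tscale (ksgn p) (cc n i m j S (Dif (tensor (replicate m V)) q T))"
  using S T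
proof (rule cc_eqI[where L = "\<lambda>S T. Dif (tensor (replicate (n + m - 2) V)) (p + q) (cc n i m j S T)"])
  let ?D = "\<lambda>n. Dif (tensor (replicate n V))"
  have Dm: "?D n p S \<in> TV n (p + 1)" if "S \<in> TV n p" for n S p
    using that by (rule Dif_mem[OF dg_replicate])
  fix S assume S: "S \<in> TV n p"
  show "lin_on (TV m q) (\<lambda>T. ?D (n + m - 2) (p + q) (cc n i m j S T))"
    by (rule lin_on_comp[OF lin_on_Dif[of "TV (n + m - 2) (p + q)"] lin_cc_right[OF i j S]]) (rule cc_mem[OF i j S])
  show "lin_on (TV m q) (\<lambda>T. cc n i m j (?D n p S) T + tscale (ksgn p) (cc n i m j S (?D m q T)))"
    by (intro lin_on_add lin_on_scale lin_cc_right[OF i j Dm[OF S]] lin_on_comp[OF lin_cc_right[OF i j S] lin_on_Dif Dm])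
next
  fix T assume T: "T \<in> TV m q"
  show "lin_on (TV n p) (\<lambda>S. Dif (tensor (replicate (n + m - 2) V)) (p + q) (cc n i m j S T))"
    by (rule lin_on_comp[OF lin_on_Dif[of "TV (n + m - 2) (p + q)"] lin_cc_left]) (rule cc_mem[OF i j _ T])
  show "lin_on (TV n p) (\<lambda>S. cc n i m j (Dif (tensor (replicate n V)) p S) T +
      tscale (ksgn p) (cc n i m j S (Dif (tensor (replicate m V)) q T)))"
    by (intro lin_on_add lin_on_scale lin_cc_left lin_on_comp[OF lin_cc_left lin_on_Dif]) (rule UNIV_I)
next
  fix xs ys
  assume xs: "homog (replicate n V) xs" "degsum xs = p" and ys: "homog (replicate m V) ys" "degsum ys = q"
  let ?N = "n + m - 2"
  let ?P = "pure (replicate ?N V)" and ?Dx = "\<lambda>k. dstep (replicate n V) k xs" and ?Dy = "\<lambda>k. dstep (replicate m V) k ys"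
  let ?zs = "delete_at i xs @ delete_at j ys"
  let ?G = "contr B ?P i j"
  have lx: "length xs = n" and ly: "length ys = m" using xs ys by (simp_all add: homog_length)
  have xi: "snd (xs ! i) \<in> Gr V (fst (xs ! i))" and yj: "snd (ys ! j) \<in> Gr V (fst (ys ! j))"
    using homog_nth[OF xs(1)] homog_nth[OF ys(1)] i j by auto
  let ?s = "contract_sign i xs j ys * B (fst (xs ! i)) (fst (ys ! j)) (snd (xs ! i)) (snd (ys ! j))"
  have lz: "length ?zs = ?N" using i j lx ly by simp
  have step_x: "dstep (replicate ?N V) (skip i k) ?zs = delete_at i (?Dx k) @ delete_at j ys"
    if "k < n" "k \<noteq> i" for k
    using that i j lx ly skip_less[of k n i]
    by (auto simp: dstep_def delete_at_update list_update_append nth_append delete_at_nth)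
  have step_y: "dstep (replicate ?N V) (n - 1 + skip j k) ?zs = delete_at i xs @ delete_at j (?Dy k)"
    if "k < m" "k \<noteq> j" for k
    using that i j lx ly skip_less[of k m j]
    by (auto simp: dstep_def delete_at_update list_update_append nth_append delete_at_nth)
  \<comment> \<open>If \<open>i < k\<close>, the step at \<open>k\<close> raises the degree that
    \<open>xs ! i\<close> has to cross, while \<open>xs ! i\<close> is missing from the degrees in
    front of \<open>k\<close> after deletion. Both effects give the sign of the degree of
    \<open>xs ! i\<close>.\<close>
  have term_x: "tscale (ksgn (degsum (take k xs))) (?G (?Dx k) ys) =
      tscale (?s * ksgn (degsum (take (skip i k) ?zs))) (?P (dstep (replicate ?N V) (skip i k) ?zs))"
    if k: "k < n" "k \<noteq> i" for k
  proof -
    have "degsum (take (skip i k) ?zs) = degsum (take k xs) - (if i < k then fst (xs ! i) else 0)"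
      using k i lx skip_less[of k n i] by (simp add: degsum_take_delete_at)
    moreover have "contract_sign i (?Dx k) j ys = (contract_sign i xs j ys * ksgn (if i < k then fst (xs ! i) else 0) :: 'k)"
      using k i lx
      by (cases "i < k") (simp_all add: contract_sign_def dstep_nth degsum_drop_dstep distrib_left ksgn_add)
    ultimately have "ksgn (degsum (take k xs)) * contract_sign i (?Dx k) j ys =
        (contract_sign i xs j ys * ksgn (degsum (take (skip i k) ?zs)) :: 'k)"
      by (simp add: ksgn_if)
    then show ?thesis
      using k i lx by (simp add: contr_def step_x dstep_nth mult.assoc[symmetric])
  qed
  have term_y: "tscale (ksgn p * ksgn (degsum (take k ys))) (?G xs (?Dy k)) =
      tscale (?s * ksgn (degsum (take (n - 1 + skip j k) ?zs))) (?P (dstep (replicate ?N V) (n - 1 + skip j k) ?zs))"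
    if k: "k < m" "k \<noteq> j" for k
  \<comment> \<open>Both sides vanish unless the contracted degrees cancel. If they do, their
    parities agree, so the degree of \<open>ys ! j\<close> in one sign can be traded for that of
    \<open>xs ! i\<close> in the other.\<close>
  proof (cases "fst (xs ! i) + fst (ys ! j) = 0")
    case True
    then have ev: "even (fst (xs ! i)) = even (fst (ys ! j))" by presburger
    have "degsum (take (n - 1 + skip j k) ?zs) = p - fst (xs ! i) + (degsum (take k ys) - (if j < k then fst (ys ! j) else 0))"
      using k i j lx ly xs(2) by (simp add: degsum_take_delete_at degsum_delete_at)
    moreover have "contract_sign i xs j (?Dy k) = (contract_sign i xs j ys * ksgn (if k < j then fst (ys ! j) else 0) :: 'k)"
      using k j ly
      by (cases "k < j") (simp_all add: contract_sign_def dstep_nth degsum_take_dstep distrib_left ksgn_add)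
    ultimately have "ksgn p * ksgn (degsum (take k ys)) * contract_sign i xs j (?Dy k) =
        (contract_sign i xs j ys * ksgn (degsum (take (n - 1 + skip j k) ?zs)) :: 'k)"
      using k(2) ev by (simp add: ksgn_if)
    then show ?thesis
      using k j ly by (simp add: contr_def step_y[simplified] dstep_nth mult.assoc[symmetric])
  next
    case False
    then show ?thesis
      using k i j lx ly by (simp add: contr_def dstep_nth form_degree)
  qed
  have term_ij: "tscale (ksgn (degsum (take i xs))) (?G (?Dx i) ys) +
      tscale (ksgn p * ksgn (degsum (take j ys))) (?G xs (?Dy j)) = 0"
  proof -
    let ?d = "fst (xs ! i)" and ?e = "fst (ys ! j)" and ?a = "degsum (drop (Suc i) xs)" and ?b = "degsum (take j ys)"
    \<comment> \<open>The sign of the step at \<open>xs ! i\<close>. The one at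
      \<open>ys ! j\<close> differs from it by the sign of the degree of \<open>xs ! i\<close>,
      which is the sign in \<open>form_chain\<close>.\<close>
    let ?c = "ksgn (degsum (take i xs) + ?a + ?d * ?a + ?e * ?b) :: 'k"
    have "ksgn (degsum (take i xs)) * contract_sign i (?Dx i) j ys = ?c"
      using i lx by (simp add: contract_sign_def dstep_nth degsum_drop_dstep distrib_right ksgn_add)
    moreover have "ksgn p * ksgn ?b * contract_sign i xs j (?Dy j) = (ksgn ?d * ?c :: 'k)"
      using i j lx ly arg_cong[OF degsum_take_drop[of i xs], of "ksgn :: int \<Rightarrow> 'k"] xs(2)
      by (simp add: contract_sign_def dstep_nth degsum_take_dstep distrib_right ksgn_add)
    ultimately have "tscale (ksgn (degsum (take i xs))) (?G (?Dx i) ys) +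
      tscale (ksgn p * ksgn ?b) (?G xs (?Dy j)) =
      tscale (?c * (B (?d + 1) ?e (Dif V ?d (snd (xs ! i))) (snd (ys ! j)) +
        ksgn ?d * B ?d (?e + 1) (snd (xs ! i)) (Dif V ?e (snd (ys ! j))))) (?P ?zs)"
      using i j lx ly
      by (simp add: contr_def dstep_nth mult.assoc[symmetric] distrib_left tens.scale_left_distrib)
        (simp add: dstep_def ac_simps)
    then show ?thesis using form_chain[OF xi yj] by simp
  qed
  have "Dif (tensor (replicate ?N V)) (p + q) (cc n i m j (pure (replicate n V) xs) (pure (replicate m V) ys)) =
      (\<Sum>k<?N. tscale (?s * ksgn (degsum (take k ?zs))) (?P (dstep (replicate ?N V) k ?zs)))"
    unfolding cc_pure[OF i j xs(1) ys(1)] contr_def Dif_scale Dif_pure[OF dg_replicate] lz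
      tens.scale_sum_right tens.scale_scale ..
  also have "\<dots> = (\<Sum>k\<in>{..<n} - {i}. tscale (ksgn (degsum (take k xs))) (?G (?Dx k) ys)) +
      (\<Sum>k\<in>{..<m} - {j}. tscale (ksgn p * ksgn (degsum (take k ys))) (?G xs (?Dy k)))"
    unfolding sum_glue_flags[OF i j] 
    by (intro arg_cong2[of _ _ _ _ "(+)"] sum.cong refl, rule term_x[symmetric], simp, simp,
      rule term_y[symmetric], simp_all)
  \<comment> \<open>The two missing terms are added to the sums; together they are 0.\<close>
  also have "\<dots> = (\<Sum>k<n. tscale (ksgn (degsum (take k xs))) (?G (?Dx k) ys)) +
      (\<Sum>k<m. tscale (ksgn p * ksgn (degsum (take k ys))) (?G xs (?Dy k)))"
    using term_ij i j by (simp add: sum.remove[of "{..<n}" i] sum.remove[of "{..<m}" j] algebra_simps add_eq_0_iff)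
  also have "(\<Sum>k<n. tscale (ksgn (degsum (take k xs))) (?G (?Dx k) ys)) =
      cc n i m j (Dif (tensor (replicate n V)) p (pure (replicate n V) xs)) (pure (replicate m V) ys)"
  proof -
    have "cc n i m j (Dif (tensor (replicate n V)) p (pure (replicate n V) xs)) (pure (replicate m V) ys) =
        (\<Sum>k<n. cc n i m j (tscale (ksgn (degsum (take k xs))) (pure (replicate n V) (?Dx k))) (pure (replicate m V) ys))"
      unfolding Dif_pure[OF dg_replicate] lx
      using lx xs
      by (intro lin_on_sum[where Ws = "replicate n V" and p = "p + 1", OF lin_cc_left] tensor_scale pure_mem[where p = "p + 1"])
        (auto simp: degsum_dstep dg intro!: homog_dstep)
    then show ?thesis
      using lx xs ys i j by (simp add: blin_scale_left cc_pure homog_dstep dg)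
  qed
  also have "(\<Sum>k<m. tscale (ksgn p * ksgn (degsum (take k ys))) (?G xs (?Dy k))) =
      tscale (ksgn p) (cc n i m j (pure (replicate n V) xs) (Dif (tensor (replicate m V)) q (pure (replicate m V) ys)))"
  proof -
    have hk: "homog (replicate m V) (?Dy k)" "degsum (?Dy k) = q + 1" if "k < m" for k
      using that ly ys by (auto simp: degsum_dstep dg intro!: homog_dstep)
    have "cc n i m j (pure (replicate n V) xs) (Dif (tensor (replicate m V)) q (pure (replicate m V) ys)) =
        (\<Sum>k<m. cc n i m j (pure (replicate n V) xs) (tscale (ksgn (degsum (take k ys))) (pure (replicate m V) (?Dy k))))"
      unfolding Dif_pure[OF dg_replicate] ly
      by (intro lin_on_sum[OF lin_cc_right[where q = "q + 1", OF i j pure_mem[OF xs]]] tensor_scale pure_mem[where p = "q + 1"])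
        (auto simp: hk)
    also have "\<dots> = (\<Sum>k<m. tscale (ksgn (degsum (take k ys))) (?G xs (?Dy k)))"
      using hk xs i j blin_scale_right[OF bimlin_cc[OF i j] pure_mem[OF xs] pure_mem[OF hk]]
      by (intro sum.cong refl) (simp add: cc_pure)
    finally show ?thesis by (simp add: tens.scale_sum_right)
  qed
  finally show "Dif (tensor (replicate ?N V)) (p + q) (cc n i m j (pure (replicate n V) xs) (pure (replicate m V) ys)) =
      cc n i m j (Dif (tensor (replicate n V)) p (pure (replicate n V) xs)) (pure (replicate m V) ys) +
      tscale (ksgn p) (cc n i m j (pure (replicate n V) xs) (Dif (tensor (replicate m V)) q (pure (replicate m V) ys)))" .
qed

end

lemma ksgn_diff: "ksgn (p - q) = (ksgn p * ksgn q :: 'k::field)"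
  by (simp add: ksgn_if)

context graded_form
begin

text \<open>Splitting the Koszul sign of \<sigma> at \<open>i\<close> by the degrees behind it and
  that of \<tau> at \<open>j\<close> by the degrees in front of it produces exactly the degrees that
  \<open>contract_sign\<close> uses, before and after the permutation. What is left over is the sign
  of \<rho> by \<open>glue_koszul\<close>.\<close>

lemma cc_equivariant:
  assumes i: "i < n" and j: "j < m" and S: "S \<in> TV n p" and T: "T \<in> TV m q"
    and \<sigma>: "\<sigma> permutes {..<n}" and \<tau>: "\<tau> permutes {..<m}" and \<rho>: "\<rho> permutes {..<n + m - 2}"
    and \<rho>x: "\<And>x. x < n \<Longrightarrow> x \<noteq> i \<Longrightarrow> \<rho> (skip i x) = skip (\<sigma> i) (\<sigma> x)"
    and \<rho>y: "\<And>y. y < m \<Longrightarrow> y \<noteq> j \<Longrightarrow> \<rho> (n - 1 + skip j y) = n - 1 + skip (\<tau> j) (\<tau> y)"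
  shows "cc n (\<sigma> i) m (\<tau> j) (tperm (replicate n V) \<sigma> S) (tperm (replicate m V) \<tau> T) =
    tperm (replicate (n + m - 2) V) \<rho> (cc n i m j S T)"
  using S T
proof (rule cc_eqI[where L = "\<lambda>S T. cc n (\<sigma> i) m (\<tau> j) (tperm (replicate n V) \<sigma> S) (tperm (replicate m V) \<tau> T)"])
  have \<sigma>i: "\<sigma> i < n" and \<tau>j: "\<tau> j < m" using i j permutes_less[OF \<sigma>] permutes_less[OF \<tau>] by auto
  show "lin_on (TV n p) (\<lambda>S. cc n (\<sigma> i) m (\<tau> j) (tperm (replicate n V) \<sigma> S) (tperm (replicate m V) \<tau> T))" for T
    by (rule lin_on_comp[OF lin_cc_left[of UNIV] lin_on_tperm]) simp
  show "lin_on (TV n p) (\<lambda>S. tperm (replicate (n + m - 2) V) \<rho> (cc n i m j S T))" for T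
    by (rule lin_on_comp[OF lin_on_tperm[of UNIV] lin_cc_left]) simp
  show "lin_on (TV m q) (\<lambda>T. cc n (\<sigma> i) m (\<tau> j) (tperm (replicate n V) \<sigma> S) (tperm (replicate m V) \<tau> T))"
    if "S \<in> TV n p" for S
    by (rule lin_on_comp[OF lin_cc_right[OF \<sigma>i \<tau>j act_mem[OF \<sigma> that]] lin_on_tperm]) (rule act_mem[OF \<tau>])
  show "lin_on (TV m q) (\<lambda>T. tperm (replicate (n + m - 2) V) \<rho> (cc n i m j S T))"
    if "S \<in> TV n p" for S
    by (rule lin_on_comp[OF lin_on_tperm[of UNIV] lin_cc_right[OF i j that]]) simp
  fix xs ys
  assume xs: "homog (replicate n V) xs" "degsum xs = p" and ys: "homog (replicate m V) ys" "degsum ys = q"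
  let ?xs = "permute_list (inv \<sigma>) xs" and ?ys = "permute_list (inv \<tau>) ys"
  let ?zs = "delete_at i xs @ delete_at j ys"
  have lx: "length xs = n" and ly: "length ys = m" using xs ys by (simp_all add: homog_length)
  note perms = \<sigma>[folded lx] \<tau>[folded ly]
  have hx: "homog (replicate n V) ?xs" "homog (replicate m V) ?ys"
    using homog_permute[OF compat_replicate] xs ys \<sigma> \<tau> by blast+
  have nth: "?xs ! \<sigma> i = xs ! i" "?ys ! \<tau> j = ys ! j"
    using i j lx ly nth_permute_inv[OF perms(1)] nth_permute_inv[OF perms(2)] by auto
  have list: "permute_list (inv \<rho>) ?zs = delete_at (\<sigma> i) ?xs @ delete_at (\<tau> j) ?ys"
    using i j \<rho> \<rho>x \<rho>y by (intro glue_permute perms) (simp_all add: lx ly)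
  have sign: "koszul \<sigma> xs * koszul \<tau> ys * contract_sign (\<sigma> i) ?xs (\<tau> j) ?ys =
      (contract_sign i xs j ys * koszul \<rho> ?zs :: 'k)"
  proof -
    have "koszul \<rho> ?zs = (inv_sign ({..<length xs} - {i}) \<sigma> (\<lambda>k. fst (xs ! k)) *
        inv_sign ({..<length ys} - {j}) \<tau> (\<lambda>k. fst (ys ! k)) :: 'k)"
      using i j \<rho>x \<rho>y by (intro glue_koszul perms) (simp_all add: lx ly)
    then show ?thesis
      unfolding koszul_split_drop[OF perms(1) i[folded lx]] koszul_split[OF perms(2) j[folded ly]]
        contract_sign_def nth
      by (simp add: distrib_left ksgn_add mult.assoc mult.left_commute)
  qed
  have "perm_compat \<rho> (replicate (n + m - 2) V) (replicate (n + m - 2) V)" by (rule compat_replicate[OF \<rho>])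
  note rho = tperm_pure[OF this]
  show "cc n (\<sigma> i) m (\<tau> j) (tperm (replicate n V) \<sigma> (pure (replicate n V) xs)) (tperm (replicate m V) \<tau> (pure (replicate m V) ys)) =
      tperm (replicate (n + m - 2) V) \<rho> (cc n i m j (pure (replicate n V) xs) (pure (replicate m V) ys))"
    unfolding tperm_pure[OF compat_replicate[OF \<sigma>]] tperm_pure[OF compat_replicate[OF \<tau>]] blin_scale_left
      blin_scale_right[OF bimlin_cc[OF \<sigma>i \<tau>j] pure_mem[OF hx(1) refl] pure_mem[OF hx(2) refl]]
      cc_pure[OF \<sigma>i \<tau>j hx] cc_pure[OF i j xs(1) ys(1)] contr_def tperm_scale rho list nth tens.scale_scale
    by (simp add: sign[symmetric] mult.assoc mult.left_commute mult.commute)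
qed

text \<open>Unless the contracted degrees cancel, both sides are 0. If they do, the symmetry of the
  form and the Koszul sign of the block permutation leave an identity of parities in the degrees of
  the four surviving segments and of one contracted entry.\<close>

lemma cc_commute:
  assumes i: "i < n" and j: "j < m" and S: "S \<in> TV n p" and T: "T \<in> TV m q"
  shows "cc m j n i T S =
    tscale (ksgn (p * q)) (tperm (replicate (n + m - 2) V) (block_swap 0 (n - 1) (m - 1)) (cc n i m j S T))"
  using S T
proof (rule cc_eqI[where L = "\<lambda>S T. cc m j n i T S"])
  let ?\<rho> = "block_swap 0 (n - 1) (m - 1)"
  show "lin_on (TV n p) (\<lambda>S. cc m j n i T S)" if "T \<in> TV m q" for T
    by (rule lin_cc_right[OF j i that])
  show "lin_on (TV m q) (\<lambda>T. cc m j n i T S)" for S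
    by (rule lin_cc_left)
  show "lin_on (TV n p) (\<lambda>S. tscale (ksgn (p * q)) (tperm (replicate (n + m - 2) V) ?\<rho> (cc n i m j S T)))" for T
    by (intro lin_on_scale lin_on_comp[OF lin_on_tperm[of UNIV] lin_cc_left]) simp
  show "lin_on (TV m q) (\<lambda>T. tscale (ksgn (p * q)) (tperm (replicate (n + m - 2) V) ?\<rho> (cc n i m j S T)))"
    if "S \<in> TV n p" for S
    by (intro lin_on_scale lin_on_comp[OF lin_on_tperm[of UNIV] lin_cc_right[OF i j that]]) simp
  fix xs ys
  assume xs: "homog (replicate n V) xs" "degsum xs = p" and ys: "homog (replicate m V) ys" "degsum ys = q"
  have lx: "length xs = n" and ly: "length ys = m" using xs ys by (simp_all add: homog_length)
  have xi: "snd (xs ! i) \<in> Gr V (fst (xs ! i))" and yj: "snd (ys ! j) \<in> Gr V (fst (ys ! j))"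
    using homog_nth[OF xs(1)] homog_nth[OF ys(1)] i j by auto
  let ?a = "delete_at i xs" and ?b = "delete_at j ys"
  let ?d = "fst (xs ! i)" and ?e = "fst (ys ! j)"
  have len: "length ?a = n - 1" "length ?b = m - 1" using i j lx ly by simp_all
  have "?\<rho> permutes {..<n + m - 2}" by (rule block_swap_permutes) (use i j in simp)
  note rho = tperm_pure[OF compat_replicate[OF this]]
  have koszul: "koszul ?\<rho> (?a @ ?b) = (ksgn ((p - ?d) * (q - ?e)) :: 'k)"
    using koszul_block_swap[of "[]" ?a ?b "[]", where 'k = 'k] len xs ys i j lx ly by (simp add: degsum_delete_at)
  have list: "permute_list (inv ?\<rho>) (?a @ ?b) = ?b @ ?a"
    using permute_block_swap[of "[]" ?a ?b "[]"] len by simp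
  have nm: "m + n - 2 = n + m - 2" by simp
  show "cc m j n i (pure (replicate m V) ys) (pure (replicate n V) xs) =
      tscale (ksgn (p * q)) (tperm (replicate (n + m - 2) V) ?\<rho> (cc n i m j (pure (replicate n V) xs) (pure (replicate m V) ys)))"
  proof (cases "?d + ?e = 0")
    case True
    then have e: "?e = - ?d" by simp
    have "contract_sign j ys i xs * ksgn (?d * ?e) =
        (ksgn (p * q) * (contract_sign i xs j ys * ksgn ((p - ?d) * (q - ?e))) :: 'k)"
    proof -
      let ?x = "degsum (take i xs)" and ?x' = "degsum (drop (Suc i) xs)"
      let ?y = "degsum (take j ys)" and ?y' = "degsum (drop (Suc j) ys)"
      have pq: "p = ?x + ?d + ?x'" "q = ?y + ?e + ?y'"
        using degsum_take_drop[of i xs] degsum_take_drop[of j ys] i j lx ly xs ys by auto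
      show ?thesis
        unfolding contract_sign_def pq e by (simp add: ksgn_if) 
    qed
    then show ?thesis
      unfolding cc_pure[OF j i ys(1) xs(1)] cc_pure[OF i j xs(1) ys(1)]
      unfolding contr_def tperm_scale rho list koszul nm
        tens.scale_scale form_sym[OF xi yj]
      by (simp add: mult.assoc[symmetric])
  next
    case False
    then show ?thesis
      unfolding cc_pure[OF j i ys(1) xs(1)] cc_pure[OF i j xs(1) ys(1)]
      using i j lx ly by (simp add: contr_degree tperm_zero add.commute)
  qed
qed

text \<open>The same two pairs are contracted on both sides. If \<open>k < j\<close>, performing one
  contraction first removes from the sign of the other the product of the degrees of
  \<open>ys ! j\<close> and \<open>ys ! k\<close>; this happens in either order, so the signs
  agree.\<close>

lemma cc_assoc:
  assumes i: "i < n" and j: "j < m" and k: "k < m" and jk: "j \<noteq> k" and h: "h < l"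
    and S: "S \<in> TV n p" and T: "T \<in> TV m q" and U: "U \<in> TV l r"
  shows "cc (n + m - 2) (n - 1 + skip j k) l h (cc n i m j S T) U =
    cc n i (m + l - 2) (skip k j) S (cc m k l h T U)"
proof -
  let ?N = "n + m - 2" and ?M = "m + l - 2" and ?u = "n - 1 + skip j k" and ?v = "skip k j"
  have u: "?u < ?N" and v: "?v < ?M" using i j k jk h skip_less[of k m j] skip_less[of j m k] by auto
  let ?R = "replicate"
  have comp_right: "lin_on (TV l r) (\<lambda>U. cc n i ?M ?v S (cc m k l h T U))" if "S \<in> TV n p" "T \<in> TV m q" for S T
    using lin_on_comp[OF lin_cc_right[OF i v that(1)] lin_cc_right[OF k h that(2)] cc_mem[OF k h that(2)]] .
  have comp_left: "lin_on (TV l r) (cc ?N ?u l h (cc n i m j S T))" if "S \<in> TV n p" "T \<in> TV m q" for S T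
    by (rule lin_cc_right[OF u h cc_mem[OF i j that]])
  have pure: "cc ?N ?u l h (cc n i m j S T) (pure (?R l V) zs) = cc n i ?M ?v S (cc m k l h T (pure (?R l V) zs))"
    if zs: "homog (?R l V) zs" "degsum zs = r" and S: "S \<in> TV n p" and T: "T \<in> TV m q" for S T zs
    using S T
  proof (rule cc_eqI[where L = "\<lambda>S T. cc ?N ?u l h (cc n i m j S T) (pure (?R l V) zs)"])
    note z = pure_mem[OF zs]
    show "lin_on (TV n p) (\<lambda>S. cc ?N ?u l h (cc n i m j S T) (pure (?R l V) zs))" for T
      by (rule lin_on_comp[OF lin_cc_left[of UNIV] lin_cc_left]) simp
    show "lin_on (TV n p) (\<lambda>S. cc n i ?M ?v S (cc m k l h T (pure (?R l V) zs)))" for T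
      by (rule lin_cc_left)
    show "lin_on (TV m q) (\<lambda>T. cc ?N ?u l h (cc n i m j S T) (pure (?R l V) zs))" if "S \<in> TV n p" for S
      by (rule lin_on_comp[OF lin_cc_left[of UNIV] lin_cc_right[OF i j that]]) simp
    show "lin_on (TV m q) (\<lambda>T. cc n i ?M ?v S (cc m k l h T (pure (?R l V) zs)))" if "S \<in> TV n p" for S
      by (rule lin_on_comp[OF lin_cc_right[OF i v that] lin_cc_left]) (rule cc_mem[OF k h _ z])
    fix xs ys
    assume xs: "homog (?R n V) xs" "degsum xs = p" and ys: "homog (?R m V) ys" "degsum ys = q"
    have lx: "length xs = n" and ly: "length ys = m" and lz: "length zs = l"
      using xs ys zs by (simp_all add: homog_length)
    note xy = homog_glue[OF i j xs(1) ys(1)] and yz = homog_glue[OF k h ys(1) zs(1)]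
    let ?xy = "delete_at i xs @ delete_at j ys" and ?yz = "delete_at k ys @ delete_at h zs"
    have la: "length (delete_at i xs) = n - 1" "length (delete_at k ys) = m - 1" "length (delete_at j ys) = m - 1"
      using i j k lx ly by simp_all
    have sk: "skip j k < m - 1" "skip k j < m - 1" using jk j k skip_less[of k m j] skip_less[of j m k] by auto
    have nth: "?xy ! ?u = ys ! k" "?yz ! ?v = ys ! j"
      using la sk i j k jk ly by (auto simp: nth_append delete_at_nth)
    have list: "delete_at ?u ?xy @ delete_at h zs = delete_at i xs @ delete_at ?v ?yz"
      using la sk j k jk ly delete_at_append_right[of "delete_at i xs" "skip j k" "delete_at j ys"]
      by (simp add: delete_at_append_left delete_at_delete_at)
    have MN: "?N + l - 2 = n + ?M - 2" using i j h k by simp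
    let ?B1 = "B (fst (xs ! i)) (fst (ys ! j)) (snd (xs ! i)) (snd (ys ! j))"
      and ?B2 = "B (fst (ys ! k)) (fst (zs ! h)) (snd (ys ! k)) (snd (zs ! h))"
    have signs: "contract_sign i xs j ys * contract_sign ?u ?xy h zs =
        (contract_sign k ys h zs * contract_sign i xs ?v ?yz :: 'k)"
    proof -
      have dd: "degsum (drop (Suc ?u) ?xy) = degsum (drop (Suc k) ys) - (if k < j then fst (ys ! j) else 0)"
        using la sk j k jk ly by (simp add: degsum_drop_delete_at)
      have tt: "degsum (take ?v ?yz) = degsum (take j ys) - (if k < j then fst (ys ! k) else 0)"
        using la sk j k jk ly by (simp add: degsum_take_delete_at)
      show ?thesis
        unfolding contract_sign_def nth dd tt
        by (cases "k < j") (simp_all add: right_diff_distrib ksgn_add ksgn_diff ac_simps)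
    qed
    show "cc ?N ?u l h (cc n i m j (pure (?R n V) xs) (pure (?R m V) ys)) (pure (?R l V) zs) =
        cc n i ?M ?v (pure (?R n V) xs) (cc m k l h (pure (?R m V) ys) (pure (?R l V) zs))"
      unfolding trans[OF cc_pure[OF i j xs(1) ys(1)] contr_def] trans[OF cc_pure[OF k h ys(1) zs(1)] contr_def]
        blin_scale_left blin_scale_right[OF bimlin_cc[OF i v] pure_mem[OF xs] pure_mem[OF yz refl]]
        trans[OF cc_pure[OF u h xy zs(1)] contr_def] trans[OF cc_pure[OF i v xs(1) yz] contr_def]
        tens.scale_scale list nth
      unfolding MN
      using arg_cong[OF signs, of "\<lambda>c. tscale (c * (?B1 * ?B2)) (pure (?R (n + ?M - 2) V) (delete_at i xs @ delete_at ?v ?yz))"]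
      by (simp only: ac_simps)
  qed
  show ?thesis
    using U comp_left[OF S T] comp_right[OF S T] by (rule lin_on_eqI) (rule pure[OF _ _ S T])
qed

theorem cyclic_operad_End: "cyclic_operad (End_cyc V B)"
proof
  fix n m l :: nat and i j k h :: nat and p q r :: int and \<sigma> \<tau> \<rho> :: "nat \<Rightarrow> nat" and a b c :: "('k, 'v) tens"
  have Csp: "Csp (End_cyc V B) n = tensor (replicate n V)" for n by (simp add: End_cyc_def)
  have act: "cact (End_cyc V B) n p = tperm (replicate n V)" for n p by (simp add: End_cyc_def)
  note sel = Csp act ccomp_End
  show "dg_vector_space (Csp (End_cyc V B) n)"
    unfolding Csp by (rule dg_tensor[OF dg_replicate])
  show "chain_map (Csp (End_cyc V B) n) (Csp (End_cyc V B) n) (\<lambda>p. cact (End_cyc V B) n p \<sigma>)"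
    if "\<sigma> permutes {..<n}"
    unfolding chain_map_def sel
    using that by (auto simp: tperm_add tperm_scale act_mem tperm_Dif[OF compat_replicate[OF that] dg_replicate dg_replicate])
  show "cact (End_cyc V B) n p id a = a" if "a \<in> Gr (Csp (End_cyc V B) n) p"
    using that unfolding sel by (rule tperm_id)
  show "cact (End_cyc V B) n p (\<sigma> \<circ> \<tau>) a = cact (End_cyc V B) n p \<sigma> (cact (End_cyc V B) n p \<tau> a)"
    if "\<sigma> permutes {..<n}" "\<tau> permutes {..<n}" "a \<in> Gr (Csp (End_cyc V B) n) p"
    using that unfolding sel by (simp add: tperm_tperm[OF compat_replicate compat_replicate])
  show "chain_bimap (Csp (End_cyc V B) n) (Csp (End_cyc V B) m) (Csp (End_cyc V B) (n + m - 2))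
      (\<lambda>p q. ccomp (End_cyc V B) n p i m q j)" if "i < n" "j < m"
    unfolding chain_bimap_def sel tensor_sel(1)
    using that lin_cc_right[OF that]
    by (auto simp: cc_mem blin_add_left blin_scale_left lin_on_def cc_Dif)
  show "ccomp (End_cyc V B) n p (\<sigma> i) m q (\<tau> j) (cact (End_cyc V B) n p \<sigma> a) (cact (End_cyc V B) m q \<tau> b) =
      cact (End_cyc V B) (n + m - 2) (p + q) \<rho> (ccomp (End_cyc V B) n p i m q j a b)"
    if "i < n" "j < m" "a \<in> Gr (Csp (End_cyc V B) n) p" "b \<in> Gr (Csp (End_cyc V B) m) q"
      "\<sigma> permutes {..<n}" "\<tau> permutes {..<m}" "\<rho> permutes {..<n + m - 2}"
      "\<And>x. x < n \<Longrightarrow> x \<noteq> i \<Longrightarrow> \<rho> (skip i x) = skip (\<sigma> i) (\<sigma> x)"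
      "\<And>y. y < m \<Longrightarrow> y \<noteq> j \<Longrightarrow> \<rho> (n - 1 + skip j y) = n - 1 + skip (\<tau> j) (\<tau> y)"
    using that unfolding sel by (rule cc_equivariant)
  show "ccomp (End_cyc V B) m q j n p i b a =
      Scl (Csp (End_cyc V B) (n + m - 2)) (ksgn (p * q))
        (cact (End_cyc V B) (n + m - 2) (p + q) (block_swap 0 (n - 1) (m - 1)) (ccomp (End_cyc V B) n p i m q j a b))"
    if "i < n" "j < m" "a \<in> Gr (Csp (End_cyc V B) n) p" "b \<in> Gr (Csp (End_cyc V B) m) q"
    using that unfolding sel tensor_sel(1) by (rule cc_commute)
  show "ccomp (End_cyc V B) (n + m - 2) (p + q) (n - 1 + skip j k) l r h (ccomp (End_cyc V B) n p i m q j a b) c =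
      ccomp (End_cyc V B) n p i (m + l - 2) (q + r) (skip k j) a (ccomp (End_cyc V B) m q k l r h b c)"
    if "i < n" "j < m" "k < m" "j \<noteq> k" "h < l" "a \<in> Gr (Csp (End_cyc V B) n) p" "b \<in> Gr (Csp (End_cyc V B) m) q"
      "c \<in> Gr (Csp (End_cyc V B) l) r"
    using that unfolding sel by (rule cc_assoc)
qed

end

section \<open>The dioperad underlying a cyclic operad\<close>

text \<open>Restriction along the functor that forgets directions; the outputs come first.\<close>

definition phi_pull :: "('k, 'o) cyc_data \<Rightarrow> ('k, 'o) dio_data" where
  "phi_pull \<O> =
   \<lparr>Dsp = (\<lambda>r s. Csp \<O> (r + s)),
    dact = (\<lambda>r s p \<sigma> \<tau>. cact \<O> (r + s) p (perm_sum r \<sigma> \<tau>)),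
    dcomp = (\<lambda>r s p i r' s' p' j a b.
      cact \<O> (r + s + (r' + s') - 2) (p + p') (block_swap (r - 1) s r')
        (ccomp \<O> (r + s) p i (r' + s') p' (r' + j) a b))\<rparr>"

section \<open>Explicit permutations of the flags of a glued corolla\<close>

lemma perm_sum_permutes:
  assumes "\<sigma> permutes {..<r}" "\<tau> permutes {..<s}"
  shows "perm_sum r \<sigma> \<tau> permutes {..<r + s}"
proof (rule bij_imp_permutes)
  have less: "perm_sum r \<sigma> \<tau> x < r + s" if "x < r + s" for x
  proof (cases "x < r")
    case True
    then have "\<sigma> x < r" using permutes_less[OF assms(1)] by simp
    then show ?thesis using True by (simp add: perm_sum_def)
  next
    case False
    then have "\<tau> (x - r) < s" using that permutes_less[OF assms(2)] by simp
    then show ?thesis using False by (simp add: perm_sum_def)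
  qed
  have inj: "inj_on (perm_sum r \<sigma> \<tau>) {..<r + s}"
  proof (rule inj_onI)
    fix x y assume h: "x \<in> {..<r + s}" "y \<in> {..<r + s}" "perm_sum r \<sigma> \<tau> x = perm_sum r \<sigma> \<tau> y"
    have *: "\<sigma> z < r \<longleftrightarrow> z < r" for z by (rule permutes_less[OF assms(1)])
    show "x = y"
      using h(3) *[of x] *[of y] injD[OF permutes_inj[OF assms(1)], of x y]
        injD[OF permutes_inj[OF assms(2)], of "x - r" "y - r"]
      by (auto simp: perm_sum_def split: if_splits)
  qed
  show "bij_betw (perm_sum r \<sigma> \<tau>) {..<r + s} {..<r + s}"
    unfolding bij_betw_def using inj less endo_inj_surj[OF _ _ inj] by blast
  show "perm_sum r \<sigma> \<tau> x = x" if "x \<notin> {..<r + s}" for x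
  proof -
    have "\<tau> (x - r) = x - r" using that by (intro permutes_not_in[OF assms(2)]) auto
    then show ?thesis using that by (simp add: perm_sum_def)
  qed
qed

lemma perm_sum_id: "perm_sum r id id = id"
  by (auto simp: perm_sum_def fun_eq_iff)

lemma perm_sum_comp:
  assumes "\<sigma>' permutes {..<r}"
  shows "perm_sum r (\<sigma> \<circ> \<sigma>') (\<tau> \<circ> \<tau>') = perm_sum r \<sigma> \<tau> \<circ> perm_sum r \<sigma>' \<tau>'"
  using permutes_less[OF assms] by (auto simp: perm_sum_def fun_eq_iff)

text \<open>The increasing enumeration of the positions other than \<open>i\<close>, inverse to
  \<open>skip i\<close>.\<close>

definition unskip :: "nat \<Rightarrow> nat \<Rightarrow> nat" where
  "unskip i z = (if z < i then z else Suc z)"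

lemma unskip_skip: "x \<noteq> i \<Longrightarrow> unskip i (skip i x) = x"
  by (auto simp: unskip_def skip_def)

text \<open>The only permutation of the \<open>n + m - 2\<close> flags that satisfies the conditions
  on \<rho> in the equivariance axiom for \<sigma> and \<tau>. The explicit formula allows its
  composites with block permutations to be computed.\<close>

definition glue_perm ::
  "nat \<Rightarrow> nat \<Rightarrow> nat \<Rightarrow> nat \<Rightarrow> (nat \<Rightarrow> nat) \<Rightarrow> (nat \<Rightarrow> nat) \<Rightarrow> nat \<Rightarrow> nat" where
  "glue_perm n i m j \<sigma> \<tau> z =
     (if z < n - 1 then skip (\<sigma> i) (\<sigma> (unskip i z))
      else if z < n + m - 2 then n - 1 + skip (\<tau> j) (\<tau> (unskip j (z - (n - 1)))) else z)"

lemma glue_perm_left: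
  "i < n \<Longrightarrow> x < n \<Longrightarrow> x \<noteq> i \<Longrightarrow> glue_perm n i m j \<sigma> \<tau> (skip i x) = skip (\<sigma> i) (\<sigma> x)"
  using skip_less[of x n i] by (simp add: glue_perm_def unskip_skip)

lemma glue_perm_right:
  "i < n \<Longrightarrow> j < m \<Longrightarrow> y < m \<Longrightarrow> y \<noteq> j \<Longrightarrow>
    glue_perm n i m j \<sigma> \<tau> (n - 1 + skip j y) = n - 1 + skip (\<tau> j) (\<tau> y)"
  using skip_less[of y m j] by (auto simp: glue_perm_def unskip_skip)

lemma glue_perm_permutes:
  assumes i: "i < n" and j: "j < m" and \<sigma>: "\<sigma> permutes {..<n}" and \<tau>: "\<tau> permutes {..<m}"
  shows "glue_perm n i m j \<sigma> \<tau> permutes {..<n + m - 2}"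
proof (rule bij_imp_permutes)
  let ?g = "glue_perm n i m j \<sigma> \<tau>"
  have neq: "\<sigma> x \<noteq> \<sigma> i" if "x \<noteq> i" for x using that permutes_inj[OF \<sigma>] by (auto dest: injD)
  have neq': "\<tau> y \<noteq> \<tau> j" if "y \<noteq> j" for y using that permutes_inj[OF \<tau>] by (auto dest: injD)
  have left: "?g (skip i x) < n - 1" if "x < n" "x \<noteq> i" for x
    using that i neq permutes_less[OF \<sigma>] skip_less[of "\<sigma> x" n "\<sigma> i"] by (simp add: glue_perm_left)
  have right: "skip (\<tau> j) (\<tau> y) < m - 1" if "y < m" "y \<noteq> j" for y
    using that j neq' permutes_less[OF \<tau>] skip_less[of "\<tau> y" m "\<tau> j"] by simp
  have "?g z < n + m - 2" if "z < n + m - 2" for z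
    using i j that
  proof (cases rule: glue_flag_cases)
    case (1 x)
    then show ?thesis using left[OF 1(1,2)] i j by simp
  next
    case (2 y)
    then show ?thesis using right[OF 2(1,2)] glue_perm_right[OF i j 2(1,2), of \<sigma> \<tau>] i j by simp
  qed
  moreover have "inj_on ?g {..<n + m - 2}"
  proof (rule inj_onI)
    fix z z' assume "z \<in> {..<n + m - 2}" and z': "z' \<in> {..<n + m - 2}" and eq: "?g z = ?g z'"
    then have "z < n + m - 2" by simp
    with i j show "z = z'"
    proof (cases rule: glue_flag_cases)
      case (1 x)
      note x = this
      from z' have "z' < n + m - 2" by simp
      with i j show ?thesis
      proof (cases rule: glue_flag_cases)
        case (1 x')
        then have "skip (\<sigma> i) (\<sigma> x) = skip (\<sigma> i) (\<sigma> x')" using eq x i by (simp add: glue_perm_left)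
        then have "\<sigma> x = \<sigma> x'" using skip_eq_iff neq x 1 by blast
        then show ?thesis using x 1 permutes_inj[OF \<sigma>] by (auto dest: injD)
      next
        case (2 y)
        then show ?thesis using left[OF x(1,2)] eq x glue_perm_right[OF i j 2(1,2), of \<sigma> \<tau>] by simp
      qed
    next
      case (2 y)
      note y = this
      from z' have "z' < n + m - 2" by simp
      with i j show ?thesis
      proof (cases rule: glue_flag_cases)
        case (1 x)
        then show ?thesis using left[OF 1(1,2)] eq y glue_perm_right[OF i j y(1,2), of \<sigma> \<tau>] by simp
      next
        case (2 y')
        then have "skip (\<tau> j) (\<tau> y) = skip (\<tau> j) (\<tau> y')"
          using eq y glue_perm_right[OF i j y(1,2), of \<sigma> \<tau>] glue_perm_right[OF i j 2(1,2), of \<sigma> \<tau>] by simp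
        then have "\<tau> y = \<tau> y'" using skip_eq_iff neq' y 2 by blast
        then show ?thesis using y 2 permutes_inj[OF \<tau>] by (auto dest: injD)
      qed
    qed
  qed
  ultimately show "bij_betw ?g {..<n + m - 2} {..<n + m - 2}"
    unfolding bij_betw_def using endo_inj_surj[of "{..<n + m - 2}" ?g] by blast
  show "?g z = z" if "z \<notin> {..<n + m - 2}" for z
    using that i j by (auto simp: glue_perm_def)
qed

lemma permutes_eqI:
  assumes "\<sigma> permutes {..<n}" "\<tau> permutes {..<n}" "\<And>z. z < n \<Longrightarrow> \<sigma> z = \<tau> z"
  shows "\<sigma> = \<tau>"
proof
  show "\<sigma> z = \<tau> z" for z
    using assms(3)[of z] permutes_not_in[OF assms(1), of z] permutes_not_in[OF assms(2), of z]
    by (cases "z < n") auto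
qed

lemmas perm_defs = glue_perm_def block_swap_def skip_def unskip_def perm_sum_def

text \<open>The arities are written as successors, which removes truncated subtraction and leaves a
  case analysis in linear arithmetic. \<open>u\<close> is the place, in the middle element, of the
  flag still to be glued after the other one is gone.\<close>

lemma glue_perm_block_swap_target:
  assumes "z < a + b + c" "u \<le> b" "i \<le> a"
  shows "block_swap 0 (a + b) c (glue_perm (Suc a) i (Suc (c + b)) (c + u) id (block_swap 0 c (Suc b)) z) =
    block_swap 0 a c z"
  using assms by (auto simp: perm_defs)

lemma glue_perm_block_swap_source:
  assumes "z < a + b + c" "u \<le> b"
  shows "glue_perm (a + Suc b) (a + u) (Suc c) l (block_swap 0 a (Suc b)) id (block_swap 0 (b + c) a z) =
    block_swap b c a z"
  using assms by (auto simp: perm_defs)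

lemma chain_mapD:
  assumes "chain_map V W f" "x \<in> Gr V p"
  shows "f p x \<in> Gr W p" and "y \<in> Gr V p \<Longrightarrow> f p (x + y) = f p x + f p y"
    and "f p (Scl V c x) = Scl W c (f p x)" and "f (p + 1) (Dif V p x) = Dif W p (f p x)"
  using assms(1)[unfolded chain_map_def, THEN spec, THEN bspec, OF assms(2)] by blast+

lemma chain_bimapD:
  assumes "chain_bimap U V W m" "x \<in> Gr U p" "y \<in> Gr V q"
  shows "m p q x y \<in> Gr W (p + q)"
    and "x' \<in> Gr U p \<Longrightarrow> m p q (x + x') y = m p q x y + m p q x' y"
    and "y' \<in> Gr V q \<Longrightarrow> m p q x (y + y') = m p q x y + m p q x y'"
    and "m p q (Scl U c x) y = Scl W c (m p q x y)"
    and "m p q x (Scl V c y) = Scl W c (m p q x y)"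
    and "Dif W (p + q) (m p q x y) =
      m (p + 1) q (Dif U p x) y + Scl W (ksgn p) (m p (q + 1) x (Dif V q y))"
  using assms(1)[unfolded chain_bimap_def, THEN spec, THEN spec, THEN bspec, THEN bspec, OF assms(2,3)] by blast+

section \<open>One-sided equivariance and the two further associativity laws\<close>

context cyclic_operad
begin

abbreviation K :: "nat \<Rightarrow> int \<Rightarrow> 'o set" where
  "K n p \<equiv> Gr (Csp \<O> n) p"

lemma K_act: "\<lbrakk>0 < n; \<sigma> permutes {..<n}; a \<in> K n p\<rbrakk> \<Longrightarrow> cact \<O> n p \<sigma> a \<in> K n p"
  by (rule chain_mapD(1)[OF act_chain])

lemma K_act_scale: "\<lbrakk>0 < n; \<sigma> permutes {..<n}; a \<in> K n p\<rbrakk>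
    \<Longrightarrow> cact \<O> n p \<sigma> (Scl (Csp \<O> n) c a) = Scl (Csp \<O> n) c (cact \<O> n p \<sigma> a)"
  by (rule chain_mapD(3)[OF act_chain])

lemma K_comp: "\<lbrakk>i < n; j < m; 2 < n + m; a \<in> K n p; b \<in> K m q\<rbrakk>
    \<Longrightarrow> ccomp \<O> n p i m q j a b \<in> K (n + m - 2) (p + q)"
  by (rule chain_bimapD(1)[OF comp_chain])

lemma K_comp_scale: "\<lbrakk>i < n; j < m; 2 < n + m; a \<in> K n p; b \<in> K m q\<rbrakk>
    \<Longrightarrow> ccomp \<O> n p i m q j (Scl (Csp \<O> n) c a) b = Scl (Csp \<O> (n + m - 2)) c (ccomp \<O> n p i m q j a b)"
  "\<lbrakk>i < n; j < m; 2 < n + m; a \<in> K n p; b \<in> K m q\<rbrakk>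
    \<Longrightarrow> ccomp \<O> n p i m q j a (Scl (Csp \<O> m) c b) = Scl (Csp \<O> (n + m - 2)) c (ccomp \<O> n p i m q j a b)"
  by (rule chain_bimapD(4)[OF comp_chain], assumption+) (rule chain_bimapD(5)[OF comp_chain], assumption+)

lemma K_scale_scale: "0 < n \<Longrightarrow> Scl (Csp \<O> n) c (Scl (Csp \<O> n) d a) = Scl (Csp \<O> n) (c * d) a"
proof -
  assume "0 < n"
  then interpret vector_space "Scl (Csp \<O> n)" using space by (simp add: dg_vector_space_def)
  show ?thesis by simp
qed

lemma act_act: "\<lbrakk>0 < n; \<sigma> permutes {..<n}; \<tau> permutes {..<n}; a \<in> K n p\<rbrakk>
    \<Longrightarrow> cact \<O> n p \<sigma> (cact \<O> n p \<tau> a) = cact \<O> n p (\<sigma> \<circ> \<tau>) a"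
  by (simp add: act_comp)

text \<open>The equivariance axiom with the identity on the other element and \<rho> made explicit.
  The new flag \<open>i'\<close> is a separate variable, so that it can be given in computed
  form.\<close>

lemma comp_act_left:
  assumes "i < n" "j < m" "2 < n + m" "a \<in> K n p" "b \<in> K m q" "\<sigma> permutes {..<n}" "i' = \<sigma> i"
  shows "ccomp \<O> n p i' m q j (cact \<O> n p \<sigma> a) b =
    cact \<O> (n + m - 2) (p + q) (glue_perm n i m j \<sigma> id) (ccomp \<O> n p i m q j a b)"
  using equivariant[of i n j m a p b q \<sigma> id "glue_perm n i m j \<sigma> id"] assms act_id[of m b q]
    glue_perm_permutes[OF assms(1,2,6) permutes_id]
    glue_perm_left[of i n _ m j \<sigma> id] glue_perm_right[of i n j m _ \<sigma> id]
  by (simp add: permutes_id)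

lemma comp_act_right:
  assumes "i < n" "j < m" "2 < n + m" "a \<in> K n p" "b \<in> K m q" "\<tau> permutes {..<m}" "j' = \<tau> j"
  shows "ccomp \<O> n p i m q j' a (cact \<O> m q \<tau> b) =
    cact \<O> (n + m - 2) (p + q) (glue_perm n i m j id \<tau>) (ccomp \<O> n p i m q j a b)"
  using equivariant[of i n j m a p b q id \<tau> "glue_perm n i m j id \<tau>"] assms act_id[of n a p]
    glue_perm_permutes[OF assms(1,2) permutes_id assms(6)]
    glue_perm_left[of i n _ m j id \<tau>] glue_perm_right[of i n j m _ id \<tau>]
  by (simp add: permutes_id)

text \<open>The axiom \<open>assoc\<close> treats trees whose middle vertex comes second. Commuting
  \<open>c\<close> to the right, applying \<open>assoc\<close> and commuting \<open>c\<close> and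
  \<open>b\<close> back gives the form needed when two edges enter the middle vertex
  \<open>b\<close>. The signs \<open>(p1 + p2) * p3\<close> and \<open>p3 * p2\<close> combine to
  \<open>p1 * p3\<close>, up to even terms.\<close>

lemma assoc_target:
  assumes i: "i < n1" and k: "k < n3" and j: "j < n2" and l: "l < n2" and jl: "j \<noteq> l" and n: "4 < n1 + n2 + n3"
    and a: "a \<in> K n1 p1" and b: "b \<in> K n2 p2" and c: "c \<in> K n3 p3"
  shows "ccomp \<O> n3 p3 k (n1 + n2 - 2) (p1 + p2) (n1 - 1 + skip j l) c (ccomp \<O> n1 p1 i n2 p2 j a b) =
    Scl (Csp \<O> (n1 + n2 + n3 - 4)) (ksgn (p1 * p3))
      (cact \<O> (n1 + n2 + n3 - 4) (p1 + p2 + p3) (block_swap 0 (n1 - 1) (n3 - 1))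
        (ccomp \<O> n1 p1 i (n3 + n2 - 2) (p3 + p2) (n3 - 1 + skip l j) a (ccomp \<O> n3 p3 k n2 p2 l c b)))"
proof -
  let ?N = "n1 + n2 + n3 - 4" and ?W = "ccomp \<O> n3 p3 k n2 p2 l c b" and ?X = "ccomp \<O> n1 p1 i n2 p2 j a b"
  let ?g = "block_swap 0 (n3 - 1) (n2 - 1)" and ?n12 = "n1 + n2 - 2" and ?n32 = "n3 + n2 - 2"
  let ?G = "glue_perm n1 i ?n32 (n3 - 1 + skip l j) id ?g" and ?b = "block_swap 0 (?n12 - 1) (n3 - 1)"
  have sk: "skip j l < n2 - 1" "skip l j < n2 - 1" using jl j l skip_less[of j n2 l] skip_less[of l n2 j] by auto
  have pos: "0 < ?N" "2 < n1 + n2" "2 < n3 + n2" "2 < n2 + n3" using n i k j l jl by auto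
  have N: "n1 + ?n32 - 2 = ?N" "?n12 + n3 - 2 = ?N" "n2 + n3 - 2 = ?n32"
    "p1 + (p3 + p2) = p1 + p2 + p3" "p2 + p3 = p3 + p2"
    using pos n i k sk by auto
  have X: "?X \<in> K ?n12 (p1 + p2)" by (rule K_comp[OF i j pos(2) a b])
  have W: "?W \<in> K ?n32 (p3 + p2)" by (rule K_comp[OF k l pos(3) c b])
  have fl: "n1 - 1 + skip j l < ?n12" "n3 - 1 + skip l j < ?n32" "skip l j < ?n32" "0 < ?n32"
    using sk i k by auto
  have gt: "2 < ?n12 + n3" "2 < n1 + ?n32" using n pos i k by auto
  have aW: "ccomp \<O> n1 p1 i ?n32 (p3 + p2) (n3 - 1 + skip l j) a ?W \<in> K ?N (p1 + p2 + p3)"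
    using K_comp[OF i fl(2) gt(2) a W] unfolding N .
  have g: "?g permutes {..<?n32}" and bp: "?b permutes {..<?N}"
    using k sk i n by (auto intro!: block_swap_permutes)
  have G: "?G permutes {..<?N}" using glue_perm_permutes[OF i fl(2) permutes_id g] unfolding N .
  \<comment> \<open>With \<open>c\<close> in front, the flag of \<open>b\<close> that is still to be
    glued lies behind the \<open>n3 - 1\<close> remaining flags of \<open>c\<close>; the block swap
    returns it to its place for the order \<open>b\<close>, \<open>c\<close>.\<close>
  have gs: "skip l j = ?g (n3 - 1 + skip l j)" using sk by (simp add: block_swap_def)
  have bc: "ccomp \<O> n2 p2 l n3 p3 k b c = Scl (Csp \<O> ?n32) (ksgn (p3 * p2)) (cact \<O> ?n32 (p3 + p2) ?g ?W)"
    by (rule commute[OF k l pos(3) c b])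
  have "ccomp \<O> n3 p3 k ?n12 (p1 + p2) (n1 - 1 + skip j l) c ?X =
      Scl (Csp \<O> ?N) (ksgn ((p1 + p2) * p3)) (cact \<O> ?N (p1 + p2 + p3) ?b
        (ccomp \<O> ?n12 (p1 + p2) (n1 - 1 + skip j l) n3 p3 k ?X c))"
    using commute[OF fl(1) k gt(1) X c] unfolding N .
  also have "ccomp \<O> ?n12 (p1 + p2) (n1 - 1 + skip j l) n3 p3 k ?X c =
      ccomp \<O> n1 p1 i ?n32 (p3 + p2) (skip l j) a (ccomp \<O> n2 p2 l n3 p3 k b c)"
    using assoc[OF i j l jl k n a b c] unfolding N .
  also have "\<dots> = Scl (Csp \<O> ?N) (ksgn (p3 * p2))
      (ccomp \<O> n1 p1 i ?n32 (p3 + p2) (skip l j) a (cact \<O> ?n32 (p3 + p2) ?g ?W))"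
    unfolding bc using K_comp_scale(2)[OF i fl(3) gt(2) a K_act[OF fl(4) g W]] unfolding N .
  also have "ccomp \<O> n1 p1 i ?n32 (p3 + p2) (skip l j) a (cact \<O> ?n32 (p3 + p2) ?g ?W) =
      cact \<O> ?N (p1 + p2 + p3) ?G (ccomp \<O> n1 p1 i ?n32 (p3 + p2) (n3 - 1 + skip l j) a ?W)"
    using comp_act_right[OF i fl(2) gt(2) a W g gs] unfolding N .
  also have "cact \<O> ?N (p1 + p2 + p3) ?b (Scl (Csp \<O> ?N) (ksgn (p3 * p2))
      (cact \<O> ?N (p1 + p2 + p3) ?G (ccomp \<O> n1 p1 i ?n32 (p3 + p2) (n3 - 1 + skip l j) a ?W))) =
      Scl (Csp \<O> ?N) (ksgn (p3 * p2)) (cact \<O> ?N (p1 + p2 + p3) (?b \<circ> ?G)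
        (ccomp \<O> n1 p1 i ?n32 (p3 + p2) (n3 - 1 + skip l j) a ?W))"
    using K_act_scale[OF pos(1) bp K_act[OF pos(1) G aW]] act_act[OF pos(1) bp G aW] by (simp only:)
  also have "?b \<circ> ?G = block_swap 0 (n1 - 1) (n3 - 1)"
  proof (rule permutes_eqI[of _ ?N])
    show "?b \<circ> ?G permutes {..<?N}" by (rule permutes_compose[OF G bp])
    show "block_swap 0 (n1 - 1) (n3 - 1) permutes {..<?N}"
      using k i sk by (intro block_swap_permutes) auto
    fix z assume z: "z < ?N"
    \<comment> \<open>The middle element has two glued flags, hence two successors for
      \<open>n2\<close>.\<close>
    obtain a b c where abc: "n1 = Suc a" "n2 = Suc (Suc b)" "n3 = Suc c"
      using i k sk that[of "n1 - 1" "n2 - 2" "n3 - 1"] by fastforce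
    have "z < a + b + c" "skip l j \<le> b" "i \<le> a" using z sk i abc by auto
    from glue_perm_block_swap_target[OF this] show "(?b \<circ> ?G) z = block_swap 0 (n1 - 1) (n3 - 1) z"
      by (simp add: abc)
  qed
  also have "Scl (Csp \<O> ?N) (ksgn ((p1 + p2) * p3)) (Scl (Csp \<O> ?N) (ksgn (p3 * p2)) z) =
      Scl (Csp \<O> ?N) (ksgn (p1 * p3)) z" for z
    unfolding K_scale_scale[OF pos(1)]
    by (rule arg_cong[of _ _ "\<lambda>e. Scl (Csp \<O> ?N) e z"]) (auto simp: ksgn_if)
  finally show ?thesis .
qed

text \<open>The mirror image of the preceding law: \<open>a\<close> is commuted in front of
  \<open>b\<close>, \<open>assoc\<close> detaches it from the composite with \<open>c\<close>, and
  it is commuted to the end. The signs \<open>p1 * p2\<close> and \<open>(p2 + p3) * p1\<close>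
  combine to \<open>p1 * p3\<close>.\<close>

lemma assoc_source:
  assumes i: "i < n2" and k: "k < n2" and ik: "i \<noteq> k" and j: "j < n1" and l: "l < n3" and n: "4 < n1 + n2 + n3"
    and a: "a \<in> K n1 p1" and b: "b \<in> K n2 p2" and c: "c \<in> K n3 p3"
  shows "ccomp \<O> (n2 + n1 - 2) (p2 + p1) (skip i k) n3 p3 l (ccomp \<O> n2 p2 i n1 p1 j b a) c =
    Scl (Csp \<O> (n1 + n2 + n3 - 4)) (ksgn (p1 * p3))
      (cact \<O> (n1 + n2 + n3 - 4) (p1 + p2 + p3) (block_swap (n2 - 2) (n3 - 1) (n1 - 1))
        (ccomp \<O> (n2 + n3 - 2) (p2 + p3) (skip k i) n1 p1 j (ccomp \<O> n2 p2 k n3 p3 l b c) a))"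
proof -
  let ?N = "n1 + n2 + n3 - 4" and ?n21 = "n2 + n1 - 2" and ?n23 = "n2 + n3 - 2"
  let ?X = "ccomp \<O> n1 p1 j n2 p2 i a b" and ?Y = "ccomp \<O> n2 p2 k n3 p3 l b c"
  let ?g = "block_swap 0 (n1 - 1) (n2 - 1)" and ?b = "block_swap 0 (?n23 - 1) (n1 - 1)"
  let ?u = "n1 - 1 + skip i k"
  let ?G = "glue_perm ?n21 ?u n3 l ?g id"
  have sk: "skip i k < n2 - 1" "skip k i < n2 - 1" using ik i k skip_less[of i n2 k] skip_less[of k n2 i] by auto
  have pos: "0 < ?N" "2 < n1 + n2" "2 < n2 + n3" using n i k j l ik by auto
  have N: "n1 + ?n23 - 2 = ?N" "?n23 + n1 - 2 = ?N" "?n21 + n3 - 2 = ?N" "n1 + n2 - 2 = ?n21"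
    "p2 + p1 = p1 + p2" "p2 + p3 + p1 = p1 + p2 + p3" "p1 + (p2 + p3) = p1 + p2 + p3"
    using pos n j l sk by auto
  have X: "?X \<in> K ?n21 (p1 + p2)" using K_comp[OF j i pos(2) a b] unfolding N .
  have Y: "?Y \<in> K ?n23 (p2 + p3)" by (rule K_comp[OF k l pos(3) b c])
  have fl: "?u < ?n21" "skip k i < ?n23" "skip i k < ?n21" "0 < ?n21" using sk j l by auto
  have gt: "2 < ?n21 + n3" "2 < n1 + ?n23" "2 < ?n23 + n1" using n pos j l by auto
  have Xc: "ccomp \<O> ?n21 (p1 + p2) ?u n3 p3 l ?X c \<in> K ?N (p1 + p2 + p3)"
    using K_comp[OF fl(1) l gt(1) X c] unfolding N .
  have Ya: "ccomp \<O> ?n23 (p2 + p3) (skip k i) n1 p1 j ?Y a \<in> K ?N (p1 + p2 + p3)"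
    using K_comp[OF fl(2) j gt(3) Y a] unfolding N .
  have g: "?g permutes {..<?n21}" and bp: "?b permutes {..<?N}"
    using j sk l n by (auto intro!: block_swap_permutes)
  have G: "?G permutes {..<?N}" using glue_perm_permutes[OF fl(1) l g permutes_id] unfolding N .
  have gs: "skip i k = ?g ?u" using sk by (simp add: block_swap_def)
  have "ccomp \<O> n2 p2 i n1 p1 j b a = Scl (Csp \<O> ?n21) (ksgn (p1 * p2)) (cact \<O> ?n21 (p1 + p2) ?g ?X)"
    using commute[OF j i pos(2) a b] unfolding N .
  then have "ccomp \<O> ?n21 (p2 + p1) (skip i k) n3 p3 l (ccomp \<O> n2 p2 i n1 p1 j b a) c =
      Scl (Csp \<O> ?N) (ksgn (p1 * p2))
        (ccomp \<O> ?n21 (p1 + p2) (skip i k) n3 p3 l (cact \<O> ?n21 (p1 + p2) ?g ?X) c)"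
    using K_comp_scale(1)[OF fl(3) l gt(1) K_act[OF fl(4) g X] c] unfolding N by simp
  also have "ccomp \<O> ?n21 (p1 + p2) (skip i k) n3 p3 l (cact \<O> ?n21 (p1 + p2) ?g ?X) c =
      cact \<O> ?N (p1 + p2 + p3) ?G (ccomp \<O> ?n21 (p1 + p2) ?u n3 p3 l ?X c)"
    using comp_act_left[OF fl(1) l gt(1) X c g gs] unfolding N .
  also have "ccomp \<O> ?n21 (p1 + p2) ?u n3 p3 l ?X c = ccomp \<O> n1 p1 j ?n23 (p2 + p3) (skip k i) a ?Y"
    using assoc[OF j i k ik l n a b c] unfolding N .
  also have "\<dots> = Scl (Csp \<O> ?N) (ksgn ((p2 + p3) * p1)) (cact \<O> ?N (p1 + p2 + p3) ?b
      (ccomp \<O> ?n23 (p2 + p3) (skip k i) n1 p1 j ?Y a))"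
    using commute[OF fl(2) j gt(3) Y a] unfolding N .
  also have "cact \<O> ?N (p1 + p2 + p3) ?G (Scl (Csp \<O> ?N) (ksgn ((p2 + p3) * p1)) (cact \<O> ?N (p1 + p2 + p3) ?b
      (ccomp \<O> ?n23 (p2 + p3) (skip k i) n1 p1 j ?Y a))) =
      Scl (Csp \<O> ?N) (ksgn ((p2 + p3) * p1)) (cact \<O> ?N (p1 + p2 + p3) (?G \<circ> ?b)
        (ccomp \<O> ?n23 (p2 + p3) (skip k i) n1 p1 j ?Y a))"
    using K_act_scale[OF pos(1) G K_act[OF pos(1) bp Ya]] act_act[OF pos(1) G bp Ya] by (simp only:)
  also have "?G \<circ> ?b = block_swap (n2 - 2) (n3 - 1) (n1 - 1)"
  proof (rule permutes_eqI[of _ ?N])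
    show "?G \<circ> ?b permutes {..<?N}" by (rule permutes_compose[OF bp G])
    show "block_swap (n2 - 2) (n3 - 1) (n1 - 1) permutes {..<?N}"
      using j l sk by (intro block_swap_permutes) auto
    fix z assume z: "z < ?N"
    obtain a b c where abc: "n1 = Suc a" "n2 = Suc (Suc b)" "n3 = Suc c"
      using j l sk that[of "n1 - 1" "n2 - 2" "n3 - 1"] by fastforce
    have "z < a + b + c" "skip i k \<le> b" using z sk abc by auto
    from glue_perm_block_swap_source[OF this, of l] show "(?G \<circ> ?b) z = block_swap (n2 - 2) (n3 - 1) (n1 - 1) z"
      by (simp add: abc add.commute[of b a])
  qed
  also have "Scl (Csp \<O> ?N) (ksgn (p1 * p2)) (Scl (Csp \<O> ?N) (ksgn ((p2 + p3) * p1)) z) =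
      Scl (Csp \<O> ?N) (ksgn (p1 * p3)) z" for z
    unfolding K_scale_scale[OF pos(1)]
    by (rule arg_cong[of _ _ "\<lambda>e. Scl (Csp \<O> ?N) e z"]) (auto simp: ksgn_if)
  finally show ?thesis .
qed

end

section \<open>Block permutations in the dioperad axioms\<close>

lemma skip_unskip [simp]: "skip i (unskip i z) = z"
  by (simp add: skip_def unskip_def)

lemma glue_perm_id_right: "glue_perm n i m j \<sigma> id z = (if z < n - 1 then skip (\<sigma> i) (\<sigma> (unskip i z)) else z)"
  by (auto simp: glue_perm_def)
lemma glue_perm_id_left: "glue_perm n i m j id \<tau> z =
   (if n - 1 \<le> z \<and> z < n + m - 2 then n - 1 + skip (\<tau> j) (\<tau> (unskip j (z - (n - 1)))) else z)"
  by (auto simp: glue_perm_def)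

lemmas perm_simps = glue_perm_id_right glue_perm_id_left block_swap_def skip_def unskip_def perm_sum_def

text \<open>\<open>z\<close> runs through six consecutive blocks, the remaining outputs and inputs
  of the three elements in turn, and both sides bring all outputs in front of all inputs. Writing
  \<open>z\<close> as the start of its block plus an offset makes each case linear arithmetic. Here
  \<open>a1\<close>, \<open>a2\<close>, \<open>b2\<close>, \<open>b3\<close> are arities reduced by
  a glued flag.\<close>

lemma block_swap_chain: assumes "z < a1 + s1 + a2 + b2 + r3 + b3" "i \<le> a1" "k \<le> a2" "j \<le> b2" "l \<le> b3"
 shows "block_swap (a1 + a2) (s1 + b2) r3
     (glue_perm (a1 + s1 + Suc a2 + b2) (a1 + s1 + k) (r3 + Suc b3) (r3 + l) (block_swap a1 s1 (Suc a2)) id z) =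
   block_swap a1 s1 (a2 + r3)
     (glue_perm (Suc a1 + s1) i (a2 + Suc b2 + r3 + b3) (a2 + j) id (block_swap a2 (Suc b2) r3) z)"
proof -
  consider "z < a1"
    | "a1 \<le> z" "z < a1 + s1"
    | "a1 + s1 \<le> z" "z < a1 + s1 + a2"
    | "a1 + s1 + a2 \<le> z" "z < a1 + s1 + a2 + b2"
    | "a1 + s1 + a2 + b2 \<le> z" "z < a1 + s1 + a2 + b2 + r3"
    | "a1 + s1 + a2 + b2 + r3 \<le> z" "z < a1 + s1 + a2 + b2 + r3 + b3"
    using assms(1) by linarith
  then show ?thesis
  proof cases
    case 1
    then show ?thesis using assms(2-) by (auto simp: perm_simps)
  next
    case 2
    then obtain w where "z = a1 + w" "w < s1" by (auto simp: le_iff_add)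
    then show ?thesis using assms(2-) by (auto simp: perm_simps)
  next
    case 3
    then obtain w where "z = a1 + s1 + w" "w < a2" by (auto simp: le_iff_add)
    then show ?thesis using assms(2-) by (auto simp: perm_simps)
  next
    case 4
    then obtain w where "z = a1 + s1 + a2 + w" "w < b2" by (auto simp: le_iff_add)
    then show ?thesis using assms(2-) by (auto simp: perm_simps)
  next
    case 5
    then obtain w where "z = a1 + s1 + a2 + b2 + w" "w < r3" by (auto simp: le_iff_add)
    then show ?thesis using assms(2-) by (auto simp: perm_simps)
  next
    case 6
    then obtain w where "z = a1 + s1 + a2 + b2 + r3 + w" "w < b3" by (auto simp: le_iff_add)
    then show ?thesis using assms(2-) by (auto simp: perm_simps)
  qed
qed
text \<open>As in \<open>block_swap_chain\<close>, with the blocks of the first, third and second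
  element in this order. The second has lost two inputs, so its last block is cut again at
  \<open>u\<close> and \<open>v\<close>, the places of one lost input after the removal of the
  other.\<close>

lemma block_swap_target: assumes "z < a1 + s1 + a3 + s3 + r2 + b2" "i \<le> a1" "k \<le> a3" "u \<le> b2" "v \<le> b2"
 shows "block_swap a3 s3 (a1 + r2)
     (glue_perm (Suc a3 + s3) k (a1 + s1 + r2 + Suc b2) (a1 + s1 + r2 + u) id (block_swap a1 s1 r2)
       (block_swap 0 (a1 + s1) (a3 + s3) z)) =
   perm_sum (a1 + r2 + a3) (block_swap 0 a1 a3) (block_swap 0 s1 s3) (block_swap a1 s1 (a3 + r2)
     (glue_perm (Suc a1 + s1) i (a3 + s3 + r2 + Suc b2) (a3 + s3 + r2 + v) id (block_swap a3 s3 r2) z))"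
proof -
  consider "z < a1"
    | "a1 \<le> z" "z < a1 + s1"
    | "a1 + s1 \<le> z" "z < a1 + s1 + a3"
    | "a1 + s1 + a3 \<le> z" "z < a1 + s1 + a3 + s3"
    | "a1 + s1 + a3 + s3 \<le> z" "z < a1 + s1 + a3 + s3 + r2"
    | "a1 + s1 + a3 + s3 + r2 \<le> z" "z < a1 + s1 + a3 + s3 + r2 + b2"
    using assms(1) by linarith
  then show ?thesis
  proof cases
    case 1
    then show ?thesis using assms(2-) by (auto simp: perm_simps)
  next
    case 2
    then obtain w where "z = a1 + w" "w < s1" by (auto simp: le_iff_add)
    then show ?thesis using assms(2-) by (auto simp: perm_simps)
  next
    case 3
    then obtain w where "z = a1 + s1 + w" "w < a3" by (auto simp: le_iff_add)
    then show ?thesis using assms(2-) by (auto simp: perm_simps)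
  next
    case 4
    then obtain w where "z = a1 + s1 + a3 + w" "w < s3" by (auto simp: le_iff_add)
    then show ?thesis using assms(2-) by (auto simp: perm_simps)
  next
    case 5
    then obtain w where "z = a1 + s1 + a3 + s3 + w" "w < r2" by (auto simp: le_iff_add)
    then show ?thesis using assms(2-) by (auto simp: perm_simps)
  next
    case 6
    then obtain w where "z = a1 + s1 + a3 + s3 + r2 + w" "w < b2" by (auto simp: le_iff_add)
    then show ?thesis using assms(2-) by (cases "w < u"; cases "w < v") (simp_all add: perm_simps)
  qed
qed
text \<open>The two glued flags of the second element are outputs here, so its first block is the
  one that is cut at \<open>u\<close> and \<open>v\<close>.\<close>

lemma block_swap_source: assumes "z < a2 + s2 + r1 + b1 + r3 + b3" "u \<le> a2" "v \<le> a2"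
 shows "block_swap (a2 + r1) (s2 + b1) r3
     (glue_perm (Suc a2 + s2 + r1 + b1) u (r3 + Suc b3) (r3 + l) (block_swap (Suc a2) s2 r1) id
       (block_swap (a2 + s2) (r3 + b3) (r1 + b1) z)) =
   perm_sum (r1 + a2 + r3) (block_swap a2 r3 r1) (block_swap s2 b3 b1) (block_swap (a2 + r3) (s2 + b3) r1
     (glue_perm (Suc a2 + s2 + r3 + b3) v (r1 + Suc b1) (r1 + j) (block_swap (Suc a2) s2 r3) id z))"
proof -
  consider "z < a2"
    | "a2 \<le> z" "z < a2 + s2"
    | "a2 + s2 \<le> z" "z < a2 + s2 + r3"
    | "a2 + s2 + r3 \<le> z" "z < a2 + s2 + r3 + b3"
    | "a2 + s2 + r3 + b3 \<le> z" "z < a2 + s2 + r3 + b3 + r1"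
    | "a2 + s2 + r3 + b3 + r1 \<le> z" "z < a2 + s2 + r3 + b3 + r1 + b1"
    using assms(1) by linarith
  then show ?thesis
  proof cases
    case 1
    then show ?thesis using assms(2-) by (cases "z < u"; cases "z < v") (simp_all add: perm_simps)
  next
    case 2
    then obtain w where "z = a2 + w" "w < s2" by (auto simp: le_iff_add)
    then show ?thesis using assms(2-) by (auto simp: perm_simps)
  next
    case 3
    then obtain w where "z = a2 + s2 + w" "w < r3" by (auto simp: le_iff_add)
    then show ?thesis using assms(2-) by (auto simp: perm_simps)
  next
    case 4
    then obtain w where "z = a2 + s2 + r3 + w" "w < b3" by (auto simp: le_iff_add)
    then show ?thesis using assms(2-) by (auto simp: perm_simps)
  next
    case 5
    then obtain w where "z = a2 + s2 + r3 + b3 + w" "w < r1" by (auto simp: le_iff_add)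
    then show ?thesis using assms(2-) by (auto simp: perm_simps)
  next
    case 6
    then obtain w where "z = a2 + s2 + r3 + b3 + r1 + w" "w < b1" by (auto simp: le_iff_add)
    then show ?thesis using assms(2-) by (auto simp: perm_simps)
  qed
qed

lemma chain_bimap_post:
  assumes m: "chain_bimap U V W m" and f: "chain_map W X f"
    and U: "dg_vector_space U" and V: "dg_vector_space V" and W: "dg_vector_space W"
  shows "chain_bimap U V X (\<lambda>p q x y. f (p + q) (m p q x y))"
  unfolding chain_bimap_def
proof (intro allI ballI conjI)
  fix p q x y assume x: "x \<in> Gr U p" and y: "y \<in> Gr V q"
  note mD = chain_bimapD[OF m x y]
  show "f (p + q) (m p q x y) \<in> Gr X (p + q)" by (rule chain_mapD(1)[OF f mD(1)])
  show "f (p + q) (m p q (x + x') y) = f (p + q) (m p q x y) + f (p + q) (m p q x' y)" if "x' \<in> Gr U p" for x'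
    unfolding mD(2)[OF that] by (rule chain_mapD(2)[OF f mD(1) chain_bimapD(1)[OF m that y]])
  show "f (p + q) (m p q x (y + y')) = f (p + q) (m p q x y) + f (p + q) (m p q x y')" if "y' \<in> Gr V q" for y'
    unfolding mD(3)[OF that] by (rule chain_mapD(2)[OF f mD(1) chain_bimapD(1)[OF m x that]])
  show "f (p + q) (m p q (Scl U c x) y) = Scl X c (f (p + q) (m p q x y))" for c
    unfolding mD(4) by (rule chain_mapD(3)[OF f mD(1)])
  show "f (p + q) (m p q x (Scl V c y)) = Scl X c (f (p + q) (m p q x y))" for c
    unfolding mD(5) by (rule chain_mapD(3)[OF f mD(1)])
  \<comment> \<open>The two terms of the Leibniz rule live in the degrees \<open>p + 1 + q\<close>
    and \<open>p + (q + 1)\<close>; \<open>f\<close> is indexed by the degree and additive only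
    within one, so they are normalised.\<close>
  have deg: "p + 1 + q = p + q + 1" "p + (q + 1) = p + q + 1" by simp_all
  have 1: "m (p + 1) q (Dif U p x) y \<in> Gr W (p + q + 1)"
    using chain_bimapD(1)[OF m dg_Dif[OF U x] y] unfolding deg .
  have 2: "m p (q + 1) x (Dif V q y) \<in> Gr W (p + q + 1)"
    using chain_bimapD(1)[OF m x dg_Dif[OF V y]] unfolding deg .
  show "Dif X (p + q) (f (p + q) (m p q x y)) =
      f (p + 1 + q) (m (p + 1) q (Dif U p x) y) + Scl X (ksgn p) (f (p + (q + 1)) (m p (q + 1) x (Dif V q y)))"
    unfolding chain_mapD(4)[OF f mD(1), symmetric] mD(6) deg
    using chain_mapD(2)[OF f 1 dg_scale[OF W 2]] chain_mapD(3)[OF f 2] by simp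
qed

lemma perm_sum_less: "x < r \<Longrightarrow> perm_sum r \<sigma> \<tau> x = \<sigma> x"
  and perm_sum_add: "perm_sum r \<sigma> \<tau> (r + x) = r + \<tau> x"
  by (simp_all add: perm_sum_def)

text \<open>Gluing concatenates all remaining flags of the two elements, and the block swap moves
  the outputs of the second in front of the inputs of the first. The four kinds of remaining flags
  are followed through both composites.\<close>

lemma block_swap_equivariant:
  fixes r r' s s' :: nat
  assumes i: "i < r" and j: "j < s'"
    and \<sigma>: "\<sigma> permutes {..<r}" and \<tau>: "\<tau> permutes {..<s}" and \<sigma>': "\<sigma>' permutes {..<r'}" and \<tau>': "\<tau>' permutes {..<s'}"
    and \<rho>: "\<And>x. x < r \<Longrightarrow> x \<noteq> i \<Longrightarrow> \<rho> (skip i x) = skip (\<sigma> i) (\<sigma> x)"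
      "\<And>y. y < r' \<Longrightarrow> \<rho> (r - 1 + y) = r - 1 + \<sigma>' y"
    and \<pi>: "\<And>x. x < s \<Longrightarrow> \<pi> x = \<tau> x"
      "\<And>y. y < s' \<Longrightarrow> y \<noteq> j \<Longrightarrow> \<pi> (s + skip j y) = s + skip (\<tau>' j) (\<tau>' y)"
    and z: "z < r + s + (r' + s') - 2"
  shows "block_swap (r - 1) s r' (glue_perm (r + s) i (r' + s') (r' + j) (perm_sum r \<sigma> \<tau>) (perm_sum r' \<sigma>' \<tau>') z) =
    perm_sum (r + r' - 1) \<rho> \<pi> (block_swap (r - 1) s r' z)"
proof -
  let ?\<Sigma> = "perm_sum r \<sigma> \<tau>" and ?\<Sigma>' = "perm_sum r' \<sigma>' \<tau>'"
  let ?G = "glue_perm (r + s) i (r' + s') (r' + j) ?\<Sigma> ?\<Sigma>'" and ?b = "block_swap (r - 1) s r'"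
  have lt: "\<sigma> x < r \<longleftrightarrow> x < r" "\<tau> x < s \<longleftrightarrow> x < s" "\<sigma>' x < r' \<longleftrightarrow> x < r'" "\<tau>' x < s' \<longleftrightarrow> x < s'" for x
    using \<sigma> \<tau> \<sigma>' \<tau>' by (simp_all add: permutes_less)
  have neq: "\<sigma> x \<noteq> \<sigma> i" if "x \<noteq> i" for x using that permutes_inj[OF \<sigma>] by (auto dest: injD)
  have neq': "\<tau>' y \<noteq> \<tau>' j" if "y \<noteq> j" for y using that permutes_inj[OF \<tau>'] by (auto dest: injD)
  have ij: "i < r + s" "r' + j < r' + s'" using i j by auto
  have \<sigma>i: "\<sigma> i < r" using lt i by simp
  from ij z show ?thesis
  proof (cases rule: glue_flag_cases)
    case (1 x)
    then have G: "?G z = skip (\<sigma> i) (?\<Sigma> x)" using glue_perm_left[OF ij(1) 1(1,2)] i by (simp add: perm_sum_less)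
    show ?thesis
    proof (cases "x < r")
      case True
      have "skip i x < r - 1" "skip (\<sigma> i) (\<sigma> x) < r - 1"
        using skip_less[of x r i] skip_less[of "\<sigma> x" r "\<sigma> i"] True 1 i lt neq by auto
      then show ?thesis unfolding G using 1 True \<rho>(1)[of x] by (simp add: block_swap_def perm_sum_less)
    next
      case False
      then obtain w where w: "x = r + w" "w < s" using 1 by (auto simp: le_iff_add not_less)
      have zz: "z = r - 1 + w" using 1 w i by (simp add: skip_def)
      have b: "?b (r - 1 + t) = r + r' - 1 + t" if "t < s" for t using that i by (auto simp: block_swap_def)
      have Gz: "?G z = r - 1 + \<tau> w" unfolding G w perm_sum_add using \<sigma>i by (simp add: skip_def)
      have "\<tau> w < s" using w lt by simp
      then have "?b (?G z) = r + r' - 1 + \<tau> w" unfolding Gz by (rule b)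
      then show ?thesis unfolding zz b[OF w(2)] perm_sum_add \<pi>(1)[OF w(2)] .
    qed
  next
    case (2 y)
    have G: "?G z = r + s - 1 + skip (r' + \<tau>' j) (?\<Sigma>' y)"
      using glue_perm_right[OF ij 2(1,2), of ?\<Sigma> ?\<Sigma>'] 2(3) by (simp add: perm_sum_add)
    show ?thesis
    proof (cases "y < r'")
      case True
      have zz: "z = r - 1 + s + y" using 2 True i by (simp add: skip_def)
      have b: "?b (r - 1 + s + t) = r - 1 + t" if "t < r'" for t using that by (simp add: block_swap_def)
      have \<sigma>'y: "\<sigma>' y < r'" using True lt by simp
      then have Gz: "?G z = r - 1 + s + \<sigma>' y" unfolding G using True i by (simp add: perm_sum_less skip_def)
      have "perm_sum (r + r' - 1) \<rho> \<pi> (r - 1 + y) = r - 1 + \<sigma>' y"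
        using perm_sum_less[of "r - 1 + y" "r + r' - 1" \<rho> \<pi>] \<rho>(2)[OF True] True i by simp
      moreover have "?b (?G z) = r - 1 + \<sigma>' y" unfolding Gz by (rule b[OF \<sigma>'y])
      ultimately show ?thesis unfolding zz b[OF True] by (simp only:)
    next
      case False
      then obtain w where w: "y = r' + w" "w < s'" "w \<noteq> j" using 2 by (auto simp: le_iff_add not_less)
      have sk: "skip (r' + a) (r' + b) = r' + skip a b" if "b \<noteq> a" for a b using that by (auto simp: skip_def)
      have zz: "z = r + r' - 1 + (s + skip j w)" using 2 w i sk[of w j] by simp
      have Gz: "?G z = r + r' - 1 + (s + skip (\<tau>' j) (\<tau>' w))"
        unfolding G w perm_sum_add using sk[OF neq'[OF w(3)]] i by simp
      have b: "?b (r + r' - 1 + (s + t)) = r + r' - 1 + (s + t)" for t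
        using i by (auto simp: block_swap_def)
      have "?b (?G z) = r + r' - 1 + (s + skip (\<tau>' j) (\<tau>' w))" unfolding Gz by (rule b)
      then show ?thesis unfolding zz b perm_sum_add \<pi>(2)[OF w(2,3)] .
    qed
  qed
qed

lemma phi_pull_sel:
  "Dsp (phi_pull \<O>) r s = Csp \<O> (r + s)"
  "dact (phi_pull \<O>) r s p \<sigma> \<tau> = cact \<O> (r + s) p (perm_sum r \<sigma> \<tau>)"
  "dcomp (phi_pull \<O>) r s p i r' s' p' j a b =
    cact \<O> (r + s + (r' + s') - 2) (p + p') (block_swap (r - 1) s r')
      (ccomp \<O> (r + s) p i (r' + s') p' (r' + j) a b)"
  by (simp_all add: phi_pull_def)

context cyclic_operad
begin

text \<open>Each composition is one of \<O> followed by a permutation. Equivariance moves all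
  permutations to the outside, which leaves a law of \<O> and an identity of permutations. The three
  shapes of directed trees need \<open>assoc\<close> and its two variants for other positions of the
  middle vertex.\<close>

theorem dioperad_phi_pull: "dioperad (phi_pull \<O>)"
proof
  fix r s r' s' :: nat
  assume "0 < r + s"
  then show "dg_vector_space (Dsp (phi_pull \<O>) r s)" by (simp add: phi_pull_def space)
next
  fix r s :: nat and \<sigma> \<tau> :: "nat \<Rightarrow> nat"
  assume "0 < r + s" "\<sigma> permutes {..<r}" "\<tau> permutes {..<s}"
  then show "chain_map (Dsp (phi_pull \<O>) r s) (Dsp (phi_pull \<O>) r s) (\<lambda>p. dact (phi_pull \<O>) r s p \<sigma> \<tau>)"
    by (simp add: phi_pull_def act_chain perm_sum_permutes)
next
  fix r s a p assume "0 < r + s" "a \<in> Gr (Dsp (phi_pull \<O>) r s) p"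
  then show "dact (phi_pull \<O>) r s p id id a = a" by (simp add: phi_pull_def perm_sum_id act_id)
next
  fix r s a p and \<sigma> \<tau> \<sigma>' \<tau>' :: "nat \<Rightarrow> nat"
  assume "0 < r + s" "\<sigma> permutes {..<r}" "\<tau> permutes {..<s}" "\<sigma>' permutes {..<r}" "\<tau>' permutes {..<s}"
    "a \<in> Gr (Dsp (phi_pull \<O>) r s) p"
  then show "dact (phi_pull \<O>) r s p (\<sigma> \<circ> \<sigma>') (\<tau> \<circ> \<tau>') a =
      dact (phi_pull \<O>) r s p \<sigma> \<tau> (dact (phi_pull \<O>) r s p \<sigma>' \<tau>' a)"
    by (simp add: phi_pull_def perm_sum_comp act_comp perm_sum_permutes)
next
  fix i r j s' s r' :: nat
  assume h: "i < r" "j < s'" "2 < r + s + r' + s'"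
  have "block_swap (r - 1) s r' permutes {..<r + s + (r' + s') - 2}"
    using h by (intro block_swap_permutes) auto
  then have "chain_bimap (Csp \<O> (r + s)) (Csp \<O> (r' + s')) (Csp \<O> (r + s + (r' + s') - 2))
      (\<lambda>p p' a b. cact \<O> (r + s + (r' + s') - 2) (p + p') (block_swap (r - 1) s r')
        (ccomp \<O> (r + s) p i (r' + s') p' (r' + j) a b))"
    using h by (intro chain_bimap_post[OF comp_chain act_chain] space) auto
  moreover have "r + r' - 1 + (s + s' - 1) = r + s + (r' + s') - 2" using h by simp
  ultimately show "chain_bimap (Dsp (phi_pull \<O>) r s) (Dsp (phi_pull \<O>) r' s')
      (Dsp (phi_pull \<O>) (r + r' - 1) (s + s' - 1)) (\<lambda>p p'. dcomp (phi_pull \<O>) r s p i r' s' p' j)"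
    by (simp add: phi_pull_def)
next
  fix i r j s' s r' :: nat and a b p p' and \<sigma> \<tau> \<sigma>' \<tau>' \<rho> \<pi> :: "nat \<Rightarrow> nat"
  assume h: "i < r" "j < s'" "2 < r + s + r' + s'"
    and a: "a \<in> Gr (Dsp (phi_pull \<O>) r s) p" and b: "b \<in> Gr (Dsp (phi_pull \<O>) r' s') p'"
    and perms: "\<sigma> permutes {..<r}" "\<tau> permutes {..<s}" "\<sigma>' permutes {..<r'}" "\<tau>' permutes {..<s'}"
      "\<rho> permutes {..<r + r' - 1}" "\<pi> permutes {..<s + s' - 1}"
    and \<rho>: "\<And>x. x < r \<Longrightarrow> x \<noteq> i \<Longrightarrow> \<rho> (skip i x) = skip (\<sigma> i) (\<sigma> x)"
      "\<And>y. y < r' \<Longrightarrow> \<rho> (r - 1 + y) = r - 1 + \<sigma>' y"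
    and \<pi>: "\<And>x. x < s \<Longrightarrow> \<pi> x = \<tau> x"
      "\<And>y. y < s' \<Longrightarrow> y \<noteq> j \<Longrightarrow> \<pi> (s + skip j y) = s + skip (\<tau>' j) (\<tau>' y)"
  let ?n = "r + s" and ?m = "r' + s'" and ?b = "block_swap (r - 1) s r'"
  let ?N = "?n + ?m - 2" and ?\<Sigma> = "perm_sum r \<sigma> \<tau>" and ?\<Sigma>' = "perm_sum r' \<sigma>' \<tau>'"
  let ?G = "glue_perm ?n i ?m (r' + j) ?\<Sigma> ?\<Sigma>'" and ?X = "ccomp \<O> ?n p i ?m p' (r' + j) a b"
  have ij: "i < ?n" "r' + j < ?m" "2 < ?n + ?m" "0 < ?N" using h by auto
  have N: "r + r' - 1 + (s + s' - 1) = ?N" using h by simp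
  have a: "a \<in> K ?n p" and b: "b \<in> K ?m p'" using a b by (simp_all add: phi_pull_def)
  have S: "?\<Sigma> permutes {..<?n}" "?\<Sigma>' permutes {..<?m}" using perms by (simp_all add: perm_sum_permutes)
  have bp: "?b permutes {..<?N}" using h by (intro block_swap_permutes) auto
  have Pp: "perm_sum (r + r' - 1) \<rho> \<pi> permutes {..<?N}" using perm_sum_permutes[OF perms(5,6)] unfolding N .
  have G: "?G permutes {..<?N}" by (rule glue_perm_permutes[OF ij(1,2) S])
  have X: "?X \<in> K ?N (p + p')" by (rule K_comp[OF ij(1-3) a b])
  have "?b \<circ> ?G = perm_sum (r + r' - 1) \<rho> \<pi> \<circ> ?b"
    by (rule permutes_eqI[OF permutes_compose[OF G bp] permutes_compose[OF bp Pp]])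
      (unfold o_apply, rule block_swap_equivariant[OF h(1,2) perms(1-4) \<rho> \<pi>])
  moreover have "ccomp \<O> ?n p (?\<Sigma> i) ?m p' (?\<Sigma>' (r' + j)) (cact \<O> ?n p ?\<Sigma> a) (cact \<O> ?m p' ?\<Sigma>' b) =
      cact \<O> ?N (p + p') ?G ?X"
    by (rule equivariant[OF ij(1-3) a b S G glue_perm_left[OF ij(1)] glue_perm_right[OF ij(1,2)]])
  moreover have "?\<Sigma> i = \<sigma> i" "?\<Sigma>' (r' + j) = r' + \<tau>' j" using h by (simp_all add: perm_sum_less perm_sum_add)
  ultimately show "dcomp (phi_pull \<O>) r s p (\<sigma> i) r' s' p' (\<tau>' j) (dact (phi_pull \<O>) r s p \<sigma> \<tau> a)
      (dact (phi_pull \<O>) r' s' p' \<sigma>' \<tau>' b) =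
    dact (phi_pull \<O>) (r + r' - 1) (s + s' - 1) (p + p') \<rho> \<pi> (dcomp (phi_pull \<O>) r s p i r' s' p' j a b)"
    using act_act[OF ij(4) bp G X] act_act[OF ij(4) Pp bp X] unfolding phi_pull_sel N by simp
next
  fix i r1 j s2 k r2 l s3 s1 r3 :: nat and a b c p1 p2 p3
  assume h: "i < r1" "j < s2" "k < r2" "l < s3" "4 < r1 + s1 + r2 + s2 + r3 + s3"
    and a: "a \<in> Gr (Dsp (phi_pull \<O>) r1 s1) p1" and b: "b \<in> Gr (Dsp (phi_pull \<O>) r2 s2) p2"
    and c: "c \<in> Gr (Dsp (phi_pull \<O>) r3 s3) p3"
  let ?n1 = "r1 + s1" and ?n2 = "r2 + s2" and ?n3 = "r3 + s3"
  let ?N12 = "?n1 + ?n2 - 2" and ?N23 = "?n2 + ?n3 - 2" and ?N = "?n1 + ?n2 + ?n3 - 4"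
  let ?b1 = "block_swap (r1 - 1) s1 r2" and ?b2 = "block_swap (r2 - 1) s2 r3"
  let ?bL = "block_swap (r1 + r2 - 1 - 1) (s1 + s2 - 1) r3" and ?bR = "block_swap (r1 - 1) s1 (r2 + r3 - 1)"
  let ?X = "ccomp \<O> ?n1 p1 i ?n2 p2 (r2 + j) a b" and ?Y = "ccomp \<O> ?n2 p2 k ?n3 p3 (r3 + l) b c"
  let ?Z = "ccomp \<O> ?N12 (p1 + p2) (?n1 - 1 + k) ?n3 p3 (r3 + l) ?X c"
  let ?G1 = "glue_perm ?N12 (?n1 - 1 + k) ?n3 (r3 + l) ?b1 id" and ?G2 = "glue_perm ?n1 i ?N23 (r2 + j - 1) id ?b2"
  have a: "a \<in> K ?n1 p1" and b: "b \<in> K ?n2 p2" and c: "c \<in> K ?n3 p3" using a b c by (simp_all add: phi_pull_def)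
  have fl: "i < ?n1" "r2 + j < ?n2" "k < ?n2" "r3 + l < ?n3" "2 < ?n1 + ?n2" "2 < ?n2 + ?n3"
      "?n1 - 1 + k < ?N12" "2 < ?N12 + ?n3" "r2 + j - 1 < ?N23" "2 < ?n1 + ?N23" "0 < ?N"
    using h by auto
  have N: "r1 + r2 - 1 + (s1 + s2 - 1) = ?N12" "r2 + r3 - 1 + (s2 + s3 - 1) = ?N23"
    "?N12 + ?n3 - 2 = ?N" "?n1 + ?N23 - 2 = ?N" "p1 + (p2 + p3) = p1 + p2 + p3"
    using h by auto
  have X: "?X \<in> K ?N12 (p1 + p2)" by (rule K_comp[OF fl(1,2,5) a b])
  have Y: "?Y \<in> K ?N23 (p2 + p3)" by (rule K_comp[OF fl(3,4,6) b c])
  have Z: "?Z \<in> K ?N (p1 + p2 + p3)" using K_comp[OF fl(7,4,8) X c] unfolding N .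
  have b1: "?b1 permutes {..<?N12}" and b2: "?b2 permutes {..<?N23}"
    and bL: "?bL permutes {..<?N}" and bR: "?bR permutes {..<?N}"
    using h by (auto intro!: block_swap_permutes)
  have G1: "?G1 permutes {..<?N}" using glue_perm_permutes[OF fl(7,4) b1 permutes_id] unfolding N .
  have G2: "?G2 permutes {..<?N}" using glue_perm_permutes[OF fl(1,9) permutes_id b2] unfolding N .
  have k1: "r1 - 1 + k = ?b1 (?n1 - 1 + k)" and j2: "r2 + r3 - 1 + j = ?b2 (r2 + j - 1)"
    using h by (auto simp: block_swap_def)
  have "ccomp \<O> ?N12 (p1 + p2) (r1 - 1 + k) ?n3 p3 (r3 + l) (cact \<O> ?N12 (p1 + p2) ?b1 ?X) c =
      cact \<O> ?N (p1 + p2 + p3) ?G1 ?Z"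
    using comp_act_left[OF fl(7,4,8) X c b1 k1] unfolding N .
  moreover have "ccomp \<O> ?n1 p1 i ?N23 (p2 + p3) (r2 + r3 - 1 + j) a (cact \<O> ?N23 (p2 + p3) ?b2 ?Y) =
      cact \<O> ?N (p1 + p2 + p3) ?G2 (ccomp \<O> ?n1 p1 i ?N23 (p2 + p3) (r2 + j - 1) a ?Y)"
    using comp_act_right[OF fl(1,9,10) a Y b2 j2] unfolding N .
  moreover have "?Z = ccomp \<O> ?n1 p1 i ?N23 (p2 + p3) (r2 + j - 1) a ?Y"
  proof -
    \<comment> \<open>The output \<open>k\<close> of \<open>b\<close> precedes all its inputs, so
      removing it shifts the flag \<open>r2 + j\<close> by one, while removing the latter leaves
      \<open>k\<close> alone.\<close>
    have sk: "skip (r2 + j) k = k" "skip k (r2 + j) = r2 + j - 1" "r2 + j \<noteq> k" "4 < ?n1 + ?n2 + ?n3"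
      using h by (auto simp: skip_def)
    show ?thesis using assoc[OF fl(1-3) sk(3) fl(4) sk(4) a b c] unfolding sk(1,2) .
  qed
  moreover have "?bL \<circ> ?G1 = ?bR \<circ> ?G2"
  proof (rule permutes_eqI[OF permutes_compose[OF G1 bL] permutes_compose[OF G2 bR]])
    fix z assume z: "z < ?N"
    obtain a1 a2 c2 c3 where e: "r1 = Suc a1" "r2 = Suc a2" "s2 = Suc c2" "s3 = Suc c3"
      using h that[of "r1 - 1" "r2 - 1" "s2 - 1" "s3 - 1"] by fastforce
    have "z < a1 + s1 + a2 + c2 + r3 + c3" "i \<le> a1" "k \<le> a2" "j \<le> c2" "l \<le> c3" using z h e by auto
    from block_swap_chain[OF this] show "(?bL \<circ> ?G1) z = (?bR \<circ> ?G2) z" by (simp add: e ac_simps)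
  qed
  ultimately show "dcomp (phi_pull \<O>) (r1 + r2 - 1) (s1 + s2 - 1) (p1 + p2) (r1 - 1 + k) r3 s3 p3 l
      (dcomp (phi_pull \<O>) r1 s1 p1 i r2 s2 p2 j a b) c =
    dcomp (phi_pull \<O>) r1 s1 p1 i (r2 + r3 - 1) (s2 + s3 - 1) (p2 + p3) j
      a (dcomp (phi_pull \<O>) r2 s2 p2 k r3 s3 p3 l b c)"
    using act_act[OF fl(11) bL G1 Z] act_act[OF fl(11) bR G2 Z] unfolding phi_pull_sel N by simp
next
  fix i r1 k r3 j s2 l s1 r2 s3 :: nat and a b c p1 p2 p3
  assume h: "i < r1" "k < r3" "j < s2" "l < s2" "j \<noteq> l" "4 < r1 + s1 + r2 + s2 + r3 + s3"
    and a: "a \<in> Gr (Dsp (phi_pull \<O>) r1 s1) p1" and b: "b \<in> Gr (Dsp (phi_pull \<O>) r2 s2) p2"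
    and c: "c \<in> Gr (Dsp (phi_pull \<O>) r3 s3) p3"
  let ?n1 = "r1 + s1" and ?n2 = "r2 + s2" and ?n3 = "r3 + s3"
  let ?N12 = "?n1 + ?n2 - 2" and ?N32 = "?n3 + ?n2 - 2" and ?N = "?n1 + ?n2 + ?n3 - 4"
  let ?b1 = "block_swap (r1 - 1) s1 r2" and ?b2 = "block_swap (r3 - 1) s3 r2"
  let ?bL = "block_swap (r3 - 1) s3 (r1 + r2 - 1)" and ?bR = "block_swap (r1 - 1) s1 (r3 + r2 - 1)"
  let ?bM = "block_swap 0 (?n1 - 1) (?n3 - 1)"
  let ?P = "perm_sum (r1 + r2 + r3 - 2) (block_swap 0 (r1 - 1) (r3 - 1)) (block_swap 0 s1 s3)"
  let ?X = "ccomp \<O> ?n1 p1 i ?n2 p2 (r2 + j) a b" and ?W = "ccomp \<O> ?n3 p3 k ?n2 p2 (r2 + l) c b"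
  let ?u = "?n1 - 1 + skip (r2 + j) (r2 + l)" and ?v = "?n3 - 1 + skip (r2 + l) (r2 + j)"
  let ?Z = "ccomp \<O> ?n1 p1 i ?N32 (p3 + p2) ?v a ?W"
  let ?G1 = "glue_perm ?n3 k ?N12 ?u id ?b1" and ?G2 = "glue_perm ?n1 i ?N32 ?v id ?b2"
  have a: "a \<in> K ?n1 p1" and b: "b \<in> K ?n2 p2" and c: "c \<in> K ?n3 p3" using a b c by (simp_all add: phi_pull_def)
  \<comment> \<open>Both glued flags of \<open>b\<close> are inputs, so the shift by its
    \<open>r2\<close> outputs passes through \<open>skip\<close>.\<close>
  have sk: "skip (r2 + j) (r2 + l) = r2 + skip j l" "skip (r2 + l) (r2 + j) = r2 + skip l j"
      "skip j l < s2 - 1" "skip l j < s2 - 1"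
    using h skip_less[of l s2 j] skip_less[of j s2 l] by (auto simp: skip_def)
  have fl: "i < ?n1" "r2 + j < ?n2" "r2 + l < ?n2" "k < ?n3" "2 < ?n1 + ?n2" "2 < ?n3 + ?n2"
      "?u < ?N12" "2 < ?n3 + ?N12" "?v < ?N32" "2 < ?n1 + ?N32" "0 < ?N"
    using h sk by auto
  have N: "r1 + r2 - 1 + (s1 + s2 - 1) = ?N12" "r3 + r2 - 1 + (s3 + s2 - 1) = ?N32"
    "?n3 + ?N12 - 2 = ?N" "?n1 + ?N32 - 2 = ?N" "r1 + r2 + r3 - 2 + (s1 + s2 + s3 - 2) = ?N"
    "p1 + (p3 + p2) = p1 + p2 + p3" "p3 + (p1 + p2) = p1 + p2 + p3"
    using h by auto
  have X: "?X \<in> K ?N12 (p1 + p2)" by (rule K_comp[OF fl(1,2,5) a b])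
  have W: "?W \<in> K ?N32 (p3 + p2)" by (rule K_comp[OF fl(4,3,6) c b])
  have Z: "?Z \<in> K ?N (p1 + p2 + p3)" using K_comp[OF fl(1,9,10) a W] unfolding N .
  have b1: "?b1 permutes {..<?N12}" and b2: "?b2 permutes {..<?N32}"
    and bL: "?bL permutes {..<?N}" and bR: "?bR permutes {..<?N}" and bM: "?bM permutes {..<?N}"
    using h sk by (auto intro!: block_swap_permutes)
  have "block_swap 0 (r1 - 1) (r3 - 1) permutes {..<r1 + r2 + r3 - 2}" "block_swap 0 s1 s3 permutes {..<s1 + s2 + s3 - 2}"
    using h by (auto intro!: block_swap_permutes)
  then have P: "?P permutes {..<?N}" using perm_sum_permutes unfolding N(5)[symmetric] by blast
  have G1: "?G1 permutes {..<?N}" using glue_perm_permutes[OF fl(4,7) permutes_id b1] unfolding N .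
  have G2: "?G2 permutes {..<?N}" using glue_perm_permutes[OF fl(1,9) permutes_id b2] unfolding N .
  have u1: "r1 + r2 - 1 + (s1 + skip j l) = ?b1 ?u" and v2: "r3 + r2 - 1 + (s3 + skip l j) = ?b2 ?v"
    unfolding sk using h by (auto simp: block_swap_def)
  have "ccomp \<O> ?n3 p3 k ?N12 (p1 + p2) (r1 + r2 - 1 + (s1 + skip j l)) c (cact \<O> ?N12 (p1 + p2) ?b1 ?X) =
      cact \<O> ?N (p1 + p2 + p3) ?G1 (ccomp \<O> ?n3 p3 k ?N12 (p1 + p2) ?u c ?X)"
    using comp_act_right[OF fl(4,7,8) c X b1 u1] unfolding N .
  moreover have "ccomp \<O> ?n3 p3 k ?N12 (p1 + p2) ?u c ?X =
      Scl (Csp \<O> ?N) (ksgn (p1 * p3)) (cact \<O> ?N (p1 + p2 + p3) ?bM ?Z)"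
    using h by (intro assoc_target[OF fl(1,4,2,3) _ _ a b c]) auto
  moreover have "ccomp \<O> ?n1 p1 i ?N32 (p3 + p2) (r3 + r2 - 1 + (s3 + skip l j)) a (cact \<O> ?N32 (p3 + p2) ?b2 ?W) =
      cact \<O> ?N (p1 + p2 + p3) ?G2 ?Z"
    using comp_act_right[OF fl(1,9,10) a W b2 v2] unfolding N .
  moreover have "?bL \<circ> (?G1 \<circ> ?bM) = ?P \<circ> (?bR \<circ> ?G2)"
  proof (rule permutes_eqI[OF permutes_compose[OF permutes_compose[OF bM G1] bL] permutes_compose[OF permutes_compose[OF G2 bR] P]])
    fix z assume z: "z < ?N"
    obtain a1 a3 c2 where e: "r1 = Suc a1" "r3 = Suc a3" "s2 = Suc (Suc c2)"
      using h sk that[of "r1 - 1" "r3 - 1" "s2 - 2"] by fastforce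
    have "z < a1 + s1 + a3 + s3 + r2 + c2" "i \<le> a1" "k \<le> a3" "skip j l \<le> c2" "skip l j \<le> c2" using z h e sk by auto
    from block_swap_target[OF this] show "(?bL \<circ> (?G1 \<circ> ?bM)) z = (?P \<circ> (?bR \<circ> ?G2)) z"
      unfolding sk by (simp add: e ac_simps)
  qed
  ultimately show "dcomp (phi_pull \<O>) r3 s3 p3 k (r1 + r2 - 1) (s1 + s2 - 1) (p1 + p2) (s1 + skip j l)
      c (dcomp (phi_pull \<O>) r1 s1 p1 i r2 s2 p2 j a b) =
    Scl (Dsp (phi_pull \<O>) (r1 + r2 + r3 - 2) (s1 + s2 + s3 - 2)) (ksgn (p1 * p3))
      (dact (phi_pull \<O>) (r1 + r2 + r3 - 2) (s1 + s2 + s3 - 2) (p1 + p2 + p3)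
        (block_swap 0 (r1 - 1) (r3 - 1)) (block_swap 0 s1 s3)
        (dcomp (phi_pull \<O>) r1 s1 p1 i (r3 + r2 - 1) (s3 + s2 - 1) (p3 + p2) (s3 + skip l j)
          a (dcomp (phi_pull \<O>) r3 s3 p3 k r2 s2 p2 l c b)))"
    using act_act[OF fl(11) bL permutes_compose[OF bM G1] Z] act_act[OF fl(11) G1 bM Z]
      act_act[OF fl(11) P permutes_compose[OF G2 bR] Z] act_act[OF fl(11) bR G2 Z]
      K_act_scale[OF fl(11) G1 K_act[OF fl(11) bM Z]] K_act_scale[OF fl(11) bL K_act[OF fl(11) permutes_compose[OF bM G1] Z]]
    unfolding phi_pull_sel N by simp
next
  fix i r2 k j s1 l s3 r1 s2 r3 :: nat and a b c p1 p2 p3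
  assume h: "i < r2" "k < r2" "i \<noteq> k" "j < s1" "l < s3" "4 < r1 + s1 + r2 + s2 + r3 + s3"
    and a: "a \<in> Gr (Dsp (phi_pull \<O>) r1 s1) p1" and b: "b \<in> Gr (Dsp (phi_pull \<O>) r2 s2) p2"
    and c: "c \<in> Gr (Dsp (phi_pull \<O>) r3 s3) p3"
  let ?n1 = "r1 + s1" and ?n2 = "r2 + s2" and ?n3 = "r3 + s3"
  let ?N21 = "?n2 + ?n1 - 2" and ?N23 = "?n2 + ?n3 - 2" and ?N = "?n1 + ?n2 + ?n3 - 4"
  let ?b1 = "block_swap (r2 - 1) s2 r1" and ?b2 = "block_swap (r2 - 1) s2 r3"
  let ?bL = "block_swap (r2 + r1 - 1 - 1) (s2 + s1 - 1) r3" and ?bR = "block_swap (r2 + r3 - 1 - 1) (s2 + s3 - 1) r1"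
  let ?bM = "block_swap (?n2 - 2) (?n3 - 1) (?n1 - 1)"
  let ?P = "perm_sum (r1 + r2 + r3 - 2) (block_swap (r2 - 2) r3 r1) (block_swap s2 (s3 - 1) (s1 - 1))"
  let ?X = "ccomp \<O> ?n2 p2 i ?n1 p1 (r1 + j) b a" and ?Y = "ccomp \<O> ?n2 p2 k ?n3 p3 (r3 + l) b c"
  let ?Z = "ccomp \<O> ?N23 (p2 + p3) (skip k i) ?n1 p1 (r1 + j) ?Y a"
  let ?G1 = "glue_perm ?N21 (skip i k) ?n3 (r3 + l) ?b1 id" and ?G2 = "glue_perm ?N23 (skip k i) ?n1 (r1 + j) ?b2 id"
  have a: "a \<in> K ?n1 p1" and b: "b \<in> K ?n2 p2" and c: "c \<in> K ?n3 p3" using a b c by (simp_all add: phi_pull_def)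
  have sk: "skip i k < r2 - 1" "skip k i < r2 - 1"
    using h skip_less[of k r2 i] skip_less[of i r2 k] by auto
  have fl: "i < ?n2" "k < ?n2" "r1 + j < ?n1" "r3 + l < ?n3" "2 < ?n2 + ?n1" "2 < ?n2 + ?n3"
      "skip i k < ?N21" "2 < ?N21 + ?n3" "skip k i < ?N23" "2 < ?N23 + ?n1" "0 < ?N"
    using h sk by auto
  have N: "r2 + r1 - 1 + (s2 + s1 - 1) = ?N21" "r2 + r3 - 1 + (s2 + s3 - 1) = ?N23"
    "?N21 + ?n3 - 2 = ?N" "?N23 + ?n1 - 2 = ?N" "r1 + r2 + r3 - 2 + (s1 + s2 + s3 - 2) = ?N"
    "p2 + p3 + p1 = p1 + p2 + p3" "p2 + p1 + p3 = p1 + p2 + p3"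
    using h by auto
  have X: "?X \<in> K ?N21 (p2 + p1)" by (rule K_comp[OF fl(1,3,5) b a])
  have Y: "?Y \<in> K ?N23 (p2 + p3)" by (rule K_comp[OF fl(2,4,6) b c])
  have Z: "?Z \<in> K ?N (p1 + p2 + p3)" using K_comp[OF fl(9,3,10) Y a] unfolding N .
  have b1: "?b1 permutes {..<?N21}" and b2: "?b2 permutes {..<?N23}"
    and bL: "?bL permutes {..<?N}" and bR: "?bR permutes {..<?N}" and bM: "?bM permutes {..<?N}"
    using h sk by (auto intro!: block_swap_permutes)
  have "block_swap (r2 - 2) r3 r1 permutes {..<r1 + r2 + r3 - 2}" "block_swap s2 (s3 - 1) (s1 - 1) permutes {..<s1 + s2 + s3 - 2}"
    using h sk by (auto intro!: block_swap_permutes)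
  then have P: "?P permutes {..<?N}" using perm_sum_permutes unfolding N(5)[symmetric] by blast
  have G1: "?G1 permutes {..<?N}" using glue_perm_permutes[OF fl(7,4) b1 permutes_id] unfolding N .
  have G2: "?G2 permutes {..<?N}" using glue_perm_permutes[OF fl(9,3) b2 permutes_id] unfolding N .
  \<comment> \<open>Both glued flags of \<open>b\<close> are outputs; the one still to be glued lies
    in the part that the block swap fixes.\<close>
  have u1: "skip i k = ?b1 (skip i k)" and v2: "skip k i = ?b2 (skip k i)"
    using sk by (auto simp: block_swap_def)
  have "ccomp \<O> ?N21 (p2 + p1) (skip i k) ?n3 p3 (r3 + l) (cact \<O> ?N21 (p2 + p1) ?b1 ?X) c =
      cact \<O> ?N (p1 + p2 + p3) ?G1 (ccomp \<O> ?N21 (p2 + p1) (skip i k) ?n3 p3 (r3 + l) ?X c)"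
    using comp_act_left[OF fl(7,4,8) X c b1 u1] unfolding N .
  moreover have "ccomp \<O> ?N21 (p2 + p1) (skip i k) ?n3 p3 (r3 + l) ?X c =
      Scl (Csp \<O> ?N) (ksgn (p1 * p3)) (cact \<O> ?N (p1 + p2 + p3) ?bM ?Z)"
    using h by (intro assoc_source[OF fl(1,2) _ fl(3,4) _ a b c]) auto
  moreover have "ccomp \<O> ?N23 (p2 + p3) (skip k i) ?n1 p1 (r1 + j) (cact \<O> ?N23 (p2 + p3) ?b2 ?Y) a =
      cact \<O> ?N (p1 + p2 + p3) ?G2 ?Z"
    using comp_act_left[OF fl(9,3,10) Y a b2 v2] unfolding N .
  moreover have "?bL \<circ> (?G1 \<circ> ?bM) = ?P \<circ> (?bR \<circ> ?G2)"
  proof (rule permutes_eqI[OF permutes_compose[OF permutes_compose[OF bM G1] bL] permutes_compose[OF permutes_compose[OF G2 bR] P]])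
    fix z assume z: "z < ?N"
    obtain a2 c1 c3 where e: "r2 = Suc (Suc a2)" "s1 = Suc c1" "s3 = Suc c3"
      using h sk that[of "r2 - 2" "s1 - 1" "s3 - 1"] by fastforce
    have "z < a2 + s2 + r1 + c1 + r3 + c3" "skip i k \<le> a2" "skip k i \<le> a2" using z h e sk by auto
    from block_swap_source[OF this, of l j] show "(?bL \<circ> (?G1 \<circ> ?bM)) z = (?P \<circ> (?bR \<circ> ?G2)) z"
      by (simp add: e ac_simps)
  qed
  ultimately show "dcomp (phi_pull \<O>) (r2 + r1 - 1) (s2 + s1 - 1) (p2 + p1) (skip i k) r3 s3 p3 l
      (dcomp (phi_pull \<O>) r2 s2 p2 i r1 s1 p1 j b a) c =
    Scl (Dsp (phi_pull \<O>) (r1 + r2 + r3 - 2) (s1 + s2 + s3 - 2)) (ksgn (p1 * p3))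
      (dact (phi_pull \<O>) (r1 + r2 + r3 - 2) (s1 + s2 + s3 - 2) (p1 + p2 + p3)
        (block_swap (r2 - 2) r3 r1) (block_swap s2 (s3 - 1) (s1 - 1))
        (dcomp (phi_pull \<O>) (r2 + r3 - 1) (s2 + s3 - 1) (p2 + p3) (skip k i) r1 s1 p1 j
          (dcomp (phi_pull \<O>) r2 s2 p2 k r3 s3 p3 l b c) a))"
    using act_act[OF fl(11) bL permutes_compose[OF bM G1] Z] act_act[OF fl(11) G1 bM Z]
      act_act[OF fl(11) P permutes_compose[OF G2 bR] Z] act_act[OF fl(11) bR G2 Z]
      K_act_scale[OF fl(11) G1 K_act[OF fl(11) bM Z]] K_act_scale[OF fl(11) bL K_act[OF fl(11) permutes_compose[OF bM G1] Z]]
    unfolding phi_pull_sel N by simp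
qed

end

text \<open>The operations preserve the graded pieces of \<open>P\<close> and \<iota> is injective
  on each of them, so every identity can be checked after applying \<iota>, where it is an axiom of
  \<open>Q\<close>. \<iota> depends on the arity but not on the degree.\<close>

lemma dioperad_embedding:
  fixes P :: "('k::field_char_0, 'p::ab_group_add) dio_data" and Q :: "('k, 'q::ab_group_add) dio_data"
  assumes Q: "dioperad Q"
    and space: "\<And>r s. 0 < r + s \<Longrightarrow> dg_vector_space (Dsp P r s)"
    and \<iota>: "\<And>r s. 0 < r + s \<Longrightarrow> chain_map (Dsp P r s) (Dsp Q r s) (\<lambda>p. \<iota> r s)"
    and inj: "\<And>r s p a b. \<lbrakk>0 < r + s; a \<in> Gr (Dsp P r s) p; b \<in> Gr (Dsp P r s) p; \<iota> r s a = \<iota> r s b\<rbrakk> \<Longrightarrow> a = b"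
    and act_mem: "\<And>r s p \<sigma> \<tau> a. \<lbrakk>0 < r + s; \<sigma> permutes {..<r}; \<tau> permutes {..<s}; a \<in> Gr (Dsp P r s) p\<rbrakk>
      \<Longrightarrow> dact P r s p \<sigma> \<tau> a \<in> Gr (Dsp P r s) p"
    and act: "\<And>r s p \<sigma> \<tau> a. \<lbrakk>0 < r + s; \<sigma> permutes {..<r}; \<tau> permutes {..<s}; a \<in> Gr (Dsp P r s) p\<rbrakk>
      \<Longrightarrow> \<iota> r s (dact P r s p \<sigma> \<tau> a) = dact Q r s p \<sigma> \<tau> (\<iota> r s a)"
    and comp_mem: "\<And>r s p i r' s' p' j a b. \<lbrakk>i < r; j < s'; 2 < r + s + r' + s'; a \<in> Gr (Dsp P r s) p; b \<in> Gr (Dsp P r' s') p'\<rbrakk>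
      \<Longrightarrow> dcomp P r s p i r' s' p' j a b \<in> Gr (Dsp P (r + r' - 1) (s + s' - 1)) (p + p')"
    and comp: "\<And>r s p i r' s' p' j a b. \<lbrakk>i < r; j < s'; 2 < r + s + r' + s'; a \<in> Gr (Dsp P r s) p; b \<in> Gr (Dsp P r' s') p'\<rbrakk>
      \<Longrightarrow> \<iota> (r + r' - 1) (s + s' - 1) (dcomp P r s p i r' s' p' j a b) =
        dcomp Q r s p i r' s' p' j (\<iota> r s a) (\<iota> r' s' b)"
  shows "dioperad P"
proof -
  interpret Q: dioperad Q by (rule Q)
  have \<iota>_mem: "\<iota> r s a \<in> Gr (Dsp Q r s) p" and \<iota>_scale: "\<iota> r s (Scl (Dsp P r s) c a) = Scl (Dsp Q r s) c (\<iota> r s a)"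
    and \<iota>_Dif: "\<iota> r s (Dif (Dsp P r s) p a) = Dif (Dsp Q r s) p (\<iota> r s a)"
    if "0 < r + s" "a \<in> Gr (Dsp P r s) p" for r s p a c
    using chain_mapD(1,3,4)[OF \<iota>[OF that(1)] that(2)] by simp_all
  have \<iota>_add: "\<iota> r s (a + b) = \<iota> r s a + \<iota> r s b"
    if "0 < r + s" "a \<in> Gr (Dsp P r s) p" "b \<in> Gr (Dsp P r s) p" for r s p a b
    using chain_mapD(2)[OF \<iota>[OF that(1)] that(2,3)] .
  note dg = dg_add[OF space] dg_scale[OF space] dg_Dif[OF space]
  show ?thesis
  proof
    fix r s :: nat assume "0 < r + s" then show "dg_vector_space (Dsp P r s)" by (rule space)
  next
    fix r s :: nat and \<sigma> \<tau> :: "nat \<Rightarrow> nat"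
    assume h: "0 < r + s" "\<sigma> permutes {..<r}" "\<tau> permutes {..<s}"
    note m = act_mem[OF h] and e = act[OF h] and q = chain_mapD[OF Q.act_chain[OF h] \<iota>_mem[OF h(1)]]
    show "chain_map (Dsp P r s) (Dsp P r s) (\<lambda>p. dact P r s p \<sigma> \<tau>)"
      unfolding chain_map_def
    proof (intro allI ballI conjI)
      fix p x assume x: "x \<in> Gr (Dsp P r s) p"
      note dx = dg(3)[OF h(1) x]
      show "dact P r s p \<sigma> \<tau> x \<in> Gr (Dsp P r s) p" by (rule m[OF x])
      show "dact P r s p \<sigma> \<tau> (x + y) = dact P r s p \<sigma> \<tau> x + dact P r s p \<sigma> \<tau> y" if y: "y \<in> Gr (Dsp P r s) p" for y
        using e[OF x] e[OF y] e[OF dg(1)[OF h(1) x y]] q(2)[OF x \<iota>_mem[OF h(1) y]] \<iota>_add[OF h(1) x y]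
          \<iota>_add[OF h(1) m[OF x] m[OF y]]
        by (intro inj[OF h(1) m[OF dg(1)[OF h(1) x y]] dg(1)[OF h(1) m[OF x] m[OF y]]]) simp
      show "dact P r s p \<sigma> \<tau> (Scl (Dsp P r s) c x) = Scl (Dsp P r s) c (dact P r s p \<sigma> \<tau> x)" for c
        using e[OF x] e[OF dg(2)[OF h(1) x]] q(3)[OF x] \<iota>_scale[OF h(1) x] \<iota>_scale[OF h(1) m[OF x]]
        by (intro inj[OF h(1) m[OF dg(2)[OF h(1) x]] dg(2)[OF h(1) m[OF x]]]) simp
      show "dact P r s (p + 1) \<sigma> \<tau> (Dif (Dsp P r s) p x) = Dif (Dsp P r s) p (dact P r s p \<sigma> \<tau> x)"
        using e[OF x] e[OF dx] q(4)[OF x] \<iota>_Dif[OF h(1) x] \<iota>_Dif[OF h(1) m[OF x]]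
        by (intro inj[OF h(1) m[OF dx] dg(3)[OF h(1) m[OF x]]]) simp
    qed
  next
    fix r s :: nat and a p assume h: "0 < r + s" "a \<in> Gr (Dsp P r s) p"
    show "dact P r s p id id a = a"
      using act[OF h(1) permutes_id permutes_id h(2)] Q.act_id[OF h(1) \<iota>_mem[OF h]]
      by (intro inj[OF h(1) act_mem[OF h(1) permutes_id permutes_id h(2)] h(2)]) simp
  next
    fix r s :: nat and a p and \<sigma> \<tau> \<sigma>' \<tau>' :: "nat \<Rightarrow> nat"
    assume h: "0 < r + s" and st: "\<sigma> permutes {..<r}" "\<tau> permutes {..<s}" and st': "\<sigma>' permutes {..<r}" "\<tau>' permutes {..<s}"
      and a: "a \<in> Gr (Dsp P r s) p"
    note m = act_mem[OF h st' a]
    note c = permutes_compose[OF st'(1) st(1)] permutes_compose[OF st'(2) st(2)]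
    show "dact P r s p (\<sigma> \<circ> \<sigma>') (\<tau> \<circ> \<tau>') a = dact P r s p \<sigma> \<tau> (dact P r s p \<sigma>' \<tau>' a)"
      using act[OF h st m] act[OF h st' a] act[OF h c a] Q.act_comp[OF h st st' \<iota>_mem[OF h a]]
      by (intro inj[OF h act_mem[OF h c a] act_mem[OF h st m]]) simp
  next
    fix i r j s' s r' :: nat
    assume h: "i < r" "j < s'" "2 < r + s + r' + s'"
    then have pos: "0 < r + s" "0 < r' + s'" "0 < r + r' - 1 + (s + s' - 1)" by auto
    note m = comp_mem[OF h] and e = comp[OF h]
      and q = chain_bimapD[OF Q.comp_chain[OF h] \<iota>_mem[OF pos(1)] \<iota>_mem[OF pos(2)]]
    show "chain_bimap (Dsp P r s) (Dsp P r' s') (Dsp P (r + r' - 1) (s + s' - 1)) (\<lambda>p p'. dcomp P r s p i r' s' p' j)"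
      unfolding chain_bimap_def
    proof (intro allI ballI conjI)
      fix p p' x y assume x: "x \<in> Gr (Dsp P r s) p" and y: "y \<in> Gr (Dsp P r' s') p'"
      note xy = m[OF x y] and dx = dg(3)[OF pos(1) x] and dy = dg(3)[OF pos(2) y]
      show "dcomp P r s p i r' s' p' j x y \<in> Gr (Dsp P (r + r' - 1) (s + s' - 1)) (p + p')" by (rule xy)
      show "dcomp P r s p i r' s' p' j (x + x') y = dcomp P r s p i r' s' p' j x y + dcomp P r s p i r' s' p' j x' y"
        if x': "x' \<in> Gr (Dsp P r s) p" for x'
        using e[OF x y] e[OF x' y] e[OF dg(1)[OF pos(1) x x'] y] q(2)[OF x y \<iota>_mem[OF pos(1) x']]
          \<iota>_add[OF pos(1) x x'] \<iota>_add[OF pos(3) xy m[OF x' y]]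
        by (intro inj[OF pos(3) m[OF dg(1)[OF pos(1) x x'] y] dg(1)[OF pos(3) xy m[OF x' y]]]) simp
      show "dcomp P r s p i r' s' p' j x (y + y') = dcomp P r s p i r' s' p' j x y + dcomp P r s p i r' s' p' j x y'"
        if y': "y' \<in> Gr (Dsp P r' s') p'" for y'
        using e[OF x y] e[OF x y'] e[OF x dg(1)[OF pos(2) y y']] q(3)[OF x y \<iota>_mem[OF pos(2) y']]
          \<iota>_add[OF pos(2) y y'] \<iota>_add[OF pos(3) xy m[OF x y']]
        by (intro inj[OF pos(3) m[OF x dg(1)[OF pos(2) y y']] dg(1)[OF pos(3) xy m[OF x y']]]) simp
      show "dcomp P r s p i r' s' p' j (Scl (Dsp P r s) c x) y =
          Scl (Dsp P (r + r' - 1) (s + s' - 1)) c (dcomp P r s p i r' s' p' j x y)" for c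
        using e[OF x y] e[OF dg(2)[OF pos(1) x] y] q(4)[OF x y] \<iota>_scale[OF pos(1) x] \<iota>_scale[OF pos(3) xy]
        by (intro inj[OF pos(3) m[OF dg(2)[OF pos(1) x] y] dg(2)[OF pos(3) xy]]) simp
      show "dcomp P r s p i r' s' p' j x (Scl (Dsp P r' s') c y) =
          Scl (Dsp P (r + r' - 1) (s + s' - 1)) c (dcomp P r s p i r' s' p' j x y)" for c
        using e[OF x y] e[OF x dg(2)[OF pos(2) y]] q(5)[OF x y] \<iota>_scale[OF pos(2) y] \<iota>_scale[OF pos(3) xy]
        by (intro inj[OF pos(3) m[OF x dg(2)[OF pos(2) y]] dg(2)[OF pos(3) xy]]) simp
      have deg: "p + 1 + p' = p + p' + 1" "p + (p' + 1) = p + p' + 1" by simp_all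
      note 1 = m[OF dx y, unfolded deg] and 2 = m[OF x dy, unfolded deg]
      note 3 = dg(2)[OF pos(3) 2, of "ksgn p"]
      show "Dif (Dsp P (r + r' - 1) (s + s' - 1)) (p + p') (dcomp P r s p i r' s' p' j x y) =
          dcomp P r s (p + 1) i r' s' p' j (Dif (Dsp P r s) p x) y +
          Scl (Dsp P (r + r' - 1) (s + s' - 1)) (ksgn p) (dcomp P r s p i r' s' (p' + 1) j x (Dif (Dsp P r' s') p' y))"
        using e[OF x y] e[OF dx y] e[OF x dy] q(6)[OF x y] \<iota>_Dif[OF pos(1) x] \<iota>_Dif[OF pos(2) y]
          \<iota>_Dif[OF pos(3) xy] \<iota>_add[OF pos(3) 1 3] \<iota>_scale[OF pos(3) 2]
        by (intro inj[OF pos(3) dg(3)[OF pos(3) xy] dg(1)[OF pos(3) 1 3]]) simp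
    qed
  next
    fix i r j s' s r' :: nat and a b p p' and \<sigma> \<tau> \<sigma>' \<tau>' \<rho> \<pi> :: "nat \<Rightarrow> nat"
    assume h: "i < r" "j < s'" "2 < r + s + r' + s'"
      and a: "a \<in> Gr (Dsp P r s) p" and b: "b \<in> Gr (Dsp P r' s') p'"
      and st: "\<sigma> permutes {..<r}" "\<tau> permutes {..<s}" and st': "\<sigma>' permutes {..<r'}" "\<tau>' permutes {..<s'}"
      and rp: "\<rho> permutes {..<r + r' - 1}" "\<pi> permutes {..<s + s' - 1}"
      and hyps: "\<And>x. x < r \<Longrightarrow> x \<noteq> i \<Longrightarrow> \<rho> (skip i x) = skip (\<sigma> i) (\<sigma> x)"
        "\<And>y. y < r' \<Longrightarrow> \<rho> (r - 1 + y) = r - 1 + \<sigma>' y" "\<And>x. x < s \<Longrightarrow> \<pi> x = \<tau> x"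
        "\<And>y. y < s' \<Longrightarrow> y \<noteq> j \<Longrightarrow> \<pi> (s + skip j y) = s + skip (\<tau>' j) (\<tau>' y)"
    from h have pos: "0 < r + s" "0 < r' + s'" "0 < r + r' - 1 + (s + s' - 1)" by auto
    have h': "\<sigma> i < r" "\<tau>' j < s'" using h permutes_less[OF st(1)] permutes_less[OF st'(2)] by auto
    note m = comp_mem[OF h a b] and ma = act_mem[OF pos(1) st a] and mb = act_mem[OF pos(2) st' b]
    show "dcomp P r s p (\<sigma> i) r' s' p' (\<tau>' j) (dact P r s p \<sigma> \<tau> a) (dact P r' s' p' \<sigma>' \<tau>' b) =
        dact P (r + r' - 1) (s + s' - 1) (p + p') \<rho> \<pi> (dcomp P r s p i r' s' p' j a b)"
      using comp[OF h' h(3) ma mb] act[OF pos(1) st a] act[OF pos(2) st' b] comp[OF h a b] act[OF pos(3) rp m]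
        Q.equivariant[OF h \<iota>_mem[OF pos(1) a] \<iota>_mem[OF pos(2) b] st st' rp hyps]
      by (intro inj[OF pos(3) comp_mem[OF h' h(3) ma mb] act_mem[OF pos(3) rp m]]) simp
  next
    fix i r1 j s2 k r2 l s3 s1 r3 :: nat and a b c p1 p2 p3
    assume h: "i < r1" "j < s2" "k < r2" "l < s3" "4 < r1 + s1 + r2 + s2 + r3 + s3"
      and a: "a \<in> Gr (Dsp P r1 s1) p1" and b: "b \<in> Gr (Dsp P r2 s2) p2" and c: "c \<in> Gr (Dsp P r3 s3) p3"
    have g: "2 < r1 + s1 + r2 + s2" "2 < r2 + s2 + r3 + s3" "r1 - 1 + k < r1 + r2 - 1" "j < s2 + s3 - 1"
      "2 < r1 + r2 - 1 + (s1 + s2 - 1) + r3 + s3" "2 < r1 + s1 + (r2 + r3 - 1) + (s2 + s3 - 1)"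
      "0 < r1 + s1" "0 < r2 + s2" "0 < r3 + s3" "0 < r1 + r2 - 1 + r3 - 1 + (s1 + s2 - 1 + s3 - 1)"
      using h by auto
    \<comment> \<open>Brings both composites to the same arities and degree, since injectivity of
      \<iota> compares elements of one graded piece.\<close>
    have N: "r1 + (r2 + r3 - 1) - 1 = r1 + r2 - 1 + r3 - 1" "s1 + (s2 + s3 - 1) - 1 = s1 + s2 - 1 + s3 - 1"
      "p1 + (p2 + p3) = p1 + p2 + p3"
      using h by auto
    note ab = comp_mem[OF h(1,2) g(1) a b] and bc = comp_mem[OF h(3,4) g(2) b c]
    note L = comp_mem[OF g(3) h(4) g(5) ab c] and R = comp_mem[OF h(1) g(4,6) a bc, unfolded N]
    show "dcomp P (r1 + r2 - 1) (s1 + s2 - 1) (p1 + p2) (r1 - 1 + k) r3 s3 p3 l (dcomp P r1 s1 p1 i r2 s2 p2 j a b) c =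
        dcomp P r1 s1 p1 i (r2 + r3 - 1) (s2 + s3 - 1) (p2 + p3) j a (dcomp P r2 s2 p2 k r3 s3 p3 l b c)"
      using comp[OF g(3) h(4) g(5) ab c] comp[OF h(1) g(4,6) a bc, unfolded N] comp[OF h(1,2) g(1) a b] comp[OF h(3,4) g(2) b c]
        Q.assoc_chain[OF h \<iota>_mem[OF g(7) a] \<iota>_mem[OF g(8) b] \<iota>_mem[OF g(9) c]]
      by (intro inj[OF g(10) L R]) (simp only:)
  next
    fix i r1 k r3 j s2 l s1 r2 s3 :: nat and a b c p1 p2 p3
    assume h: "i < r1" "k < r3" "j < s2" "l < s2" "j \<noteq> l" "4 < r1 + s1 + r2 + s2 + r3 + s3"
      and a: "a \<in> Gr (Dsp P r1 s1) p1" and b: "b \<in> Gr (Dsp P r2 s2) p2" and c: "c \<in> Gr (Dsp P r3 s3) p3"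
    let ?r = "r1 + r2 + r3 - 2" and ?s = "s1 + s2 + s3 - 2"
    have sk: "skip j l < s2 - 1" "skip l j < s2 - 1" using h skip_less[of l s2 j] skip_less[of j s2 l] by auto
    have g: "2 < r1 + s1 + r2 + s2" "2 < r3 + s3 + r2 + s2" "s1 + skip j l < s1 + s2 - 1" "s3 + skip l j < s3 + s2 - 1"
      "2 < r3 + s3 + (r1 + r2 - 1) + (s1 + s2 - 1)" "2 < r1 + s1 + (r3 + r2 - 1) + (s3 + s2 - 1)"
      "0 < r1 + s1" "0 < r2 + s2" "0 < r3 + s3" "0 < ?r + ?s"
      using h sk by auto
    have N: "r3 + (r1 + r2 - 1) - 1 = ?r" "s3 + (s1 + s2 - 1) - 1 = ?s" "r1 + (r3 + r2 - 1) - 1 = ?r" "s1 + (s3 + s2 - 1) - 1 = ?s"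
      "p1 + (p3 + p2) = p1 + p2 + p3" "p3 + (p1 + p2) = p1 + p2 + p3"
      using h by auto
    have bs: "block_swap 0 (r1 - 1) (r3 - 1) permutes {..<?r}" "block_swap 0 s1 s3 permutes {..<?s}"
      using h by (auto intro!: block_swap_permutes)
    note ab = comp_mem[OF h(1,3) g(1) a b] and cb = comp_mem[OF h(2,4) g(2) c b]
    note L = comp_mem[OF h(2) g(3,5) c ab, unfolded N] and R = comp_mem[OF h(1) g(4,6) a cb, unfolded N]
    note R' = act_mem[OF g(10) bs R]
    show "dcomp P r3 s3 p3 k (r1 + r2 - 1) (s1 + s2 - 1) (p1 + p2) (s1 + skip j l)
        c (dcomp P r1 s1 p1 i r2 s2 p2 j a b) =
      Scl (Dsp P ?r ?s) (ksgn (p1 * p3)) (dact P ?r ?s (p1 + p2 + p3) (block_swap 0 (r1 - 1) (r3 - 1)) (block_swap 0 s1 s3)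
        (dcomp P r1 s1 p1 i (r3 + r2 - 1) (s3 + s2 - 1) (p3 + p2) (s3 + skip l j) a (dcomp P r3 s3 p3 k r2 s2 p2 l c b)))"
      using comp[OF h(2) g(3,5) c ab, unfolded N] comp[OF h(1) g(4,6) a cb, unfolded N] comp[OF h(1,3) g(1) a b]
        comp[OF h(2,4) g(2) c b] act[OF g(10) bs R] \<iota>_scale[OF g(10) R', of "ksgn (p1 * p3)"]
        Q.assoc_target[OF h \<iota>_mem[OF g(7) a] \<iota>_mem[OF g(8) b] \<iota>_mem[OF g(9) c]]
      by (intro inj[OF g(10) L dg(2)[OF g(10) R']]) (simp only:)
  next
    fix i r2 k j s1 l s3 r1 s2 r3 :: nat and a b c p1 p2 p3
    assume h: "i < r2" "k < r2" "i \<noteq> k" "j < s1" "l < s3" "4 < r1 + s1 + r2 + s2 + r3 + s3"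
      and a: "a \<in> Gr (Dsp P r1 s1) p1" and b: "b \<in> Gr (Dsp P r2 s2) p2" and c: "c \<in> Gr (Dsp P r3 s3) p3"
    let ?r = "r1 + r2 + r3 - 2" and ?s = "s1 + s2 + s3 - 2"
    have sk: "skip i k < r2 - 1" "skip k i < r2 - 1" using h skip_less[of k r2 i] skip_less[of i r2 k] by auto
    have g: "2 < r2 + s2 + r1 + s1" "2 < r2 + s2 + r3 + s3" "skip i k < r2 + r1 - 1" "skip k i < r2 + r3 - 1"
      "2 < r2 + r1 - 1 + (s2 + s1 - 1) + r3 + s3" "2 < r2 + r3 - 1 + (s2 + s3 - 1) + r1 + s1"
      "0 < r1 + s1" "0 < r2 + s2" "0 < r3 + s3" "0 < ?r + ?s"
      using h sk by auto
    have N: "r2 + r1 - 1 + r3 - 1 = ?r" "s2 + s1 - 1 + s3 - 1 = ?s" "r2 + r3 - 1 + r1 - 1 = ?r" "s2 + s3 - 1 + s1 - 1 = ?s"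
      "p2 + p3 + p1 = p1 + p2 + p3" "p2 + p1 + p3 = p1 + p2 + p3"
      using h by auto
    have bs: "block_swap (r2 - 2) r3 r1 permutes {..<?r}" "block_swap s2 (s3 - 1) (s1 - 1) permutes {..<?s}"
      using h sk by (auto intro!: block_swap_permutes)
    note ba = comp_mem[OF h(1,4) g(1) b a] and bc = comp_mem[OF h(2,5) g(2) b c]
    note L = comp_mem[OF g(3) h(5) g(5) ba c, unfolded N] and R = comp_mem[OF g(4) h(4) g(6) bc a, unfolded N]
    note R' = act_mem[OF g(10) bs R]
    show "dcomp P (r2 + r1 - 1) (s2 + s1 - 1) (p2 + p1) (skip i k) r3 s3 p3 l (dcomp P r2 s2 p2 i r1 s1 p1 j b a) c =
      Scl (Dsp P ?r ?s) (ksgn (p1 * p3)) (dact P ?r ?s (p1 + p2 + p3) (block_swap (r2 - 2) r3 r1) (block_swap s2 (s3 - 1) (s1 - 1))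
        (dcomp P (r2 + r3 - 1) (s2 + s3 - 1) (p2 + p3) (skip k i) r1 s1 p1 j (dcomp P r2 s2 p2 k r3 s3 p3 l b c) a))"
      using comp[OF g(3) h(5) g(5) ba c, unfolded N] comp[OF g(4) h(4) g(6) bc a, unfolded N] comp[OF h(1,4) g(1) b a]
        comp[OF h(2,5) g(2) b c] act[OF g(10) bs R] \<iota>_scale[OF g(10) R', of "ksgn (p1 * p3)"]
        Q.assoc_source[OF h \<iota>_mem[OF g(7) a] \<iota>_mem[OF g(8) b] \<iota>_mem[OF g(9) c]]
      by (intro inj[OF g(10) L dg(2)[OF g(10) R']]) (simp only:)
  qed
qed


section \<open>The double\<close>

lemma dg_vector_spaceI:
  assumes "vector_space (Scl W)"
    and "\<And>p. 0 \<in> Gr W p" "\<And>p x y. x \<in> Gr W p \<Longrightarrow> y \<in> Gr W p \<Longrightarrow> x + y \<in> Gr W p"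
    and "\<And>p c x. x \<in> Gr W p \<Longrightarrow> Scl W c x \<in> Gr W p" "\<And>p x. x \<in> Gr W p \<Longrightarrow> Dif W p x \<in> Gr W (p + 1)"
    and "\<And>p x y. x \<in> Gr W p \<Longrightarrow> y \<in> Gr W p \<Longrightarrow> Dif W p (x + y) = Dif W p x + Dif W p y"
    and "\<And>p c x. x \<in> Gr W p \<Longrightarrow> Dif W p (Scl W c x) = Scl W c (Dif W p x)"
    and "\<And>p x. x \<in> Gr W p \<Longrightarrow> Dif W (p + 1) (Dif W p x) = 0"
  shows "dg_vector_space W"
proof -
  interpret vector_space "Scl W" by (rule assms(1))
  show ?thesis unfolding dg_vector_space_def subspace_def
    using assms by simp
qed

lemma dg_Dif_zero: "dg_vector_space W \<Longrightarrow> 0 \<in> Gr W p \<Longrightarrow> Dif W p 0 = 0"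
  using dg_Dif_add[of W 0 p 0] by simp

lemma dg_zero_mem: "dg_vector_space W \<Longrightarrow> 0 \<in> Gr W p"
proof -
  assume W: "dg_vector_space W"
  then interpret vector_space "Scl W" by (simp add: dg_vector_space_def)
  show ?thesis using W subspace_0 by (auto simp: dg_vector_space_def)
qed

lemma dual_zero: "\<eta> \<in> Gr (dual A) p \<Longrightarrow> dg_vector_space A \<Longrightarrow> \<eta> 0 = 0"
  using dg_zero_mem[of A "- p"] by (force simp: dual_def)

lemma dg_dual:
  fixes A :: "('k::field, 'a::ab_group_add) dgvs"
  assumes A: "dg_vector_space A"
  shows "dg_vector_space (dual A)"
proof (rule dg_vector_spaceI)
  show "vector_space (Scl (dual A))"
    by unfold_locales (auto simp: dual_def fun_eq_iff algebra_simps plus_fun_apply)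
  fix p :: int and \<eta> \<xi> :: "'a \<Rightarrow> 'k" and c :: 'k
  show "0 \<in> Gr (dual A) p" by (simp add: dual_def zero_fun_apply)
  \<comment> \<open>\<open>dual\<close> uses both forms: the first in its graded pieces, the second
    in its differential.\<close>
  have shift: "- (p + 1) = - p - 1" by simp
  have dA: "Dif A (- p - 1) x \<in> Gr A (- p)" if "x \<in> Gr A (- p - 1)" for x
    using dg_Dif[OF A that] by simp
  assume \<eta>: "\<eta> \<in> Gr (dual A) p"
  show "\<eta> + \<xi> \<in> Gr (dual A) p" if "\<xi> \<in> Gr (dual A) p"
    using \<eta> that by (auto simp: dual_def plus_fun_apply algebra_simps)
  show "Scl (dual A) c \<eta> \<in> Gr (dual A) p"
    using \<eta> by (auto simp: dual_def algebra_simps)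
  show "Dif (dual A) p \<eta> \<in> Gr (dual A) (p + 1)"
  proof -
    have Dif: "Dif (dual A) p \<eta> x = (if x \<in> Gr A (- p - 1) then - ksgn p * \<eta> (Dif A (- p - 1) x) else 0)" for x
      by (simp add: dual_def)
    have lin: "\<eta> (x + y) = \<eta> x + \<eta> y" if "x \<in> Gr A (- p)" "y \<in> Gr A (- p)" for x y
      using \<eta> that by (auto simp: dual_def)
    have scl: "\<eta> (Scl A c x) = c * \<eta> x" if "x \<in> Gr A (- p)" for x c
      using \<eta> that by (auto simp: dual_def)
    have Gr: "\<xi> \<in> Gr (dual A) (p + 1) \<longleftrightarrow> (\<forall>x \<in> Gr A (- p - 1).
        (\<forall>y \<in> Gr A (- p - 1). \<xi> (x + y) = \<xi> x + \<xi> y) \<and> (\<forall>c. \<xi> (Scl A c x) = c * \<xi> x)) \<and>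
        (\<forall>x. x \<notin> Gr A (- p - 1) \<longrightarrow> \<xi> x = 0)" for \<xi>
      unfolding dual_def shift[symmetric] by simp
    show ?thesis
      unfolding Gr Dif
      using dA dg_add[OF A] dg_scale[OF A] dg_Dif_add[OF A] dg_Dif_scale[OF A] lin scl
      by (simp add: distrib_left)
  qed
  show "Dif (dual A) p (\<eta> + \<xi>) = Dif (dual A) p \<eta> + Dif (dual A) p \<xi>"
    by (auto simp: dual_def fun_eq_iff plus_fun_apply algebra_simps)
  show "Dif (dual A) p (Scl (dual A) c \<eta>) = Scl (dual A) c (Dif (dual A) p \<eta>)"
    by (auto simp: dual_def fun_eq_iff)
  show "Dif (dual A) (p + 1) (Dif (dual A) p \<eta>) = 0"
  proof
    fix x
    show "Dif (dual A) (p + 1) (Dif (dual A) p \<eta>) x = 0 x"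
    proof (cases "x \<in> Gr A (- (p + 1) - 1)")
      case True
      have "- (p + 1) - 1 + 1 = - p - 1" by simp
      then have "Dif A (- p - 1) (Dif A (- (p + 1) - 1) x) = 0"
        using dg_Dif_Dif[OF A True] by metis
      then show ?thesis
        using True dual_zero[OF \<eta> A] by (simp add: dual_def zero_fun_apply)
    qed (simp add: dual_def zero_fun_apply)
  qed
qed

lemma dg_double:
  fixes A :: "('k::field, 'a::ab_group_add) dgvs"
  assumes A: "dg_vector_space A"
  shows "dg_vector_space (double A)"
proof (rule dg_vector_spaceI)
  note D = dg_dual[OF A]
  interpret a: vector_space "Scl A" using A by (simp add: dg_vector_space_def)
  interpret d: vector_space "Scl (dual A)" using D by (simp add: dg_vector_space_def)
  show "vector_space (Scl (double A))"
    by unfold_locales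
      (auto simp: double_def prod_eq_iff a.scale_right_distrib a.scale_left_distrib d.scale_right_distrib d.scale_left_distrib)
qed (use A dg_dual[OF A] in \<open>auto simp: double_def zero_prod_def dg_zero_mem dg_add dg_scale dg_Dif dg_Dif_add
  dg_Dif_scale dg_Dif_Dif\<close>)

lemma summand_dg:
  fixes A :: "('k::field, 'a::ab_group_add) dgvs"
  assumes A: "dg_vector_space A"
  shows "dg_vector_space (summand A)" "dg_vector_space (dual_summand A)"
    "sub_dg (summand A) (double A)" "sub_dg (dual_summand A) (double A)"
proof -
  note D = dg_dual[OF A]
  \<comment> \<open>The absent component has to stay 0 under the operations of the double for the
    summands to be closed.\<close>
  have z: "Scl (dual A) c 0 = 0" "Dif (dual A) p 0 = 0" "Scl A c 0 = 0" "Dif A p 0 = 0" for c p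
  proof -
    interpret a: vector_space "Scl A" using A by (simp add: dg_vector_space_def)
    interpret d: vector_space "Scl (dual A)" using D by (simp add: dg_vector_space_def)
    show "Scl (dual A) c 0 = 0" "Dif (dual A) p 0 = 0" "Scl A c 0 = 0" "Dif A p 0 = 0"
      using dg_Dif_zero[OF A dg_zero_mem[OF A]] dg_Dif_zero[OF D dg_zero_mem[OF D]] by simp_all
  qed
  have V: "vector_space (Scl (double A))" using dg_double[OF A] by (simp add: dg_vector_space_def)
  show "sub_dg (summand A) (double A)" "sub_dg (dual_summand A) (double A)"
    using dg_zero_mem[OF A] dg_zero_mem[OF D] by (auto simp: sub_dg_def summand_def dual_summand_def double_def)
  show "dg_vector_space (summand A)"
    by (rule dg_vector_spaceI)
      (use V A z in \<open>auto simp: summand_def double_def zero_prod_def dg_zero_mem dg_add dg_scale dg_Dif dg_Dif_add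
        dg_Dif_scale dg_Dif_Dif\<close>)
  show "dg_vector_space (dual_summand A)"
    by (rule dg_vector_spaceI)
      (use V D z in \<open>auto simp: dual_summand_def double_def zero_prod_def dg_zero_mem dg_add dg_scale dg_Dif dg_Dif_add
        dg_Dif_scale dg_Dif_Dif\<close>)
qed

text \<open>Symmetry exchanges the two terms of the form, and the sign in \<open>eval_form\<close>
  makes this a graded symmetry. The differential of the dual is chosen so that evaluation is a chain
  map, which is what \<open>form_chain\<close> expresses for each of the two terms.\<close>

lemma graded_form_double:
  fixes A :: "('k::field_char_0, 'a::ab_group_add) dgvs"
  assumes A: "dg_vector_space A"
  shows "graded_form (double A) double_form"
proof
  show "dg_vector_space (double A)" by (rule dg_double[OF A])
  fix p q :: int and x x' y :: "'a \<times> ('a \<Rightarrow> 'k)" and c :: 'k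
  show "double_form p q x y = 0" if "p + q \<noteq> 0" using that by (simp add: double_form_def eval_form_def)
  assume x: "x \<in> Gr (double A) p" and y: "y \<in> Gr (double A) q"
  have neg: "q = - p" if "p + q = 0" using that by simp
  show "double_form p q (x + x') y = double_form p q x y + double_form p q x' y" if "x' \<in> Gr (double A) p"
    using x y that
    by (cases "p + q = 0") (auto simp: double_form_def eval_form_def double_def dual_def plus_fun_apply algebra_simps dest: neg)
  show "double_form p q (Scl (double A) c x) y = c * double_form p q x y"
    using x y
    by (cases "p + q = 0") (auto simp: double_form_def eval_form_def double_def dual_def algebra_simps dest: neg)
  show "double_form q p y x = ksgn (p * q) * double_form p q x y"
    by (simp add: double_form_def eval_form_def algebra_simps)
  show "double_form (p + 1) q (Dif (double A) p x) y + ksgn p * double_form p (q + 1) x (Dif (double A) q y) = 0"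
  proof (cases "p + q + 1 = 0")
    case True
    then have q: "q = - p - 1" by simp
    show ?thesis
      using x y unfolding q by (auto simp: double_form_def eval_form_def double_def dual_def ksgn_if)
  qed (simp add: double_form_def eval_form_def)
qed

section \<open>The endomorphism dioperad\<close>

lemma bilin_eqI:
  assumes "S \<in> Gr (tensor Ws) p" "T \<in> Gr (tensor Us) q"
    and "\<And>T. T \<in> Gr (tensor Us) q \<Longrightarrow> lin_on (Gr (tensor Ws) p) (\<lambda>S. L S T)"
    and "\<And>T. T \<in> Gr (tensor Us) q \<Longrightarrow> lin_on (Gr (tensor Ws) p) (\<lambda>S. M S T)"
    and "\<And>S. S \<in> Gr (tensor Ws) p \<Longrightarrow> lin_on (Gr (tensor Us) q) (L S)"
    and "\<And>S. S \<in> Gr (tensor Ws) p \<Longrightarrow> lin_on (Gr (tensor Us) q) (M S)"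
    and "\<And>xs ys. \<lbrakk>homog Ws xs; degsum xs = p; homog Us ys; degsum ys = q\<rbrakk>
      \<Longrightarrow> L (pure Ws xs) (pure Us ys) = M (pure Ws xs) (pure Us ys)"
  shows "L S T = M S T"
  using assms(1) assms(3)[OF assms(2)] assms(4)[OF assms(2)]
proof (rule lin_on_eqI)
  fix xs assume xs: "homog Ws xs" "degsum xs = p"
  show "L (pure Ws xs) T = M (pure Ws xs) T"
    using assms(2) assms(5)[OF pure_mem[OF xs]] assms(6)[OF pure_mem[OF xs]]
    by (rule lin_on_eqI) (rule assms(7)[OF xs])
qed

lemma bimlin_cong:
  assumes "bimlin Ws Us G" "dg_list Us" "\<And>xs ys. homog Ws xs \<Longrightarrow> homog Us ys \<Longrightarrow> G xs ys = H xs ys"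
  shows "bimlin Ws Us H"
proof -
  have "mlin Us (H xs)" if "homog Ws xs" for xs
    using assms that mlin_cong[of Us "G xs" "H xs"] by (simp add: bimlin_def)
  moreover have "mlin Ws (\<lambda>xs. H xs ys)" if "homog Us ys" for ys
    using assms that mlin_cong[of Ws "\<lambda>xs. G xs ys" "\<lambda>xs. H xs ys"] by (simp add: bimlin_def)
  ultimately show ?thesis using assms(1) by (simp add: bimlin_def)
qed

lemma tperm_id_pure: "perm_compat id Ws Us \<Longrightarrow> tperm Us id (pure Ws xs) = pure Us xs"
  unfolding tperm_pure by simp

section \<open>Ranks and the sorting of flags by direction\<close>

lemma unshuffle_less: "X \<subseteq> {..<n} \<Longrightarrow> k < card X \<Longrightarrow> unshuffle n X k = sorted_list_of_set X ! k"
  using card_mono[of "{..<n}" X] finite_subset[of X "{..<n}"] by (simp add: unshuffle_def nth_append)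

lemma unshuffle_add:
  assumes "X \<subseteq> {..<n}" "k < n - card X"
  shows "unshuffle n X (card X + k) = sorted_list_of_set ({..<n} - X) ! k"
proof -
  have "card X + k < n" using assms(2) by simp
  then show ?thesis using finite_subset[OF assms(1)] by (simp add: unshuffle_def nth_append)
qed

lemma nth_sorted_mem: "finite X \<Longrightarrow> k < card X \<Longrightarrow> sorted_list_of_set X ! k \<in> X"
  by (metis nth_mem sorted_list_of_set.length_sorted_key_list_of_set sorted_list_of_set.set_sorted_key_list_of_set)

lemma rank_nth:
  assumes "finite X" "k < card X"
  shows "rank X (sorted_list_of_set X ! k) = k"
proof -
  let ?xs = "sorted_list_of_set X"
  have len: "length ?xs = card X" by simp
  have less: "?xs ! l < ?xs ! m \<longleftrightarrow> l < m" if "l < card X" "m < card X" for l m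
    using that sorted_wrt_nth_less[OF strict_sorted_list_of_set, of l m X]
      sorted_wrt_nth_less[OF strict_sorted_list_of_set, of m l X] len
    by (metis linorder_less_linear order_less_asym)
  have "{y \<in> X. y < ?xs ! k} = (!) ?xs ` {..<k}"
  proof (intro equalityI subsetI)
    fix y assume y: "y \<in> {y \<in> X. y < ?xs ! k}"
    then have "y \<in> set ?xs" using assms by simp
    then obtain l where l: "l < card X" "y = ?xs ! l" by (metis in_set_conv_nth len)
    then show "y \<in> (!) ?xs ` {..<k}" using y less[of l k] assms by auto
  next
    fix y assume "y \<in> (!) ?xs ` {..<k}"
    then obtain l where "l < k" "y = ?xs ! l" by auto
    then show "y \<in> {y \<in> X. y < ?xs ! k}" using assms less[of l k] nth_sorted_mem[of X l] by auto
  qed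
  moreover have "inj_on ((!) ?xs) {..<k}"
    using assms by (auto simp: inj_on_def nth_eq_iff_index_eq)
  ultimately show ?thesis by (simp add: rank_def card_image)
qed

lemma rank_less: "finite X \<Longrightarrow> x \<in> X \<Longrightarrow> rank X x < card X"
  unfolding rank_def by (rule psubset_card_mono) auto

lemma nth_rank:
  assumes "finite X" "x \<in> X"
  shows "sorted_list_of_set X ! rank X x = x"
proof -
  have "x \<in> set (sorted_list_of_set X)" using assms by simp
  then obtain k where "k < card X" "x = sorted_list_of_set X ! k"
    by (metis in_set_conv_nth sorted_list_of_set.length_sorted_key_list_of_set)
  then show ?thesis using rank_nth[OF assms(1)] by simp
qed

lemma unshuffle_rank:
  "X \<subseteq> {..<n} \<Longrightarrow> x \<in> X \<Longrightarrow> unshuffle n X (rank X x) = x"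
  using finite_subset[of X "{..<n}"] by (simp add: unshuffle_less rank_less nth_rank)

lemma card_compl: "X \<subseteq> {..<n} \<Longrightarrow> card ({..<n} - X) = n - card X"
  using card_Diff_subset[of X "{..<n}"] finite_subset[of X "{..<n}"] by simp

lemma unshuffle_rank_compl:
  "X \<subseteq> {..<n} \<Longrightarrow> x < n \<Longrightarrow> x \<notin> X \<Longrightarrow> unshuffle n X (card X + rank ({..<n} - X) x) = x"
  using rank_less[of "{..<n} - X" x] by (simp add: unshuffle_add card_compl nth_rank)

lemma unshuffle_mem_iff:
  assumes "X \<subseteq> {..<n}" "k < n"
  shows "unshuffle n X k < n" "unshuffle n X k \<in> X \<longleftrightarrow> k < card X"
proof -
  have fin: "finite X" using assms finite_subset by blast
  have "unshuffle n X k < n \<and> (unshuffle n X k \<in> X \<longleftrightarrow> k < card X)"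
  proof (cases "k < card X")
    case True
    then show ?thesis using assms nth_sorted_mem[OF fin True] by (auto simp: unshuffle_less)
  next
    case False
    then have "k - card X < n - card X" using assms by simp
    then have "sorted_list_of_set ({..<n} - X) ! (k - card X) \<in> {..<n} - X"
      using nth_sorted_mem[of "{..<n} - X" "k - card X"] card_compl[OF assms(1)] by simp
    then show ?thesis
      using False unshuffle_add[OF assms(1), of "k - card X"] \<open>k - card X < n - card X\<close> by auto
  qed
  then show "unshuffle n X k < n" "unshuffle n X k \<in> X \<longleftrightarrow> k < card X" by auto
qed

text \<open>Surjectivity suffices on a finite set: a flag in \<open>X\<close> is found at its rank,
  any other flag at its rank in the complement shifted by \<open>card X\<close>.\<close>

lemma unshuffle_permutes: "X \<subseteq> {..<n} \<Longrightarrow> unshuffle n X permutes {..<n}"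
proof (rule bij_imp_permutes)
  assume X: "X \<subseteq> {..<n}"
  have "x \<in> unshuffle n X ` {..<n}" if "x < n" for x
  proof (cases "x \<in> X")
    case True
    have "rank X x < n" using rank_less[of X x] True X finite_subset[OF X] card_mono[OF _ X] by fastforce
    then show ?thesis using unshuffle_rank[OF X True] by (metis imageI lessThan_iff)
  next
    case False
    have "card X + rank ({..<n} - X) x < n"
      using rank_less[of "{..<n} - X" x] False that card_compl[OF X] by simp
    then show ?thesis using unshuffle_rank_compl[OF X that False] by (metis imageI lessThan_iff)
  qed
  then have "unshuffle n X ` {..<n} = {..<n}" using unshuffle_mem_iff(1)[OF X] by auto
  then show "bij_betw (unshuffle n X) {..<n} {..<n}"
    unfolding bij_betw_def using eq_card_imp_inj_on[of "{..<n}" "unshuffle n X"] by simp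
qed (simp add: unshuffle_def)

locale dg_space =
  fixes A :: "('k::field_char_0, 'a::ab_group_add) dgvs"
  assumes dg_space: "dg_vector_space A"

sublocale dg_space \<subseteq> graded_form "double A" double_form
  by (rule graded_form_double[OF dg_space])

section \<open>Summands of the tensor power of the double and composition between them\<close>

context dg_space
begin

abbreviation V :: "('k, 'a \<times> ('a \<Rightarrow> 'k)) dgvs" where "V \<equiv> double A"

text \<open>The factors of the summand of the tensor power that belongs to \<open>X\<close>, with A
  and A* in their original positions. \<open>mixed A r s\<close> is the case
  \<open>X = {..<r}\<close>, so results on \<open>orient\<close> carry over to
  \<open>End_di\<close>.\<close>

definition orient :: "nat set \<Rightarrow> nat \<Rightarrow> ('k, 'a \<times> ('a \<Rightarrow> 'k)) dgvs list" where
  "orient X n = map (\<lambda>k. if k \<in> X then summand A else dual_summand A) [0..<n]"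

lemma length_orient [simp]: "length (orient X n) = n"
  and orient_nth: "k < n \<Longrightarrow> orient X n ! k = (if k \<in> X then summand A else dual_summand A)"
  by (simp_all add: orient_def)

lemma orient_sub: "W \<in> set (orient X n) \<Longrightarrow> sub_dg W V \<and> dg_vector_space W"
  using summand_dg[OF dg_space] by (auto simp: orient_def)

lemma mixed_orient: "mixed A r s = orient {..<r} (r + s)"
  by (rule nth_equalityI) (auto simp: mixed_def orient_nth nth_append)

lemma length_mixed [simp]: "length (mixed A r s) = r + s"
  by (simp add: mixed_def)

lemma dg_mixed: "dg_list (mixed A r s)"
  unfolding mixed_orient using orient_sub by blast

lemma orient_compat_id: "perm_compat id (orient X n) (replicate n V)"
  using orient_sub[of _ X n] by (auto simp: perm_compat_def permutes_id)

lemma mixed_compat_id: "perm_compat id (mixed A r s) (replicate (r + s) V)"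
  unfolding mixed_orient by (rule orient_compat_id)

lemma unshuffle_compat:
  assumes "X \<subseteq> {..<n}"
  shows "perm_compat (unshuffle n X) (mixed A (card X) (n - card X)) (orient X n)"
proof -
  have "card X \<le> n" using card_mono[OF _ assms] by simp
  then show ?thesis
    using unshuffle_permutes[OF assms] unshuffle_mem_iff[OF assms]
    by (simp add: perm_compat_def mixed_orient orient_nth)
qed

lemma mixed_compat:
  assumes "\<sigma> permutes {..<r}" "\<tau> permutes {..<s}"
  shows "perm_compat (perm_sum r \<sigma> \<tau>) (mixed A r s) (mixed A r s)"
proof -
  have "perm_sum r \<sigma> \<tau> k < r \<longleftrightarrow> k < r" for k
    using permutes_less[OF assms(1)] by (auto simp: perm_sum_def)
  then show ?thesis
    using perm_sum_permutes[OF assms] permutes_less[OF perm_sum_permutes[OF assms]]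
    by (simp add: perm_compat_def mixed_orient orient_nth)
qed

text \<open>Keeps in each factor the component prescribed by \<open>X\<close> and replaces the other
  by 0. On tensors it induces a retraction of the inclusion of the summand for
  \<open>X\<close>.\<close>

definition project :: "nat set \<Rightarrow> (int \<times> 'a \<times> ('a \<Rightarrow> 'k)) list \<Rightarrow> (int \<times> 'a \<times> ('a \<Rightarrow> 'k)) list" where
  "project X xs = map (\<lambda>k. (fst (xs ! k),
     if k \<in> X then (fst (snd (xs ! k)), 0) else (0, snd (snd (xs ! k))))) [0..<length xs]"

lemma length_project [simp]: "length (project X xs) = length xs"
  by (simp add: project_def)

lemma project_nth: "k < length xs \<Longrightarrow> project X xs ! k =
    (fst (xs ! k), if k \<in> X then (fst (snd (xs ! k)), 0) else (0, snd (snd (xs ! k))))"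
  by (simp add: project_def)

lemma degsum_project: "degsum (project X xs) = degsum xs"
  by (simp add: degsum_sum project_nth)

lemma homog_project: "homog (replicate n V) xs \<Longrightarrow> homog (orient X n) (project X xs)"
  by (auto simp: homog_iff project_nth orient_nth summand_def dual_summand_def double_def split: if_splits)

lemma project_update: "k < length xs \<Longrightarrow> project X (xs[k := (p, z)]) =
    (project X xs)[k := (p, if k \<in> X then (fst z, 0) else (0, snd z))]"
  by (rule nth_equalityI) (auto simp: project_nth nth_list_update)

lemma project_oriented:
  assumes "homog (orient X n) xs"
  shows "project X xs = xs"
proof (rule nth_equalityI)
  fix k assume "k < length (project X xs)"
  then have k: "k < length xs" "k < n" using assms by (simp_all add: homog_length)
  have "snd (xs ! k) \<in> Gr (if k \<in> X then summand A else dual_summand A) (fst (xs ! k))"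
    using homog_nth[OF assms, of k] k by (simp add: orient_nth)
  then show "project X xs ! k = xs ! k"
    using k by (auto simp: project_nth prod_eq_iff summand_def dual_summand_def split: if_splits)
qed simp

lemma mlin_project:
  assumes "mlin (orient X n) F"
  shows "mlin (replicate n V) (\<lambda>xs. F (project X xs))"
proof (rule mlinI)
  let ?c = "\<lambda>k z. if k \<in> X then (fst z, 0) else (0, snd z) :: 'a \<times> ('a \<Rightarrow> 'k)"
  interpret a: vector_space "Scl A" using dg_space by (simp add: dg_vector_space_def)
  interpret d: vector_space "Scl (dual A)" using dg_dual[OF dg_space] by (simp add: dg_vector_space_def)
  fix xs k p x
  assume h: "homog (replicate n V) xs" "k < length (replicate n V)" "x \<in> Gr (replicate n V ! k) p"
  then have k: "k < length xs" "k < n" by (simp_all add: homog_length)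
  have mem: "?c k z \<in> Gr (orient X n ! k) p" if "z \<in> Gr V p" for z
    using that k by (auto simp: orient_nth summand_def dual_summand_def double_def)
  have x: "x \<in> Gr V p" using h by simp
  have add: "?c k (x + y) = ?c k x + ?c k y" for x y by (simp add: prod_eq_iff)
  have scl: "?c k (Scl V c x) = Scl (orient X n ! k) c (?c k x)" for c x
    using k by (simp add: orient_nth summand_def dual_summand_def double_def)
  show "F (project X (xs[k := (p, x + y)])) = F (project X (xs[k := (p, x)])) + F (project X (xs[k := (p, y)]))"
    if "y \<in> Gr (replicate n V ! k) p" for y
    using mlin_add[OF assms homog_project[OF h(1)] _ mem[OF x] mem[of y]] that k
    by (simp only: project_update[OF k(1)] add length_orient) simp
  show "F (project X (xs[k := (p, Scl (replicate n V ! k) c x)])) = tscale c (F (project X (xs[k := (p, x)])))" for c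
    using mlin_scale[OF assms homog_project[OF h(1)] _ mem[OF x]] k
    by (simp add: project_update[OF k(1)] scl)
qed

definition tproject :: "nat set \<Rightarrow> nat \<Rightarrow> ('k, 'a \<times> ('a \<Rightarrow> 'k)) tens \<Rightarrow> ('k, 'a \<times> ('a \<Rightarrow> 'k)) tens" where
  "tproject X n = tlin (\<lambda>xs. pure (orient X n) (project X xs))"

lemma tproject_pure: "tproject X n (pure (replicate n V) xs) = pure (orient X n) (project X xs)"
  unfolding tproject_def by (rule tlin_pure[OF mlin_project[OF mlin_pure]])

lemma lin_on_tproject: "lin_on C (tproject X n)"
  by (simp add: lin_on_def tproject_def tlin_add tlin_scale)

lemma tproject_sum: "tproject X n (sum f S) = (\<Sum>s\<in>S. tproject X n (f s))"
  by (simp add: tproject_def tlin_sum)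

lemma tproject_mem: "T \<in> TV n p \<Longrightarrow> tproject X n T \<in> Gr (tensor (orient X n)) p"
  unfolding tproject_def
  by (rule tlin_mem[OF _ mlin_project[OF mlin_pure]]) (auto simp: degsum_project intro!: pure_mem homog_project)

lemma tproject_id:
  assumes "T \<in> Gr (tensor (orient X n)) p"
  shows "tproject X n (tperm (replicate n V) id T) = T"
proof (rule lin_on_eqI[where L = "\<lambda>T. tproject X n (tperm (replicate n V) id T)" and M = "\<lambda>T. T", OF assms])
  show "lin_on (Gr (tensor (orient X n)) p) (\<lambda>T. tproject X n (tperm (replicate n V) id T))"
    by (rule lin_on_comp[OF lin_on_tproject[of UNIV] lin_on_tperm]) simp
  fix xs assume xs: "homog (orient X n) xs"
  show "tproject X n (tperm (replicate n V) id (pure (orient X n) xs)) = pure (orient X n) xs"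
    unfolding tperm_id_pure[OF orient_compat_id] tproject_pure project_oriented[OF xs] ..
qed (rule lin_on_id)

text \<open>A tensor over the summands is a functional that also sees forms multilinear for these
  alone, a larger class than for the double, so the inclusion might lose information. The retraction
  \<open>tproject\<close> shows that it does not.\<close>

lemma orient_inj:
  assumes "S \<in> Gr (tensor (orient X n)) p" "T \<in> Gr (tensor (orient X n)) p"
    "tperm (replicate n V) id S = tperm (replicate n V) id T"
  shows "S = T"
  by (rule trans[OF sym[OF tproject_id[OF assms(1)], unfolded assms(3)] tproject_id[OF assms(2)]])

definition dcontr :: "nat \<Rightarrow> nat \<Rightarrow> nat \<Rightarrow> nat \<Rightarrow> nat \<Rightarrow> nat \<Rightarrow> (int \<times> 'a \<times> ('a \<Rightarrow> 'k)) list \<Rightarrow>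
    (int \<times> 'a \<times> ('a \<Rightarrow> 'k)) list \<Rightarrow> ('k, 'a \<times> ('a \<Rightarrow> 'k)) tens" where
  "dcontr r s i r' s' j xs ys =
     tscale (contract_sign i xs (r' + j) ys * ksgn (degsum (drop r xs) * degsum (take r' ys)) *
       eval_form (fst (xs ! i)) (fst (ys ! (r' + j))) (fst (snd (xs ! i))) (snd (snd (ys ! (r' + j)))))
     (pure (mixed A (r + r' - 1) (s + s' - 1))
       (delete_at i (take r xs) @ take r' ys @ drop r xs @ delete_at j (drop r' ys)))"

lemma dcomp_End: "dcomp (End_di A) r s p i r' s' p' j = blin (dcontr r s i r' s' j)"
  unfolding End_di_def blin_def[abs_def] dcontr_def[abs_def] by simp

text \<open>The first argument has no component in A*, which removes the other term of the
  form.\<close>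

lemma form_mixed:
  assumes "x \<in> Gr (summand A) p" "y \<in> Gr (dual_summand A) q"
  shows "double_form p q x y = eval_form p q (fst x) (snd y)"
  using assms by (auto simp: double_form_def summand_def dual_summand_def zero_fun_apply)

text \<open>The factor \<open>ksgn (degsum (drop r xs) * degsum (take r' ys))\<close> is the Koszul
  sign of moving the outputs of \<open>ys\<close> across the inputs of \<open>xs\<close>. So
  composing in \<open>End_di\<close> is contracting with the form of the double and then swapping
  these two blocks, the recipe of \<open>phi_pull\<close>.\<close>

lemma dcontr_eq:
  assumes i: "i < r" and j: "j < s'" and xs: "homog (mixed A r s) xs" and ys: "homog (mixed A r' s') ys"
  shows "dcontr r s i r' s' j xs ys =
    contr double_form (\<lambda>zs. tscale (koszul (block_swap (r - 1) s r') zs)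
      (pure (mixed A (r + r' - 1) (s + s' - 1)) (permute_list (inv (block_swap (r - 1) s r')) zs))) i (r' + j) xs ys"
proof -
  have len: "length xs = r + s" "length ys = r' + s'" using xs ys by (simp_all add: homog_length)
  let ?a = "delete_at i (take r xs)" and ?b = "delete_at j (drop r' ys)"
  have x: "delete_at i xs = ?a @ drop r xs"
    using delete_at_append_left[of i "take r xs" "drop r xs"] i len by simp
  have y: "delete_at (r' + j) ys = take r' ys @ ?b"
    using delete_at_append_right[of "take r' ys" j "drop r' ys"] len by simp
  have l: "length ?a = r - 1" "length (drop r xs) = s" "length (take r' ys) = r'" using i len by simp_all
  have "snd (xs ! i) \<in> Gr (summand A) (fst (xs ! i))"
    using homog_nth[OF xs, of i] i by (simp add: mixed_orient orient_nth)
  moreover have "snd (ys ! (r' + j)) \<in> Gr (dual_summand A) (fst (ys ! (r' + j)))"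
    using homog_nth[OF ys, of "r' + j"] j by (simp add: mixed_orient orient_nth)
  ultimately have form: "double_form (fst (xs ! i)) (fst (ys ! (r' + j))) (snd (xs ! i)) (snd (ys ! (r' + j))) =
      eval_form (fst (xs ! i)) (fst (ys ! (r' + j))) (fst (snd (xs ! i))) (snd (snd (ys ! (r' + j))))"
    by (rule form_mixed)
  show ?thesis
    using koszul_block_swap[of ?a "drop r xs" "take r' ys" ?b, where 'k = 'k]
      permute_block_swap[of ?a "drop r xs" "take r' ys" ?b]
    unfolding dcontr_def contr_def x y form l append_assoc by (simp add: ac_simps)
qed

text \<open>After deletion the types of the factors are A, A*, A, A* in blocks of sizes
  \<open>r - 1\<close>, \<open>s\<close>, \<open>r'\<close>, \<open>s' - 1\<close>; exchanging the
  middle two puts all copies of A first.\<close>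

lemma block_swap_compat:
  assumes i: "i < r" and j: "j < s'"
  shows "perm_compat (block_swap (r - 1) s r') (delete_at i (mixed A r s) @ delete_at (r' + j) (mixed A r' s'))
    (mixed A (r + r' - 1) (s + s' - 1))"
proof -
  let ?S = "summand A" and ?D = "dual_summand A"
  have "delete_at i (mixed A r s) @ delete_at (r' + j) (mixed A r' s') =
      replicate (r - 1) ?S @ replicate s ?D @ replicate r' ?S @ replicate (s' - 1) ?D"
    using i j delete_at_append_left[of i "replicate r ?S" "replicate s ?D"]
      delete_at_append_right[of "replicate r' ?S" j "replicate s' ?D"]
    by (simp add: mixed_def delete_at_replicate)
  moreover have "block_swap (r - 1) s r' permutes {..<r - 1 + (s + (r' + (s' - 1)))}"
    by (rule block_swap_permutes) simp
  moreover have "sub_dg ((replicate (r - 1) ?S @ replicate s ?D @ replicate r' ?S @ replicate (s' - 1) ?D) ! k)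
      (mixed A (r + r' - 1) (s + s' - 1) ! block_swap (r - 1) s r' k)"
    if k: "k < r - 1 + (s + (r' + (s' - 1)))" for k
  proof -
    let ?out = "k < r - 1 \<or> r - 1 + s \<le> k \<and> k < r - 1 + s + r'"
    have bound: "block_swap (r - 1) s r' k < r + r' - 1 + (s + s' - 1)"
      using k i j by (auto simp: block_swap_def)
    have L: "(replicate (r - 1) ?S @ replicate s ?D @ replicate r' ?S @ replicate (s' - 1) ?D) ! k =
        (if ?out then ?S else ?D)"
      using k by (auto simp: nth_append) (rule nth_replicate, linarith)
    have R: "block_swap (r - 1) s r' k < r + r' - 1 \<longleftrightarrow> ?out"
      using i by (auto simp: block_swap_def)
    show ?thesis
      unfolding mixed_orient orient_nth[OF bound] L lessThan_iff R by simp
  qed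
  ultimately show ?thesis using i j by (simp add: perm_compat_def)
qed

lemma mixed_mem: "W \<in> set (mixed A r s) \<Longrightarrow> sub_dg W V \<and> dg_vector_space W"
  unfolding mixed_orient by (rule orient_sub)

lemma bimlin_dcontr:
  assumes "i < r" "j < s'"
  shows "bimlin (mixed A r s) (mixed A r' s') (dcontr r s i r' s' j)"
proof (rule bimlin_cong)
  show "bimlin (mixed A r s) (mixed A r' s') (contr double_form (\<lambda>zs. tscale (koszul (block_swap (r - 1) s r') zs)
      (pure (mixed A (r + r' - 1) (s + s' - 1)) (permute_list (inv (block_swap (r - 1) s r')) zs))) i (r' + j))"
    using assms by (intro bimlin_contr mlin_tperm[OF block_swap_compat[OF assms]]) (auto dest: mixed_mem)
qed (use assms in \<open>simp_all add: dcontr_eq dg_mixed\<close>)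

lemma dcontr_mem:
  assumes i: "i < r" and j: "j < s'" and xs: "homog (mixed A r s) xs" and ys: "homog (mixed A r' s') ys"
  shows "dcontr r s i r' s' j xs ys \<in> Gr (tensor (mixed A (r + r' - 1) (s + s' - 1))) (degsum xs + degsum ys)"
proof (cases "fst (xs ! i) + fst (ys ! (r' + j)) = 0")
  case True
  have len: "length xs = r + s" "length ys = r' + s'" using xs ys by (simp_all add: homog_length)
  let ?zs = "delete_at i xs @ delete_at (r' + j) ys" and ?b = "block_swap (r - 1) s r'"
  have h: "homog (delete_at i (mixed A r s) @ delete_at (r' + j) (mixed A r' s')) ?zs"
    using i len by (simp add: homog_append homog_delete_at xs ys)
  have "degsum (permute_list (inv ?b) ?zs) = degsum xs + degsum ys"
    using degsum_permute[OF perm_compat_permutes[OF block_swap_compat[OF i j] h]] True i j len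
    by (simp add: degsum_delete_at)
  then show ?thesis
    unfolding dcontr_eq[OF assms] contr_def
    by (intro tensor_scale pure_mem homog_permute[OF block_swap_compat[OF i j] h])
next
  case False
  then show ?thesis
    unfolding dcontr_eq[OF assms] using i j xs ys by (simp add: contr_degree homog_length)
qed

lemma dcomp_mem:
  assumes "i < r" "j < s'" "S \<in> Gr (tensor (mixed A r s)) p" "T \<in> Gr (tensor (mixed A r' s')) p'"
  shows "blin (dcontr r s i r' s' j) S T \<in> Gr (tensor (mixed A (r + r' - 1) (s + s' - 1))) (p + p')"
  by (rule blin_mem[OF bimlin_dcontr[OF assms(1,2)] assms(3,4)]) (use dcontr_mem[OF assms(1,2)] in blast)

text \<open>On pure tensors \<open>dcontr_eq\<close> makes both sides the same contraction followed
  by the same block swap; only the space in which the permuted list is read differs, and the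
  inclusion bridges this.\<close>

lemma dcomp_embed:
  assumes i: "i < r" and j: "j < s'" and S: "S \<in> Gr (tensor (mixed A r s)) p" and T: "T \<in> Gr (tensor (mixed A r' s')) p'"
  shows "tperm (replicate (r + s + (r' + s') - 2) V) id (blin (dcontr r s i r' s' j) S T) =
    tperm (replicate (r + s + (r' + s') - 2) V) (block_swap (r - 1) s r')
      (cc (r + s) i (r' + s') (r' + j) (tperm (replicate (r + s) V) id S) (tperm (replicate (r' + s') V) id T))"
  using S T
proof (rule bilin_eqI[where L = "\<lambda>S T. tperm (replicate (r + s + (r' + s') - 2) V) id (blin (dcontr r s i r' s' j) S T)"])
  let ?n = "r + s" and ?m = "r' + s'" and ?b = "block_swap (r - 1) s r'" and ?M = "mixed A (r + r' - 1) (s + s' - 1)"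
  let ?N = "?n + ?m - 2"
  have ij: "i < ?n" "r' + j < ?m" using i j by auto
  show "lin_on (Gr (tensor (mixed A r s)) p) (\<lambda>S. tperm (replicate ?N V) id (blin (dcontr r s i r' s' j) S T))" for T
    by (rule lin_on_comp[OF lin_on_tperm[of UNIV] lin_on_blin_left]) simp
  show "lin_on (Gr (tensor (mixed A r s)) p)
      (\<lambda>S. tperm (replicate ?N V) ?b (cc ?n i ?m (r' + j) (tperm (replicate ?n V) id S) (tperm (replicate ?m V) id T)))" for T
    by (rule lin_on_comp[OF lin_on_tperm[of UNIV] lin_on_comp[OF lin_cc_left[of UNIV] lin_on_tperm]]) simp_all
  show "lin_on (Gr (tensor (mixed A r' s')) p') (\<lambda>T. tperm (replicate ?N V) id (blin (dcontr r s i r' s' j) S T))"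
    if "S \<in> Gr (tensor (mixed A r s)) p" for S
    by (rule lin_on_comp[OF lin_on_tperm[of UNIV] lin_on_blin_right[OF bimlin_dcontr[OF i j] that]]) simp
  show "lin_on (Gr (tensor (mixed A r' s')) p')
      (\<lambda>T. tperm (replicate ?N V) ?b (cc ?n i ?m (r' + j) (tperm (replicate ?n V) id S) (tperm (replicate ?m V) id T)))"
    if "S \<in> Gr (tensor (mixed A r s)) p" for S
    by (rule lin_on_comp[OF lin_on_tperm[of UNIV] lin_on_comp[OF lin_cc_right[OF ij tperm_mem[OF mixed_compat_id that]]
      lin_on_tperm tperm_mem[OF mixed_compat_id]]]) simp_all
  fix xs ys
  assume xs: "homog (mixed A r s) xs" and ys: "homog (mixed A r' s') ys"
  have sub: "homog (replicate ?n V) xs" "homog (replicate ?m V) ys"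
    using homog_permute[OF mixed_compat_id xs] homog_permute[OF mixed_compat_id ys] by simp_all
  have N: "r + r' - 1 + (s + s' - 1) = ?N" using i j by simp
  have bp: "?b permutes {..<?N}" using i j by (intro block_swap_permutes) auto
  show "tperm (replicate ?N V) id (blin (dcontr r s i r' s' j) (pure (mixed A r s) xs) (pure (mixed A r' s') ys)) =
      tperm (replicate ?N V) ?b (cc ?n i ?m (r' + j) (tperm (replicate ?n V) id (pure (mixed A r s) xs))
        (tperm (replicate ?m V) id (pure (mixed A r' s') ys)))"
    unfolding blin_pure[OF bimlin_dcontr[OF i j] xs ys] dcontr_eq[OF i j xs ys] tperm_id_pure[OF mixed_compat_id]
      cc_pure[OF ij sub] contr_def tperm_scale tperm_pure[OF compat_replicate[OF bp]]
      tperm_id_pure[OF mixed_compat_id[of "r + r' - 1" "s + s' - 1", unfolded N]] ..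
qed

theorem dioperad_End: "dioperad (End_di A)"
proof (rule dioperad_embedding[where Q = "phi_pull (End_cyc V double_form)" and \<iota> = "\<lambda>r s. tperm (replicate (r + s) V) id"])
  interpret C: cyclic_operad "End_cyc V double_form" by (rule cyclic_operad_End)
  have sel: "Dsp (End_di A) r s = tensor (mixed A r s)" "dact (End_di A) r s p \<sigma> \<tau> = tperm (mixed A r s) (perm_sum r \<sigma> \<tau>)"
    "Csp (End_cyc V double_form) n = tensor (replicate n V)" "cact (End_cyc V double_form) n p = tperm (replicate n V)"
    for r s p \<sigma> \<tau> n
    by (simp_all add: End_di_def End_cyc_def)
  show "dioperad (phi_pull (End_cyc V double_form))" by (rule C.dioperad_phi_pull)
  fix r s r' s' i j :: nat and p p' :: int and \<sigma> \<tau> :: "nat \<Rightarrow> nat" and a b :: "('k, 'a \<times> ('a \<Rightarrow> 'k)) tens"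
  show "dg_vector_space (Dsp (End_di A) r s)" unfolding sel by (rule dg_tensor[OF dg_mixed])
  show "chain_map (Dsp (End_di A) r s) (Dsp (phi_pull (End_cyc V double_form)) r s) (\<lambda>p. tperm (replicate (r + s) V) id)"
    unfolding chain_map_def sel phi_pull_sel tensor_sel(1)
    by (simp add: tperm_add tperm_scale tperm_mem[OF mixed_compat_id] tperm_Dif[OF mixed_compat_id dg_mixed dg_replicate])
  show "a = b" if "a \<in> Gr (Dsp (End_di A) r s) p" "b \<in> Gr (Dsp (End_di A) r s) p"
    "tperm (replicate (r + s) V) id a = tperm (replicate (r + s) V) id b"
    using that unfolding sel mixed_orient by (rule orient_inj)
  show "dact (End_di A) r s p \<sigma> \<tau> a \<in> Gr (Dsp (End_di A) r s) p"
    if "\<sigma> permutes {..<r}" "\<tau> permutes {..<s}" "a \<in> Gr (Dsp (End_di A) r s) p"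
    using that unfolding sel by (intro tperm_mem[OF mixed_compat])
  show "tperm (replicate (r + s) V) id (dact (End_di A) r s p \<sigma> \<tau> a) =
      dact (phi_pull (End_cyc V double_form)) r s p \<sigma> \<tau> (tperm (replicate (r + s) V) id a)"
    if "\<sigma> permutes {..<r}" "\<tau> permutes {..<s}" "a \<in> Gr (Dsp (End_di A) r s) p"
    using that tperm_tperm[OF mixed_compat mixed_compat_id] tperm_tperm[OF mixed_compat_id compat_replicate[OF perm_sum_permutes]]
    unfolding sel phi_pull_sel by simp
  show "dcomp (End_di A) r s p i r' s' p' j a b \<in> Gr (Dsp (End_di A) (r + r' - 1) (s + s' - 1)) (p + p')"
    if "i < r" "j < s'" "a \<in> Gr (Dsp (End_di A) r s) p" "b \<in> Gr (Dsp (End_di A) r' s') p'"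
    using that unfolding sel dcomp_End by (rule dcomp_mem)
  show "tperm (replicate (r + r' - 1 + (s + s' - 1)) V) id (dcomp (End_di A) r s p i r' s' p' j a b) =
      dcomp (phi_pull (End_cyc V double_form)) r s p i r' s' p' j (tperm (replicate (r + s) V) id a) (tperm (replicate (r' + s') V) id b)"
    if ij: "i < r" "j < s'" and ab: "a \<in> Gr (Dsp (End_di A) r s) p" "b \<in> Gr (Dsp (End_di A) r' s') p'"
  proof -
    have N: "r + r' - 1 + (s + s' - 1) = r + s + (r' + s') - 2" using ij by simp
    show ?thesis
      using dcomp_embed[OF ij] ab unfolding sel phi_pull_sel dcomp_End ccomp_End N by blast
  qed
qed

end

section \<open>Morphisms of cyclic operads\<close>

text \<open>The conditions of \<open>cyc_hom\<close> without the requirement to be undefined off the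
  carriers, so that maps given by a formula, such as \<open>canonical_map\<close>, qualify.\<close>

definition cyc_map ::
  "('k, 'o::ab_group_add) cyc_data \<Rightarrow> ('k, 'q::ab_group_add) cyc_data \<Rightarrow> (nat \<Rightarrow> int \<Rightarrow> 'o \<Rightarrow> 'q) \<Rightarrow> bool" where
  "cyc_map X Y f \<longleftrightarrow>
     (\<forall>n>0. chain_map (Csp X n) (Csp Y n) (f n)) \<and>
     (\<forall>n>0. \<forall>p \<sigma>. \<sigma> permutes {..<n} \<longrightarrow> (\<forall>a \<in> Gr (Csp X n) p.
        f n p (cact X n p \<sigma> a) = cact Y n p \<sigma> (f n p a))) \<and>
     (\<forall>n m p q i j. i < n \<and> j < m \<and> 2 < n + m \<longrightarrow>
        (\<forall>a \<in> Gr (Csp X n) p. \<forall>b \<in> Gr (Csp X m) q.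
          f (n + m - 2) (p + q) (ccomp X n p i m q j a b) =
          ccomp Y n p i m q j (f n p a) (f m q b)))"

lemma cyc_hom_iff: "f \<in> cyc_hom X Y \<longleftrightarrow> (\<forall>n p. f n p \<in> extensional (ccar X n p)) \<and> cyc_map X Y f"
  by (auto simp: cyc_hom_def cyc_map_def)

lemma cyc_mapI:
  assumes "\<And>n. 0 < n \<Longrightarrow> chain_map (Csp X n) (Csp Y n) (f n)"
    and "\<And>n p \<sigma> a. \<lbrakk>0 < n; \<sigma> permutes {..<n}; a \<in> Gr (Csp X n) p\<rbrakk>
      \<Longrightarrow> f n p (cact X n p \<sigma> a) = cact Y n p \<sigma> (f n p a)"
    and "\<And>n m p q i j a b. \<lbrakk>i < n; j < m; 2 < n + m; a \<in> Gr (Csp X n) p; b \<in> Gr (Csp X m) q\<rbrakk>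
      \<Longrightarrow> f (n + m - 2) (p + q) (ccomp X n p i m q j a b) = ccomp Y n p i m q j (f n p a) (f m q b)"
  shows "cyc_map X Y f"
  by (simp add: cyc_map_def assms)

lemma cyc_mapD:
  assumes "cyc_map X Y f"
  shows "0 < n \<Longrightarrow> chain_map (Csp X n) (Csp Y n) (f n)"
    and "\<lbrakk>0 < n; \<sigma> permutes {..<n}; a \<in> Gr (Csp X n) p\<rbrakk>
      \<Longrightarrow> f n p (cact X n p \<sigma> a) = cact Y n p \<sigma> (f n p a)"
    and "\<lbrakk>i < n; j < m; 2 < n + m; a \<in> Gr (Csp X n) p; b \<in> Gr (Csp X m) q\<rbrakk>
      \<Longrightarrow> f (n + m - 2) (p + q) (ccomp X n p i m q j a b) = ccomp Y n p i m q j (f n p a) (f m q b)"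
  using assms by (simp_all add: cyc_map_def)

lemma ccar_pos: "0 < n \<Longrightarrow> ccar \<O> n p = Gr (Csp \<O> n) p"
  by (simp add: ccar_def)

lemma chain_mapI:
  assumes "\<And>p x. x \<in> Gr V p \<Longrightarrow> f p x \<in> Gr W p"
    and "\<And>p x y. x \<in> Gr V p \<Longrightarrow> y \<in> Gr V p \<Longrightarrow> f p (x + y) = f p x + f p y"
    and "\<And>p c x. x \<in> Gr V p \<Longrightarrow> f p (Scl V c x) = Scl W c (f p x)"
    and "\<And>p x. x \<in> Gr V p \<Longrightarrow> f (p + 1) (Dif V p x) = Dif W p (f p x)"
  shows "chain_map V W f"
  unfolding chain_map_def using assms by simp

text \<open>Data closed under the operations; for such data injective maps reflect the conditions on morphisms.\<close>

definition cyc_closed :: "('k::field, 'o::ab_group_add) cyc_data \<Rightarrow> bool" where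
  "cyc_closed X \<longleftrightarrow> (\<forall>n>0. dg_vector_space (Csp X n)) \<and>
     (\<forall>n p \<sigma>. 0 < n \<and> \<sigma> permutes {..<n} \<longrightarrow> (\<forall>a \<in> Gr (Csp X n) p. cact X n p \<sigma> a \<in> Gr (Csp X n) p)) \<and>
     (\<forall>n m p q i j. i < n \<and> j < m \<and> 2 < n + m \<longrightarrow> (\<forall>a \<in> Gr (Csp X n) p. \<forall>b \<in> Gr (Csp X m) q.
        ccomp X n p i m q j a b \<in> Gr (Csp X (n + m - 2)) (p + q)))"

lemma cyc_closedD:
  assumes "cyc_closed X"
  shows "0 < n \<Longrightarrow> dg_vector_space (Csp X n)"
    and "\<lbrakk>0 < n; \<sigma> permutes {..<n}; a \<in> Gr (Csp X n) p\<rbrakk> \<Longrightarrow> cact X n p \<sigma> a \<in> Gr (Csp X n) p"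
    and "\<lbrakk>i < n; j < m; 2 < n + m; a \<in> Gr (Csp X n) p; b \<in> Gr (Csp X m) q\<rbrakk>
      \<Longrightarrow> ccomp X n p i m q j a b \<in> Gr (Csp X (n + m - 2)) (p + q)"
  using assms by (simp_all add: cyc_closed_def)

lemma (in cyclic_operad) cyc_closed: "cyc_closed \<O>"
  by (simp add: cyc_closed_def space K_act K_comp)

lemma cyc_compose_apply: "a \<in> ccar \<O> n p \<Longrightarrow> cyc_compose \<O> g f n p a = g n p (f n p a)"
  by (simp add: cyc_compose_def)

text \<open>On the carriers the composite is given by its formula. Since \<O> is closed under its
  operations, every element at which a condition on morphisms evaluates it lies in a carrier, and
  the conditions pass on from \<open>f\<close> and \<open>g\<close>.\<close>

lemma cyc_compose_hom:
  assumes \<O>: "cyc_closed \<O>" and f: "f \<in> cyc_hom \<O> X" and g: "cyc_map X Y g"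
  shows "cyc_compose \<O> g f \<in> cyc_hom \<O> Y"
  unfolding cyc_hom_iff
proof (intro conjI allI cyc_mapI)
  note fm = cyc_mapD[OF conjunct2[OF f[unfolded cyc_hom_iff]]] and gm = cyc_mapD[OF g] and c = cyc_closedD[OF \<O>]
  show "cyc_compose \<O> g f n p \<in> extensional (ccar \<O> n p)" for n p
    by (simp add: cyc_compose_def)
  have ap: "cyc_compose \<O> g f n p a = g n p (f n p a)" if "0 < n" "a \<in> Gr (Csp \<O> n) p" for n p a
    using that by (simp add: cyc_compose_apply ccar_pos)
  have f_mem: "f n p a \<in> Gr (Csp X n) p" if "0 < n" "a \<in> Gr (Csp \<O> n) p" for n p a
    by (rule chain_mapD(1)[OF fm(1)[OF that(1)] that(2)])
  show "chain_map (Csp \<O> n) (Csp Y n) (cyc_compose \<O> g f n)" if n: "0 < n" for n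
  proof (rule chain_mapI)
    note d = c(1)[OF n] and F = chain_mapD[OF fm(1)[OF n]] and G = chain_mapD[OF gm(1)[OF n] f_mem[OF n]]
    fix p x assume x: "x \<in> Gr (Csp \<O> n) p"
    show "cyc_compose \<O> g f n p x \<in> Gr (Csp Y n) p" unfolding ap[OF n x] by (rule G(1)[OF x])
    show "cyc_compose \<O> g f n p (x + y) = cyc_compose \<O> g f n p x + cyc_compose \<O> g f n p y" if "y \<in> Gr (Csp \<O> n) p" for y
      unfolding ap[OF n x] ap[OF n that] ap[OF n dg_add[OF d x that]] F(2)[OF x that] by (rule G(2)[OF x f_mem[OF n that]])
    show "cyc_compose \<O> g f n p (Scl (Csp \<O> n) k x) = Scl (Csp Y n) k (cyc_compose \<O> g f n p x)" for k
      unfolding ap[OF n x] ap[OF n dg_scale[OF d x]] F(3)[OF x] by (rule G(3)[OF x])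
    show "cyc_compose \<O> g f n (p + 1) (Dif (Csp \<O> n) p x) = Dif (Csp Y n) p (cyc_compose \<O> g f n p x)"
      unfolding ap[OF n x] ap[OF n dg_Dif[OF d x]] F(4)[OF x] by (rule G(4)[OF x])
  qed
  show "cyc_compose \<O> g f n p (cact \<O> n p \<sigma> a) = cact Y n p \<sigma> (cyc_compose \<O> g f n p a)"
    if "0 < n" "\<sigma> permutes {..<n}" "a \<in> Gr (Csp \<O> n) p" for n p \<sigma> a
    unfolding ap[OF that(1,3)] ap[OF that(1) c(2)[OF that]] fm(2)[OF that] by (rule gm(2)[OF that(1,2) f_mem[OF that(1,3)]])
  show "cyc_compose \<O> g f (n + m - 2) (p + q) (ccomp \<O> n p i m q j a b) =
      ccomp Y n p i m q j (cyc_compose \<O> g f n p a) (cyc_compose \<O> g f m q b)"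
    if h: "i < n" "j < m" "2 < n + m" "a \<in> Gr (Csp \<O> n) p" "b \<in> Gr (Csp \<O> m) q" for n m p q i j a b
  proof -
    have pos: "0 < n" "0 < m" "0 < n + m - 2" using h by auto
    show ?thesis
      unfolding ap[OF pos(1) h(4)] ap[OF pos(2) h(5)] ap[OF pos(3) c(3)[OF h]] fm(3)[OF h]
      by (rule gm(3)[OF h(1-3) f_mem[OF pos(1) h(4)] f_mem[OF pos(2) h(5)]])
  qed
qed

text \<open>A preimage of \<open>h\<close> is built by inverting \<open>g\<close> elementwise. It
  satisfies the conditions of a morphism because they hold after applying the injective map
  \<open>g\<close>. Off the carriers all morphisms are undefined, so they are determined by their
  values on the carriers.\<close>

lemma bij_betw_cyc_compose:
  assumes \<O>: "cyc_closed \<O>" and X: "cyc_closed X" and g: "cyc_map X Y g"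
    and bij: "\<And>n p. 0 < n \<Longrightarrow> bij_betw (g n p) (Gr (Csp X n) p) (Gr (Csp Y n) p)"
  shows "bij_betw (cyc_compose \<O> g) (cyc_hom \<O> X) (cyc_hom \<O> Y)"
proof (rule bij_betw_imageI)
  note gm = cyc_mapD[OF g] and c = cyc_closedD[OF \<O>] and x = cyc_closedD[OF X]
  have inj: "a = b" if "0 < n" "a \<in> Gr (Csp X n) p" "b \<in> Gr (Csp X n) p" "g n p a = g n p b" for n p a b
    using bij_betw_imp_inj_on[OF bij[OF that(1), of p]] that by (auto dest: inj_onD)
  show "inj_on (cyc_compose \<O> g) (cyc_hom \<O> X)"
  proof (rule inj_onI, intro ext)
    fix f f' n p a
    assume f: "f \<in> cyc_hom \<O> X" and f': "f' \<in> cyc_hom \<O> X" and eq: "cyc_compose \<O> g f = cyc_compose \<O> g f'"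
    show "f n p a = f' n p a"
    proof (cases "a \<in> ccar \<O> n p")
      case True
      then have n: "0 < n" and a: "a \<in> Gr (Csp \<O> n) p" by (auto simp: ccar_def split: if_splits)
      have "f n p a \<in> Gr (Csp X n) p" "f' n p a \<in> Gr (Csp X n) p"
        using chain_mapD(1)[OF cyc_mapD(1)[of \<O> X _, OF _ n] a] f f' unfolding cyc_hom_iff by blast+
      moreover have "g n p (f n p a) = g n p (f' n p a)"
        using fun_cong[OF fun_cong[OF fun_cong[OF eq, of n], of p], of a] True by (simp add: cyc_compose_apply)
      ultimately show ?thesis by (rule inj[OF n])
    next
      case False
      then show ?thesis using f f' unfolding cyc_hom_iff by (metis extensional_arb)
    qed
  qed
  show "cyc_compose \<O> g ` cyc_hom \<O> X = cyc_hom \<O> Y"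
  proof (intro equalityI subsetI)
    fix h assume h: "h \<in> cyc_hom \<O> Y"
    note hm = cyc_mapD[OF conjunct2[OF h[unfolded cyc_hom_iff]]]
    \<comment> \<open>\<open>restrict\<close> makes the preimage undefined off the carriers, as
      membership in \<open>cyc_hom\<close> demands.\<close>
    define f where "f = (\<lambda>n p. restrict (\<lambda>a. inv_into (Gr (Csp X n) p) (g n p) (h n p a)) (ccar \<O> n p))"
    have f: "f n p a \<in> Gr (Csp X n) p" "g n p (f n p a) = h n p a" if "0 < n" "a \<in> Gr (Csp \<O> n) p" for n p a
    proof -
      have "h n p a \<in> g n p ` Gr (Csp X n) p"
        using chain_mapD(1)[OF hm(1)[OF that(1)] that(2)] bij_betw_imp_surj_on[OF bij[OF that(1), of p]] by simp
      then show "f n p a \<in> Gr (Csp X n) p" "g n p (f n p a) = h n p a"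
        using that by (simp_all add: f_def ccar_pos inv_into_into f_inv_into_f)
    qed
    have "f \<in> cyc_hom \<O> X"
      unfolding cyc_hom_iff
    proof (intro conjI allI cyc_mapI)
      show "f n p \<in> extensional (ccar \<O> n p)" for n p by (simp add: f_def)
      show "chain_map (Csp \<O> n) (Csp X n) (f n)" if n: "0 < n" for n
      proof (rule chain_mapI)
        note d = c(1)[OF n] and dx = x(1)[OF n] and H = chain_mapD[OF hm(1)[OF n]] and G = chain_mapD[OF gm(1)[OF n]]
        fix p u assume u: "u \<in> Gr (Csp \<O> n) p"
        note fu = f[OF n u]
        show "f n p u \<in> Gr (Csp X n) p" by (rule fu(1))
        show "f n p (u + v) = f n p u + f n p v" if v: "v \<in> Gr (Csp \<O> n) p" for v
          using f[OF n dg_add[OF d u v]] f[OF n v] fu H(2)[OF u v] G(2)[OF fu(1) f(1)[OF n v]]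
          by (intro inj[OF n f(1)[OF n dg_add[OF d u v]] dg_add[OF dx fu(1) f(1)[OF n v]]]) simp
        show "f n p (Scl (Csp \<O> n) k u) = Scl (Csp X n) k (f n p u)" for k
          using f[OF n dg_scale[OF d u]] fu H(3)[OF u] G(3)[OF fu(1)]
          by (intro inj[OF n f(1)[OF n dg_scale[OF d u]] dg_scale[OF dx fu(1)]]) simp
        show "f n (p + 1) (Dif (Csp \<O> n) p u) = Dif (Csp X n) p (f n p u)"
          using f[OF n dg_Dif[OF d u]] fu H(4)[OF u] G(4)[OF fu(1)]
          by (intro inj[OF n f(1)[OF n dg_Dif[OF d u]] dg_Dif[OF dx fu(1)]]) simp
      qed
      show "f n p (cact \<O> n p \<sigma> a) = cact X n p \<sigma> (f n p a)"
        if a: "0 < n" "\<sigma> permutes {..<n}" "a \<in> Gr (Csp \<O> n) p" for n p \<sigma> a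
        using f(2)[OF a(1) c(2)[OF a]] f(2)[OF a(1,3)] hm(2)[OF a] gm(2)[OF a(1,2) f(1)[OF a(1,3)]]
        by (intro inj[OF a(1) f(1)[OF a(1) c(2)[OF a]] x(2)[OF a(1,2) f(1)[OF a(1,3)]]]) simp
      show "f (n + m - 2) (p + q) (ccomp \<O> n p i m q j a b) = ccomp X n p i m q j (f n p a) (f m q b)"
        if ab: "i < n" "j < m" "2 < n + m" "a \<in> Gr (Csp \<O> n) p" "b \<in> Gr (Csp \<O> m) q" for n m p q i j a b
      proof -
        have pos: "0 < n" "0 < m" "0 < n + m - 2" using ab by auto
        note fa = f[OF pos(1) ab(4)] and fb = f[OF pos(2) ab(5)] and fab = f[OF pos(3) c(3)[OF ab]]
        show ?thesis
          using fa(2) fb(2) fab(2) hm(3)[OF ab] gm(3)[OF ab(1-3) fa(1) fb(1)]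
          by (intro inj[OF pos(3) fab(1) x(3)[OF ab(1-3) fa(1) fb(1)]]) simp
      qed
    qed
    moreover have "cyc_compose \<O> g f = h"
    proof (intro ext)
      fix n p a
      show "cyc_compose \<O> g f n p a = h n p a"
      proof (cases "a \<in> ccar \<O> n p")
        case True
        then have "0 < n" "a \<in> Gr (Csp \<O> n) p" by (auto simp: ccar_def split: if_splits)
        then show ?thesis using f(2) True by (simp add: cyc_compose_apply)
      next
        case False
        then show ?thesis using h unfolding cyc_hom_iff by (metis cyc_compose_def extensional_arb restrict_apply)
      qed
    qed
    ultimately show "h \<in> cyc_compose \<O> g ` cyc_hom \<O> X" by blast
  qed (use cyc_compose_hom[OF \<O> _ g] in blast)
qed


section \<open>Forgetting directions\<close>

text \<open>On \<open>{..<card X}\<close> the map is a composite of injections: the enumeration of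
  \<open>X\<close>, then \<sigma>, then the rank in the image.\<close>

lemma std_permutes:
  assumes "finite X" "inj_on \<sigma> X"
  shows "std \<sigma> X permutes {..<card X}"
proof (rule bij_imp_permutes)
  have card: "card (\<sigma> ` X) = card X" by (rule card_image[OF assms(2)])
  have "std \<sigma> X k < card X" if "k < card X" for k
    using that rank_less[of "\<sigma> ` X" "\<sigma> (sorted_list_of_set X ! k)"] nth_sorted_mem[OF assms(1) that] assms(1) card
    by (simp add: std_def)
  moreover have "inj_on (std \<sigma> X) {..<card X}"
  proof (rule inj_onI)
    fix k l assume h: "k \<in> {..<card X}" "l \<in> {..<card X}" "std \<sigma> X k = std \<sigma> X l"
    let ?x = "sorted_list_of_set X ! k" and ?y = "sorted_list_of_set X ! l"
    have xy: "?x \<in> X" "?y \<in> X" using h nth_sorted_mem[OF assms(1)] by auto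
    have "rank (\<sigma> ` X) (\<sigma> ?x) = rank (\<sigma> ` X) (\<sigma> ?y)" using h by (simp add: std_def)
    then have "\<sigma> ?x = \<sigma> ?y" using nth_rank[of "\<sigma> ` X"] xy assms(1) by (metis finite_imageI imageI)
    then have "?x = ?y" using assms(2) xy by (auto dest: inj_onD)
    then show "k = l" using rank_nth[OF assms(1)] h by (metis lessThan_iff)
  qed
  ultimately show "bij_betw (std \<sigma> X) {..<card X} {..<card X}"
    unfolding bij_betw_def using endo_inj_surj[of "{..<card X}" "std \<sigma> X"] by blast
qed (simp add: std_def)

lemma glued_subset:
  assumes "i < n" "j < m" "X \<subseteq> {..<n}" "Y \<subseteq> {..<m}"
  shows "glued_outputs n i X j Y \<subseteq> {..<n + m - 2}"
  unfolding glued_outputs_def glue_flags[OF assms(1,2)] using assms(3,4) by blast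

lemma card_glued:
  assumes "i < n" "j < m" "X \<subseteq> {..<n}" "Y \<subseteq> {..<m}"
  shows "card (glued_outputs n i X j Y) = card (X - {i}) + card (Y - {j})"
proof -
  have fin: "finite X" "finite Y" using assms finite_subset by blast+
  have "skip i ` (X - {i}) \<subseteq> {..<n - 1}" using skip_image[OF assms(1)] assms(3) by blast
  then have "skip i ` (X - {i}) \<inter> (\<lambda>y. n - 1 + skip j y) ` (Y - {j}) = {}" by fastforce
  moreover have "inj_on (skip i) (X - {i})" "inj_on (\<lambda>y. n - 1 + skip j y) (Y - {j})"
    by (auto simp: inj_on_def skip_eq_iff)
  ultimately show ?thesis
    unfolding glued_outputs_def using fin by (simp add: card_Un_disjoint card_image)
qed

lemma dio_homD:
  assumes "f \<in> dio_hom P Q"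
  shows "0 < r + s \<Longrightarrow> chain_map (Dsp P r s) (Dsp Q r s) (f r s)"
    and "\<lbrakk>0 < r + s; \<sigma> permutes {..<r}; \<tau> permutes {..<s}; a \<in> Gr (Dsp P r s) p\<rbrakk>
      \<Longrightarrow> f r s p (dact P r s p \<sigma> \<tau> a) = dact Q r s p \<sigma> \<tau> (f r s p a)"
    and "\<lbrakk>i < r; j < s'; 2 < r + s + r' + s'; a \<in> Gr (Dsp P r s) p; b \<in> Gr (Dsp P r' s') p'\<rbrakk>
      \<Longrightarrow> f (r + r' - 1) (s + s' - 1) (p + p') (dcomp P r s p i r' s' p' j a b) =
        dcomp Q r s p i r' s' p' j (f r s p a) (f r' s' p' b)"
proof -
  note f = assms[unfolded dio_hom_def mem_Collect_eq, THEN conjunct2]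
  show "0 < r + s \<Longrightarrow> chain_map (Dsp P r s) (Dsp Q r s) (f r s)"
    by (rule f[THEN conjunct1, rule_format])
  show "\<lbrakk>0 < r + s; \<sigma> permutes {..<r}; \<tau> permutes {..<s}; a \<in> Gr (Dsp P r s) p\<rbrakk>
      \<Longrightarrow> f r s p (dact P r s p \<sigma> \<tau> a) = dact Q r s p \<sigma> \<tau> (f r s p a)"
    by (rule f[THEN conjunct2, THEN conjunct1, rule_format]) (intro conjI | assumption)+
  show "\<lbrakk>i < r; j < s'; 2 < r + s + r' + s'; a \<in> Gr (Dsp P r s) p; b \<in> Gr (Dsp P r' s') p'\<rbrakk>
      \<Longrightarrow> f (r + r' - 1) (s + s' - 1) (p + p') (dcomp P r s p i r' s' p' j a b) =
        dcomp Q r s p i r' s' p' j (f r s p a) (f r' s' p' b)"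
    by (rule f[THEN conjunct2, THEN conjunct2, rule_format]) (intro conjI | assumption)+
qed

lemma chain_map_zero: "chain_map V W f \<Longrightarrow> dg_vector_space V \<Longrightarrow> f p 0 = 0"
  using chain_mapD(2)[of V W f 0 p 0] dg_zero_mem by fastforce

lemma dg_sum: "dg_vector_space V \<Longrightarrow> (\<And>s. s \<in> S \<Longrightarrow> x s \<in> Gr V p) \<Longrightarrow> sum x S \<in> Gr V p"
  by (induction S rule: infinite_finite_induct) (auto intro: dg_zero_mem dg_add)

lemma chain_map_sum:
  assumes "chain_map V W f" "dg_vector_space V" "\<And>s. s \<in> S \<Longrightarrow> x s \<in> Gr V p"
  shows "f p (sum x S) = (\<Sum>s\<in>S. f p (x s))"
  using assms(3)
proof (induction S rule: infinite_finite_induct)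
  case (insert a S)
  then have "f p (x a + sum x S) = f p (x a) + f p (sum x S)"
    by (intro chain_mapD(2)[OF assms(1)] dg_sum[OF assms(2)]) auto
  then show ?case using insert by simp
qed (simp_all add: chain_map_zero[OF assms(1,2)])

lemma dg_scale_zero: "dg_vector_space V \<Longrightarrow> Scl V c 0 = 0"
proof -
  assume "dg_vector_space V"
  then interpret vector_space "Scl V" by (simp add: dg_vector_space_def)
  show ?thesis by simp
qed

lemma phi_push_Gr: "u \<in> Gr (Csp (phi_push P) n) p \<longleftrightarrow>
    (\<forall>X. if X \<subseteq> {..<n} then u X \<in> Gr (Dsp P (card X) (n - card X)) p else u X = 0)"
  by (simp add: phi_push_def)

lemma phi_push_sel:
  "Scl (Csp (phi_push P) n) c u X = Scl (Dsp P (card X) (n - card X)) c (u X)"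
  "Dif (Csp (phi_push P) n) p u X = (if X \<subseteq> {..<n} then Dif (Dsp P (card X) (n - card X)) p (u X) else 0)"
  "cact (phi_push P) n p \<sigma> u Y = (if Y \<subseteq> {..<n} then dact P (card (inv \<sigma> ` Y)) (n - card (inv \<sigma> ` Y)) p
     (std \<sigma> (inv \<sigma> ` Y)) (std \<sigma> ({..<n} - inv \<sigma> ` Y)) (u (inv \<sigma> ` Y)) else 0)"
  "ccomp (phi_push P) n p i m q j u v Z = (\<Sum>X \<in> Pow {..<n}. \<Sum>Y \<in> Pow {..<m}.
     if glued_outputs n i X j Y = Z then glue P n p i X m q j Y (u X) (v Y) else 0)"
  by (simp_all add: phi_push_def Let_def)

lemma inv_image_facts:
  fixes \<sigma> :: "nat \<Rightarrow> nat"
  assumes "\<sigma> permutes {..<n}" "Y \<subseteq> {..<n}"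
  shows "inv \<sigma> ` Y \<subseteq> {..<n}" "card (inv \<sigma> ` Y) = card Y" "\<sigma> ` inv \<sigma> ` Y = Y"
    "std \<sigma> (inv \<sigma> ` Y) permutes {..<card Y}" "std \<sigma> ({..<n} - inv \<sigma> ` Y) permutes {..<n - card Y}"
proof -
  have p: "inv \<sigma> permutes {..<n}" by (rule permutes_inv[OF assms(1)])
  show sub: "inv \<sigma> ` Y \<subseteq> {..<n}" using assms(2) permutes_image[OF p] by blast
  show card: "card (inv \<sigma> ` Y) = card Y" using permutes_inj[OF p] by (simp add: card_image inj_on_subset)
  show "\<sigma> ` inv \<sigma> ` Y = Y" by (simp add: image_image permutes_inverses(1)[OF assms(1)])
  have inj: "inj_on \<sigma> Z" for Z
    by (rule inj_on_subset[OF permutes_inj[OF assms(1)] subset_UNIV])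
  show "std \<sigma> (inv \<sigma> ` Y) permutes {..<card Y}" "std \<sigma> ({..<n} - inv \<sigma> ` Y) permutes {..<n - card Y}"
    using std_permutes[OF finite_subset[OF sub] inj] std_permutes[of "{..<n} - inv \<sigma> ` Y", OF _ inj] card card_compl[OF sub]
    by simp_all
qed

lemma card_le: "X \<subseteq> {..<n} \<Longrightarrow> card X \<le> n"
  using card_mono[of "{..<n}" X] by simp

text \<open>The glued edge uses up one output and one input, whichever of the two corollas each
  comes from.\<close>

lemma glue_arities:
  assumes "i < n" "j < m" "X \<subseteq> {..<n}" "Y \<subseteq> {..<m}" "(i \<in> X) \<noteq> (j \<in> Y)"
  shows "card (glued_outputs n i X j Y) = card X + card Y - 1"
    and "n + m - 2 - card (glued_outputs n i X j Y) = n - card X + (m - card Y) - 1"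
proof -
  have fin: "finite X" "finite Y" using assms finite_subset by blast+
  have "card X \<le> n" "card Y \<le> m" using assms card_le by auto
  moreover have "0 < card X" if "i \<in> X" using that fin by (auto simp: card_gt_0_iff)
  moreover have "0 < card Y" if "j \<in> Y" using that fin by (auto simp: card_gt_0_iff)
  moreover have "card X < n" if "i \<notin> X"
    using psubset_card_mono[of "{..<n}" X] that assms(1,3) by auto
  moreover have "card Y < m" if "j \<notin> Y"
    using psubset_card_mono[of "{..<m}" Y] that assms(2,4) by auto
  ultimately show "card (glued_outputs n i X j Y) = card X + card Y - 1"
    "n + m - 2 - card (glued_outputs n i X j Y) = n - card X + (m - card Y) - 1"
    unfolding card_glued[OF assms(1-4)] using assms(5) fin by (auto simp: card_Diff_singleton_if)
qed

section \<open>Push-forward of a dioperad and of its morphisms\<close>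

context dioperad
begin

lemma dact_mem: "\<lbrakk>0 < r + s; \<sigma> permutes {..<r}; \<tau> permutes {..<s}; a \<in> Gr (Dsp P r s) p\<rbrakk>
    \<Longrightarrow> dact P r s p \<sigma> \<tau> a \<in> Gr (Dsp P r s) p"
  by (rule chain_mapD(1)[OF act_chain])

lemma dcomp_mem: "\<lbrakk>i < r; j < s'; 2 < r + s + r' + s'; a \<in> Gr (Dsp P r s) p; b \<in> Gr (Dsp P r' s') p'\<rbrakk>
    \<Longrightarrow> dcomp P r s p i r' s' p' j a b \<in> Gr (Dsp P (r + r' - 1) (s + s' - 1)) (p + p')"
  by (rule chain_bimapD(1)[OF comp_chain])

lemma glue_out:
  assumes "i < n" "j < m" "2 < n + m" "X \<subseteq> {..<n}" "Y \<subseteq> {..<m}" "i \<in> X" "j \<notin> Y"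
    "a \<in> Gr (Dsp P (card X) (n - card X)) p" "b \<in> Gr (Dsp P (card Y) (m - card Y)) q"
  shows "rank X i < card X" "rank ({..<m} - Y) j < m - card Y" "2 < card X + (n - card X) + card Y + (m - card Y)"
    "dcomp P (card X) (n - card X) p (rank X i) (card Y) (m - card Y) q (rank ({..<m} - Y) j) a b
       \<in> Gr (Dsp P (card X + card Y - 1) (n - card X + (m - card Y) - 1)) (p + q)"
proof -
  have fin: "finite X" using assms finite_subset by blast
  show 1: "rank X i < card X" using rank_less[OF fin assms(6)] .
  show 2: "rank ({..<m} - Y) j < m - card Y"
    using rank_less[of "{..<m} - Y" j] assms card_compl[OF assms(5)] by simp
  show 3: "2 < card X + (n - card X) + card Y + (m - card Y)"
    using card_le[OF assms(4)] card_le[OF assms(5)] assms(3) by simp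
  show "dcomp P (card X) (n - card X) p (rank X i) (card Y) (m - card Y) q (rank ({..<m} - Y) j) a b
       \<in> Gr (Dsp P (card X + card Y - 1) (n - card X + (m - card Y) - 1)) (p + q)"
    by (rule dcomp_mem[OF 1 2 3 assms(8,9)])
qed

lemma glue_in_perms:
  assumes "i < n" "j < m" "X \<subseteq> {..<n}" "Y \<subseteq> {..<m}" "i \<notin> X" "j \<in> Y"
  shows "block_swap 0 (card Y - 1) (card X) permutes {..<card X + card Y - 1}"
    "block_swap 0 (m - card Y) (n - card X - 1) permutes {..<n - card X + (m - card Y) - 1}"
proof -
  have "0 < card Y" using assms finite_subset[OF assms(4)] by (auto simp: card_gt_0_iff)
  moreover have "card X < n" using psubset_card_mono[of "{..<n}" X] assms by auto
  ultimately show "block_swap 0 (card Y - 1) (card X) permutes {..<card X + card Y - 1}"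
    "block_swap 0 (m - card Y) (n - card X - 1) permutes {..<n - card X + (m - card Y) - 1}"
    by (auto intro!: block_swap_permutes)
qed

lemma glue_mem:
  assumes h: "i < n" "j < m" "2 < n + m" "X \<subseteq> {..<n}" "Y \<subseteq> {..<m}"
    and a: "a \<in> Gr (Dsp P (card X) (n - card X)) p" and b: "b \<in> Gr (Dsp P (card Y) (m - card Y)) q"
    and Z: "glued_outputs n i X j Y = Z"
  shows "glue P n p i X m q j Y a b \<in> Gr (Dsp P (card Z) (n + m - 2 - card Z)) (p + q)"
proof -
  have "0 < n + m - 2" using h by simp
  moreover have "card Z \<le> n + m - 2" using card_le[OF glued_subset[OF h(1,2,4,5)]] Z by simp
  ultimately have pos: "0 < card Z + (n + m - 2 - card Z)" by simp
  consider "i \<in> X" "j \<notin> Y" | "i \<notin> X" "j \<in> Y" | "(i \<in> X) = (j \<in> Y)" by blast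
  then show ?thesis
  proof cases
    case 1
    then have N: "card Z = card X + card Y - 1" "n + m - 2 - card Z = n - card X + (m - card Y) - 1"
      using glue_arities[OF h(1,2,4,5)] Z by auto
    show ?thesis
      \<comment> \<open>The order matters: \<open>card Z\<close>, the left side of
        \<open>N(1)\<close>, also occurs in the left side of \<open>N(2)\<close>.\<close>
      unfolding N(2) unfolding N(1) using glue_out(4)[OF h 1 a b] 1 by (simp add: glue_def Let_def)
  next
    case 2
    have N: "card Z = card X + card Y - 1" "n + m - 2 - card Z = n - card X + (m - card Y) - 1"
      using glue_arities[OF h(1,2,4,5)] 2 Z by auto
    have M: "card Y + card X - 1 = card X + card Y - 1" "m - card Y + (n - card X) - 1 = n - card X + (m - card Y) - 1"
      "q + p = p + q" by auto
    have "2 < m + n" using h by simp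
    note c = glue_out(4)[OF h(2,1) this h(5,4) 2(2,1) b a, unfolded M] and pos' = pos[unfolded N(2), unfolded N(1)]
    show ?thesis
      unfolding N(2) unfolding N(1)
      using 2 dg_scale[OF space[OF pos'] dact_mem[OF pos' glue_in_perms[OF h(1,2,4,5) 2] c]]
      by (simp add: glue_def Let_def)
  next
    case 3
    then show ?thesis using dg_zero_mem[OF space[OF pos]] by (auto simp: glue_def Let_def)
  qed
qed

lemma cyc_closed_phi_push: "cyc_closed (phi_push P)"
  unfolding cyc_closed_def
proof (intro conjI allI impI ballI; (elim conjE)?)
  \<comment> \<open>Stated for every set \<open>X\<close>, since scalar multiplication acts
    pointwise also at sets that are not contained in \<open>{..<n}\<close>.\<close>
  have pos: "0 < card X + (n - card X)" if "0 < n" for n and X :: "nat set" using that by arith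
  note sp = space[OF pos]
  fix n :: nat assume n: "0 < n"
  show "dg_vector_space (Csp (phi_push P) n)"
  proof (rule dg_vector_spaceI)
    have vs: "vector_space (Scl (Dsp P (card X) (n - card X)))" for X :: "nat set"
      using sp[OF n] by (simp add: dg_vector_space_def)
    note v = vector_space.vector_space_assms[OF vs]
    show "vector_space (Scl (Csp (phi_push P) n))"
      by unfold_locales (simp_all add: fun_eq_iff phi_push_sel plus_fun_apply v)
  qed (use n in \<open>auto simp: phi_push_Gr phi_push_sel fun_eq_iff plus_fun_apply zero_fun_apply sp dg_zero_mem dg_add dg_scale
      dg_Dif dg_Dif_add dg_Dif_scale dg_Dif_Dif dg_scale_zero split: if_splits\<close>)
next
  fix n p \<sigma> a assume n: "0 < n" and \<sigma>: "\<sigma> permutes {..<n}" and a: "a \<in> Gr (Csp (phi_push P) n) p"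
  show "cact (phi_push P) n p \<sigma> a \<in> Gr (Csp (phi_push P) n) p"
    unfolding phi_push_Gr
  proof (intro allI)
    fix Y
    have "dact P (card Y) (n - card Y) p (std \<sigma> (inv \<sigma> ` Y)) (std \<sigma> ({..<n} - inv \<sigma> ` Y)) (a (inv \<sigma> ` Y))
        \<in> Gr (Dsp P (card Y) (n - card Y)) p" if "Y \<subseteq> {..<n}"
    proof (rule dact_mem)
      note f = inv_image_facts[OF \<sigma> that]
      show "a (inv \<sigma> ` Y) \<in> Gr (Dsp P (card Y) (n - card Y)) p"
        using a[unfolded phi_push_Gr, rule_format, of "inv \<sigma> ` Y"] f by simp
    qed (use n inv_image_facts[OF \<sigma> that] in auto)
    then show "if Y \<subseteq> {..<n} then cact (phi_push P) n p \<sigma> a Y \<in> Gr (Dsp P (card Y) (n - card Y)) p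
        else cact (phi_push P) n p \<sigma> a Y = 0"
      using inv_image_facts(2)[OF \<sigma>] by (simp add: phi_push_sel)
  qed
next
  fix n m p q i j a b
  assume h: "i < n" "j < m" "2 < n + m" and a: "a \<in> Gr (Csp (phi_push P) n) p" and b: "b \<in> Gr (Csp (phi_push P) m) q"
  show "ccomp (phi_push P) n p i m q j a b \<in> Gr (Csp (phi_push P) (n + m - 2)) (p + q)"
    unfolding phi_push_Gr
  proof (intro allI)
    fix Z
    have "ccomp (phi_push P) n p i m q j a b Z \<in> Gr (Dsp P (card Z) (n + m - 2 - card Z)) (p + q)" if "Z \<subseteq> {..<n + m - 2}"
    proof -
      have d: "dg_vector_space (Dsp P (card Z) (n + m - 2 - card Z))"
        using h by (intro space) auto
      show ?thesis
        unfolding phi_push_sel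
      proof (intro dg_sum[OF d])
        fix X Y assume XY: "X \<in> Pow {..<n}" "Y \<in> Pow {..<m}"
        show "(if glued_outputs n i X j Y = Z then glue P n p i X m q j Y (a X) (b Y) else 0)
            \<in> Gr (Dsp P (card Z) (n + m - 2 - card Z)) (p + q)"
          using glue_mem[OF h, of X Y "a X" p "b Y" q Z] XY a[unfolded phi_push_Gr, rule_format, of X]
            b[unfolded phi_push_Gr, rule_format, of Y] dg_zero_mem[OF d] by simp
      qed
    qed
    moreover have "ccomp (phi_push P) n p i m q j a b Z = 0" if "\<not> Z \<subseteq> {..<n + m - 2}"
      unfolding phi_push_sel
    proof (intro sum.neutral ballI)
      fix X Y assume "X \<in> Pow {..<n}" "Y \<in> Pow {..<m}"
      then have "glued_outputs n i X j Y \<noteq> Z" using glued_subset[OF h(1,2), of X Y] that by auto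
      then show "(if glued_outputs n i X j Y = Z then glue P n p i X m q j Y (a X) (b Y) else 0) = 0" by simp
    qed
    ultimately show "if Z \<subseteq> {..<n + m - 2} then ccomp (phi_push P) n p i m q j a b Z \<in> Gr (Dsp P (card Z) (n + m - 2 - card Z)) (p + q)
        else ccomp (phi_push P) n p i m q j a b Z = 0" by simp
  qed
qed

text \<open>Each branch of \<open>glue\<close> is built from composition, action, scalars and 0, all
  of which \<open>f\<close> respects.\<close>

lemma glue_hom:
  assumes f: "f \<in> dio_hom P Q" and h: "i < n" "j < m" "2 < n + m" "X \<subseteq> {..<n}" "Y \<subseteq> {..<m}"
    and a: "a \<in> Gr (Dsp P (card X) (n - card X)) p" and b: "b \<in> Gr (Dsp P (card Y) (m - card Y)) q"
    and Z: "glued_outputs n i X j Y = Z"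
  shows "f (card Z) (n + m - 2 - card Z) (p + q) (glue P n p i X m q j Y a b) =
    glue Q n p i X m q j Y (f (card X) (n - card X) p a) (f (card Y) (m - card Y) q b)"
proof -
  have "0 < n + m - 2" using h by simp
  moreover have "card Z \<le> n + m - 2" using card_le[OF glued_subset[OF h(1,2,4,5)]] Z by simp
  ultimately have pos: "0 < card Z + (n + m - 2 - card Z)" by simp
  note fh = dio_homD[OF f]
  consider "i \<in> X" "j \<notin> Y" | "i \<notin> X" "j \<in> Y" | "(i \<in> X) = (j \<in> Y)" by blast
  then show ?thesis
  proof cases
    case 1
    then have N: "card Z = card X + card Y - 1" "n + m - 2 - card Z = n - card X + (m - card Y) - 1"
      using glue_arities[OF h(1,2,4,5)] Z by auto
    note g = glue_out[OF h 1 a b]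
    show ?thesis
      unfolding N(2) unfolding N(1) using fh(3)[OF g(1-3) a b] 1 by (simp add: glue_def Let_def)
  next
    case 2
    have N: "card Z = card X + card Y - 1" "n + m - 2 - card Z = n - card X + (m - card Y) - 1"
      using glue_arities[OF h(1,2,4,5)] 2 Z by auto
    have M: "card Y + card X - 1 = card X + card Y - 1" "m - card Y + (n - card X) - 1 = n - card X + (m - card Y) - 1"
      "q + p = p + q" by auto
    have "2 < m + n" using h by simp
    note g = glue_out[OF h(2,1) this h(5,4) 2(2,1) b a]
    note c = g(4)[unfolded M] and perms = glue_in_perms[OF h(1,2,4,5) 2] and pos' = pos[unfolded N(2), unfolded N(1)]
    show ?thesis
      unfolding N(2) unfolding N(1)
      using fh(3)[OF g(1-3) b a, unfolded M] fh(2)[OF pos' perms c] chain_mapD(3)[OF fh(1)[OF pos'] dact_mem[OF pos' perms c]] 2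
      by (simp add: glue_def Let_def)
  next
    case 3
    then show ?thesis using chain_map_zero[OF fh(1)[OF pos] space[OF pos]] by (auto simp: glue_def Let_def)
  qed
qed

text \<open>Each component is treated by \<open>f\<close> alone; sets outside the range of flags
  carry the value 0 on both sides.\<close>

lemma cyc_map_phi_push_map:
  assumes Q: "dioperad Q" and f: "f \<in> dio_hom P Q"
  shows "cyc_map (phi_push P) (phi_push Q) (phi_push_map P f)"
proof (rule cyc_mapI)
  have pos: "0 < card X + (n - card X)" if "0 < n" for n and X :: "nat set" using that by arith
  note sp = space[OF pos] and spQ = dioperad.space[OF Q pos] and fh = dio_homD[OF f] and cl = cyc_closedD[OF cyc_closed_phi_push]
  have ap: "phi_push_map P f n p u = (\<lambda>X. if X \<subseteq> {..<n} then f (card X) (n - card X) p (u X) else 0)"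
    if "0 < n" "u \<in> Gr (Csp (phi_push P) n) p" for n p u
    using that by (simp add: phi_push_map_def ccar_pos)
  have uX: "u X \<in> Gr (Dsp P (card X) (n - card X)) p" if "u \<in> Gr (Csp (phi_push P) n) p" "X \<subseteq> {..<n}" for u n p X
    using that unfolding phi_push_Gr by metis
  show "chain_map (Csp (phi_push P) n) (Csp (phi_push Q) n) (phi_push_map P f n)" if n: "0 < n" for n
  proof (rule chain_mapI)
    note F = chain_mapD[OF fh(1)[OF pos[OF n]]] and d = cl(1)[OF n]
    fix p x assume x: "x \<in> Gr (Csp (phi_push P) n) p"
    show "phi_push_map P f n p x \<in> Gr (Csp (phi_push Q) n) p"
      unfolding ap[OF n x] phi_push_Gr using F(1) uX[OF x] by simp
    show "phi_push_map P f n p (x + y) = phi_push_map P f n p x + phi_push_map P f n p y" if y: "y \<in> Gr (Csp (phi_push P) n) p" for y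
      unfolding ap[OF n x] ap[OF n y] ap[OF n dg_add[OF d x y]] using F(2)[OF uX[OF x] uX[OF y]]
      by (auto simp: fun_eq_iff plus_fun_apply)
    show "phi_push_map P f n p (Scl (Csp (phi_push P) n) c x) = Scl (Csp (phi_push Q) n) c (phi_push_map P f n p x)" for c
      unfolding ap[OF n x] ap[OF n dg_scale[OF d x]] using F(3)[OF uX[OF x]] dg_scale_zero[OF spQ[OF n]]
      by (auto simp: fun_eq_iff phi_push_sel)
    show "phi_push_map P f n (p + 1) (Dif (Csp (phi_push P) n) p x) = Dif (Csp (phi_push Q) n) p (phi_push_map P f n p x)"
      unfolding ap[OF n x] ap[OF n dg_Dif[OF d x]] using F(4)[OF uX[OF x]]
      by (auto simp: fun_eq_iff phi_push_sel)
  qed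
  show "phi_push_map P f n p (cact (phi_push P) n p \<sigma> a) = cact (phi_push Q) n p \<sigma> (phi_push_map P f n p a)"
    if n: "0 < n" and \<sigma>: "\<sigma> permutes {..<n}" and a: "a \<in> Gr (Csp (phi_push P) n) p" for n p \<sigma> a
  proof
    fix Y
    show "phi_push_map P f n p (cact (phi_push P) n p \<sigma> a) Y = cact (phi_push Q) n p \<sigma> (phi_push_map P f n p a) Y"
    proof (cases "Y \<subseteq> {..<n}")
      case True
      note i = inv_image_facts[OF \<sigma> True]
      show ?thesis
        using True i fh(2)[OF pos[OF n] i(4,5) uX[OF a i(1), unfolded i(2)]]
        unfolding ap[OF n a] ap[OF n cl(2)[OF n \<sigma> a]] by (simp add: phi_push_sel)
    next
      case False
      then show ?thesis unfolding ap[OF n a] ap[OF n cl(2)[OF n \<sigma> a]] by (simp add: phi_push_sel)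
    qed
  qed
  show "phi_push_map P f (n + m - 2) (p + q) (ccomp (phi_push P) n p i m q j a b) =
      ccomp (phi_push Q) n p i m q j (phi_push_map P f n p a) (phi_push_map P f m q b)"
    if h: "i < n" "j < m" "2 < n + m" and a: "a \<in> Gr (Csp (phi_push P) n) p" and b: "b \<in> Gr (Csp (phi_push P) m) q"
    for n m p q i j a b
  proof
    have n: "0 < n" "0 < m" "0 < n + m - 2" using h by auto
    fix Z
    let ?fa = "\<lambda>X. f (card X) (n - card X) p (a X)" and ?fb = "\<lambda>Y. f (card Y) (m - card Y) q (b Y)"
    let ?S = "\<Sum>X \<in> Pow {..<n}. \<Sum>Y \<in> Pow {..<m}. if glued_outputs n i X j Y = Z then glue Q n p i X m q j Y (?fa X) (?fb Y) else 0"
    have R: "ccomp (phi_push Q) n p i m q j (phi_push_map P f n p a) (phi_push_map P f m q b) Z = ?S"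
      unfolding phi_push_sel ap[OF n(1) a] ap[OF n(2) b] by (intro sum.cong refl) auto
    show "phi_push_map P f (n + m - 2) (p + q) (ccomp (phi_push P) n p i m q j a b) Z =
        ccomp (phi_push Q) n p i m q j (phi_push_map P f n p a) (phi_push_map P f m q b) Z"
    proof (cases "Z \<subseteq> {..<n + m - 2}")
      case True
      note d = sp[OF n(3), of Z] and F = fh(1)[OF pos[OF n(3)], of Z]
      let ?t = "\<lambda>X Y. if glued_outputs n i X j Y = Z then glue P n p i X m q j Y (a X) (b Y) else 0"
      \<comment> \<open>\<open>f\<close> is additive only on graded pieces, so every summand has to
        be located there before \<open>f\<close> is moved inside the double sum.\<close>
      have t: "?t X Y \<in> Gr (Dsp P (card Z) (n + m - 2 - card Z)) (p + q)" if "X \<in> Pow {..<n}" "Y \<in> Pow {..<m}" for X Y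
        using glue_mem[OF h, of X Y "a X" p "b Y" q Z] that uX[OF a] uX[OF b] dg_zero_mem[OF d] by simp
      have "f (card Z) (n + m - 2 - card Z) (p + q) (\<Sum>X \<in> Pow {..<n}. \<Sum>Y \<in> Pow {..<m}. ?t X Y) =
          (\<Sum>X \<in> Pow {..<n}. \<Sum>Y \<in> Pow {..<m}. f (card Z) (n + m - 2 - card Z) (p + q) (?t X Y))"
        by (subst chain_map_sum[OF F d], rule dg_sum[OF d], erule (1) t)
          (intro sum.cong refl chain_map_sum[OF F d], erule (1) t)
      also have "\<dots> = ?S"
      proof (intro sum.cong refl)
        fix X Y assume "X \<in> Pow {..<n}" "Y \<in> Pow {..<m}"
        then show "f (card Z) (n + m - 2 - card Z) (p + q) (?t X Y) =
            (if glued_outputs n i X j Y = Z then glue Q n p i X m q j Y (?fa X) (?fb Y) else 0)"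
          using glue_hom[OF f h, of X Y "a X" p "b Y" q Z] uX[OF a, of X] uX[OF b, of Y] chain_map_zero[OF F d] by simp
      qed
      finally show ?thesis
        unfolding R ap[OF n(3) cl(3)[OF h a b]] using True by (simp add: phi_push_sel)
    next
      case False
      have "?S = 0"
      proof (intro sum.neutral ballI)
        fix X Y assume "X \<in> Pow {..<n}" "Y \<in> Pow {..<m}"
        then have "glued_outputs n i X j Y \<noteq> Z" using glued_subset[OF h(1,2), of X Y] False by auto
        then show "(if glued_outputs n i X j Y = Z then glue Q n p i X m q j Y (?fa X) (?fb Y) else 0) = 0" by simp
      qed
      then show ?thesis unfolding R ap[OF n(3) cl(3)[OF h a b]] using False by simp
    qed
  qed
qed

end

section \<open>The canonical isomorphism\<close>

text \<open>The place of the flag \<open>w\<close> once the flags in \<open>X\<close> are listed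
  before the others; inverse to \<open>unshuffle n X\<close>.\<close>

definition position :: "nat \<Rightarrow> nat set \<Rightarrow> nat \<Rightarrow> nat" where
  "position n X w = (if w \<in> X then rank X w else card X + rank ({..<n} - X) w)"

lemma unshuffle_position: "X \<subseteq> {..<n} \<Longrightarrow> w < n \<Longrightarrow> unshuffle n X (position n X w) = w"
  by (simp add: position_def unshuffle_rank unshuffle_rank_compl)

lemma position_unshuffle: "X \<subseteq> {..<n} \<Longrightarrow> k < n \<Longrightarrow> position n X (unshuffle n X k) = k"
  using unshuffle_position[of X n "unshuffle n X k"] unshuffle_mem_iff(1)[of X n k]
    permutes_inj[OF unshuffle_permutes[of X n]] by (auto dest: injD)

text \<open>Each \<open>k\<close> is the place of a unique flag \<open>w\<close>, so both composites
  may be evaluated at \<open>position n X w\<close>; the claim then becomes a computation of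
  ranks.\<close>

lemma unshuffle_comp_eqI:
  assumes X: "X \<subseteq> {..<n}" and Y: "Y \<subseteq> {..<n}" and \<rho>: "\<rho> permutes {..<n}" and \<sigma>: "\<sigma> permutes {..<n}"
    and eq: "\<And>w. w < n \<Longrightarrow> \<rho> (position n X w) = position n Y (\<sigma> w)"
  shows "unshuffle n Y \<circ> \<rho> = \<sigma> \<circ> unshuffle n X"
proof (rule permutes_eqI[OF permutes_compose[OF \<rho> unshuffle_permutes[OF Y]] permutes_compose[OF unshuffle_permutes[OF X] \<sigma>]])
  fix k assume k: "k < n"
  have w: "unshuffle n X k < n" by (rule unshuffle_mem_iff(1)[OF X k])
  have "\<rho> k = position n Y (\<sigma> (unshuffle n X k))" using eq[OF w] by (simp add: position_unshuffle[OF X k])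
  moreover have "\<sigma> (unshuffle n X k) < n" using permutes_less[OF \<sigma>] w by simp
  ultimately show "(unshuffle n Y \<circ> \<rho>) k = (\<sigma> \<circ> unshuffle n X) k" by (simp add: unshuffle_position[OF Y])
qed

text \<open>\<open>std \<sigma> X\<close> sends the rank of a flag in \<open>X\<close> to the rank
  of its image in the image of \<open>X\<close>, and likewise for the complement.\<close>

lemma unshuffle_std:
  assumes X: "X \<subseteq> {..<n}" and \<sigma>: "\<sigma> permutes {..<n}"
  shows "unshuffle n (\<sigma> ` X) \<circ> perm_sum (card X) (std \<sigma> X) (std \<sigma> ({..<n} - X)) = \<sigma> \<circ> unshuffle n X"
proof (rule unshuffle_comp_eqI[OF X _ _ \<sigma>])
  have fin: "finite X" "finite ({..<n} - X)" using finite_subset[OF X] by simp_all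
  have inj: "inj_on \<sigma> Z" for Z by (rule inj_on_subset[OF permutes_inj[OF \<sigma>] subset_UNIV])
  show sub: "\<sigma> ` X \<subseteq> {..<n}" using X permutes_image[OF \<sigma>] by blast
  have "perm_sum (card X) (std \<sigma> X) (std \<sigma> ({..<n} - X)) permutes {..<card X + (n - card X)}"
    using std_permutes[OF fin(1) inj] std_permutes[OF fin(2) inj] card_compl[OF X] by (intro perm_sum_permutes) simp_all
  then show "perm_sum (card X) (std \<sigma> X) (std \<sigma> ({..<n} - X)) permutes {..<n}" using card_le[OF X] by simp
  have compl: "\<sigma> ` ({..<n} - X) = {..<n} - \<sigma> ` X"
    using permutes_image[OF \<sigma>] image_set_diff[OF permutes_inj[OF \<sigma>]] by blast
  have mem: "\<sigma> w \<in> \<sigma> ` X \<longleftrightarrow> w \<in> X" for w using permutes_inj[OF \<sigma>] by (simp add: inj_image_mem_iff)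
  fix w assume w: "w < n"
  show "perm_sum (card X) (std \<sigma> X) (std \<sigma> ({..<n} - X)) (position n X w) = position n (\<sigma> ` X) (\<sigma> w)"
  proof (cases "w \<in> X")
    case True
    then show ?thesis
      using rank_less[OF fin(1) True] by (simp add: position_def perm_sum_less std_def nth_rank[OF fin(1)])
  next
    case False
    then have "w \<in> {..<n} - X" using w by simp
    then show ?thesis
      using rank_less[OF fin(2)] False mem card_image[OF inj]
      by (simp add: position_def perm_sum_add std_def nth_rank[OF fin(2)] compl)
  qed
qed

text \<open>The glued outputs below \<open>skip i x\<close> form again a set of glued outputs, made
  from the elements of \<open>X\<close> below \<open>x\<close> and the empty set;
  \<open>card_glued\<close> counts them.\<close>

lemma rank_glued_left:
  assumes "i < n" "j < m" "X \<subseteq> {..<n}" "x < n" "x \<noteq> i"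
  shows "rank (glued_outputs n i X j Y) (skip i x) = rank (X - {i}) x"
proof -
  have "{z \<in> glued_outputs n i X j Y. z < skip i x} = glued_outputs n i {y \<in> X. y < x} j {}"
    using assms(5) skip_less[OF assms(4,5,1)] by (auto simp: glued_outputs_def skip_less_iff)
  moreover have "{y \<in> X. y < x} \<subseteq> {..<n}" using assms(3) by auto
  ultimately have "rank (glued_outputs n i X j Y) (skip i x) = card ({y \<in> X. y < x} - {i})"
    using card_glued[OF assms(1,2), of "{y \<in> X. y < x}" "{}"] by (simp add: rank_def)
  also have "{y \<in> X. y < x} - {i} = {y \<in> X - {i}. y < x}" by auto
  finally show ?thesis by (simp add: rank_def)
qed

text \<open>Here all remaining elements of \<open>X\<close> lie below the flag, together with the
  elements of \<open>Y\<close> below \<open>y\<close>.\<close>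

lemma rank_glued_right:
  assumes "i < n" "j < m" "X \<subseteq> {..<n}" "Y \<subseteq> {..<m}" "y \<noteq> j"
  shows "rank (glued_outputs n i X j Y) (n - 1 + skip j y) = card (X - {i}) + rank (Y - {j}) y"
proof -
  have "skip i x < n - 1 + skip j y" if "x \<in> X - {i}" for x
    using skip_less[of x n i] that assms by fastforce
  then have "{z \<in> glued_outputs n i X j Y. z < n - 1 + skip j y} = glued_outputs n i X j {b \<in> Y. b < y}"
    using assms(5) by (auto simp: glued_outputs_def skip_less_iff)
  moreover have "{b \<in> Y. b < y} \<subseteq> {..<m}" using assms(4) by auto
  ultimately have "rank (glued_outputs n i X j Y) (n - 1 + skip j y) = card (X - {i}) + card ({b \<in> Y. b < y} - {j})"
    using card_glued[OF assms(1-3), of "{b \<in> Y. b < y}"] by (simp add: rank_def)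
  also have "{b \<in> Y. b < y} - {j} = {b \<in> Y - {j}. b < y}" by auto
  finally show ?thesis by (simp add: rank_def)
qed

lemma glued_mem_left:
  assumes "i < n" "x < n" "x \<noteq> i"
  shows "skip i x \<in> glued_outputs n i X j Y \<longleftrightarrow> x \<in> X"
proof -
  have "skip i x \<noteq> n - 1 + skip j y" for y using skip_less[OF assms(2,3,1)] by simp
  moreover have "x \<in> X" if "skip i x \<in> skip i ` (X - {i})"
    using that
  proof
    fix z assume "skip i x = skip i z" "z \<in> X - {i}"
    then show "x \<in> X" using skip_eq_iff[of x i z] assms(3) by simp
  qed
  ultimately show ?thesis using assms(3) by (auto simp: glued_outputs_def)
qed

lemma glued_mem_right:
  assumes "i < n" "X \<subseteq> {..<n}" "y \<noteq> j"
  shows "n - 1 + skip j y \<in> glued_outputs n i X j Y \<longleftrightarrow> y \<in> Y"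
proof -
  have "skip i x \<noteq> n - 1 + skip j y" if "x \<in> X - {i}" for x
    using skip_less[of x n i] that assms by fastforce
  then have "n - 1 + skip j y \<notin> skip i ` (X - {i})" by (metis imageE)
  moreover have "y \<in> Y" if "n - 1 + skip j y \<in> (\<lambda>y. n - 1 + skip j y) ` (Y - {j})"
    using that
  proof
    fix z assume "n - 1 + skip j y = n - 1 + skip j z" "z \<in> Y - {j}"
    then show "y \<in> Y" using skip_eq_iff[of y j z] assms(3) by simp
  qed
  ultimately show ?thesis using assms(3) by (auto simp: glued_outputs_def)
qed

text \<open>Gluing treats inputs like outputs, so the formulas for ranks among the outputs also give
  those among the inputs.\<close>

lemma glued_compl:
  assumes "i < n" "j < m" "X \<subseteq> {..<n}" "Y \<subseteq> {..<m}"
  shows "{..<n + m - 2} - glued_outputs n i X j Y = glued_outputs n i ({..<n} - X) j ({..<m} - Y)"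
proof -
  have "z \<notin> glued_outputs n i X j Y \<longleftrightarrow> z \<in> glued_outputs n i ({..<n} - X) j ({..<m} - Y)" if "z < n + m - 2" for z
    using assms(1,2) that
  proof (cases rule: glue_flag_cases)
    case (1 x)
    then show ?thesis
      using glued_mem_left[OF assms(1) 1(1,2), of X j Y]
        glued_mem_left[OF assms(1) 1(1,2), of "{..<n} - X" j "{..<m} - Y"] by simp
  next
    case (2 y)
    then show ?thesis
      using glued_mem_right[OF assms(1) assms(3) 2(2), of Y]
        glued_mem_right[OF assms(1) Diff_subset 2(2), of X "{..<m} - Y"] by simp
  qed
  moreover have "glued_outputs n i ({..<n} - X) j ({..<m} - Y) \<subseteq> {..<n + m - 2}"
    using assms by (intro glued_subset) auto
  ultimately show ?thesis by blast
qed

lemma position_glued_left: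
  assumes "i < n" "j < m" "X \<subseteq> {..<n}" "Y \<subseteq> {..<m}" "x < n" "x \<noteq> i"
  shows "position (n + m - 2) (glued_outputs n i X j Y) (skip i x) =
    (if x \<in> X then rank (X - {i}) x else card (glued_outputs n i X j Y) + rank ({..<n} - X - {i}) x)"
  unfolding position_def glued_compl[OF assms(1-4)] glued_mem_left[OF assms(1,5,6)]
    rank_glued_left[OF assms(1-3,5,6)] rank_glued_left[OF assms(1,2) Diff_subset assms(5,6)] ..

lemma position_glued_right:
  assumes "i < n" "j < m" "X \<subseteq> {..<n}" "Y \<subseteq> {..<m}" "y \<noteq> j"
  shows "position (n + m - 2) (glued_outputs n i X j Y) (n - 1 + skip j y) =
    (if y \<in> Y then card (X - {i}) + rank (Y - {j}) y
     else card (glued_outputs n i X j Y) + (card ({..<n} - X - {i}) + rank ({..<m} - Y - {j}) y))"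
  unfolding position_def glued_compl[OF assms(1-4)] glued_mem_right[OF assms(1,3,5)]
    rank_glued_right[OF assms(1-5)] rank_glued_right[OF assms(1,2) Diff_subset Diff_subset assms(5)] ..

lemma rank_less_iff:
  assumes "finite X" "x \<in> X" "y \<in> X"
  shows "rank X x < rank X y \<longleftrightarrow> x < y"
proof -
  have mono: "rank X a < rank X b" if "a < b" "a \<in> X" for a b
    unfolding rank_def using that assms(1) by (intro psubset_card_mono) auto
  show ?thesis using mono[of x y] mono[of y x] assms by (metis less_asym linorder_less_linear less_irrefl)
qed

lemma rank_delete:
  assumes "finite X" "i \<in> X" "x \<in> X" "x \<noteq> i"
  shows "rank (X - {i}) x = skip (rank X i) (rank X x)"
proof -
  have "{y \<in> X - {i}. y < x} = {y \<in> X. y < x} - {i}" by auto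
  then have "rank (X - {i}) x = rank X x - (if i < x then 1 else 0)"
    using assms(1,2) by (simp add: rank_def card_Diff_singleton_if)
  then show ?thesis
    using rank_less_iff[OF assms(1,3,2)] assms(4) by (auto simp: skip_def)
qed

text \<open>Each flag of the glued corolla is a remaining output or input of the first or second
  corolla. In all four cases its place in the sorted order is computed from ranks and compared with
  the block swap.\<close>

lemma unshuffle_glue_out:
  assumes h: "i < n" "j < m" "X \<subseteq> {..<n}" "Y \<subseteq> {..<m}" and i: "i \<in> X" and j: "j \<notin> Y"
  shows "unshuffle (n + m - 2) (glued_outputs n i X j Y) \<circ> block_swap (card X - 1) (n - card X) (card Y) =
    glue_perm n (rank X i) m (card Y + rank ({..<m} - Y) j) (unshuffle n X) (unshuffle m Y)"
proof -
  let ?r = "card X" and ?s = "n - card X" and ?r' = "card Y" and ?s' = "m - card Y" and ?N = "n + m - 2"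
  let ?Z = "glued_outputs n i X j Y" and ?b = "block_swap (?r - 1) ?s ?r'"
  let ?i = "rank X i" and ?j = "rank ({..<m} - Y) j"
  let ?G = "glue_perm n ?i m (?r' + ?j) (unshuffle n X) (unshuffle m Y)"
  have fin: "finite X" "finite ({..<m} - Y)" using finite_subset[OF h(3)] by auto
  have le: "?r \<le> n" "?r' \<le> m" using card_le h by auto
  have i0: "?i < ?r" by (rule rank_less[OF fin(1) i])
  have j0: "?j < ?s'" using rank_less[OF fin(2), of j] j h card_compl[OF h(4)] by simp
  have ij: "?i < n" "?r' + ?j < m" using i0 j0 le by auto
  have ui: "unshuffle n X ?i = i" by (rule unshuffle_rank[OF h(3) i])
  have uj: "unshuffle m Y (?r' + ?j) = j" by (rule unshuffle_rank_compl[OF h(4,2) j])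
  have Z: "?Z \<subseteq> {..<?N}" by (rule glued_subset[OF h])
  have cZ: "card ?Z = ?r + ?r' - 1" using glue_arities(1)[OF h] i j by simp
  have bp: "?b permutes {..<?N}" using le i0 j0 by (intro block_swap_permutes) auto
  show ?thesis
  proof (rule permutes_eqI[OF permutes_compose[OF bp unshuffle_permutes[OF Z]]
        glue_perm_permutes[OF ij unshuffle_permutes[OF h(3)] unshuffle_permutes[OF h(4)]]])
    fix z assume "z < ?N"
    \<comment> \<open>It is enough that the block swap carries \<open>z\<close> to the place of the
      flag \<open>w\<close> that the right-hand side yields.\<close>
    have suff: "(unshuffle ?N ?Z \<circ> ?b) z = w" if "?b z = position ?N ?Z w" "w < ?N" for w
      using unshuffle_position[OF Z that(2)] that(1) by simp
    from ij \<open>z < ?N\<close> show "(unshuffle ?N ?Z \<circ> ?b) z = ?G z"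
    proof (cases rule: glue_flag_cases)
      case (1 x)
      define a where "a = unshuffle n X x"
      have a: "a < n" "a \<noteq> i" "x = position n X a"
        using 1 unshuffle_mem_iff(1)[OF h(3) 1(1)] position_unshuffle[OF h(3) 1(1)] position_unshuffle[OF h(3) ij(1)] ui
        by (auto simp: a_def)
      have G: "?G z = skip i a" using glue_perm_left[OF ij(1) 1(1,2)] 1(3) ui by (simp add: a_def)
      have "?b z = position ?N ?Z (skip i a)"
        unfolding position_glued_left[OF h a(1,2)] cZ
      proof (cases "a \<in> X")
        case True
        then have x: "x = rank X a" using a by (simp add: position_def)
        then have "z = rank (X - {i}) a" using 1(3) rank_delete[OF fin(1) i True a(2)] by simp
        moreover have "skip ?i x < ?r - 1"
          using skip_less[OF _ 1(2) i0] rank_less[OF fin(1) True] x by simp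
        ultimately show "?b z = (if a \<in> X then rank (X - {i}) a else ?r + ?r' - 1 + rank ({..<n} - X - {i}) a)"
          using True 1(3) by (simp add: block_swap_def)
      next
        case False
        define t where "t = rank ({..<n} - X) a"
        have t: "t < ?s" using rank_less[of "{..<n} - X" a] False a card_compl[OF h(3)] by (simp add: t_def)
        have x: "x = ?r + t" using a False by (simp add: position_def t_def)
        have zz: "z = ?r - 1 + t" using 1(3) x i0 by (simp add: skip_def)
        have "?b z = ?r + ?r' - 1 + t" unfolding zz using t i0 by (auto simp: block_swap_def)
        moreover have "{..<n} - X - {i} = {..<n} - X" using i by blast
        ultimately show "?b z = (if a \<in> X then rank (X - {i}) a else ?r + ?r' - 1 + rank ({..<n} - X - {i}) a)"
          using False by (simp add: t_def)
      qed
      moreover have "skip i a < ?N" using skip_less[OF a(1,2) h(1)] h(2) by simp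
      ultimately show ?thesis unfolding G by (rule suff)
    next
      case (2 y)
      define b where "b = unshuffle m Y y"
      have b: "b < m" "b \<noteq> j" "y = position m Y b"
        using 2 unshuffle_mem_iff(1)[OF h(4) 2(1)] position_unshuffle[OF h(4) 2(1)] position_unshuffle[OF h(4) ij(2)] uj
        by (auto simp: b_def)
      have G: "?G z = n - 1 + skip j b" using glue_perm_right[OF ij 2(1,2)] 2(3) uj by (simp add: b_def)
      have n1: "n - 1 = ?r - 1 + ?s" using i0 le by simp
      have cards: "card (X - {i}) = ?r - 1" "{..<n} - X - {i} = {..<n} - X" "Y - {j} = Y"
        using fin i j by auto
      have "?b z = position ?N ?Z (n - 1 + skip j b)"
        unfolding position_glued_right[OF h b(2)] cZ cards card_compl[OF h(3)]
      proof (cases "b \<in> Y")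
        case True
        then have y: "y = rank Y b" using b by (simp add: position_def)
        have yl: "y < ?r'" using rank_less[OF finite_subset[OF h(4)] True] y by simp
        have zz: "z = ?r - 1 + ?s + y" using 2(3) yl n1 by (simp add: skip_def)
        have "?b z = ?r - 1 + y" unfolding zz using yl by (simp add: block_swap_def)
        then show "?b z = (if b \<in> Y then ?r - 1 + rank Y b
            else ?r + ?r' - 1 + (?s + rank ({..<m} - Y - {j}) b))"
          using True y by simp
      next
        case False
        define t where "t = rank ({..<m} - Y) b"
        have y: "y = ?r' + t" using b False by (simp add: position_def t_def)
        have "t \<noteq> ?j" using 2(2) y by simp
        then have "skip (?r' + ?j) y = ?r' + skip ?j t" unfolding y by (auto simp: skip_def)
        then have zz: "z = ?r - 1 + ?s + ?r' + skip ?j t" using 2(3) n1 by simp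
        have "?b z = z" unfolding zz by (simp add: block_swap_def)
        moreover have "rank ({..<m} - Y - {j}) b = skip ?j t"
          unfolding t_def using rank_delete[OF fin(2), of j b] False j h(2) b by simp
        ultimately show "?b z = (if b \<in> Y then ?r - 1 + rank Y b
            else ?r + ?r' - 1 + (?s + rank ({..<m} - Y - {j}) b))"
          using False i0 unfolding zz by simp arith
      qed
      moreover have "n - 1 + skip j b < ?N" using skip_less[OF b(1,2) h(2)] h(1) by simp
      ultimately show ?thesis unfolding G by (rule suff)
    qed
  qed
qed

text \<open>Here an output of the second corolla meets an input of the first, and the dioperad lists
  the flags of the second first. The sum of two block swaps repairs the order among outputs and
  among inputs; in the unsorted order this is one swap of all remaining flags.\<close>

lemma unshuffle_glue_in:
  assumes h: "i < n" "j < m" "X \<subseteq> {..<n}" "Y \<subseteq> {..<m}" and i: "i \<notin> X" and j: "j \<in> Y"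
  shows "unshuffle (n + m - 2) (glued_outputs n i X j Y) \<circ>
      perm_sum (card X + card Y - 1) (block_swap 0 (card Y - 1) (card X)) (block_swap 0 (m - card Y) (n - card X - 1)) =
    block_swap 0 (m - 1) (n - 1) \<circ> unshuffle (n + m - 2) (glued_outputs m j Y i X)"
proof -
  let ?r = "card X" and ?s = "n - card X" and ?r' = "card Y" and ?s' = "m - card Y" and ?N = "n + m - 2"
  let ?Z = "glued_outputs n i X j Y" and ?Z' = "glued_outputs m j Y i X"
  let ?P = "perm_sum (?r + ?r' - 1) (block_swap 0 (?r' - 1) ?r) (block_swap 0 ?s' (?s - 1))" and ?b = "block_swap 0 (m - 1) (n - 1)"
  have N: "m + n - 2 = ?N" by simp
  have fin: "finite X" "finite Y" "finite ({..<n} - X)" "finite ({..<m} - Y)" using finite_subset h by auto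
  have le: "?r \<le> n" "?r' \<le> m" using card_le h by auto
  have r': "0 < ?r'" using fin j by (auto simp: card_gt_0_iff)
  have s: "0 < ?s" using psubset_card_mono[of "{..<n}" X] h i by auto
  have cZ: "card ?Z = ?r + ?r' - 1" "card ?Z' = ?r + ?r' - 1"
    using glue_arities(1)[OF h] glue_arities(1)[OF h(2,1,4,3)] i j by auto
  have cards: "X - {i} = X" "card (Y - {j}) = ?r' - 1" "card ({..<n} - X - {i}) = ?s - 1" "{..<m} - Y - {j} = {..<m} - Y"
    "card ({..<n} - X) = ?s" "card ({..<m} - Y) = ?s'"
    using fin i j h card_compl[OF h(3)] card_compl[OF h(4)] by (auto simp: card_Diff_singleton_if)
  show ?thesis
  proof (rule unshuffle_comp_eqI)
    show "?Z' \<subseteq> {..<?N}" using glued_subset[OF h(2,1,4,3)] unfolding N .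
    show "?Z \<subseteq> {..<?N}" by (rule glued_subset[OF h])
    have "?P permutes {..<?r + ?r' - 1 + (?s + ?s' - 1)}"
      using r' s by (intro perm_sum_permutes block_swap_permutes) auto
    moreover have "?r + ?r' - 1 + (?s + ?s' - 1) = ?N" using le r' s by simp
    ultimately show "?P permutes {..<?N}" by simp
    show "?b permutes {..<?N}" using h by (intro block_swap_permutes) auto
    fix w assume "w < ?N"
    then have "w < m + n - 2" by simp
    with h(2,1) show "?P (position ?N ?Z' w) = position ?N ?Z (?b w)"
    proof (cases rule: glue_flag_cases)
      case (1 y)
      have "skip j y < m - 1" by (rule skip_less[OF 1(1,2) h(2)])
      then have b: "?b w = n - 1 + skip j y" using 1 by (simp add: block_swap_def)
      have p: "position ?N ?Z' w = (if y \<in> Y then rank (Y - {j}) y else ?r + ?r' - 1 + rank ({..<m} - Y) y)"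
        using position_glued_left[OF h(2,1,4,3) 1(1,2)] unfolding N 1(3) cZ cards .
      have q: "position ?N ?Z (?b w) = (if y \<in> Y then ?r + rank (Y - {j}) y
          else ?r + ?r' - 1 + (?s - 1 + rank ({..<m} - Y) y))"
        using position_glued_right[OF h 1(2)] unfolding b cZ cards .
      show ?thesis
      proof (cases "y \<in> Y")
        case True
        then have k: "rank (Y - {j}) y < ?r' - 1" using rank_less[of "Y - {j}" y] fin 1 cards by simp
        then show ?thesis unfolding p q using True perm_sum_less[of "rank (Y - {j}) y" "?r + ?r' - 1"]
          by (simp add: block_swap_def)
      next
        case False
        then have k: "rank ({..<m} - Y) y < ?s'" using rank_less[OF fin(4), of y] 1 cards by simp
        show ?thesis unfolding p q using False k by (simp only: if_False perm_sum_add) (simp add: block_swap_def)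
      qed
    next
      case (2 x)
      have sk: "skip i x < n - 1" by (rule skip_less[OF 2(1,2) h(1)])
      then have b: "?b w = skip i x" using 2 h by (auto simp: block_swap_def)
      have p: "position ?N ?Z' w = (if x \<in> X then ?r' - 1 + rank X x
          else ?r + ?r' - 1 + (?s' + rank ({..<n} - X - {i}) x))"
        using position_glued_right[OF h(2,1,4,3) 2(2)] unfolding N 2(3) cZ cards .
      have q: "position ?N ?Z (?b w) = (if x \<in> X then rank X x else ?r + ?r' - 1 + rank ({..<n} - X - {i}) x)"
        using position_glued_left[OF h 2(1,2)] unfolding b cZ cards .
      show ?thesis
      proof (cases "x \<in> X")
        case True
        then have k: "rank X x < ?r" using rank_less[OF fin(1)] by simp
        then have "?r' - 1 + rank X x < ?r + ?r' - 1" using r' by simp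
        then show ?thesis unfolding p q using True k perm_sum_less[of "?r' - 1 + rank X x" "?r + ?r' - 1"]
          by (simp add: block_swap_def)
      next
        case False
        then have k: "rank ({..<n} - X - {i}) x < ?s - 1"
          using rank_less[of "{..<n} - X - {i}" x] 2 cards by simp
        show ?thesis unfolding p q using False k by (simp only: if_False perm_sum_add) (use le h(2) in \<open>auto simp: block_swap_def\<close>)
      qed
    qed
  qed
qed

section \<open>The canonical map and gluing\<close>

context dg_space
begin

lemma End_sel:
  "Dsp (End_di A) r s = tensor (mixed A r s)" "dact (End_di A) r s p \<sigma> \<tau> = tperm (mixed A r s) (perm_sum r \<sigma> \<tau>)"
  "Csp (End_cyc V double_form) n = tensor (replicate n V)" "cact (End_cyc V double_form) n p = tperm (replicate n V)"
  by (simp_all add: End_di_def End_cyc_def)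

abbreviation MX :: "nat \<Rightarrow> nat set \<Rightarrow> int \<Rightarrow> ('k, 'a \<times> ('a \<Rightarrow> 'k)) tens set" where
  "MX n X p \<equiv> Gr (tensor (mixed A (card X) (n - card X))) p"

text \<open>Moves the copies of A to the positions in \<open>X\<close> and those of A* to the
  others: one summand of \<open>canonical_map\<close>.\<close>

abbreviation place :: "nat \<Rightarrow> nat set \<Rightarrow> ('k, 'a \<times> ('a \<Rightarrow> 'k)) tens \<Rightarrow> ('k, 'a \<times> ('a \<Rightarrow> 'k)) tens" where
  "place n X \<equiv> tperm (replicate n V) (unshuffle n X)"

lemma place_compat: "X \<subseteq> {..<n} \<Longrightarrow> perm_compat (unshuffle n X) (mixed A (card X) (n - card X)) (replicate n V)"
  using perm_compat_comp[OF unshuffle_compat orient_compat_id] by simp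

lemma place_orient:
  "X \<subseteq> {..<n} \<Longrightarrow> S \<in> MX n X p \<Longrightarrow>
    place n X S = tperm (replicate n V) id (tperm (orient X n) (unshuffle n X) S)"
  using tperm_tperm[OF unshuffle_compat orient_compat_id] by simp

lemma place_mem: "X \<subseteq> {..<n} \<Longrightarrow> S \<in> MX n X p \<Longrightarrow> place n X S \<in> TV n p"
  by (rule tperm_mem[OF place_compat])

text \<open>Reading the tensor in the power of the double before permuting changes nothing, but
  makes the equivariance of the cyclic composition applicable.\<close>

lemma place_incl:
  assumes "X \<subseteq> {..<n}" "S \<in> MX n X p"
  shows "place n X (tperm (replicate n V) id S) = place n X S"
proof -
  have "card X + (n - card X) = n" using card_le[OF assms(1)] by simp
  then show ?thesis
    using tperm_tperm[OF mixed_compat_id[of "card X" "n - card X"] compat_replicate assms(2), of "unshuffle n X"]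
      unshuffle_permutes[OF assms(1)] by simp
qed

text \<open>Equivariance moves the gluing from the flags \<open>i\<close> and \<open>j\<close> to
  their places in the sorted order. There \<open>dcomp_embed\<close> recognises the dioperad
  composition up to a block swap, and \<open>unshuffle_glue_out\<close> identifies the remaining
  permutations.\<close>

lemma place_glue_out:
  assumes h: "i < n" "j < m" "2 < n + m" "X \<subseteq> {..<n}" "Y \<subseteq> {..<m}" and i: "i \<in> X" and j: "j \<notin> Y"
    and S: "S \<in> MX n X p" and T: "T \<in> MX m Y q"
  shows "place (n + m - 2) (glued_outputs n i X j Y)
      (dcomp (End_di A) (card X) (n - card X) p (rank X i) (card Y) (m - card Y) q (rank ({..<m} - Y) j) S T) =
    cc n i m j (place n X S) (place m Y T)"
proof -
  let ?r = "card X" and ?s = "n - card X" and ?r' = "card Y" and ?s' = "m - card Y" and ?N = "n + m - 2"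
  let ?Z = "glued_outputs n i X j Y" and ?b = "block_swap (?r - 1) ?s ?r'"
  let ?i = "rank X i" and ?j = "rank ({..<m} - Y) j"
  let ?G = "glue_perm n ?i m (?r' + ?j) (unshuffle n X) (unshuffle m Y)"
  let ?S = "tperm (replicate n V) id S" and ?T = "tperm (replicate m V) id T"
  let ?D = "blin (dcontr ?r ?s ?i ?r' ?s' ?j) S T"
  have g: "?i < ?r" "?j < ?s'"
    using rank_less[OF finite_subset[OF h(4)] i] rank_less[of "{..<m} - Y" j] j h card_compl[OF h(5)] by auto
  have n: "?r + ?s = n" "?r' + ?s' = m" "?r + ?r' - 1 + (?s + ?s' - 1) = ?N"
    using card_le[OF h(4)] card_le[OF h(5)] g by auto
  have ij: "?i < n" "?r' + ?j < m" using g n by auto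
  have u: "unshuffle n X ?i = i" "unshuffle m Y (?r' + ?j) = j"
    using unshuffle_rank[OF h(4) i] unshuffle_rank_compl[OF h(5,2) j] by auto
  note uX = unshuffle_permutes[OF h(4)] and uY = unshuffle_permutes[OF h(5)]
  have uZ: "unshuffle ?N ?Z permutes {..<?N}" by (rule unshuffle_permutes[OF glued_subset[OF h(1,2,4,5)]])
  have bp: "?b permutes {..<?N}" using g n by (intro block_swap_permutes) auto
  have S': "?S \<in> TV n p" and T': "?T \<in> TV m q"
    using tperm_mem[OF mixed_compat_id S] tperm_mem[OF mixed_compat_id T] unfolding n .
  have C: "cc n ?i m (?r' + ?j) ?S ?T \<in> TV ?N (p + q)" by (rule cc_mem[OF ij S' T'])
  have D: "?D \<in> Gr (tensor (mixed A (?r + ?r' - 1) (?s + ?s' - 1))) (p + q)"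
    by (rule dcomp_mem[OF g S T])
  have "cc n i m j (place n X S) (place m Y T) = cc n (unshuffle n X ?i) m (unshuffle m Y (?r' + ?j)) (place n X ?S) (place m Y ?T)"
    unfolding u place_incl[OF h(4) S] place_incl[OF h(5) T] ..
  also have "\<dots> = tperm (replicate ?N V) ?G (cc n ?i m (?r' + ?j) ?S ?T)"
    by (rule cc_equivariant[OF ij S' T' uX uY glue_perm_permutes[OF ij uX uY] glue_perm_left[OF ij(1)] glue_perm_right[OF ij]])
  also have "\<dots> = place ?N ?Z (tperm (replicate ?N V) ?b (cc n ?i m (?r' + ?j) ?S ?T))"
    unfolding tperm_tperm[OF compat_replicate[OF bp] compat_replicate[OF uZ] C] unshuffle_glue_out[OF h(1,2,4,5) i j] ..
  also have "tperm (replicate ?N V) ?b (cc n ?i m (?r' + ?j) ?S ?T) = tperm (replicate ?N V) id ?D"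
    using dcomp_embed[OF g S T] unfolding n by (rule sym)
  also have "place ?N ?Z \<dots> = place ?N ?Z ?D"
    using tperm_tperm[OF mixed_compat_id[of "?r + ?r' - 1" "?s + ?s' - 1", unfolded n] compat_replicate[OF uZ] D] by simp
  finally show ?thesis unfolding dcomp_End by (rule sym)
qed

text \<open>Exchanging the two arguments reduces this to the preceding case. The sign and the block
  swaps in \<open>glue\<close> are those of \<open>cc_commute\<close>, once
  \<open>unshuffle_glue_in\<close> has related the sorted orders.\<close>

lemma place_glue_in:
  assumes h: "i < n" "j < m" "2 < n + m" "X \<subseteq> {..<n}" "Y \<subseteq> {..<m}" and i: "i \<notin> X" and j: "j \<in> Y"
    and S: "S \<in> MX n X p" and T: "T \<in> MX m Y q"
  shows "place (n + m - 2) (glued_outputs n i X j Y) (glue (End_di A) n p i X m q j Y S T) =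
    cc n i m j (place n X S) (place m Y T)"
proof -
  let ?r = "card X" and ?s = "n - card X" and ?r' = "card Y" and ?s' = "m - card Y" and ?N = "n + m - 2"
  let ?Z = "glued_outputs n i X j Y" and ?Z' = "glued_outputs m j Y i X" and ?M = "mixed A (?r + ?r' - 1) (?s + ?s' - 1)"
  let ?P = "perm_sum (?r + ?r' - 1) (block_swap 0 (?r' - 1) ?r) (block_swap 0 ?s' (?s - 1))" and ?b = "block_swap 0 (m - 1) (n - 1)"
  let ?D = "dcomp (End_di A) ?r' ?s' q (rank Y j) ?r ?s p (rank ({..<n} - X) i) T S"
  interpret E: dioperad "End_di A" by (rule dioperad_End)
  have mn: "2 < m + n" "m + n - 2 = ?N" using h by auto
  have M: "?r' + ?r - 1 = ?r + ?r' - 1" "?s' + ?s - 1 = ?s + ?s' - 1" "q + p = p + q" by auto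
  have D: "?D \<in> Gr (tensor ?M) (p + q)"
    using E.glue_out(4)[OF h(2,1) mn(1) h(5,4) j i T[folded End_sel] S[folded End_sel]] unfolding End_sel M .
  have ar: "card ?Z = ?r + ?r' - 1" "?N - card ?Z = ?s + ?s' - 1"
    using glue_arities[OF h(1,2,4,5)] i j by simp_all
  have ar': "card ?Z' = ?r + ?r' - 1" "?N - card ?Z' = ?s + ?s' - 1"
    using glue_arities[OF h(2,1,5,4)] i j unfolding mn(2) M(1,2) by simp_all
  have cZ: "perm_compat (unshuffle ?N ?Z) ?M (replicate ?N V)"
    using place_compat[OF glued_subset[OF h(1,2,4,5)]] unfolding ar(2) unfolding ar(1) .
  have cZ': "perm_compat (unshuffle ?N ?Z') ?M (replicate ?N V)"
    using place_compat[OF glued_subset[OF h(2,1,5,4)]] unfolding mn(2) ar'(2) unfolding ar'(1) .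
  have bp: "?b permutes {..<?N}" using h(1,2) by (intro block_swap_permutes) auto
  have "place ?N ?Z (glue (End_di A) n p i X m q j Y S T) = tscale (ksgn (p * q)) (place ?N ?Z (tperm ?M ?P ?D))"
    using i j by (simp add: glue_def Let_def End_sel tperm_scale)
  also have "place ?N ?Z (tperm ?M ?P ?D) = tperm (replicate ?N V) (?b \<circ> unshuffle ?N ?Z') ?D"
    unfolding tperm_tperm[OF mixed_compat[OF E.glue_in_perms[OF h(1,2,4,5) i j]] cZ D] unshuffle_glue_in[OF h(1,2,4,5) i j] ..
  also have "\<dots> = tperm (replicate ?N V) ?b (place ?N ?Z' ?D)"
    by (rule tperm_tperm[OF cZ' compat_replicate[OF bp] D, symmetric])
  also have "place ?N ?Z' ?D = cc m j n i (place m Y T) (place n X S)"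
    using place_glue_out[OF h(2,1) mn(1) h(5,4) j i T S] unfolding mn .
  also have "tscale (ksgn (p * q)) (tperm (replicate ?N V) ?b (cc m j n i (place m Y T) (place n X S))) =
      cc n i m j (place n X S) (place m Y T)"
    using cc_commute[OF h(2,1) place_mem[OF h(5) T] place_mem[OF h(4) S]] unfolding mn mult.commute[of q p] by (rule sym)
  finally show ?thesis .
qed

text \<open>Each term of the form pairs a component in A with one in A*. If the types agree, one of
  the two is 0, and elements of the dual vanish at 0.\<close>

lemma form_same_type:
  assumes "x \<in> Gr (summand A) p \<and> y \<in> Gr (summand A) q \<or> x \<in> Gr (dual_summand A) p \<and> y \<in> Gr (dual_summand A) q"
  shows "double_form p q x y = 0"
proof -
  have z: "\<xi> 0 = 0" if "\<xi> \<in> Gr (dual A) r" for \<xi> r by (rule dual_zero[OF that dg_space])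
  show ?thesis
    using assms z[of "snd x" p] z[of "snd y" q]
    by (auto simp: double_form_def eval_form_def summand_def dual_summand_def zero_fun_apply)
qed

text \<open>With the factors in their original positions, the types at \<open>i\<close> and
  \<open>j\<close> can be read off from \<open>X\<close> and \<open>Y\<close>; they agree, so the
  form kills every pure tensor.\<close>

lemma place_glue_zero:
  assumes h: "i < n" "j < m" "X \<subseteq> {..<n}" "Y \<subseteq> {..<m}" and ij: "(i \<in> X) = (j \<in> Y)"
    and S: "S \<in> MX n X p" and T: "T \<in> MX m Y q"
  shows "cc n i m j (place n X S) (place m Y T) = 0"
proof -
  let ?I = "\<lambda>n. tperm (replicate n V) id"
  have "cc n i m j (?I n S) (?I m T) = 0" if "S \<in> Gr (tensor (orient X n)) p" "T \<in> Gr (tensor (orient Y m)) q" for S T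
    using that
  proof (rule bilin_eqI[where L = "\<lambda>S T. cc n i m j (?I n S) (?I m T)" and M = "\<lambda>S T. 0"])
    show "lin_on (Gr (tensor (orient X n)) p) (\<lambda>S. cc n i m j (?I n S) (?I m T))" for T
      by (rule lin_on_comp[OF lin_cc_left[of UNIV] lin_on_tperm]) simp
    show "lin_on (Gr (tensor (orient Y m)) q) (\<lambda>T. cc n i m j (?I n S) (?I m T))" if "S \<in> Gr (tensor (orient X n)) p" for S
      by (rule lin_on_comp[OF lin_cc_right[OF h(1,2) tperm_mem[OF orient_compat_id that]] lin_on_tperm tperm_mem[OF orient_compat_id]])
    fix xs ys assume xs: "homog (orient X n) xs" and ys: "homog (orient Y m) ys"
    have sub: "homog (replicate n V) xs" "homog (replicate m V) ys"
      using homog_permute[OF orient_compat_id xs] homog_permute[OF orient_compat_id ys] by simp_all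
    have "double_form (fst (xs ! i)) (fst (ys ! j)) (snd (xs ! i)) (snd (ys ! j)) = 0"
      using homog_nth[OF xs, of i] homog_nth[OF ys, of j] h ij
      by (intro form_same_type) (auto simp: orient_nth split: if_splits)
    then show "cc n i m j (?I n (pure (orient X n) xs)) (?I m (pure (orient Y m) ys)) = 0"
      unfolding tperm_id_pure[OF orient_compat_id] cc_pure[OF h(1,2) sub] contr_def by simp
  qed (simp_all add: lin_on_def)
  then show ?thesis
    unfolding place_orient[OF h(3) S] place_orient[OF h(4) T]
    using tperm_mem[OF unshuffle_compat[OF h(3)] S] tperm_mem[OF unshuffle_compat[OF h(4)] T] by blast
qed

lemma place_glue:
  assumes h: "i < n" "j < m" "2 < n + m" "X \<subseteq> {..<n}" "Y \<subseteq> {..<m}" and S: "S \<in> MX n X p" and T: "T \<in> MX m Y q"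
  shows "place (n + m - 2) (glued_outputs n i X j Y) (glue (End_di A) n p i X m q j Y S T) =
    cc n i m j (place n X S) (place m Y T)"
proof -
  consider "i \<in> X" "j \<notin> Y" | "i \<notin> X" "j \<in> Y" | "(i \<in> X) = (j \<in> Y)" by blast
  then show ?thesis
  proof cases
    case 1
    then show ?thesis using place_glue_out[OF h 1 S T] by (simp add: glue_def Let_def)
  next
    case 2
    then show ?thesis by (rule place_glue_in[OF h _ _ S T])
  next
    case 3
    then show ?thesis using place_glue_zero[OF h(1,2,4,5) 3 S T] by (auto simp: glue_def Let_def tperm_zero)
  qed
qed

lemma phi_push_End_mem: "u \<in> Gr (Csp (phi_push (End_di A)) n) p \<Longrightarrow> X \<subseteq> {..<n} \<Longrightarrow> u X \<in> MX n X p"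
  unfolding phi_push_Gr End_sel by metis

text \<open>For the action the sets \<open>X\<close> are replaced by their images under \<sigma>,
  which permutes the summands. For the composition each pair \<open>X\<close>, \<open>Y\<close>
  contributes to exactly one set of outputs, and \<open>place_glue\<close> treats its
  contribution.\<close>

lemma cyc_map_canonical: "cyc_map (phi_push (End_di A)) (End_cyc V double_form) (canonical_map A)"
proof (rule cyc_mapI)
  interpret E: dioperad "End_di A" by (rule dioperad_End)
  let ?C = "phi_push (End_di A)"
  show "chain_map (Csp ?C n) (Csp (End_cyc V double_form) n) (canonical_map A n)" for n
  proof (rule chain_mapI)
    fix p u assume u: "u \<in> Gr (Csp ?C n) p"
    note m = phi_push_End_mem[OF u]
    show "canonical_map A n p u \<in> Gr (Csp (End_cyc V double_form) n) p"
      unfolding canonical_map_def End_sel using m by (intro tensor_sum place_mem) auto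
    show "canonical_map A n p (u + v) = canonical_map A n p u + canonical_map A n p v" for v
      by (simp add: canonical_map_def plus_fun_apply tperm_add sum.distrib)
    show "canonical_map A n p (Scl (Csp ?C n) c u) = Scl (Csp (End_cyc V double_form) n) c (canonical_map A n p u)" for c
      by (simp add: canonical_map_def phi_push_sel End_sel tperm_scale tens.scale_sum_right)
    show "canonical_map A n (p + 1) (Dif (Csp ?C n) p u) = Dif (Csp (End_cyc V double_form) n) p (canonical_map A n p u)"
      using m by (simp add: canonical_map_def phi_push_sel End_sel Dif_sum tperm_Dif[OF place_compat dg_mixed dg_replicate])
  qed
  show "canonical_map A n p (cact ?C n p \<sigma> u) = cact (End_cyc V double_form) n p \<sigma> (canonical_map A n p u)"
    if \<sigma>: "\<sigma> permutes {..<n}" and u: "u \<in> Gr (Csp ?C n) p" for n p \<sigma> u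
  proof -
    have inj: "inj \<sigma>" by (rule permutes_inj[OF \<sigma>])
    have img: "\<sigma> ` X \<subseteq> {..<n}" if "X \<subseteq> {..<n}" for X using that permutes_image[OF \<sigma>] by blast
    have bij: "bij_betw ((`) \<sigma>) (Pow {..<n}) (Pow {..<n})"
      using bij_betw_Pow[OF permutes_imp_bij[OF \<sigma>]] .
    have "canonical_map A n p (cact ?C n p \<sigma> u) = (\<Sum>X \<in> Pow {..<n}. place n (\<sigma> ` X) (cact ?C n p \<sigma> u (\<sigma> ` X)))"
      unfolding canonical_map_def by (rule sum.reindex_bij_betw[OF bij, symmetric])
    also have "\<dots> = (\<Sum>X \<in> Pow {..<n}. tperm (replicate n V) \<sigma> (place n X (u X)))"
    proof (rule sum.cong[OF refl])
      fix X assume "X \<in> Pow {..<n}"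
      then have X: "X \<subseteq> {..<n}" by simp
      have inv: "inv \<sigma> ` \<sigma> ` X = X" by (simp add: image_image permutes_inverses(2)[OF \<sigma>])
      have fin: "finite X" "finite ({..<n} - X)" using finite_subset[OF X] by simp_all
      have inj_on: "inj_on \<sigma> Z" for Z by (rule inj_on_subset[OF inj subset_UNIV])
      have st: "std \<sigma> X permutes {..<card X}" "std \<sigma> ({..<n} - X) permutes {..<n - card X}"
        using std_permutes[OF fin(1) inj_on] std_permutes[OF fin(2) inj_on] card_compl[OF X] by simp_all
      have card: "card (\<sigma> ` X) = card X" by (rule card_image[OF inj_on])
      have c: "perm_compat (unshuffle n (\<sigma> ` X)) (mixed A (card X) (n - card X)) (replicate n V)"
        using place_compat[OF img[OF X]] unfolding card .
      have "place n (\<sigma> ` X) (cact ?C n p \<sigma> u (\<sigma> ` X)) =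
          place n (\<sigma> ` X) (tperm (mixed A (card X) (n - card X)) (perm_sum (card X) (std \<sigma> X) (std \<sigma> ({..<n} - X))) (u X))"
        using img[OF X] by (simp add: phi_push_sel inv End_sel)
      also have "\<dots> = tperm (replicate n V) (\<sigma> \<circ> unshuffle n X) (u X)"
        unfolding tperm_tperm[OF mixed_compat[OF st] c phi_push_End_mem[OF u X]] unshuffle_std[OF X \<sigma>] ..
      also have "\<dots> = tperm (replicate n V) \<sigma> (place n X (u X))"
        by (rule tperm_tperm[OF place_compat[OF X] compat_replicate[OF \<sigma>] phi_push_End_mem[OF u X], symmetric])
      finally show "place n (\<sigma> ` X) (cact ?C n p \<sigma> u (\<sigma> ` X)) = tperm (replicate n V) \<sigma> (place n X (u X))" .
    qed
    finally show ?thesis by (simp add: canonical_map_def End_sel tperm_sum)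
  qed
  show "canonical_map A (n + m - 2) (p + q) (ccomp ?C n p i m q j u v) =
      ccomp (End_cyc V double_form) n p i m q j (canonical_map A n p u) (canonical_map A m q v)"
    if h: "i < n" "j < m" "2 < n + m" and u: "u \<in> Gr (Csp ?C n) p" and v: "v \<in> Gr (Csp ?C m) q" for n m p q i j u v
  proof -
    let ?N = "n + m - 2" and ?Z = "\<lambda>X Y. glued_outputs n i X j Y" and ?g = "\<lambda>X Y. glue (End_di A) n p i X m q j Y (u X) (v Y)"
    have "canonical_map A ?N (p + q) (ccomp ?C n p i m q j u v) =
        (\<Sum>Z\<in>Pow {..<?N}. \<Sum>X\<in>Pow {..<n}. \<Sum>Y\<in>Pow {..<m}. if Z = ?Z X Y then place ?N (?Z X Y) (?g X Y) else 0)"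
      unfolding canonical_map_def phi_push_sel tperm_sum
      by (intro sum.cong refl) (simp add: tperm_zero)
    \<comment> \<open>The sum over \<open>Z\<close> is moved to the inside, where only the set of
      glued outputs of \<open>X\<close> and \<open>Y\<close> gives a term.\<close>
    also have "\<dots> = (\<Sum>X\<in>Pow {..<n}. \<Sum>Z\<in>Pow {..<?N}. \<Sum>Y\<in>Pow {..<m}. if Z = ?Z X Y then place ?N (?Z X Y) (?g X Y) else 0)"
      by (rule sum.swap)
    also have "\<dots> = (\<Sum>X\<in>Pow {..<n}. \<Sum>Y\<in>Pow {..<m}. \<Sum>Z\<in>Pow {..<?N}. if Z = ?Z X Y then place ?N (?Z X Y) (?g X Y) else 0)"
      by (intro sum.cong refl sum.swap)
    also have "\<dots> = (\<Sum>X\<in>Pow {..<n}. \<Sum>Y\<in>Pow {..<m}. cc n i m j (place n X (u X)) (place m Y (v Y)))"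
    proof (intro sum.cong refl)
      fix X Y assume "X \<in> Pow {..<n}" "Y \<in> Pow {..<m}"
      then have XY: "X \<subseteq> {..<n}" "Y \<subseteq> {..<m}" by auto
      have "(\<Sum>Z\<in>Pow {..<?N}. if Z = ?Z X Y then place ?N (?Z X Y) (?g X Y) else 0) = place ?N (?Z X Y) (?g X Y)"
        using glued_subset[OF h(1,2) XY] by (simp add: sum.delta)
      also have "\<dots> = cc n i m j (place n X (u X)) (place m Y (v Y))"
        by (rule place_glue[OF h XY phi_push_End_mem[OF u XY(1)] phi_push_End_mem[OF v XY(2)]])
      finally show "(\<Sum>Z\<in>Pow {..<?N}. if Z = ?Z X Y then place ?N (?Z X Y) (?g X Y) else 0) =
          cc n i m j (place n X (u X)) (place m Y (v Y))" .
    qed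
    also have "\<dots> = (\<Sum>X\<in>Pow {..<n}. cc n i m j (place n X (u X)) (canonical_map A m q v))"
    proof (rule sum.cong[OF refl])
      fix X assume X: "X \<in> Pow {..<n}"
      show "(\<Sum>Y\<in>Pow {..<m}. cc n i m j (place n X (u X)) (place m Y (v Y))) = cc n i m j (place n X (u X)) (canonical_map A m q v)"
        unfolding canonical_map_def using X phi_push_End_mem[OF u] phi_push_End_mem[OF v]
        by (intro lin_on_sum[OF lin_cc_right[OF h(1,2), where p = p and q = q], symmetric]) (auto intro: place_mem)
    qed
    also have "\<dots> = cc n i m j (canonical_map A n p u) (canonical_map A m q v)"
      unfolding canonical_map_def[of A n p u] using phi_push_End_mem[OF u]
      by (intro lin_on_sum[where Ws = "replicate n V" and p = p, OF lin_cc_left, symmetric]) (auto intro: place_mem)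
    finally show ?thesis unfolding ccomp_End .
  qed
qed

text \<open>Every factor is the sum of its components in A and A*, and expanding the pure tensor
  yields one term per subset. \<open>pr m X\<close> is the list in which only the first
  \<open>m\<close> factors have been replaced by a component; the induction expands one factor at a
  time.\<close>

lemma sum_project:
  assumes "homog (replicate n V) xs"
  shows "(\<Sum>X\<in>Pow {..<n}. pure (replicate n V) (project X xs)) = pure (replicate n V) xs"
proof -
  define pr where "pr m X = map (\<lambda>k. (fst (xs ! k), if m \<le> k then snd (xs ! k)
     else if k \<in> X then (fst (snd (xs ! k)), 0) else (0, snd (snd (xs ! k))))) [0..<n]" for m X
  have len: "length xs = n" using assms by (simp add: homog_length)
  have "(\<Sum>X\<in>Pow {..<m}. pure (replicate n V) (pr m X)) = pure (replicate n V) xs" if "m \<le> n" for m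
    using that
  proof (induction m)
    case 0
    have "pr 0 {} = xs" by (rule nth_equalityI) (simp_all add: pr_def len)
    then show ?case by simp
  next
    case (Suc m)
    let ?p = "fst (xs ! m)" and ?a = "fst (snd (xs ! m))" and ?\<eta> = "snd (snd (xs ! m))"
    have mem: "snd (xs ! m) \<in> Gr V ?p" using homog_nth[OF assms, of m] Suc.prems by simp
    have mem': "(?a, 0) \<in> Gr V ?p" "(0, ?\<eta>) \<in> Gr V ?p"
      using mem dg_zero_mem[OF dg_space] dg_zero_mem[OF dg_dual[OF dg_space]] by (auto simp: double_def)
    have hom: "homog (replicate n V) (pr m X)" for X
      unfolding homog_iff
    proof (intro conjI allI impI)
      fix k assume "k < length (replicate n V)"
      then have k: "k < n" by simp
      then have "snd (xs ! k) \<in> Gr V (fst (xs ! k))" using homog_nth[OF assms, of k] by simp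
      then show "snd (pr m X ! k) \<in> Gr (replicate n V ! k) (fst (pr m X ! k))"
        using k dg_zero_mem[OF dg_space] dg_zero_mem[OF dg_dual[OF dg_space]] by (auto simp: pr_def double_def)
    qed (simp add: pr_def)
    have out: "pr (Suc m) X = (pr m X)[m := (?p, (0, ?\<eta>))]" if "X \<subseteq> {..<m}" for X
    proof (intro nth_equalityI)
      fix k assume "k < length (pr (Suc m) X)"
      then have "k < n" "m < n" using Suc.prems by (simp_all add: pr_def)
      then show "pr (Suc m) X ! k = (pr m X)[m := (?p, (0, ?\<eta>))] ! k"
        using that by (cases "k = m") (auto simp: pr_def nth_list_update)
    qed (simp add: pr_def)
    have ins: "pr (Suc m) (insert m X) = (pr m X)[m := (?p, (?a, 0))]" for X
    proof (intro nth_equalityI)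
      fix k assume "k < length (pr (Suc m) (insert m X))"
      then have "k < n" "m < n" using Suc.prems by (simp_all add: pr_def)
      then show "pr (Suc m) (insert m X) ! k = (pr m X)[m := (?p, (?a, 0))] ! k"
        by (cases "k = m") (auto simp: pr_def nth_list_update)
    qed (simp add: pr_def)
    have same: "(pr m X)[m := (?p, (?a, 0) + (0, ?\<eta>))] = pr m X" for X
    proof (intro nth_equalityI)
      fix k assume "k < length ((pr m X)[m := (?p, (?a, 0) + (0, ?\<eta>))])"
      then have "k < n" "m < n" using Suc.prems by (simp_all add: pr_def)
      then show "(pr m X)[m := (?p, (?a, 0) + (0, ?\<eta>))] ! k = pr m X ! k"
        by (cases "k = m") (auto simp: pr_def nth_list_update)
    qed (simp add: pr_def)
    have step: "pure (replicate n V) (pr (Suc m) X) + pure (replicate n V) (pr (Suc m) (insert m X)) = pure (replicate n V) (pr m X)"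
      if "X \<subseteq> {..<m}" for X
      using mlin_add[OF mlin_pure hom[of X], of m "(?a, 0)" ?p "(0, ?\<eta>)"] mem' Suc.prems
      unfolding same by (simp add: out[OF that] ins add.commute)
    \<comment> \<open>A subset of \<open>{..<Suc m}\<close> either avoids \<open>m\<close> or arises
      from one that does by adding \<open>m\<close>.\<close>
    have "Pow {..<Suc m} = Pow {..<m} \<union> insert m ` Pow {..<m}" unfolding lessThan_Suc Pow_insert ..
    moreover have "Pow {..<m} \<inter> insert m ` Pow {..<m} = {}" by auto
    moreover have "inj_on (insert m) (Pow {..<m})" by (auto simp: inj_on_def)
    ultimately have "(\<Sum>X\<in>Pow {..<Suc m}. pure (replicate n V) (pr (Suc m) X)) =
        (\<Sum>X\<in>Pow {..<m}. pure (replicate n V) (pr (Suc m) X) + pure (replicate n V) (pr (Suc m) (insert m X)))"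
      by (simp add: sum.union_disjoint sum.reindex sum.distrib)
    also have "\<dots> = (\<Sum>X\<in>Pow {..<m}. pure (replicate n V) (pr m X))" by (intro sum.cong refl step) simp
    finally show ?case using Suc by simp
  qed
  from this[of n] have "(\<Sum>X\<in>Pow {..<n}. pure (replicate n V) (pr n X)) = pure (replicate n V) xs" by simp
  moreover have "pr n X = project X xs" for X by (rule nth_equalityI) (simp_all add: pr_def project_nth len)
  ultimately show ?thesis by simp
qed

lemma sum_tproject:
  assumes "T \<in> TV n p"
  shows "(\<Sum>X\<in>Pow {..<n}. tperm (replicate n V) id (tproject X n T)) = T"
  using assms
proof (rule lin_on_eqI[where L = "\<lambda>T. \<Sum>X\<in>Pow {..<n}. tperm (replicate n V) id (tproject X n T)" and M = "\<lambda>T. T"])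
  show "lin_on (TV n p) (\<lambda>T. \<Sum>X\<in>Pow {..<n}. tperm (replicate n V) id (tproject X n T))"
    by (simp add: lin_on_def tproject_def tlin_add tlin_scale tperm_add tperm_scale sum.distrib tens.scale_sum_right)
  fix xs assume "homog (replicate n V) xs"
  then show "(\<Sum>X\<in>Pow {..<n}. tperm (replicate n V) id (tproject X n (pure (replicate n V) xs))) = pure (replicate n V) xs"
    unfolding tproject_pure tperm_id_pure[OF orient_compat_id] by (rule sum_project)
qed (rule lin_on_id)

text \<open>At a position where \<open>X\<close> and \<open>Y\<close> differ, the vector has no
  component of the type that \<open>Y\<close> prescribes. The projected list has an entry 0 there,
  so its pure tensor vanishes.\<close>

lemma tproject_other:
  assumes X: "X \<subseteq> {..<n}" and Y: "Y \<subseteq> {..<n}" and XY: "X \<noteq> Y" and T: "T \<in> Gr (tensor (orient X n)) p"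
  shows "tproject Y n (tperm (replicate n V) id T) = 0"
proof (rule lin_on_eqI[where L = "\<lambda>T. tproject Y n (tperm (replicate n V) id T)" and M = "\<lambda>T. 0", OF T])
  show "lin_on (Gr (tensor (orient X n)) p) (\<lambda>T. tproject Y n (tperm (replicate n V) id T))"
    by (rule lin_on_comp[OF lin_on_tproject[of UNIV] lin_on_tperm]) simp
  fix xs assume xs: "homog (orient X n) xs"
  obtain k where k: "k < n" "(k \<in> X) \<noteq> (k \<in> Y)" using X Y XY by blast
  have len: "length xs = n" using xs by (simp add: homog_length)
  have sub: "homog (replicate n V) xs" using homog_permute[OF orient_compat_id xs] by simp
  have "snd (xs ! k) \<in> Gr (if k \<in> X then summand A else dual_summand A) (fst (xs ! k))"
    using homog_nth[OF xs, of k] k by (simp add: orient_nth)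
  then have "project Y xs ! k = (fst (xs ! k), 0)"
    using k len by (auto simp: project_nth summand_def dual_summand_def zero_prod_def split: if_splits)
  then have "project Y xs = (project Y xs)[k := (fst (xs ! k), 0)]" by (metis list_update_id)
  moreover have "0 \<in> Gr (orient Y n ! k) (fst (xs ! k))"
    using dg_zero_mem[of "orient Y n ! k"] orient_sub[of "orient Y n ! k" Y n] k by simp
  ultimately have "pure (orient Y n) (project Y xs) = 0"
    using mlin_zero_entry[OF mlin_pure homog_project[OF sub], of k Y "fst (xs ! k)"] k by simp
  then show "tproject Y n (tperm (replicate n V) id (pure (orient X n) xs)) = 0"
    unfolding tperm_id_pure[OF orient_compat_id] tproject_pure .
qed (simp add: lin_on_def)

lemma unshuffle_inv_compat:
  assumes "X \<subseteq> {..<n}"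
  shows "perm_compat (inv (unshuffle n X)) (orient X n) (mixed A (card X) (n - card X))"
proof -
  note u = unshuffle_permutes[OF assms]
  have "inv (unshuffle n X) k < card X \<longleftrightarrow> k \<in> X" "inv (unshuffle n X) k < n" if "k < n" for k
    using that unshuffle_mem_iff(2)[OF assms, of "inv (unshuffle n X) k"] permutes_less[OF permutes_inv[OF u]]
    by (simp_all add: permutes_inverses(1)[OF u])
  then show ?thesis
    using card_le[OF assms] permutes_inv[OF u] by (simp add: perm_compat_def mixed_orient orient_nth)
qed

text \<open>The inverse takes the projections of a tensor to all summands and sorts their factors.
  It is a right inverse because the projections add up to the tensor, and a left inverse because a
  projection fixes its own summand and kills the others.\<close>

lemma bij_canonical:
  assumes n: "0 < n"
  shows "bij_betw (canonical_map A n p) (Gr (Csp (phi_push (End_di A)) n) p) (Gr (Csp (End_cyc V double_form) n) p)"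
proof -
  let ?C = "Csp (phi_push (End_di A)) n" and ?M = "\<lambda>X. mixed A (card X) (n - card X)"
  \<comment> \<open>The value 0 for other \<open>X\<close> is what membership in the pieces of
    \<open>phi_push\<close> demands.\<close>
  define f where "f T X = (if X \<subseteq> {..<n} then tperm (?M X) (inv (unshuffle n X)) (tproject X n T) else 0)" for T X
  have inv: "tperm (?M X) (inv (unshuffle n X)) (tperm (orient X n) (unshuffle n X) S) = S"
    if "X \<subseteq> {..<n}" "S \<in> MX n X p" for X S
    using tperm_tperm[OF unshuffle_compat[OF that(1)] unshuffle_inv_compat[OF that(1)] that(2)] tperm_id[OF that(2)]
      permutes_inv_o(2)[OF unshuffle_permutes[OF that(1)]] by simp
  have inv': "tperm (orient X n) (unshuffle n X) (tperm (?M X) (inv (unshuffle n X)) S) = S"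
    if "X \<subseteq> {..<n}" "S \<in> Gr (tensor (orient X n)) p" for X S
    using tperm_tperm[OF unshuffle_inv_compat[OF that(1)] unshuffle_compat[OF that(1)] that(2)] tperm_id[OF that(2)]
      permutes_inv_o(1)[OF unshuffle_permutes[OF that(1)]] by simp
  have f_mem: "tperm (?M X) (inv (unshuffle n X)) (tproject X n T) \<in> MX n X p" if "T \<in> TV n p" "X \<subseteq> {..<n}" for T X
    by (rule tperm_mem[OF unshuffle_inv_compat[OF that(2)] tproject_mem[OF that(1)]])
  have 1: "\<forall>u\<in>Gr ?C p. f (canonical_map A n p u) = u"
  proof (intro ballI, rule ext)
    fix u X assume u: "u \<in> Gr ?C p"
    show "f (canonical_map A n p u) X = u X"
    proof (cases "X \<subseteq> {..<n}")
      case True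
      let ?o = "\<lambda>Y. tperm (orient Y n) (unshuffle n Y) (u Y)"
      have o: "?o Y \<in> Gr (tensor (orient Y n)) p" if "Y \<subseteq> {..<n}" for Y
        by (rule tperm_mem[OF unshuffle_compat[OF that] phi_push_End_mem[OF u that]])
      have "tproject X n (canonical_map A n p u) = (\<Sum>Y\<in>Pow {..<n}. if Y = X then ?o X else 0)"
        unfolding canonical_map_def tproject_sum
      proof (rule sum.cong[OF refl])
        fix Y assume "Y \<in> Pow {..<n}"
        then have Y: "Y \<subseteq> {..<n}" by simp
        show "tproject X n (place n Y (u Y)) = (if Y = X then ?o X else 0)"
          unfolding place_orient[OF Y phi_push_End_mem[OF u Y]]
          using tproject_id[OF o[OF True]] tproject_other[OF Y True _ o[OF Y]] by simp
      qed
      also have "\<dots> = ?o X" using True by (simp add: sum.delta)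
      finally show ?thesis using True inv[OF True phi_push_End_mem[OF u True]] by (simp add: f_def)
    next
      case False
      then show ?thesis using u unfolding phi_push_Gr f_def by simp
    qed
  qed
  have 2: "\<forall>T\<in>Gr (Csp (End_cyc V double_form) n) p. canonical_map A n p (f T) = T"
    unfolding End_sel
  proof
    fix T assume T: "T \<in> TV n p"
    have "canonical_map A n p (f T) = (\<Sum>X\<in>Pow {..<n}. tperm (replicate n V) id (tproject X n T))"
      unfolding canonical_map_def
    proof (rule sum.cong[OF refl])
      fix X assume "X \<in> Pow {..<n}"
      then have X: "X \<subseteq> {..<n}" by simp
      show "place n X (f T X) = tperm (replicate n V) id (tproject X n T)"
        using X place_orient[OF X f_mem[OF T X]] inv'[OF X tproject_mem[OF T]] by (simp add: f_def)
    qed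
    then show "canonical_map A n p (f T) = T" using sum_tproject[OF T] by simp
  qed
  have 3: "canonical_map A n p ` Gr ?C p \<subseteq> Gr (Csp (End_cyc V double_form) n) p"
    using chain_mapD(1)[OF cyc_mapD(1)[OF cyc_map_canonical n]] by blast
  have 4: "f ` Gr (Csp (End_cyc V double_form) n) p \<subseteq> Gr ?C p"
    unfolding End_sel using f_mem by (auto simp: phi_push_Gr End_sel f_def)
  show ?thesis by (rule bij_betw_byWitness[OF 1 2 3 4])
qed

end

section \<open>Algebra structures on A and on its double\<close>

theorem corollary1p6:
  fixes \<O> :: "('k::field_char_0, 'o::ab_group_add) cyc_data"
    and A :: "('k, 'a::ab_group_add) dgvs"
    and P :: "('k, 'p::ab_group_add) dio_data"
    and \<eta> :: "nat \<Rightarrow> int \<Rightarrow> 'o \<Rightarrow> (nat set \<Rightarrow> 'p)"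
  assumes "cyclic_operad \<O>"
    and "dg_vector_space A" and "finite_type A"
    and "phi_left_adjoint TYPE(('k, 'a \<times> ('a \<Rightarrow> 'k)) tens) \<O> P \<eta>"
  shows "bij_betw (induced_structure \<O> P \<eta> A)
    (dioperad_algebras P A)
    (cyclic_algebras \<O> (double A) double_form)"
proof -
  interpret dg_space A by (rule dg_space.intro[OF assms(2)])
  have \<O>: "cyc_closed \<O>" by (rule cyclic_operad.cyc_closed[OF assms(1)])
  have P: "dioperad P" and \<eta>: "\<eta> \<in> cyc_hom \<O> (phi_push P)"
    \<comment> \<open>The elements of \<open>End_di A\<close> have the type fixed as parameter in
      the last assumption, so it may serve as the test dioperad.\<close>
    and univ: "\<And>g. g \<in> cyc_hom \<O> (phi_push (End_di A)) \<Longrightarrow>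
      \<exists>!f. f \<in> dio_hom P (End_di A) \<and> cyc_compose \<O> (phi_push_map P f) \<eta> = g"
    using assms(4) dioperad_End unfolding phi_left_adjoint_def by blast+
  let ?F = "\<lambda>f. cyc_compose \<O> (phi_push_map P f) \<eta>"
  have F: "?F f \<in> cyc_hom \<O> (phi_push (End_di A))" if "f \<in> dio_hom P (End_di A)" for f
    by (rule cyc_compose_hom[OF \<O> \<eta> dioperad.cyc_map_phi_push_map[OF P dioperad_End that]])
  \<comment> \<open>Unique factorisation through \<eta> is bijectivity of \<open>?F\<close>:
    existence gives surjectivity and uniqueness gives injectivity.\<close>
  have "bij_betw ?F (dio_hom P (End_di A)) (cyc_hom \<O> (phi_push (End_di A)))"
  proof (rule bij_betw_imageI)
    show "inj_on ?F (dio_hom P (End_di A))" using F univ by (intro inj_onI) blast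
    show "?F ` dio_hom P (End_di A) = cyc_hom \<O> (phi_push (End_di A))" using F univ by blast
  qed
  moreover have "bij_betw (cyc_compose \<O> (canonical_map A)) (cyc_hom \<O> (phi_push (End_di A)))
      (cyc_hom \<O> (End_cyc (double A) double_form))"
    by (rule bij_betw_cyc_compose[OF \<O> dioperad.cyc_closed_phi_push[OF dioperad_End] cyc_map_canonical bij_canonical])
  ultimately have "bij_betw (cyc_compose \<O> (canonical_map A) \<circ> ?F) (dio_hom P (End_di A))
      (cyc_hom \<O> (End_cyc (double A) double_form))"
    by (rule bij_betw_trans)
  moreover have "cyc_compose \<O> (canonical_map A) \<circ> ?F = induced_structure \<O> P \<eta> A"
    by (simp add: induced_structure_def fun_eq_iff)
  ultimately show ?thesis by (simp add: dioperad_algebras_def cyclic_algebras_def)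
qed

end
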